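(* Let $m,N\geq 1$ be integers, let $\Omega\subset\mathbb{R}^N$ be a bounded open set with Lipschitz boundary, let $\mathbb{M}$ be the space of real $m\times N$ matrices, let $p\in\,]1,\infty[$, and let $L:\mathbb{M}\to[0,\infty[$ be continuous (and finite everywhere). Assume that $L$ is $W^{1,q}$-quasiconvex, that $L$ is $q$-coercive, i.e. there exists $\beta>0$ with $\beta|\xi|^q\leq L(\xi)$ for all $\xi\in\mathbb{M}$, and that $$\limsup_{|\xi|\to\infty}\frac{L(\xi)}{|\xi|^q}<\infty$$ (where $q$ is as in (i) or (ii) below). Let $I:W^{1,p}(\Omega;\mathbb{R}^m)\to[0,\infty]$ be defined by $I(u):=\int_\Omega L(\nabla u(x))\,dx$. Then: (i) if $p\in\,]1,N[$ and $q\in\,]1,p^*]$ with $p^*:=\frac{Np}{N-p}$, then $I$ is sequentially weakly lower semicontinuous on $W^{1,p}(\Omega;\mathbb{R}^m)$; (ii) if $p\in[N,\infty[$ and $q\in\,]1,\infty[$, then $I$ is sequentially weakly lower semicontinuous on $W^{1,p}(\Omega;\mathbb{R}^m)$.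
   Context: $Y:=\,]-\tfrac12,\tfrac12[^N$ is the open unit cube of $\mathbb{R}^N$, and for $\xi\in\mathbb{M}$, $l_\xi(y):=\xi y$. $W^{1,q}$-quasiconvexity: $L$ is $W^{1,q}$-quasiconvex if for every $\xi\in\mathbb{M}$, $\int_Y L(\nabla u(y))\,dy\geq L(\xi)$ for all $u\in l_\xi+W^{1,q}_0(Y;\mathbb{R}^m)$. Sequential weak lower semicontinuity of $I$ on $W^{1,p}(\Omega;\mathbb{R}^m)$: $u_n\rightharpoonup u$ weakly in $W^{1,p}(\Omega;\mathbb{R}^m)$ implies $\liminf_{n\to\infty}I(u_n)\geq I(u)$. *)

theory Defs
  imports "HOL-Analysis.Analysis"
begin

text \<open>
  Points of \<open>\<real>\<^sup>N\<close> have type \<^typ>\<open>real^'n\<close>, values type \<^typ>\<open>real^'m\<close>, and \<open>m \<times> N\<close> matrices type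
  \<^typ>\<open>real^'n^'m\<close>, whose norm is the Frobenius norm.  Members of Lebesgue and Sobolev spaces on
  \<open>U\<close> are functions on the whole type whose values outside \<open>U\<close> are irrelevant; functions that agree
  almost everywhere on \<open>U\<close> are not identified.
\<close>

definition partial_deriv :: "'n::finite \<Rightarrow> (real^'n \<Rightarrow> real) \<Rightarrow> real^'n \<Rightarrow> real" where
  "partial_deriv j f x = frechet_derivative f (at x) (axis j 1)"

text \<open>Everywhere differentiability of all partial derivatives of order less than \<open>k\<close>; holding for
  every \<open>k\<close>, this is membership in \<open>C\<^sup>\<infinity>\<close>.\<close>

primrec times_differentiable :: "nat \<Rightarrow> (real^'n::finite \<Rightarrow> real) \<Rightarrow> bool" where
  "times_differentiable 0 f \<longleftrightarrow> True"
| "times_differentiable (Suc k) f \<longleftrightarrow>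
     (\<forall>x. f differentiable (at x)) \<and> (\<forall>j. times_differentiable k (partial_deriv j f))"

definition test_functions :: "(real^'n::finite) set \<Rightarrow> (real^'n \<Rightarrow> real) set" where
  "test_functions U = {\<phi>. (\<forall>k. times_differentiable k \<phi>) \<and>
     compact (closure {x. \<phi> x \<noteq> 0}) \<and> closure {x. \<phi> x \<noteq> 0} \<subseteq> U}"

definition vector_test_functions ::
    "(real^'n::finite) set \<Rightarrow> (real^'n \<Rightarrow> real^'m::finite) set" where
  "vector_test_functions U = {\<phi>. \<forall>i. (\<lambda>x. \<phi> x $ i) \<in> test_functions U}"

definition Lp_space :: "(real^'n::finite) set \<Rightarrow> real \<Rightarrow> (real^'n \<Rightarrow> 'b::euclidean_space) set" where
  "Lp_space U p = {f. f \<in> borel_measurable (lebesgue_on U) \<and>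
     integrable (lebesgue_on U) (\<lambda>x. norm (f x) powr p)}"

definition locally_integrable ::
    "(real^'n::finite) set \<Rightarrow> (real^'n \<Rightarrow> 'b::euclidean_space) \<Rightarrow> bool" where
  "locally_integrable U f \<longleftrightarrow> (\<forall>K. compact K \<and> K \<subseteq> U \<longrightarrow> f absolutely_integrable_on K)"

definition has_weak_gradient ::
    "(real^'n::finite) set \<Rightarrow> (real^'n \<Rightarrow> real^'m::finite) \<Rightarrow> (real^'n \<Rightarrow> real^'n^'m) \<Rightarrow> bool" where
  "has_weak_gradient U u G \<longleftrightarrow> locally_integrable U u \<and> locally_integrable U G \<and>
     (\<forall>\<phi>\<in>test_functions U. \<forall>i j.
        (\<integral>x. u x $ i * partial_deriv j \<phi> x \<partial>lebesgue_on U) =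
        - (\<integral>x. G x $ i $ j * \<phi> x \<partial>lebesgue_on U))"

text \<open>For open \<open>U\<close> a weak gradient is unique up to a null subset of \<open>U\<close>; this chooses a
  representative.\<close>

definition weak_gradient ::
    "(real^'n::finite) set \<Rightarrow> (real^'n \<Rightarrow> real^'m::finite) \<Rightarrow> real^'n \<Rightarrow> real^'n^'m" where
  "weak_gradient U u = (SOME G. has_weak_gradient U u G)"

definition sobolev :: "(real^'n::finite) set \<Rightarrow> real \<Rightarrow> (real^'n \<Rightarrow> real^'m::finite) set" where
  "sobolev U p = {u \<in> Lp_space U p. \<exists>G\<in>Lp_space U p. has_weak_gradient U u G}"

definition sobolev_norm ::
    "(real^'n::finite) set \<Rightarrow> real \<Rightarrow> (real^'n \<Rightarrow> real^'m::finite) \<Rightarrow> real" where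
  "sobolev_norm U p u =
     ((\<integral>x. norm (u x) powr p \<partial>lebesgue_on U) +
      (\<integral>x. norm (weak_gradient U u x) powr p \<partial>lebesgue_on U)) powr (1 / p)"

definition sobolev0 :: "(real^'n::finite) set \<Rightarrow> real \<Rightarrow> (real^'n \<Rightarrow> real^'m::finite) set" where
  "sobolev0 U p = {u \<in> sobolev U p. \<exists>\<phi>::nat \<Rightarrow> real^'n \<Rightarrow> real^'m.
     (\<forall>k. \<phi> k \<in> vector_test_functions U) \<and>
     (\<lambda>k. sobolev_norm U p (\<lambda>x. u x - \<phi> k x)) \<longlonglongrightarrow> 0}"

text \<open>Bounded linear functionals.  Boundedness forces them to respect almost everywhere equality,
  so they are exactly the functionals on the quotient space.\<close>

definition sobolev_dual ::
    "(real^'n::finite) set \<Rightarrow> real \<Rightarrow> ((real^'n \<Rightarrow> real^'m::finite) \<Rightarrow> real) set" where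
  "sobolev_dual U p = {l.
     (\<forall>u\<in>sobolev U p. \<forall>v\<in>sobolev U p. l (\<lambda>x. u x + v x) = l u + l v) \<and>
     (\<forall>c. \<forall>u\<in>sobolev U p. l (\<lambda>x. c *\<^sub>R u x) = c * l u) \<and>
     (\<exists>C. \<forall>u\<in>sobolev U p. \<bar>l u\<bar> \<le> C * sobolev_norm U p u)}"

definition sobolev_weakly_converges ::
    "(real^'n::finite) set \<Rightarrow> real \<Rightarrow> (nat \<Rightarrow> real^'n \<Rightarrow> real^'m::finite) \<Rightarrow> (real^'n \<Rightarrow> real^'m) \<Rightarrow> bool"
  where
  "sobolev_weakly_converges U p us u \<longleftrightarrow> (\<forall>k. us k \<in> sobolev U p) \<and> u \<in> sobolev U p \<and>
     (\<forall>l\<in>sobolev_dual U p. (\<lambda>k. l (us k)) \<longlonglongrightarrow> l u)"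

text \<open>Meaningful only for \<open>p < N\<close>.\<close>

definition sobolev_exponent :: "nat \<Rightarrow> real \<Rightarrow> real" where
  "sobolev_exponent N p = real N * p / (real N - p)"

text \<open>Near every boundary point the set is, after a rotation of the axes, the strict epigraph of a
  Lipschitz function of \<open>N - 1\<close> variables.  The unit vector \<open>e\<close> is the rotated last axis, and
  \<open>x - (x \<bullet> e) *\<^sub>R e\<close> is the projection of \<open>x\<close> to the hyperplane of the remaining coordinates.\<close>

definition lipschitz_boundary :: "(real^'n::finite) set \<Rightarrow> bool" where
  "lipschitz_boundary U \<longleftrightarrow> (\<forall>x0\<in>frontier U. \<exists>r>0. \<exists>e. norm e = 1 \<and>
     (\<exists>K \<gamma>. K-lipschitz_on {z. z \<bullet> e = 0} \<gamma> \<and>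
        U \<inter> ball x0 r = {x \<in> ball x0 r. \<gamma> (x - (x \<bullet> e) *\<^sub>R e) < x \<bullet> e}))"

definition unit_cube :: "(real^'n::finite) set" where
  "unit_cube = box (\<chi> i. - 1 / 2) (\<chi> i. 1 / 2)"

definition energy ::
    "(real^'n::finite) set \<Rightarrow> (real^'n^'m::finite \<Rightarrow> real) \<Rightarrow> (real^'n \<Rightarrow> real^'m) \<Rightarrow> ennreal" where
  "energy U L u = (\<integral>\<^sup>+x. ennreal (L (weak_gradient U u x)) \<partial>lebesgue_on U)"

definition W1_quasiconvex :: "real \<Rightarrow> (real^'n::finite^'m::finite \<Rightarrow> real) \<Rightarrow> bool" where
  "W1_quasiconvex q L \<longleftrightarrow>
     (\<forall>\<xi>. \<forall>v\<in>sobolev0 unit_cube q. energy unit_cube L (\<lambda>y. \<xi> *v y + v y) \<ge> ennreal (L \<xi>))"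

definition coercive :: "real \<Rightarrow> (real^'n::finite^'m::finite \<Rightarrow> real) \<Rightarrow> bool" where
  "coercive q L \<longleftrightarrow> (\<exists>\<beta>>0. \<forall>\<xi>. \<beta> * norm \<xi> powr q \<le> L \<xi>)"

definition seq_weakly_lsc ::
    "(real^'n::finite) set \<Rightarrow> real \<Rightarrow> ((real^'n \<Rightarrow> real^'m::finite) \<Rightarrow> ennreal) \<Rightarrow> bool" where
  "seq_weakly_lsc U p J \<longleftrightarrow>
     (\<forall>us u. sobolev_weakly_converges U p us u \<longrightarrow> J u \<le> liminf (\<lambda>k. J (us k)))"

end

theory Submission
  imports Defs
begin

text \<open>
  Passing to a subsequence of bounded energy, coercivity bounds the gradients in \<open>L\<^sup>q\<close>, and the claim
  is local.  Mollification replaces the sequence by smooth maps without increasing the limit of the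
  energies.  At scale \<open>r\<close> around almost every \<open>x\<close>, the limit map is \<open>L\<^sup>1\<close>-close to an affine map of
  gradient \<open>\<xi> = \<nabla>u(x)\<close> by Poincare's inequality, and the sequence is \<open>L\<^sup>1\<close>-close to its limit by a Rellich
  type argument.  A smooth map \<open>w\<close> that is \<open>L\<^sup>1\<close>-close to an affine map on the cube is modified by cutting off
  \<open>z = w - \<xi>y\<close> both near the boundary of the cube and where \<open>|z|\<close> is not small; choosing the transition
  layers among many disjoint ones makes their energy negligible, so quasiconvexity, applied to test
  functions only, gives \<open>\<integral> L(\<nabla>w) \<ge> L(\<xi>) - \<epsilon>\<close>.  Fubini's theorem and Fatou's lemma, applied to the averages
  \<open>x \<mapsto> \<integral> L(\<nabla>w(x + r y)) dy\<close> over the cube, replace a covering argument.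
\<close>

section \<open>Smooth functions and cutoffs\<close>

text \<open>The obstacle is uniformity in the scale. For a fixed point the energies rescaled to
  cubes of side r have no bound that is uniform in r, yet the L1 closeness \<delta> asked of a map
  must be fixed before r is chosen. \<open>quasiconvex_near_affine\<close> obtains such a \<delta>
  from a dichotomy: if the energy on the cube exceeds L(\<xi>) there is nothing to prove, and
  otherwise coercivity bounds the integral of |\<xi> + grad z|^q by L(\<xi>)/\<beta>. So the number
  of layers, and then \<delta>, depend on \<xi> and \<epsilon> and on the constants of
  \<open>L\<close> only. Because all competitors are smooth, product and chain rules are classical;
  weak gradients enter only where the gradient of a mollification or of a smooth map is identified.
  Mollifying does not spoil the energy because coercivity makes |grad u|^q integrable, and Jensen's
  inequality with the growth bound then dominates L of the mollified gradient. The strong L1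
  convergence is obtained at each fixed scale, so the limit along the sequence is taken before the
  scale shrinks; this is why there are two nested lower limits, each with its own use of Fatou's
  lemma.\<close>

lemma partial_deriv_has_derivative:
  assumes "(f has_derivative f') (at x)"
  shows "partial_deriv j f x = f' (axis j 1)"
  using frechet_derivative_at[OF assms] by (simp add: partial_deriv_def)

lemma has_derivative_partial_deriv:
  fixes f :: "real^'n::finite \<Rightarrow> real"
  assumes "f differentiable (at x)"
  shows "(f has_derivative (\<lambda>h. \<Sum>j\<in>UNIV. partial_deriv j f x * h $ j)) (at x)"
proof -
  have d: "(f has_derivative frechet_derivative f (at x)) (at x)"
    using assms frechet_derivative_works by blast
  interpret bounded_linear "frechet_derivative f (at x)"
    using d has_derivative_bounded_linear by blast
  have "frechet_derivative f (at x) h = (\<Sum>j\<in>UNIV. partial_deriv j f x * h $ j)" for h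
  proof -
    have "h = (\<Sum>j\<in>UNIV. h $ j *\<^sub>R axis j 1)"
      by (simp add: vec_eq_iff axis_def if_distrib cong: if_cong)
    then have "frechet_derivative f (at x) h = frechet_derivative f (at x) (\<Sum>j\<in>UNIV. h $ j *\<^sub>R axis j 1)"
      by simp
    also have "\<dots> = (\<Sum>j\<in>UNIV. h $ j * partial_deriv j f x)"
      by (simp add: sum scaleR partial_deriv_def)
    finally show ?thesis by (simp add: mult.commute)
  qed
  then have "frechet_derivative f (at x) = (\<lambda>h. \<Sum>j\<in>UNIV. partial_deriv j f x * h $ j)"
    by (rule ext)
  with d show ?thesis by (simp only:)
qed

lemma times_differentiable_Suc_imp:
  "times_differentiable (Suc k) f \<Longrightarrow> times_differentiable k f"
  by (induction k arbitrary: f) auto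

lemma times_differentiable_const: "times_differentiable k (\<lambda>x::real^'n::finite. c)"
proof (induction k arbitrary: c)
  case (Suc k)
  have "partial_deriv j (\<lambda>x::real^'n. c) = (\<lambda>x. 0)" for j
    by (auto simp: partial_deriv_has_derivative[OF has_derivative_const])
  with Suc show ?case by simp
qed simp

lemma times_differentiable_add:
  fixes f :: "real^'n::finite \<Rightarrow> real"
  assumes "times_differentiable k f" "times_differentiable k g"
  shows "times_differentiable k (\<lambda>x. f x + g x)"
  using assms
proof (induction k arbitrary: f g)
  case (Suc k)
  have "partial_deriv j (\<lambda>x. f x + g x) = (\<lambda>x. partial_deriv j f x + partial_deriv j g x)" for j
  proof
    fix x
    have "(f has_derivative frechet_derivative f (at x)) (at x)"
      "(g has_derivative frechet_derivative g (at x)) (at x)"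
      using Suc.prems by (auto simp: frechet_derivative_works)
    from has_derivative_add[OF this] show
      "partial_deriv j (\<lambda>x. f x + g x) x = partial_deriv j f x + partial_deriv j g x"
      by (subst partial_deriv_has_derivative) (auto simp: partial_deriv_def)
  qed
  with Suc show ?case by simp
qed simp

lemma partial_deriv_mult:
  fixes f :: "real^'n::finite \<Rightarrow> real"
  assumes "f differentiable (at x)" "g differentiable (at x)"
  shows "partial_deriv j (\<lambda>x. f x * g x) x = f x * partial_deriv j g x + partial_deriv j f x * g x"
proof -
  have "(f has_derivative frechet_derivative f (at x)) (at x)"
    "(g has_derivative frechet_derivative g (at x)) (at x)"
    using assms by (auto simp: frechet_derivative_works)
  from has_derivative_mult[OF this] show ?thesis
    by (subst partial_deriv_has_derivative) (auto simp: partial_deriv_def)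
qed

lemma times_differentiable_mult:
  fixes f :: "real^'n::finite \<Rightarrow> real"
  assumes "times_differentiable k f" "times_differentiable k g"
  shows "times_differentiable k (\<lambda>x. f x * g x)"
  using assms
proof (induction k arbitrary: f g)
  case (Suc k)
  have "partial_deriv j (\<lambda>x. f x * g x) =
      (\<lambda>x. f x * partial_deriv j g x + partial_deriv j f x * g x)" for j
    using Suc.prems by (auto intro!: partial_deriv_mult)
  moreover have "times_differentiable k f" "times_differentiable k g"
    using Suc.prems times_differentiable_Suc_imp by blast+
  ultimately show ?case using Suc.prems by (auto intro!: times_differentiable_add Suc.IH)
qed simp

lemma partial_deriv_compose:
  fixes f :: "real^'n::finite \<Rightarrow> real"
  assumes "f differentiable (at x)" "(g has_real_derivative g') (at (f x))"
  shows "partial_deriv j (\<lambda>x. g (f x)) x = g' * partial_deriv j f x"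
proof -
  have "(f has_derivative frechet_derivative f (at x)) (at x)"
    using assms by (auto simp: frechet_derivative_works)
  from has_derivative_compose[OF this assms(2)[unfolded has_field_derivative_def]] show ?thesis
    by (subst partial_deriv_has_derivative) (auto simp: partial_deriv_def)
qed

text \<open>The outer function comes with all its derivatives, \<open>g (Suc l)\<close> being the
  derivative of \<open>g l\<close>. Differentiating \<open>g l (f x)\<close> produces
  \<open>g (Suc l) (f x)\<close>, so the induction on the order has to treat all \<open>l\<close> at
  once.\<close>

lemma times_differentiable_compose:
  fixes f :: "real^'n::finite \<Rightarrow> real" and g :: "nat \<Rightarrow> real \<Rightarrow> real"
  assumes g: "\<And>l t. (g l has_real_derivative g (Suc l) t) (at t)"
    and "times_differentiable k f"
  shows "times_differentiable k (\<lambda>x. g l (f x))"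
  using assms(2)
proof (induction k arbitrary: l)
  case (Suc k)
  have "partial_deriv j (\<lambda>x. g l (f x)) = (\<lambda>x. g (Suc l) (f x) * partial_deriv j f x)" for j
    using Suc.prems g by (auto intro!: partial_deriv_compose)
  moreover have "(\<lambda>x. g l (f x)) differentiable (at x)" for x
  proof -
    have "g l differentiable (at (f x))" using g real_differentiable_def by blast
    with Suc.prems show ?thesis using differentiable_chain_at[of f x "g l"] by (auto simp: o_def)
  qed
  moreover have "times_differentiable k f"
    using Suc.prems times_differentiable_Suc_imp by blast
  ultimately show ?case using Suc by (auto intro!: times_differentiable_mult)
qed simp

lemma partial_deriv_affine:
  fixes f :: "real^'n::finite \<Rightarrow> real"
  assumes "f differentiable (at (a + c *\<^sub>R x))"
  shows "partial_deriv j (\<lambda>x. f (a + c *\<^sub>R x)) x = c * partial_deriv j f (a + c *\<^sub>R x)"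
proof -
  let ?D = "frechet_derivative f (at (a + c *\<^sub>R x))"
  have d: "(f has_derivative ?D) (at (a + c *\<^sub>R x))"
    using assms by (auto simp: frechet_derivative_works)
  interpret bounded_linear ?D using d has_derivative_bounded_linear by blast
  have "((\<lambda>x. a + c *\<^sub>R x) has_derivative (\<lambda>x. c *\<^sub>R x)) (at x)"
    by (auto intro!: derivative_eq_intros)
  from has_derivative_compose[OF this d] show ?thesis
    by (subst partial_deriv_has_derivative) (auto simp: partial_deriv_def scaleR)
qed

lemma times_differentiable_affine:
  fixes f :: "real^'n::finite \<Rightarrow> real"
  assumes "times_differentiable k f"
  shows "times_differentiable k (\<lambda>x. f (a + c *\<^sub>R x))"
  using assms
proof (induction k arbitrary: f)
  case (Suc k)
  have "partial_deriv j (\<lambda>x. f (a + c *\<^sub>R x)) = (\<lambda>x. c * partial_deriv j f (a + c *\<^sub>R x))" for j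
    using Suc.prems by (auto intro!: partial_deriv_affine)
  moreover have "(\<lambda>x. f (a + c *\<^sub>R x)) differentiable (at x)" for x
  proof -
    have "(\<lambda>x. a + c *\<^sub>R x) differentiable (at x)"
      by (simp add: differentiable_add differentiable_scaleR)
    with Suc.prems show ?thesis using differentiable_chain_at[of "\<lambda>x. a + c *\<^sub>R x" x f]
      by (auto simp: o_def)
  qed
  ultimately show ?case using Suc
    by (auto intro!: times_differentiable_mult times_differentiable_const)
qed simp

lemma has_derivative_vec_nth: "((\<lambda>x::real^'n::finite. x $ i) has_derivative (\<lambda>x. x $ i)) F"
  by (rule bounded_linear_imp_has_derivative[OF bounded_linear_vec_nth])

lemma partial_deriv_vec_nth: "partial_deriv j (\<lambda>x::real^'n::finite. x $ i) x = (if i = j then 1 else 0)"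
  by (auto simp: partial_deriv_has_derivative[OF has_derivative_vec_nth] axis_def)

definition smooth :: "(real^'n::finite \<Rightarrow> real) \<Rightarrow> bool" where
  "smooth f \<longleftrightarrow> (\<forall>k. times_differentiable k f)"

lemma smooth_const: "smooth (\<lambda>x::real^'n::finite. c)"
  by (simp add: smooth_def times_differentiable_const)

lemma smooth_add: "smooth f \<Longrightarrow> smooth g \<Longrightarrow> smooth (\<lambda>x. f x + g x)"
  by (simp add: smooth_def times_differentiable_add)

lemma smooth_mult: "smooth f \<Longrightarrow> smooth g \<Longrightarrow> smooth (\<lambda>x. f x * g x)"
  by (simp add: smooth_def times_differentiable_mult)

lemma smooth_uminus: "smooth f \<Longrightarrow> smooth (\<lambda>x. - f x)"
  using smooth_mult[OF smooth_const[of "-1"], of f] by simp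

lemma smooth_diff: "smooth f \<Longrightarrow> smooth g \<Longrightarrow> smooth (\<lambda>x. f x - g x)"
  using smooth_add[OF _ smooth_uminus, of f g] by simp

lemma smooth_power2: "smooth f \<Longrightarrow> smooth (\<lambda>x. (f x)\<^sup>2)"
  using smooth_mult[of f f] by (simp add: power2_eq_square)

lemma smooth_sum: "finite A \<Longrightarrow> (\<And>i. i \<in> A \<Longrightarrow> smooth (f i)) \<Longrightarrow> smooth (\<lambda>x. \<Sum>i\<in>A. f i x)"
  by (induction A rule: finite_induct) (auto intro: smooth_const smooth_add)

lemma smooth_prod: "finite A \<Longrightarrow> (\<And>i. i \<in> A \<Longrightarrow> smooth (f i)) \<Longrightarrow> smooth (\<lambda>x. \<Prod>i\<in>A. f i x)"
  by (induction A rule: finite_induct) (auto intro: smooth_const smooth_mult)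

lemma smooth_compose:
  "(\<And>l t. (g l has_real_derivative g (Suc l) t) (at t)) \<Longrightarrow> smooth f \<Longrightarrow> smooth (\<lambda>x. g l (f x))"
  by (simp add: smooth_def times_differentiable_compose)

lemma smooth_affine: "smooth f \<Longrightarrow> smooth (\<lambda>x. f (a + c *\<^sub>R x))"
  by (simp add: smooth_def times_differentiable_affine)

lemma smooth_partial_deriv: "smooth f \<Longrightarrow> smooth (partial_deriv j f)"
  unfolding smooth_def by (metis times_differentiable.simps(2))

lemma smooth_differentiable: "smooth f \<Longrightarrow> f differentiable (at x)"
  unfolding smooth_def by (metis times_differentiable.simps(2))

text \<open>Smoothness speaks of iterated partial derivatives only, so a class of differentiable
  functions that is closed under \<open>partial_deriv\<close> contains smooth functions only. This
  handles explicit families, such as convolutions with varying kernel.\<close>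

lemma smooth_coinduct:
  assumes "P f" "\<And>f x. P f \<Longrightarrow> f differentiable (at x)" "\<And>f j. P f \<Longrightarrow> P (partial_deriv j f)"
  shows "smooth f"
proof -
  have "P f \<Longrightarrow> times_differentiable k f" for k
    by (induction k arbitrary: f) (auto simp: assms)
  with assms(1) show ?thesis by (simp add: smooth_def)
qed

lemma smooth_vec_nth: "smooth (\<lambda>x::real^'n::finite. x $ i)"
\<comment> \<open>Constants join the class because they are the partial derivatives of a
  coordinate.\<close>
proof (rule smooth_coinduct[where P="\<lambda>f. f = (\<lambda>x. x $ i) \<or> (\<exists>c. f = (\<lambda>x. c))"])
  fix f :: "real^'n \<Rightarrow> real" and x
  assume "f = (\<lambda>x. x $ i) \<or> (\<exists>c. f = (\<lambda>x. c))"
  then show "f differentiable (at x)"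
    using has_derivative_vec_nth[of i "at x"] has_derivative_const[of _ "at x"]
    unfolding differentiable_def by blast
next
  fix f :: "real^'n \<Rightarrow> real" and j
  assume "f = (\<lambda>x. x $ i) \<or> (\<exists>c. f = (\<lambda>x. c))"
  then show "partial_deriv j f = (\<lambda>x. x $ i) \<or> (\<exists>c. partial_deriv j f = (\<lambda>x. c))"
  proof
    assume f: "f = (\<lambda>x. x $ i)"
    have "partial_deriv j f = (\<lambda>x. if i = j then 1 else 0)"
      unfolding f by (rule ext) (rule partial_deriv_vec_nth)
    then show ?thesis by blast
  next
    assume "\<exists>c. f = (\<lambda>x. c)"
    then obtain c where f: "f = (\<lambda>x. c)" by blast
    have "partial_deriv j f = (\<lambda>x. 0)"
      unfolding f by (rule ext) (rule partial_deriv_has_derivative[OF has_derivative_const])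
    then show ?thesis by blast
  qed
qed simp

lemma smooth_continuous: "smooth f \<Longrightarrow> continuous_on S f"
  by (meson smooth_differentiable continuous_at_imp_continuous_on differentiable_imp_continuous_within)

lemma smooth_borel: "smooth f \<Longrightarrow> f \<in> borel_measurable borel"
  using smooth_continuous borel_measurable_continuous_onI by blast

lemma smooth_has_derivative:
  "smooth f \<Longrightarrow> (f has_derivative (\<lambda>h. \<Sum>j\<in>UNIV. partial_deriv j f x * h $ j)) (at x)"
  by (simp add: has_derivative_partial_deriv smooth_differentiable)

text \<open>The polynomial factors make the family closed under differentiation.\<close>

definition flat :: "real poly \<Rightarrow> real \<Rightarrow> real" where
  "flat P t = (if t > 0 then poly P (1 / t) * exp (- 1 / t) else 0)"

lemma poly_times_exp_uminus_tendsto_0: "((\<lambda>x::real. poly P x * exp (- x)) \<longlongrightarrow> 0) at_top"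
proof -
  \<comment> \<open>The extra factor x^k absorbs the x that each \<open>pCons\<close> splits off
    from the polynomial; hence \<open>k\<close> stays arbitrary in the induction.\<close>
  have *: "((\<lambda>x. poly P x * x ^ k * exp (- x)) \<longlongrightarrow> 0) at_top" for k
  proof (induction P arbitrary: k)
    case (pCons a P)
    have "((\<lambda>x. a * (x ^ k / exp x) + poly P x * x ^ Suc k * exp (- x)) \<longlongrightarrow> a * 0 + 0) at_top"
      by (intro tendsto_add tendsto_mult tendsto_const tendsto_power_div_exp_0 pCons)
    then show ?case by (simp add: algebra_simps exp_minus divide_inverse)
  qed simp
  show ?thesis using *[of 0] by simp
qed

text \<open>With x = 1/t the derivative for t > 0 is x^2 (P(x) - P'(x)) exp(-x), and
  \<open>[:0,0,1:]\<close> is the polynomial x^2. At 0 the difference quotient from the right is x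
  P(x) exp(-x) with x = 1/h, which is where \<open>pCons 0 P\<close> comes from, and it tends to
  0.\<close>

lemma flat_has_derivative:
  "(flat P has_real_derivative flat ([:0,0,1:] * (P - pderiv P)) t) (at t)"
proof -
  consider "t > 0" | "t < 0" | "t = 0" by linarith
  then show ?thesis
  proof cases
    case 1
    have "((\<lambda>t. poly P (1 / t) * exp (- 1 / t)) has_real_derivative
        flat ([:0,0,1:] * (P - pderiv P)) t) (at t)"
      using 1 by (auto intro!: derivative_eq_intros simp: flat_def divide_simps power2_eq_square algebra_simps)
    then show ?thesis
      by (rule has_field_derivative_transform_within_open[of _ _ _ "{0<..}"]) (use 1 in \<open>auto simp: flat_def\<close>)
  next
    case 2
    have "((\<lambda>t. 0) has_real_derivative flat ([:0,0,1:] * (P - pderiv P)) t) (at t)"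
      using 2 by (simp add: flat_def)
    then show ?thesis
      by (rule has_field_derivative_transform_within_open[of _ _ _ "{..<0}"]) (use 2 in \<open>auto simp: flat_def\<close>)
  next
    case 3
    have l: "((\<lambda>h. flat P h / h) \<longlongrightarrow> 0) (at_left 0)"
      by (rule tendsto_eventually) (auto simp: flat_def eventually_at_filter)
    have "((\<lambda>x. poly (pCons 0 P) x * exp (- x)) \<longlongrightarrow> 0) at_top"
      by (rule poly_times_exp_uminus_tendsto_0)
    then have "((\<lambda>h. poly (pCons 0 P) (inverse h) * exp (- inverse h)) \<longlongrightarrow> 0) (at_right 0)"
      by (rule filterlim_compose) (rule filterlim_inverse_at_top_right)
    then have r: "((\<lambda>h. flat P h / h) \<longlongrightarrow> 0) (at_right 0)"
      by (rule Lim_transform_eventually)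
        (auto simp: flat_def eventually_at_filter field_simps)
    from l r have "((\<lambda>h. flat P h / h) \<longlongrightarrow> 0) (at 0)"
      by (rule filterlim_split_at)
    then show ?thesis using 3 by (simp add: DERIV_def flat_def)
  qed
qed

lemma smooth_flat: "smooth f \<Longrightarrow> smooth (\<lambda>x. flat P (f x))"
  using smooth_compose[of "\<lambda>l. flat (((\<lambda>P. [:0,0,1:] * (P - pderiv P)) ^^ l) P)" f 0]
    flat_has_derivative by simp

text \<open>Two nested copies of exp(-1/t): the inner one makes the argument of the outer one equal
  to 1 for t \<le> a and non-positive for t \<ge> b, the outer one turns non-positive arguments into
  0, and \<open>flat [:1:] 1\<close> normalises the plateau to 1. All denominators are constants, so
  smoothness follows without a quotient rule.\<close>

definition cutoff :: "real \<Rightarrow> real \<Rightarrow> real \<Rightarrow> real" where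
  "cutoff a b t = flat [:1:] (1 - flat [:1:] (t - a) / flat [:1:] (b - a)) / flat [:1:] 1"

lemma flat_one_mono: "s \<le> t \<Longrightarrow> flat [:1:] s \<le> flat [:1:] t"
  by (auto simp: flat_def divide_simps)

lemma flat_one_pos: "0 < t \<Longrightarrow> 0 < flat [:1:] t"
  by (simp add: flat_def)

lemma flat_nonpos: "t \<le> 0 \<Longrightarrow> flat P t = 0"
  by (simp add: flat_def)

lemma flat_one_nonneg: "0 \<le> flat [:1:] t"
  by (simp add: flat_def)

lemma cutoff_eq_1: "t \<le> a \<Longrightarrow> cutoff a b t = 1"
  by (simp add: cutoff_def flat_def)

lemma cutoff_eq_0: "a < b \<Longrightarrow> b \<le> t \<Longrightarrow> cutoff a b t = 0"
  using flat_one_mono[of "b - a" "t - a"] flat_one_pos[of "b - a"]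
  by (auto simp: cutoff_def divide_simps intro!: flat_nonpos)

lemma cutoff_nonneg: "0 \<le> cutoff a b t"
  by (simp add: cutoff_def flat_one_nonneg)

lemma cutoff_le_1: "cutoff a b t \<le> 1"
  using flat_one_mono[of "1 - flat [:1:] (t - a) / flat [:1:] (b - a)" 1]
    flat_one_pos[of 1] flat_one_nonneg[of "t - a"] flat_one_nonneg[of "b - a"]
  by (simp add: cutoff_def)

lemma smooth_cutoff: "smooth f \<Longrightarrow> smooth (\<lambda>x. cutoff a b (f x))"
  unfolding cutoff_def divide_inverse
  by (intro smooth_mult smooth_flat smooth_diff smooth_const)

text \<open>The derivative given by the chain rule is continuous, hence bounded on
  \<open>{a..b}\<close>. Outside it vanishes, below \<open>a\<close> through the inner and above
  \<open>b\<close> through the outer factor. Its vanishing beyond \<open>b\<close> later keeps the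
  gradient bound for truncations independent of the truncation level.\<close>

lemma cutoff_has_derivative_bounded:
  assumes "a < b"
  obtains d H where "\<And>t. (cutoff a b has_real_derivative d t) (at t)" "\<And>t. \<bar>d t\<bar> \<le> H"
    "\<And>t. t \<le> a \<or> b \<le> t \<Longrightarrow> d t = 0"
proof -
  define P1 where "P1 = [:0,0,1:] * ([:1::real:] - pderiv [:1:])"
  define d where "d t = flat P1 (1 - flat [:1:] (t - a) / flat [:1:] (b - a))
     * (- flat P1 (t - a) / flat [:1:] (b - a)) / flat [:1:] 1" for t
  have flat': "(flat [:1:] has_real_derivative flat P1 t) (at t)" for t
    unfolding P1_def by (rule flat_has_derivative)
  have 1: "(cutoff a b has_real_derivative d t) (at t)" for t
  proof -
    have "((\<lambda>t. flat [:1:] (t - a)) has_real_derivative flat P1 (t - a) * 1) (at t)"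
      by (rule DERIV_chain2[OF flat']) (auto intro!: derivative_eq_intros)
    from DERIV_diff[OF DERIV_const DERIV_cdivide[OF this]]
    have "((\<lambda>t. 1 - flat [:1:] (t - a) / flat [:1:] (b - a)) has_real_derivative
        - flat P1 (t - a) / flat [:1:] (b - a)) (at t)" by simp
    from DERIV_cdivide[OF DERIV_chain2[OF flat' this]] show ?thesis
      unfolding cutoff_def[abs_def] d_def .
  qed
  have 2: "d t = 0" if "t \<le> a \<or> b \<le> t" for t
  proof (cases "t \<le> a")
    case False
    then have "flat [:1:] (b - a) \<le> flat [:1:] (t - a)" using that by (intro flat_one_mono) auto
    then have "1 \<le> flat [:1:] (t - a) / flat [:1:] (b - a)"
      by (subst le_divide_eq_1_pos[OF flat_one_pos]) (use assms in auto)
    then have "1 - flat [:1:] (t - a) / flat [:1:] (b - a) \<le> 0" by (rule iffD2[OF diff_le_0_iff_le])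
    then show ?thesis unfolding d_def by (subst flat_nonpos) auto
  qed (simp add: d_def flat_nonpos)
  have c: "continuous_on UNIV (flat P)" for P
    using DERIV_isCont[OF flat_has_derivative] by (simp add: continuous_on_eq_continuous_at)
  have "continuous_on {a..b} d"
    unfolding d_def divide_inverse
    by (intro continuous_on_mult continuous_on_minus continuous_on_diff continuous_on_const
        continuous_on_compose2[OF c] continuous_on_id) auto
  then have "compact (d ` {a..b})"
    using compact_continuous_image by blast
  then obtain H where H: "\<And>t. t \<in> {a..b} \<Longrightarrow> \<bar>d t\<bar> \<le> H"
    using compact_imp_bounded[of "d ` {a..b}"] unfolding bounded_iff real_norm_def by blast
  moreover have "0 \<le> H" using H[of a] assms by auto
  ultimately have "\<bar>d t\<bar> \<le> H" for t using 2[of t] by (cases "t \<in> {a..b}") auto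
  with 1 2 that show ?thesis by blast
qed

section \<open>Translations in L1\<close>

lemma nn_integral_lborel_affine:
  fixes f :: "'a::euclidean_space \<Rightarrow> ennreal"
  assumes [measurable]: "f \<in> borel_measurable borel" and c: "c \<noteq> 0"
  shows "(\<integral>\<^sup>+x. f x \<partial>lborel) = ennreal (\<bar>c\<bar> ^ DIM('a)) * (\<integral>\<^sup>+x. f (t + c *\<^sub>R x) \<partial>lborel)"
  by (subst lborel_affine[OF c, of t])
    (simp add: nn_integral_density nn_integral_distr nn_integral_cmult ennreal_power)

lemma integrable_lborel_affine:
  fixes f :: "'a::euclidean_space \<Rightarrow> 'b::{banach, second_countable_topology}"
  assumes f: "integrable lborel f" and c: "c \<noteq> 0"
  shows "integrable lborel (\<lambda>x. f (t + c *\<^sub>R x))"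
proof -
  have [measurable]: "f \<in> borel_measurable borel" using f by auto
  have "(\<integral>\<^sup>+x. norm (f x) \<partial>lborel) = ennreal (\<bar>c\<bar> ^ DIM('a)) * (\<integral>\<^sup>+x. norm (f (t + c *\<^sub>R x)) \<partial>lborel)"
    by (rule nn_integral_lborel_affine) (use c in measurable)
  with f c show ?thesis unfolding integrable_iff_bounded
    by (auto simp: ennreal_mult_less_top)
qed

lemma integral_lborel_affine:
  fixes f :: "'a::euclidean_space \<Rightarrow> 'b::{banach, second_countable_topology}"
  assumes f[measurable]: "f \<in> borel_measurable borel" and c: "c \<noteq> 0"
  shows "(\<integral>x. f x \<partial>lborel) = (\<bar>c\<bar> ^ DIM('a)) *\<^sub>R (\<integral>x. f (t + c *\<^sub>R x) \<partial>lborel)"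
  by (subst lborel_affine[OF c, of t]) (simp add: integral_density integral_distr)

lemma nn_integral_lborel_translate:
  fixes f :: "'a::euclidean_space \<Rightarrow> ennreal"
  assumes "f \<in> borel_measurable borel"
  shows "(\<integral>\<^sup>+x. f (x + h) \<partial>lborel) = (\<integral>\<^sup>+x. f x \<partial>lborel)"
  using nn_integral_lborel_affine[OF assms, of 1 h] by (simp add: add.commute)

lemma compact_open_separated:
  assumes "compact (K::'a::euclidean_space set)" "open V" "K \<subseteq> V"
  obtains d where "d > 0" "\<And>x h. x \<in> K \<Longrightarrow> norm h < d \<Longrightarrow> x + h \<in> V"
proof (cases "K = {} \<or> V = UNIV")
  case True then show ?thesis using that[of 1] by auto
next
  case False
  have "\<exists>d>0. \<forall>x\<in>K. \<forall>y\<in>-V. d \<le> dist x y"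
    by (rule separate_compact_closed) (use assms in auto)
  then obtain d where d: "d > 0" "\<forall>x\<in>K. \<forall>y\<in>-V. d \<le> dist x y" by blast
  show ?thesis
  proof (rule that[OF d(1)])
    fix x h :: 'a assume "x \<in> K" "norm h < d"
    then show "x + h \<in> V" using d(2)[rule_format, of x "x + h"] by (auto simp: dist_norm)
  qed
qed

text \<open>\<open>A\<close> is squeezed between a compact \<open>K\<close> and an open
  \<open>V\<close> with \<open>V - K\<close> of measure at most e/2. A shift shorter than the
  distance from \<open>K\<close> to the complement of \<open>V\<close> moves no point of
  \<open>K\<close> out of \<open>V\<close>, so the two indicators differ at x only if x or x + h
  lies in \<open>V - K\<close>.\<close>

lemma L1_translation_indicator:
  fixes A :: "'a::euclidean_space set"
  assumes A[measurable]: "A \<in> sets borel" and fin: "emeasure lborel A < \<infinity>" and e: "(e::real) > 0"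
  shows "\<exists>d>0. \<forall>h. norm h < d \<longrightarrow>
    (\<integral>\<^sup>+x. norm (indicat_real A (x + h) - indicat_real A x) \<partial>lborel) \<le> ennreal e"
proof -
  have Al: "A \<in> sets lebesgue" by simp
  obtain V where V: "open V" "A \<subseteq> V" "emeasure lebesgue (V - A) < ennreal (e/8)"
    using sets_lebesgue_outer_open[OF Al, of "e/8"] e by (metis divide_pos_pos zero_less_numeral)
  obtain C where C: "closed C" "C \<subseteq> A" "emeasure lebesgue (A - C) < ennreal (e/8)"
    using sets_lebesgue_inner_closed[OF Al, of "e/8"] e by (metis divide_pos_pos zero_less_numeral)
  have "(\<lambda>n. emeasure lborel (A - cball 0 (real n))) \<longlonglongrightarrow> emeasure lborel (\<Inter>n. A - cball 0 (real n))"
  proof (rule Lim_emeasure_decseq)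
    show "emeasure lborel (A - cball 0 (real n)) \<noteq> \<infinity>" for n
      using emeasure_mono[of "A - cball 0 (real n)" A lborel] fin by (auto simp: top_unique)
  qed (auto simp: decseq_def)
  moreover have "(\<Inter>n. A - cball 0 (real n)) = {}"
    using real_arch_simple by auto
  ultimately have "(\<lambda>n. emeasure lborel (A - cball 0 (real n))) \<longlonglongrightarrow> 0"
    by (simp only: emeasure_empty)
  from order_tendstoD(2)[OF this, of "ennreal (e/8)"] e
  obtain n where n: "emeasure lborel (A - cball 0 (real n)) < ennreal (e/8)"
    by (auto simp: eventually_sequentially)
  define K where "K = C \<inter> cball 0 (real n)"
  have K: "compact K" "K \<subseteq> A" "K \<in> sets borel" "V \<in> sets borel"
    unfolding K_def using C V by (auto simp: closed_Int_compact)
  note [measurable] = K(3,4)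
  obtain d where d: "d > 0" "\<And>x h. x \<in> K \<Longrightarrow> norm h < d \<Longrightarrow> x + h \<in> V"
    using compact_open_separated[OF K(1) V(1)] K V by auto
  have "emeasure lborel (V - K) \<le> emeasure lborel ((V - A) \<union> (A - C) \<union> (A - cball 0 (real n)))"
    using C by (intro emeasure_mono) (auto simp: K_def)
  also have "\<dots> \<le> emeasure lborel (V - A) + emeasure lborel (A - C) + emeasure lborel (A - cball 0 (real n))"
    using C by (intro order_trans[OF emeasure_subadditive] add_right_mono) auto
  also have "\<dots> \<le> ennreal (e/8) + ennreal (e/8) + ennreal (e/8)"
    using V C n by (intro add_mono) auto
  also have "\<dots> \<le> ennreal (e/2)"
    using e by (simp flip: ennreal_plus)
  finally have VK: "emeasure lborel (V - K) \<le> ennreal (e/2)" .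
  show ?thesis
  proof (intro exI[of _ d] conjI allI impI d)
    fix h :: 'a assume h: "norm h < d"
    have "norm (indicat_real A (x + h) - indicat_real A x) \<le> indicat_real (V - K) x + indicat_real (V - K) (x + h)" for x
      using d(2)[of x h] d(2)[of "x + h" "-h"] h K(2) V(2) by (auto simp: indicator_def)
    from ennreal_leI[OF this] have "(\<integral>\<^sup>+x. norm (indicat_real A (x + h) - indicat_real A x) \<partial>lborel)
        \<le> (\<integral>\<^sup>+x. indicator (V - K) x + indicator (V - K) (x + h) \<partial>lborel)"
      by (intro nn_integral_mono) (simp add: ennreal_plus ennreal_indicator)
    also have "\<dots> = emeasure lborel (V - K) + emeasure lborel (V - K)"
      by (subst nn_integral_add) (auto simp: nn_integral_lborel_translate[of "indicator (V - K)"])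
    also have "\<dots> \<le> ennreal (e/2) + ennreal (e/2)" using VK by (intro add_mono)
    also have "\<dots> = ennreal e" using e by (simp flip: ennreal_plus)
    finally show "(\<integral>\<^sup>+x. norm (indicat_real A (x + h) - indicat_real A x) \<partial>lborel) \<le> ennreal e" .
  qed
qed

text \<open>Density argument: \<open>integrable_induct\<close> reduces the claim to indicators, sums
  and dominated limits. In the limit case one approximant within e/4 of \<open>f\<close> is used
  both at x and at x + h, which costs the same by translation invariance.\<close>

lemma L1_translation_continuous:
  fixes f :: "'a::euclidean_space \<Rightarrow> 'b::{banach, second_countable_topology}"
  assumes "integrable lborel f" and "(e::real) > 0"
  shows "\<exists>d>0. \<forall>h. norm h < d \<longrightarrow> (\<integral>\<^sup>+x. norm (f (x + h) - f x) \<partial>lborel) \<le> ennreal e"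
  using assms
proof (induction f arbitrary: e rule: integrable_induct)
  case (base A c)
  have [measurable]: "A \<in> sets borel" using base by simp
  \<comment> \<open>Dividing by \<open>norm c + 1\<close> instead of \<open>norm c\<close> covers c
    = 0.\<close>
  have "e / (norm c + 1) > 0" using base by (simp add: add_nonneg_pos)
  from L1_translation_indicator[OF _ base(2) this] base(1)
  obtain d where d: "d > 0" "\<And>h. norm h < d \<Longrightarrow>
    (\<integral>\<^sup>+x. norm (indicat_real A (x + h) - indicat_real A x) \<partial>lborel) \<le> ennreal (e / (norm c + 1))" by auto
  show ?case
  proof (intro exI[of _ d] conjI allI impI d)
    fix h :: 'a assume "norm h < d"
    have "(\<integral>\<^sup>+x. norm (indicat_real A (x + h) *\<^sub>R c - indicat_real A x *\<^sub>R c) \<partial>lborel)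
      = (\<integral>\<^sup>+x. ennreal (norm c) * norm (indicat_real A (x + h) - indicat_real A x) \<partial>lborel)"
      by (intro nn_integral_cong) (simp flip: scaleR_diff_left ennreal_mult add: mult.commute)
    also have "\<dots> = ennreal (norm c) * (\<integral>\<^sup>+x. norm (indicat_real A (x + h) - indicat_real A x) \<partial>lborel)"
      by (rule nn_integral_cmult) measurable
    also have "\<dots> \<le> ennreal (norm c) * ennreal (e / (norm c + 1))"
      using d(2)[OF \<open>norm h < d\<close>] by (intro mult_left_mono) auto
    also have "\<dots> = ennreal (norm c * (e / (norm c + 1)))"
      using base by (intro ennreal_mult[symmetric]) auto
    also have "\<dots> \<le> ennreal e"
      using base(3) by (intro ennreal_leI) (simp add: pos_divide_le_eq add_pos_nonneg algebra_simps)
    finally show "(\<integral>\<^sup>+x. norm (indicat_real A (x + h) *\<^sub>R c - indicat_real A x *\<^sub>R c) \<partial>lborel) \<le> ennreal e" .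
  qed
next
  case (add f g)
  have [measurable]: "f \<in> borel_measurable borel" "g \<in> borel_measurable borel" using add by auto
  obtain d1 where d1: "d1 > 0" "\<And>h. norm h < d1 \<Longrightarrow> (\<integral>\<^sup>+x. norm (f (x + h) - f x) \<partial>lborel) \<le> ennreal (e/2)"
    using add.IH(1)[OF half_gt_zero[OF add.prems]] by blast
  obtain d2 where d2: "d2 > 0" "\<And>h. norm h < d2 \<Longrightarrow> (\<integral>\<^sup>+x. norm (g (x + h) - g x) \<partial>lborel) \<le> ennreal (e/2)"
    using add.IH(2)[OF half_gt_zero[OF add.prems]] by blast
  show ?case
  proof (intro exI[of _ "min d1 d2"] conjI allI impI)
    fix h :: 'a assume h: "norm h < min d1 d2"
    have "(\<integral>\<^sup>+x. norm (f (x + h) + g (x + h) - (f x + g x)) \<partial>lborel) \<le>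
        (\<integral>\<^sup>+x. ennreal (norm (f (x + h) - f x)) + ennreal (norm (g (x + h) - g x)) \<partial>lborel)"
      by (intro nn_integral_mono)
        (simp flip: ennreal_plus add: ennreal_leI norm_diff_triangle_ineq)
    also have "\<dots> = (\<integral>\<^sup>+x. norm (f (x + h) - f x) \<partial>lborel) + (\<integral>\<^sup>+x. norm (g (x + h) - g x) \<partial>lborel)"
      by (rule nn_integral_add) measurable
    also have "\<dots> \<le> ennreal (e/2) + ennreal (e/2)"
      using d1(2)[of h] d2(2)[of h] h by (intro add_mono) auto
    also have "\<dots> = ennreal e" using add.prems by (simp flip: ennreal_plus)
    finally show "(\<integral>\<^sup>+x. norm (f (x + h) + g (x + h) - (f x + g x)) \<partial>lborel) \<le> ennreal e" .
  qed (use d1 d2 in auto)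
next
  case (lim f s)
  have [measurable]: "f \<in> borel_measurable borel" "\<And>i. s i \<in> borel_measurable borel"
    using borel_measurable_integrable[OF lim.hyps(4)] borel_measurable_integrable[OF lim.hyps(1)] by auto
  \<comment> \<open>The approximants of the induction are bounded by 2 |f|, which upgrades their
    pointwise convergence to convergence in L1.\<close>
  have "(\<lambda>i. \<integral>\<^sup>+x. norm (f x - s i x) \<partial>lborel) \<longlonglongrightarrow> 0"
  proof (rule nn_integral_dominated_convergence_norm[where w="\<lambda>x. 2 * norm (f x)"])
    show "(\<integral>\<^sup>+x. ennreal (2 * norm (f x)) \<partial>lborel) < \<infinity>"
      using lim.hyps(4) by (simp add: integrable_iff_bounded ennreal_mult nn_integral_cmult ennreal_mult_less_top)
  qed (auto intro!: lim.hyps(2-3))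
  from eventually_happens'[OF _ order_tendstoD(2)[OF this, of "ennreal (e/4)"]] lim.prems
  obtain i where "(\<integral>\<^sup>+x. norm (f x - s i x) \<partial>lborel) < ennreal (e/4)" by auto
  then have i: "(\<integral>\<^sup>+x. norm (f x - s i x) \<partial>lborel) \<le> ennreal (e/4)" by (rule less_imp_le)
  obtain d where d: "d > 0" "\<And>h. norm h < d \<Longrightarrow> (\<integral>\<^sup>+x. norm (s i (x + h) - s i x) \<partial>lborel) \<le> ennreal (e/4)"
    using lim.IH[of "e/4" i] lim.prems by (metis divide_pos_pos zero_less_numeral)
  show ?case
  proof (intro exI[of _ d] conjI allI impI d)
    fix h :: 'a assume h: "norm h < d"
    have "norm (f (x + h) - f x) \<le> norm (f (x + h) - s i (x + h)) + norm (s i (x + h) - s i x) + norm (f x - s i x)" for x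
      using norm_triangle_ineq[of "f (x + h) - s i (x + h)" "s i (x + h) - s i x"]
        norm_triangle_ineq[of "f (x + h) - s i x" "s i x - f x"]
      by (simp add: norm_minus_commute)
    from ennreal_leI[OF this] have "(\<integral>\<^sup>+x. norm (f (x + h) - f x) \<partial>lborel) \<le>
        (\<integral>\<^sup>+x. ennreal (norm (f (x + h) - s i (x + h))) + ennreal (norm (s i (x + h) - s i x)) + ennreal (norm (f x - s i x)) \<partial>lborel)"
      by (intro nn_integral_mono) (simp only: ennreal_plus norm_ge_zero add_nonneg_nonneg)
    also have "\<dots> = (\<integral>\<^sup>+x. norm (f (x + h) - s i (x + h)) \<partial>lborel) + (\<integral>\<^sup>+x. norm (s i (x + h) - s i x) \<partial>lborel)
         + (\<integral>\<^sup>+x. norm (f x - s i x) \<partial>lborel)"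
    proof -
      have "(\<lambda>x. ennreal (norm (f (x + h) - s i (x + h)))) \<in> borel_measurable lborel"
        "(\<lambda>x. ennreal (norm (s i (x + h) - s i x))) \<in> borel_measurable lborel"
        "(\<lambda>x. ennreal (norm (f x - s i x))) \<in> borel_measurable lborel" by measurable
      from nn_integral_add[OF borel_measurable_add[OF this(1,2)] this(3)] nn_integral_add[OF this(1,2)]
      show ?thesis by (simp only:)
    qed
    also have "(\<integral>\<^sup>+x. norm (f (x + h) - s i (x + h)) \<partial>lborel) = (\<integral>\<^sup>+x. norm (f x - s i x) \<partial>lborel)"
      by (rule nn_integral_lborel_translate) measurable
    also have "(\<integral>\<^sup>+x. norm (f x - s i x) \<partial>lborel) + (\<integral>\<^sup>+x. norm (s i (x + h) - s i x) \<partial>lborel)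
         + (\<integral>\<^sup>+x. norm (f x - s i x) \<partial>lborel) \<le> ennreal (e/4) + ennreal (e/4) + ennreal (e/4)"
      using d(2)[OF h] i by (intro add_mono)
    also have "\<dots> \<le> ennreal e" using lim.prems by (simp flip: ennreal_plus)
    finally show "(\<integral>\<^sup>+x. norm (f (x + h) - f x) \<partial>lborel) \<le> ennreal e" .
  qed
qed

section \<open>Test functions\<close>

text \<open>One statement for two purposes: with the mollifier as weight it gives L1 convergence of
  mollifications, with the indicator of the unit cube it gives convergence of averages over small
  cubes. Exchanging the integrals leaves, for each \<open>z\<close>, a translation by r z, and these
  are uniformly short because the weight vanishes for |z| > R.\<close>

lemma L1_translation_average:
  fixes f :: "'a::euclidean_space \<Rightarrow> 'b::{banach, second_countable_topology}" and K :: "'a \<Rightarrow> real"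
  assumes f: "integrable lborel f" and K[measurable]: "K \<in> borel_measurable borel" and K0: "\<And>z. norm z > R \<Longrightarrow> K z = 0"
    and e: "(e::real) > 0"
  shows "\<exists>d>0. \<forall>r. \<bar>r\<bar> < d \<longrightarrow>
    (\<integral>\<^sup>+x. \<integral>\<^sup>+z. ennreal (K z) * ennreal (norm (f (x + r *\<^sub>R z) - f x)) \<partial>lborel \<partial>lborel)
      \<le> ennreal e * (\<integral>\<^sup>+z. K z \<partial>lborel)"
proof -
  have [measurable]: "f \<in> borel_measurable borel" using f by auto
  obtain d where d: "d > 0" "\<And>h. norm h < d \<Longrightarrow> (\<integral>\<^sup>+x. norm (f (x + h) - f x) \<partial>lborel) \<le> ennreal e"
    using L1_translation_continuous[OF f e] by blast
  show ?thesis
  proof (intro exI[of _ "d / (\<bar>R\<bar> + 1)"] conjI allI impI)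
    fix r assume r: "\<bar>r\<bar> < d / (\<bar>R\<bar> + 1)"
    have "(\<integral>\<^sup>+x. \<integral>\<^sup>+z. ennreal (K z) * ennreal (norm (f (x + r *\<^sub>R z) - f x)) \<partial>lborel \<partial>lborel) =
      (\<integral>\<^sup>+z. \<integral>\<^sup>+x. ennreal (K z) * ennreal (norm (f (x + r *\<^sub>R z) - f x)) \<partial>lborel \<partial>lborel)"
      by (rule lborel_pair.Fubini'[symmetric]) measurable
    also have "\<dots> = (\<integral>\<^sup>+z. ennreal (K z) * (\<integral>\<^sup>+x. ennreal (norm (f (x + r *\<^sub>R z) - f x)) \<partial>lborel) \<partial>lborel)"
      by (intro nn_integral_cong nn_integral_cmult) measurable
    also have "\<dots> \<le> (\<integral>\<^sup>+z. ennreal e * ennreal (K z) \<partial>lborel)"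
    proof (intro nn_integral_mono)
      fix z :: 'a
      show "ennreal (K z) * (\<integral>\<^sup>+x. ennreal (norm (f (x + r *\<^sub>R z) - f x)) \<partial>lborel) \<le> ennreal e * ennreal (K z)"
      proof (cases "norm z > R")
        case False
        have "norm (r *\<^sub>R z) \<le> \<bar>r\<bar> * (\<bar>R\<bar> + 1)" using False by (auto intro!: mult_left_mono)
        also have "\<dots> < d" using r by (simp add: pos_less_divide_eq add_nonneg_pos)
        finally show ?thesis using d(2) by (subst mult.commute) (intro mult_right_mono, auto)
      qed (simp add: K0)
    qed
    also have "\<dots> = ennreal e * (\<integral>\<^sup>+z. K z \<partial>lborel)" by (rule nn_integral_cmult) measurable
    finally show "(\<integral>\<^sup>+x. \<integral>\<^sup>+z. ennreal (K z) * ennreal (norm (f (x + r *\<^sub>R z) - f x)) \<partial>lborel \<partial>lborel)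
      \<le> ennreal e * (\<integral>\<^sup>+z. K z \<partial>lborel)" .
  qed (use d in \<open>auto intro!: divide_pos_pos add_nonneg_pos\<close>)
qed

lemma test_function_smooth: "\<phi> \<in> test_functions U \<Longrightarrow> smooth \<phi>"
  by (simp add: test_functions_def smooth_def)

lemma test_functionI:
  assumes "smooth \<phi>" "compact K" "K \<subseteq> U" "\<And>x. x \<notin> K \<Longrightarrow> \<phi> x = 0"
  shows "\<phi> \<in> test_functions U"
proof -
  have "closure {x. \<phi> x \<noteq> 0} \<subseteq> K"
    using assms by (intro closure_minimal) (auto simp: compact_imp_closed)
  moreover from this assms have "compact (closure {x. \<phi> x \<noteq> 0})"
    by (meson bounded_subset closed_closure compact_eq_bounded_closed)
  ultimately show ?thesis using assms by (auto simp: test_functions_def smooth_def)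
qed

lemma test_function_support:
  assumes "\<phi> \<in> test_functions U"
  obtains K where "compact K" "K \<subseteq> U" "\<And>x. x \<notin> K \<Longrightarrow> \<phi> x = 0" "\<And>x j. x \<notin> K \<Longrightarrow> partial_deriv j \<phi> x = 0"
proof (rule that[of "closure {x. \<phi> x \<noteq> 0}"])
  show "\<phi> x = 0" if "x \<notin> closure {x. \<phi> x \<noteq> 0}" for x
    using that closure_subset[of "{x. \<phi> x \<noteq> 0}"] by blast
  show "partial_deriv j \<phi> x = 0" if "x \<notin> closure {x. \<phi> x \<noteq> 0}" for x j
  proof -
    have "((\<lambda>x. 0) has_derivative (\<lambda>x. 0)) (at x)" by simp
    then have "(\<phi> has_derivative (\<lambda>x. 0)) (at x)"
    proof (rule has_derivative_transform_within_open)
      show "open (- closure {x. \<phi> x \<noteq> 0})" by (simp add: open_Compl)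
      show "0 = \<phi> y" if "y \<in> - closure {x. \<phi> x \<noteq> 0}" for y
        using that closure_subset[of "{x. \<phi> x \<noteq> 0}"] by force
    qed (use that in auto)
    then show ?thesis by (rule partial_deriv_has_derivative)
  qed
qed (use assms in \<open>auto simp: test_functions_def\<close>)

lemma test_function_partial_deriv:
  assumes "\<phi> \<in> test_functions U" shows "partial_deriv j \<phi> \<in> test_functions U"
proof -
  obtain K where "compact K" "K \<subseteq> U" "\<And>x. x \<notin> K \<Longrightarrow> \<phi> x = 0" "\<And>x j. x \<notin> K \<Longrightarrow> partial_deriv j \<phi> x = 0"
    using test_function_support[OF assms] by blast
  then show ?thesis
    using smooth_partial_deriv[OF test_function_smooth[OF assms]] by (intro test_functionI) auto
qed

lemma test_function_bounded:
  assumes "\<phi> \<in> test_functions U"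
  obtains B where "0 < B" "\<And>x. \<bar>\<phi> x\<bar> \<le> B"
proof -
  obtain K where K: "compact K" "K \<subseteq> U" "\<And>x. x \<notin> K \<Longrightarrow> \<phi> x = 0"
    "\<And>x j. x \<notin> K \<Longrightarrow> partial_deriv j \<phi> x = 0"
    using test_function_support[OF assms] by blast
  have "bounded (\<phi> ` K)"
    using K smooth_continuous[OF test_function_smooth[OF assms]] compact_continuous_image compact_imp_bounded by blast
  then obtain B where B: "B > 0" "\<And>x. x \<in> K \<Longrightarrow> \<bar>\<phi> x\<bar> \<le> B"
    unfolding bounded_pos real_norm_def by blast
  show ?thesis by (rule that[OF B(1)]) (use B K(3) in \<open>metis abs_zero less_imp_le\<close>)
qed

lemma test_function_borel[measurable_dest]: "\<phi> \<in> test_functions U \<Longrightarrow> \<phi> \<in> borel_measurable borel"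
  by (simp add: smooth_borel test_function_smooth)

lemma integrable_bounded_support:
  fixes f :: "'a::euclidean_space \<Rightarrow> 'b::{banach, second_countable_topology}"
  assumes [measurable]: "f \<in> borel_measurable borel" and "bounded K" "\<And>x. x \<notin> K \<Longrightarrow> f x = 0"
    "\<And>x. norm (f x) \<le> B"
  shows "integrable lborel f"
proof (rule integrableI_bounded_set[of "closure K" _ _ B])
  show "emeasure lborel (closure K) < \<infinity>" using assms by (intro emeasure_bounded_finite) auto
  show "AE x in lborel. x \<notin> closure K \<longrightarrow> f x = 0"
    using assms(3) closure_subset[of K] by (intro AE_I2) blast
qed (use assms in auto)

lemma test_function_integrable:
  assumes "\<phi> \<in> test_functions U" shows "integrable lborel \<phi>"
proof -
  obtain K where K: "compact K" "K \<subseteq> U" "\<And>x. x \<notin> K \<Longrightarrow> \<phi> x = 0"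
    "\<And>x j. x \<notin> K \<Longrightarrow> partial_deriv j \<phi> x = 0"
    using test_function_support[OF assms] by blast
  obtain B where "0 < B" "\<And>x. \<bar>\<phi> x\<bar> \<le> B" using test_function_bounded[OF assms] by blast
  with K assms show ?thesis
    by (intro integrable_bounded_support[of _ K B]) (auto simp: compact_imp_bounded)
qed

lemma test_function_lipschitz:
  assumes "\<phi> \<in> test_functions U"
  obtains B where "0 < B" "\<And>x y. \<bar>\<phi> x - \<phi> y\<bar> \<le> B * norm (x - y)"
    "\<And>x h. \<bar>\<Sum>j\<in>UNIV. partial_deriv j \<phi> x * h $ j\<bar> \<le> B * norm h"
proof -
  have "\<exists>B>0. \<forall>x. \<bar>partial_deriv j \<phi> x\<bar> \<le> B" for j
    using test_function_bounded[OF test_function_partial_deriv[OF assms, of j]] by metis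
  then obtain B where B: "\<And>j. B j > 0" "\<And>j x. \<bar>partial_deriv j \<phi> x\<bar> \<le> B j" by metis
  define C where "C = (\<Sum>j\<in>UNIV. B j)"
  have C0: "C > 0" unfolding C_def using B by (intro sum_pos) auto
  have bd: "\<bar>\<Sum>j\<in>UNIV. partial_deriv j \<phi> x * h $ j\<bar> \<le> C * norm h" for x h
  proof -
    have "\<bar>\<Sum>j\<in>UNIV. partial_deriv j \<phi> x * h $ j\<bar> \<le> (\<Sum>j\<in>UNIV. \<bar>partial_deriv j \<phi> x * h $ j\<bar>)" by (rule sum_abs)
    also have "\<dots> \<le> (\<Sum>j\<in>UNIV. B j * norm h)"
      unfolding abs_mult using B component_le_norm_cart[of h] by (intro sum_mono mult_mono) (auto simp: less_imp_le)
    finally show ?thesis by (simp add: C_def sum_distrib_right)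
  qed
  have "norm (\<phi> x - \<phi> y) \<le> C * norm (x - y)" for x y
  proof (rule differentiable_bound[of UNIV])
    show "(\<phi> has_derivative (\<lambda>h. \<Sum>j\<in>UNIV. partial_deriv j \<phi> x * h $ j)) (at x within UNIV)" for x
      using smooth_has_derivative[OF test_function_smooth[OF assms]] by simp
    show "onorm (\<lambda>h. \<Sum>j\<in>UNIV. partial_deriv j \<phi> x * h $ j) \<le> C" for x
      using bd by (intro onorm_le) auto
  qed auto
  with bd C0 show ?thesis by (intro that[of C]) auto
qed

lemma has_real_derivative_along_line:
  assumes "smooth f"
  shows "((\<lambda>s. f (x + s *\<^sub>R v)) has_real_derivative (\<Sum>j\<in>UNIV. partial_deriv j f (x + s *\<^sub>R v) * v $ j)) (at s)"
proof -
  have "((\<lambda>s. x + s *\<^sub>R v) has_derivative (\<lambda>s. s *\<^sub>R v)) (at s)"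
    by (auto intro!: derivative_eq_intros)
  from has_derivative_compose[OF this smooth_has_derivative[OF assms]]
  show ?thesis unfolding has_field_derivative_def
    by (elim has_derivative_eq_rhs) (simp add: fun_eq_iff sum_distrib_left mult_ac)
qed

text \<open>By translation invariance every difference quotient has integral 0. The quotients
  converge to the derivative and are dominated by the Lipschitz constant times the indicator of a
  ball; its radius is R + 1 because the increments \<open>t n\<close> are at most 1.\<close>

lemma integral_partial_deriv_eq_0:
  assumes "\<phi> \<in> test_functions (U :: (real^'n::finite) set)"
  shows "(\<integral>x. partial_deriv j \<phi> x \<partial>lborel) = 0"
proof -
  obtain K where K: "compact K" "K \<subseteq> U" "\<And>x. x \<notin> K \<Longrightarrow> \<phi> x = 0"
    "\<And>x j. x \<notin> K \<Longrightarrow> partial_deriv j \<phi> x = 0"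
    using test_function_support[OF assms] by blast
  obtain B where B: "0 < B" "\<And>x y. \<bar>\<phi> x - \<phi> y\<bar> \<le> B * norm (x - y)"
    using test_function_lipschitz[OF assms] by metis
  obtain R where R: "R > 0" "K \<subseteq> ball 0 R" using compact_imp_bounded[OF K(1)]
    by (meson bounded_subset_ballD)
  define t where "t n = inverse (real (Suc n))" for n
  have t: "0 < t n" "t n \<le> 1" for n by (auto simp: t_def field_simps)
  have [measurable]: "\<phi> \<in> borel_measurable borel" using assms by measurable
  have [measurable]: "partial_deriv j \<phi> \<in> borel_measurable borel"
    using test_function_borel[OF test_function_partial_deriv[OF assms]] .
  define s where "s n x = (\<phi> (x + t n *\<^sub>R axis j 1) - \<phi> x) / t n" for n x
  have "(\<lambda>n. \<integral>x. s n x \<partial>lborel) \<longlonglongrightarrow> (\<integral>x. partial_deriv j \<phi> x \<partial>lborel)"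
  proof (rule integral_dominated_convergence[where w="\<lambda>x. B * indicator (cball 0 (R+1)) x"])
    show "partial_deriv j \<phi> \<in> borel_measurable lborel" "s n \<in> borel_measurable lborel" for n
      unfolding s_def[abs_def] by measurable
    show "integrable lborel (\<lambda>x. B * indicator (cball 0 (R+1)) x)"
      by (intro integrable_mult_right integrable_real_indicator emeasure_bounded_finite) auto
    show "AE x in lborel. norm (s n x) \<le> B * indicator (cball 0 (R + 1)) x" for n
    proof (rule AE_I2)
      fix x :: "real^'n"
      have "norm x \<le> R + 1" if "x + t n *\<^sub>R axis j 1 \<in> K \<or> x \<in> K"
      proof -
        have "norm (t n *\<^sub>R axis j 1 :: real^'n) \<le> 1" using t[of n] by (simp add: norm_axis_1)
        then show ?thesis using that R norm_diff_ineq[of x "t n *\<^sub>R axis j 1"] by (auto simp: subset_iff)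
      qed
      moreover have "\<bar>\<phi> (x + t n *\<^sub>R axis j 1) - \<phi> x\<bar> \<le> B * t n"
        using B(2)[of "x + t n *\<^sub>R axis j 1" x] t[of n] by (simp add: norm_axis_1)
      moreover have "0 \<le> B * indicator (cball 0 (R + 1)) x" using B(1) by simp
      ultimately show "norm (s n x) \<le> B * indicator (cball 0 (R + 1)) x"
        using t[of n] K(3)[of x] K(3)[of "x + t n *\<^sub>R axis j 1"]
        by (cases "x + t n *\<^sub>R axis j 1 \<in> K \<or> x \<in> K") (auto simp: s_def divide_simps)
    qed
    show "AE x in lborel. (\<lambda>n. s n x) \<longlonglongrightarrow> partial_deriv j \<phi> x"
    proof (rule AE_I2)
      fix x :: "real^'n"
      have "((\<lambda>s. \<phi> (x + s *\<^sub>R axis j 1)) has_real_derivative partial_deriv j \<phi> x) (at 0)"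
        using has_real_derivative_along_line[OF test_function_smooth[OF assms], of x "axis j 1" 0]
        by (simp add: axis_def if_distrib cong: if_cong)
      then have "((\<lambda>h. (\<phi> (x + h *\<^sub>R axis j 1) - \<phi> x) / h) \<longlongrightarrow> partial_deriv j \<phi> x) (at 0)"
        by (simp add: DERIV_def)
      moreover have "filterlim t (at 0) sequentially"
        unfolding filterlim_at t_def using LIMSEQ_inverse_real_of_nat by auto
      ultimately show "(\<lambda>n. s n x) \<longlonglongrightarrow> partial_deriv j \<phi> x"
        unfolding s_def by (rule filterlim_compose)
    qed
  qed
  moreover have "(\<integral>x. s n x \<partial>lborel) = 0" for n
  proof -
    have i: "integrable lborel \<phi>" by (rule test_function_integrable[OF assms])
    have "(\<integral>x. \<phi> (x + t n *\<^sub>R axis j 1) \<partial>lborel) = (\<integral>x. \<phi> x \<partial>lborel)"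
      using integral_lborel_affine[of \<phi> 1 "t n *\<^sub>R axis j 1"] by (simp add: add.commute)
    moreover have "integrable lborel (\<lambda>x. \<phi> (x + t n *\<^sub>R axis j 1))"
      using integrable_lborel_affine[OF i, of 1 "t n *\<^sub>R axis j 1"] by (simp add: add.commute)
    ultimately show ?thesis using i unfolding s_def by simp
  qed
  ultimately have "(\<lambda>n. 0) \<longlonglongrightarrow> (\<integral>x. partial_deriv j \<phi> x \<partial>lborel)" by simp
  then show ?thesis by (simp add: LIMSEQ_const_iff)
qed

lemma test_function_mult_smooth:
  assumes "\<phi> \<in> test_functions U" "smooth f" shows "(\<lambda>x. f x * \<phi> x) \<in> test_functions U"
proof -
  obtain K where K: "compact K" "K \<subseteq> U" "\<And>x. x \<notin> K \<Longrightarrow> \<phi> x = 0"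
    "\<And>x j. x \<notin> K \<Longrightarrow> partial_deriv j \<phi> x = 0"
    using test_function_support[OF assms(1)] by blast
  then show ?thesis
    using smooth_mult[OF assms(2) test_function_smooth[OF assms(1)]] by (intro test_functionI) auto
qed

lemma integral_by_parts_smooth:
  assumes "\<phi> \<in> test_functions U" "smooth f"
  shows "(\<integral>x. f x * partial_deriv j \<phi> x \<partial>lborel) = - (\<integral>x. partial_deriv j f x * \<phi> x \<partial>lborel)"
proof -
  have eq: "partial_deriv j (\<lambda>x. f x * \<phi> x) x = f x * partial_deriv j \<phi> x + partial_deriv j f x * \<phi> x" for x
    using assms by (intro partial_deriv_mult smooth_differentiable) (auto simp: test_function_smooth)
  have "0 = (\<integral>x. f x * partial_deriv j \<phi> x + partial_deriv j f x * \<phi> x \<partial>lborel)"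
    using integral_partial_deriv_eq_0[OF test_function_mult_smooth[OF assms], of j] by (simp add: eq)
  also have "\<dots> = (\<integral>x. f x * partial_deriv j \<phi> x \<partial>lborel) + (\<integral>x. partial_deriv j f x * \<phi> x \<partial>lborel)"
    by (intro Bochner_Integration.integral_add test_function_integrable[of _ U]
      test_function_mult_smooth test_function_partial_deriv assms smooth_partial_deriv)
  finally show ?thesis by simp
qed

section \<open>Mollification\<close>

definition convolution :: "(real^'n::finite \<Rightarrow> real) \<Rightarrow> (real^'n \<Rightarrow> real) \<Rightarrow> real^'n \<Rightarrow> real" where
  "convolution \<kappa> f x = (\<integral>y. \<kappa> (x - y) * f y \<partial>lborel)"

lemma integrable_bounded_mult:
  fixes f :: "'a \<Rightarrow> 'b::{banach, second_countable_topology}"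
  assumes "integrable M f" "g \<in> borel_measurable M" "\<And>x. \<bar>g x\<bar> \<le> B"
  shows "integrable M (\<lambda>x. g x *\<^sub>R f x)"
proof (rule Bochner_Integration.integrable_bound)
  show "integrable M (\<lambda>x. B * norm (f x))" using assms by auto
  show "AE x in M. norm (g x *\<^sub>R f x) \<le> norm (B * norm (f x))"
  proof (rule AE_I2)
    fix x
    have "\<bar>g x\<bar> * norm (f x) \<le> \<bar>B\<bar> * norm (f x)" using assms(3)[of x] by (intro mult_right_mono) auto
    then show "norm (g x *\<^sub>R f x) \<le> norm (B * norm (f x))" by (simp add: abs_mult)
  qed
qed (use assms in auto)

lemma integrable_convolution:
  assumes "\<kappa> \<in> test_functions U" "integrable lborel f"
  shows "integrable lborel (\<lambda>y. \<kappa> (x - y) * f y)"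
proof -
  obtain B where B: "0 < B" "\<And>x. \<bar>\<kappa> x\<bar> \<le> B" using test_function_bounded[OF assms(1)] by blast
  have [measurable]: "\<kappa> \<in> borel_measurable borel" using assms(1) by measurable
  show ?thesis
    using integrable_bounded_mult[OF assms(2), of "\<lambda>y. \<kappa> (x - y)" B] B by simp
qed

text \<open>Differentiation under the integral sign: the remainder quotient of the kernel is at most
  2 B, one \<open>B\<close> for the increment and one for the differential, so 2 B |f| dominates it
  and the remainder of the convolution tends to 0.\<close>

lemma convolution_has_derivative:
  fixes x :: "real^'n::finite"
  assumes \<kappa>: "\<kappa> \<in> test_functions U" and f: "integrable lborel f"
  shows "(convolution \<kappa> f has_derivative (\<lambda>h. \<Sum>j\<in>UNIV. convolution (partial_deriv j \<kappa>) f x * h $ j)) (at x)"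
proof -
  obtain B where B: "0 < B" "\<And>x y. \<bar>\<kappa> x - \<kappa> y\<bar> \<le> B * norm (x - y)"
    "\<And>x h. \<bar>\<Sum>j\<in>UNIV. partial_deriv j \<kappa> x * h $ j\<bar> \<le> B * norm h"
    using test_function_lipschitz[OF \<kappa>] by blast
  have [measurable]: "\<kappa> \<in> borel_measurable borel" "\<And>j. partial_deriv j \<kappa> \<in> borel_measurable borel"
    "f \<in> borel_measurable borel"
    using \<kappa> f test_function_borel[OF test_function_partial_deriv[OF \<kappa>]] by measurable
  let ?D = "\<lambda>x h. \<Sum>j\<in>UNIV. partial_deriv j \<kappa> x * h $ j"
  let ?D' = "\<lambda>h. \<Sum>j\<in>UNIV. convolution (partial_deriv j \<kappa>) f x * h $ j"
  have blin: "bounded_linear ?D'"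
    by (intro bounded_linear_sum bounded_linear_mult_right[THEN bounded_linear_compose] bounded_linear_vec_nth)
  note ik = integrable_convolution[OF \<kappa> f] integrable_convolution[OF test_function_partial_deriv[OF \<kappa>] f]
  have iD: "integrable lborel (\<lambda>u. ?D (x - u) h * f u)"
    and eq': "?D' h = (\<integral>u. ?D (x - u) h * f u \<partial>lborel)" for h
  proof -
    have *: "(\<lambda>u. ?D (x - u) h * f u) = (\<lambda>u. \<Sum>j\<in>UNIV. h $ j * (partial_deriv j \<kappa> (x - u) * f u))"
      by (simp add: sum_distrib_right sum_distrib_left mult_ac)
    show "integrable lborel (\<lambda>u. ?D (x - u) h * f u)"
      unfolding * using ik by auto
    show "?D' h = (\<integral>u. ?D (x - u) h * f u \<partial>lborel)"
      unfolding * using ik by (subst Bochner_Integration.integral_sum) (auto simp: convolution_def mult.commute)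
  qed
  let ?q = "\<lambda>y u. (\<kappa> (y - u) - \<kappa> (x - u) - ?D (x - u) (y - x)) / norm (y - x) * f u"
  have eq: "(convolution \<kappa> f y - convolution \<kappa> f x - ?D' (y - x)) / norm (y - x) = (\<integral>u. ?q y u \<partial>lborel)" for y
  proof -
    have "(\<integral>u. ?q y u \<partial>lborel) = (\<integral>u. (\<kappa> (y - u) * f u - \<kappa> (x - u) * f u - ?D (x - u) (y - x) * f u) / norm (y - x) \<partial>lborel)"
      by (intro Bochner_Integration.integral_cong) (auto simp: field_simps)
    also have "\<dots> = (\<integral>u. (\<kappa> (y - u) * f u - \<kappa> (x - u) * f u - ?D (x - u) (y - x) * f u) \<partial>lborel) / norm (y - x)"
      by (rule integral_divide_zero)
    also have "(\<integral>u. (\<kappa> (y - u) * f u - \<kappa> (x - u) * f u - ?D (x - u) (y - x) * f u) \<partial>lborel)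
        = convolution \<kappa> f y - convolution \<kappa> f x - ?D' (y - x)"
      unfolding eq' unfolding convolution_def
      using Bochner_Integration.integral_diff[OF Bochner_Integration.integrable_diff[OF ik(1)[of y] ik(1)[of x]] iD[of "y - x"]]
        Bochner_Integration.integral_diff[OF ik(1)[of y] ik(1)[of x]] by (simp only:)
    finally show ?thesis by (rule sym)
  qed
  have "((\<lambda>y. (convolution \<kappa> f y - convolution \<kappa> f x - ?D' (y - x)) / norm (y - x)) \<longlongrightarrow> 0) (at x)"
    unfolding eq tendsto_at_iff_sequentially comp_def
  proof safe
    fix X :: "nat \<Rightarrow> real^'n" assume X: "\<forall>i. X i \<in> UNIV - {x}" "X \<longlonglongrightarrow> x"
    have "(\<lambda>i. \<integral>u. ?q (X i) u \<partial>lborel) \<longlonglongrightarrow> (\<integral>u. (0::real) \<partial>(lborel :: (real^'n) measure))"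
    proof (rule integral_dominated_convergence[where w="\<lambda>u. (2 * B) * norm (f u)"])
      show "integrable lborel (\<lambda>u. 2 * B * norm (f u))" using f by auto
      show "(\<lambda>u. ?q (X i) u) \<in> borel_measurable lborel" for i by measurable
      show "AE u in lborel. norm (?q (X i) u) \<le> 2 * B * norm (f u)" for i
      proof (rule AE_I2)
        fix u
        have "\<bar>\<kappa> (X i - u) - \<kappa> (x - u) - ?D (x - u) (X i - x)\<bar> \<le> 2 * B * norm (X i - x)"
          using B(2)[of "X i - u" "x - u"] B(3)[of "x - u" "X i - x"] by simp
        then have "\<bar>\<kappa> (X i - u) - \<kappa> (x - u) - ?D (x - u) (X i - x)\<bar> / norm (X i - x) \<le> 2 * B"
          using X(1) by (simp add: pos_divide_le_eq)
        then have "\<bar>\<kappa> (X i - u) - \<kappa> (x - u) - ?D (x - u) (X i - x)\<bar> / norm (X i - x) * \<bar>f u\<bar> \<le> 2 * B * \<bar>f u\<bar>"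
          by (rule mult_right_mono) simp
        then show "norm (?q (X i) u) \<le> 2 * B * norm (f u)"
          by (simp only: real_norm_def abs_mult abs_divide abs_norm_cancel)
      qed
      show "AE u in lborel. (\<lambda>i. ?q (X i) u) \<longlonglongrightarrow> 0"
      proof (rule AE_I2)
        fix u
        have "((\<lambda>y. y - u) has_derivative (\<lambda>y. y)) (at x)"
          by (auto intro!: derivative_eq_intros)
        from has_derivative_compose[OF this smooth_has_derivative[OF test_function_smooth[OF \<kappa>]]]
        have "((\<lambda>y. \<kappa> (y - u)) has_derivative ?D (x - u)) (at x)" .
        then have "((\<lambda>y. norm (\<kappa> (y - u) - \<kappa> (x - u) - ?D (x - u) (y - x)) / norm (y - x)) \<longlongrightarrow> 0) (at x)"
          unfolding has_derivative_iff_norm by (rule conjunct2)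
        then have "((\<lambda>y. \<bar>(\<kappa> (y - u) - \<kappa> (x - u) - ?D (x - u) (y - x)) / norm (y - x)\<bar>) \<longlongrightarrow> 0) (at x)"
          unfolding abs_divide abs_norm_cancel real_norm_def .
        then have "((\<lambda>y. (\<kappa> (y - u) - \<kappa> (x - u) - ?D (x - u) (y - x)) / norm (y - x)) \<longlongrightarrow> 0) (at x)"
          by (rule tendsto_rabs_zero_cancel)
        moreover have "filterlim X (at x) sequentially"
          using X by (simp add: filterlim_at)
        ultimately have "(\<lambda>i. (\<kappa> (X i - u) - \<kappa> (x - u) - ?D (x - u) (X i - x)) / norm (X i - x)) \<longlonglongrightarrow> 0"
          by (rule filterlim_compose)
        then show "(\<lambda>i. ?q (X i) u) \<longlonglongrightarrow> 0" by (rule tendsto_mult_left_zero)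
      qed
    qed simp
    then show "(\<lambda>i. \<integral>u. ?q (X i) u \<partial>lborel) \<longlonglongrightarrow> 0" by simp
  qed
  from tendsto_rabs_zero[OF this] have "((\<lambda>y. norm (convolution \<kappa> f y - convolution \<kappa> f x - ?D' (y - x)) / norm (y - x)) \<longlongrightarrow> 0) (at x)"
    by (simp only: abs_divide abs_norm_cancel real_norm_def)
  with blin show ?thesis unfolding has_derivative_iff_norm by blast
qed

lemma partial_deriv_convolution:
  assumes "\<kappa> \<in> test_functions U" "integrable lborel f"
  shows "partial_deriv j (convolution \<kappa> f) x = convolution (partial_deriv j \<kappa>) f x"
  by (subst partial_deriv_has_derivative[OF convolution_has_derivative[OF assms]])
    (simp add: axis_def if_distrib cong: if_cong)

lemma smooth_convolution:
  assumes "\<kappa> \<in> test_functions U" "integrable lborel f"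
  shows "smooth (convolution \<kappa> f)"
proof (rule smooth_coinduct[where P="\<lambda>g. \<exists>\<kappa>\<in>test_functions U. g = convolution \<kappa> f"])
  show "\<exists>\<kappa>'\<in>test_functions U. convolution \<kappa> f = convolution \<kappa>' f" using assms by blast
next
  fix g x assume "\<exists>\<kappa>\<in>test_functions U. g = convolution \<kappa> f"
  then show "g differentiable at x"
    using convolution_has_derivative[OF _ assms(2)] differentiable_def by blast
next
  fix g j assume "\<exists>\<kappa>\<in>test_functions U. g = convolution \<kappa> f"
  then obtain \<kappa>' where \<kappa>': "\<kappa>' \<in> test_functions U" "g = convolution \<kappa>' f" by blast
  then have "partial_deriv j g = convolution (partial_deriv j \<kappa>') f"
    using partial_deriv_convolution[OF \<kappa>'(1) assms(2)] by blast
  with \<kappa>' show "\<exists>\<kappa>\<in>test_functions U. partial_deriv j g = convolution \<kappa> f"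
    using test_function_partial_deriv by blast
qed

text \<open>The cutoff is composed with the squared norm, since the norm is not smooth at 0; the
  thresholds 1/4 and 1 are the squares of the radii 1/2 and 1.\<close>

definition bump :: "real^'n::finite \<Rightarrow> real" where
  "bump x = cutoff (1/4) 1 (x \<bullet> x)"

definition mollifier :: "real^'n::finite \<Rightarrow> real" where
  "mollifier x = bump x / (\<integral>y. bump (y::real^'n) \<partial>lborel)"

lemma smooth_inner_self: "smooth (\<lambda>x::real^'n::finite. x \<bullet> x)"
  unfolding inner_vec_def by (intro smooth_sum) (auto intro: smooth_mult smooth_vec_nth)

lemma bump_eq_0: "norm x \<ge> 1 \<Longrightarrow> bump x = 0"
  unfolding bump_def by (rule cutoff_eq_0) (auto simp: dot_square_norm)

lemma bump_test_function: "bump \<in> test_functions (UNIV :: (real^'n::finite) set)"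
proof (rule test_functionI[of _ "cball 0 1"])
  show "smooth (bump :: real^'n \<Rightarrow> real)" unfolding bump_def[abs_def]
    by (intro smooth_cutoff smooth_inner_self)
qed (auto intro: bump_eq_0)

lemma bump_nonneg: "0 \<le> bump x" by (simp add: bump_def cutoff_nonneg)

lemma integral_bump_pos: "0 < (\<integral>y. bump (y::real^'n::finite) \<partial>lborel)"
proof -
  have "0 < measure lborel (ball (0::real^'n) (1/2))" by (rule content_ball_pos) simp
  also have "\<dots> = (\<integral>y. indicator (ball (0::real^'n) (1/2)) y \<partial>lborel)" by simp
  also have "\<dots> \<le> (\<integral>y. bump (y::real^'n) \<partial>lborel)"
  proof (intro integral_mono test_function_integrable[OF bump_test_function] integrable_real_indicator)
    fix y :: "real^'n"
    have "bump y = 1" if "norm y < 1/2"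
      unfolding bump_def using that power_mono[of "norm y" "1/2" 2]
      by (intro cutoff_eq_1) (auto simp: dot_square_norm power2_eq_square)
    then show "indicator (ball 0 (1/2)) y \<le> bump y"
      using bump_nonneg[of y] by (auto simp: indicator_def)
  qed (use emeasure_bounded_finite[OF bounded_ball[of "0::real^'n"]] in auto)
  finally show ?thesis .
qed

lemma test_function_cmult: "\<phi> \<in> test_functions U \<Longrightarrow> (\<lambda>x. c * \<phi> x) \<in> test_functions U"
  using test_function_mult_smooth[OF _ smooth_const] .

lemma mollifier_test_function: "mollifier \<in> test_functions (UNIV :: (real^'n::finite) set)"
  using test_function_cmult[OF bump_test_function, of "inverse (\<integral>y. bump (y::real^'n) \<partial>lborel)"]
  by (simp add: mollifier_def[abs_def] divide_inverse mult.commute)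

lemma mollifier_nonneg: "0 \<le> mollifier x"
  unfolding mollifier_def by (intro divide_nonneg_nonneg bump_nonneg less_imp_le[OF integral_bump_pos])

lemma mollifier_eq_0: "norm x \<ge> 1 \<Longrightarrow> mollifier x = 0"
  by (simp add: mollifier_def bump_eq_0)

lemma mollifier_borel[measurable]: "mollifier \<in> borel_measurable borel"
  using test_function_borel[OF mollifier_test_function] .

lemma mollifier_integrable: "integrable lborel mollifier"
  by (rule test_function_integrable[OF mollifier_test_function])

lemma integral_mollifier: "(\<integral>x. mollifier (x::real^'n::finite) \<partial>lborel) = 1"
  unfolding mollifier_def using integral_bump_pos[where 'n='n] by simp

lemma nn_integral_mollifier: "(\<integral>\<^sup>+x. mollifier (x::real^'n::finite) \<partial>lborel) = 1"
  by (subst nn_integral_eq_integral[OF mollifier_integrable])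
    (auto simp: mollifier_nonneg integral_mollifier)

text \<open>The scale sits in the argument of \<open>f\<close> and not in the kernel, so the weight
  is one fixed probability density for all \<open>d\<close>; this is the convenient form for
  Jensen's inequality and for L1 convergence. For scalar functions
  \<open>mollify_eq_convolution\<close> recovers the usual convolution with a rescaled
  kernel.\<close>

definition mollify :: "real \<Rightarrow> (real^'n::finite \<Rightarrow> 'b::{banach, second_countable_topology}) \<Rightarrow> real^'n \<Rightarrow> 'b" where
  "mollify d f x = (\<integral>z. mollifier z *\<^sub>R f (x - d *\<^sub>R z) \<partial>lborel)"

lemma integrable_mollify:
  fixes f :: "real^'n::finite \<Rightarrow> 'b::{banach, second_countable_topology}"
  assumes "integrable lborel f" "d \<noteq> 0"
  shows "integrable lborel (\<lambda>z. mollifier z *\<^sub>R f (x - d *\<^sub>R z))"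
proof -
  obtain B where "\<And>x::real^'n. \<bar>mollifier x\<bar> \<le> B" using test_function_bounded[OF mollifier_test_function] by blast
  moreover have "integrable lborel (\<lambda>z. f (x - d *\<^sub>R z))"
    using integrable_lborel_affine[OF assms(1), of "-d" x] assms(2) by simp
  ultimately show ?thesis by (intro integrable_bounded_mult[of _ _ _ B]) auto
qed

lemma scaled_mollifier_test_function:
  fixes x :: "real^'n::finite"
  assumes "d > 0" "cball x d \<subseteq> U"
  shows "(\<lambda>y. c * mollifier ((1/d) *\<^sub>R (x - y))) \<in> test_functions U"
proof (rule test_functionI[of _ "cball x d"])
  have "smooth (mollifier :: real^'n \<Rightarrow> real)" by (rule test_function_smooth[OF mollifier_test_function])
  from smooth_affine[OF this, of "(1/d) *\<^sub>R x" "-1/d"]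
  show "smooth (\<lambda>y. c * mollifier ((1/d) *\<^sub>R (x - y)))"
    by (intro smooth_mult smooth_const) (simp add: algebra_simps)
  show "c * mollifier ((1 / d) *\<^sub>R (x - y)) = 0" if "y \<notin> cball x d" for y
    using that assms(1) by (auto intro!: mollifier_eq_0 simp: dist_norm divide_simps)
qed (use assms in auto)

lemma mollify_eq_convolution:
  fixes f :: "real^'n::finite \<Rightarrow> real"
  assumes [measurable]: "f \<in> borel_measurable borel" and d: "d > 0"
  shows "mollify d f x = convolution (\<lambda>z. (1 / d ^ CARD('n)) * mollifier ((1/d) *\<^sub>R z)) f x"
proof -
  have "convolution (\<lambda>z. (1 / d ^ CARD('n)) * mollifier ((1/d) *\<^sub>R z)) f x
      = \<bar>-d\<bar> ^ DIM(real^'n) *\<^sub>R (\<integral>z. (1 / d ^ CARD('n)) * mollifier ((1/d) *\<^sub>R (x - (x + (-d) *\<^sub>R z))) * f (x + (-d) *\<^sub>R z) \<partial>lborel)"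
    unfolding convolution_def using d
    by (intro integral_lborel_affine) auto
  also have "\<dots> = (\<integral>z. mollifier z * f (x - d *\<^sub>R z) \<partial>lborel)"
    using d by (simp add: mult.assoc)
  finally show ?thesis by (simp add: mollify_def)
qed

lemma smooth_mollify:
  fixes f :: "real^'n::finite \<Rightarrow> real"
  assumes "integrable lborel f" "d > 0"
  shows "smooth (mollify d f)"
proof -
  have t: "(\<lambda>y. (1 / d ^ CARD('n)) * mollifier ((1/d) *\<^sub>R y)) \<in> test_functions (UNIV :: (real^'n) set)"
  proof (rule test_functionI[of _ "cball 0 d"])
    show "smooth (\<lambda>y::real^'n. (1 / d ^ CARD('n)) * mollifier ((1/d) *\<^sub>R y))"
      using smooth_affine[OF test_function_smooth[OF mollifier_test_function], of 0 "1/d"]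
      by (intro smooth_mult smooth_const) simp
  qed (use assms in \<open>auto intro!: mollifier_eq_0 simp: divide_simps\<close>)
  have "mollify d f = convolution (\<lambda>z. (1 / d ^ CARD('n)) * mollifier ((1/d) *\<^sub>R z)) f"
    using mollify_eq_convolution[OF borel_measurable_integrable[OF assms(1), simplified] assms(2)] by blast
  with smooth_convolution[OF t assms(1)] show ?thesis by simp
qed


lemma mollify_borel:
  fixes f :: "real^'n::finite \<Rightarrow> 'b::{banach, second_countable_topology}"
  assumes [measurable]: "f \<in> borel_measurable borel"
  shows "mollify d f \<in> borel_measurable borel"
  unfolding mollify_def[abs_def] by measurable

lemma mollify_vec_nth:
  fixes f :: "real^'n::finite \<Rightarrow> 'b::euclidean_space^'m::finite"
  assumes "integrable lborel f" "d > 0"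
  shows "mollify d f x $ i = mollify d (\<lambda>x. f x $ i) x"
  using integral_bounded_linear[OF bounded_linear_vec_nth integrable_mollify[OF assms(1), of d x], of i] assms(2)
  by (simp add: mollify_def)

lemma integrable_vec_nth:
  fixes f :: "'a \<Rightarrow> 'b::euclidean_space^'m::finite"
  shows "integrable M f \<Longrightarrow> integrable M (\<lambda>x. f x $ i)"
  by (rule integrable_bounded_linear[OF bounded_linear_vec_nth])

lemma norm_mollify_diff_le:
  fixes f :: "real^'n::finite \<Rightarrow> 'b::{banach, second_countable_topology}"
  assumes "integrable lborel f" "d > 0"
  shows "ennreal (norm (mollify d f x - f x)) \<le>
    (\<integral>\<^sup>+z. ennreal (mollifier z) * ennreal (norm (f (x + (-d) *\<^sub>R z) - f x)) \<partial>lborel)"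
proof -
  have i: "integrable lborel (\<lambda>z. mollifier z *\<^sub>R f (x - d *\<^sub>R z))"
    "integrable lborel (\<lambda>z. mollifier z *\<^sub>R f x)"
    using integrable_mollify[OF assms(1)] assms(2) mollifier_integrable by auto
  have c: "(\<integral>z. mollifier z *\<^sub>R f x \<partial>lborel) = f x"
    by (subst integral_scaleR_left[OF mollifier_integrable]) (simp add: integral_mollifier)
  have "mollify d f x - f x = (\<integral>z. mollifier z *\<^sub>R f (x - d *\<^sub>R z) - mollifier z *\<^sub>R f x \<partial>lborel)"
    unfolding mollify_def by (subst Bochner_Integration.integral_diff[OF i]) (simp only: c)
  also have "ennreal (norm \<dots>) \<le> (\<integral>\<^sup>+z. norm (mollifier z *\<^sub>R f (x - d *\<^sub>R z) - mollifier z *\<^sub>R f x) \<partial>lborel)"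
    using i by (intro integral_norm_bound_ennreal) auto
  also have "\<dots> = (\<integral>\<^sup>+z. ennreal (mollifier z) * ennreal (norm (f (x + (-d) *\<^sub>R z) - f x)) \<partial>lborel)"
    by (intro nn_integral_cong) (simp flip: scaleR_diff_right ennreal_mult add: mollifier_nonneg)
  finally show ?thesis .
qed

lemma mollify_L1_converges:
  fixes f :: "real^'n::finite \<Rightarrow> 'b::{banach, second_countable_topology}"
  assumes "integrable lborel f" "(e::real) > 0"
  shows "\<exists>d0>0. \<forall>d. 0 < d \<and> d < d0 \<longrightarrow> (\<integral>\<^sup>+x. norm (mollify d f x - f x) \<partial>lborel) \<le> ennreal e"
proof -
  obtain d0 where d0: "d0 > 0" "\<And>r. \<bar>r\<bar> < d0 \<Longrightarrow>
    (\<integral>\<^sup>+x. \<integral>\<^sup>+z. ennreal (mollifier (z::real^'n)) * ennreal (norm (f (x + r *\<^sub>R z) - f x)) \<partial>lborel \<partial>lborel)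
      \<le> ennreal e * (\<integral>\<^sup>+z. mollifier (z::real^'n) \<partial>lborel)"
    using L1_translation_average[OF assms(1) mollifier_borel mollifier_eq_0[OF less_imp_le] assms(2)] by blast
  show ?thesis
  proof (intro exI[of _ d0] conjI allI impI d0(1))
    fix d assume d: "0 < d \<and> d < d0"
    have "(\<integral>\<^sup>+x. norm (mollify d f x - f x) \<partial>lborel) \<le>
      (\<integral>\<^sup>+x. \<integral>\<^sup>+z. ennreal (mollifier z) * ennreal (norm (f (x + (-d) *\<^sub>R z) - f x)) \<partial>lborel \<partial>lborel)"
      using d by (intro nn_integral_mono norm_mollify_diff_le assms) auto
    also have "\<dots> \<le> ennreal e" using d0(2)[of "-d"] d by (simp add: nn_integral_mollifier)
    finally show "(\<integral>\<^sup>+x. norm (mollify d f x - f x) \<partial>lborel) \<le> ennreal e" .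
  qed
qed

text \<open>Differentiating the convolution puts the derivative on the kernel. Read as a function of
  y, the kernel at x - y is a test function of \<open>V\<close> because the closed ball fits into
  \<open>V\<close>, so the weak identity applies to it; the reflection y -> x - y supplies the sign
  that cancels the one in the weak identity. The identity is local: only the ball around x has to
  lie in \<open>V\<close>.\<close>

lemma partial_deriv_mollify:
  fixes u :: "real^'n::finite \<Rightarrow> real"
  assumes u: "integrable lborel u" and g: "integrable lborel g" and d: "d > 0" "cball x d \<subseteq> V"
    and weak: "\<And>\<phi>. \<phi> \<in> test_functions V \<Longrightarrow>
      (\<integral>y. u y * partial_deriv j \<phi> y \<partial>lborel) = - (\<integral>y. g y * \<phi> y \<partial>lborel)"
  shows "partial_deriv j (mollify d u) x = mollify d g x"
proof -
  let ?r = "\<lambda>y::real^'n. (1 / d ^ CARD('n)) * mollifier ((1/d) *\<^sub>R y)"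
  have sm: "smooth ?r"
    using smooth_affine[OF test_function_smooth[OF mollifier_test_function], of 0 "1/d"]
    by (intro smooth_mult smooth_const) simp
  have t: "?r \<in> test_functions UNIV"
    by (rule test_functionI[of _ "cball 0 d", OF sm])
      (use d in \<open>auto intro!: mollifier_eq_0 simp: divide_simps\<close>)
  have t': "(\<lambda>y. ?r (x - y)) \<in> test_functions V"
    by (rule scaled_mollifier_test_function[OF d])
  have pd: "partial_deriv j (\<lambda>y. ?r (x - y)) y = - partial_deriv j ?r (x - y)" for y
    using partial_deriv_affine[OF smooth_differentiable[OF sm], of j x "-1" y] by simp
  have "mollify d u = convolution ?r u"
    using mollify_eq_convolution[of u d] u d by auto
  then have "partial_deriv j (mollify d u) x = (\<integral>y. partial_deriv j ?r (x - y) * u y \<partial>lborel)"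
    using partial_deriv_convolution[OF t u] by (simp add: convolution_def)
  also have "\<dots> = - (\<integral>y. u y * partial_deriv j (\<lambda>y. ?r (x - y)) y \<partial>lborel)"
    unfolding pd by (simp add: mult.commute)
  also have "\<dots> = (\<integral>y. g y * ?r (x - y) \<partial>lborel)" using weak[OF t'] by simp
  also have "\<dots> = convolution ?r g x" by (simp add: convolution_def mult.commute)
  also have "\<dots> = mollify d g x" using mollify_eq_convolution[of g d x] g d by auto
  finally show ?thesis .
qed

text \<open>Up to rearrangement this says that t^q lies above its tangent at a; it is Young's
  inequality with exponents q and q/(q - 1).\<close>

lemma powr_tangent_le:
  assumes "q > 1" "a > 0" "t \<ge> (0::real)"
  shows "a powr (q - 1) * t \<le> t powr q / q + (1 - 1/q) * a powr q"
proof -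
  have "t * a powr (q - 1) \<le> t powr q / q + (a powr (q - 1)) powr (q / (q - 1)) / (q / (q - 1))"
    using assms by (intro Youngs_inequality) (auto simp: field_simps)
  also have "(a powr (q - 1)) powr (q / (q - 1)) = a powr q"
    using assms by (simp add: powr_powr)
  also have "a powr q / (q / (q - 1)) = (1 - 1/q) * a powr q" using assms by (simp add: field_simps)
  finally show ?thesis by (simp add: mult.commute)
qed

text \<open>Jensen's inequality for the probability density \<open>mollifier\<close>: integrate the
  tangent inequality for t^q whose base point is the mean \<open>?a\<close> of the norms.\<close>

lemma mollify_jensen:
  fixes f :: "real^'n::finite \<Rightarrow> 'b::{banach, second_countable_topology}"
  assumes f: "integrable lborel f" and fq: "integrable lborel (\<lambda>x. norm (f x) powr q)" and q: "q > 1" and d: "d > 0"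
  shows "norm (mollify d f x) powr q \<le> mollify d (\<lambda>x. norm (f x) powr q) x"
proof -
  let ?a = "\<integral>z. mollifier z * norm (f (x - d *\<^sub>R z)) \<partial>lborel"
  have i1: "integrable lborel (\<lambda>z. mollifier z * norm (f (x - d *\<^sub>R z)))"
    using integrable_mollify[OF integrable_norm[OF f], of d x] d by simp
  have i2: "integrable lborel (\<lambda>z. mollifier z * norm (f (x - d *\<^sub>R z)) powr q)"
    using integrable_mollify[OF fq, of d x] d by simp
  have le: "norm (mollify d f x) \<le> ?a"
  proof -
    have "norm (mollify d f x) \<le> (\<integral>z. norm (mollifier z *\<^sub>R f (x - d *\<^sub>R z)) \<partial>lborel)"
      unfolding mollify_def by (rule integral_norm_bound)
    then show ?thesis by (simp add: mollifier_nonneg)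
  qed
  have "?a powr q \<le> mollify d (\<lambda>x. norm (f x) powr q) x"
  \<comment> \<open>\<open>0 powr q\<close> is 0, so a vanishing mean leaves only the sign of the
    right-hand side; the tangent needs a positive base point.\<close>
  proof (cases "?a = 0")
    case True
    then show ?thesis by (simp add: mollify_def integral_nonneg mollifier_nonneg)
  next
    case False
    then have a: "?a > 0" using le norm_ge_zero[of "mollify d f x"] by linarith
    have "?a powr q = ?a powr (q - 1) * ?a" using a by (simp add: powr_diff)
    also have "\<dots> = (\<integral>z. ?a powr (q - 1) * (mollifier z * norm (f (x - d *\<^sub>R z))) \<partial>lborel)" by simp
    also have "\<dots> \<le> (\<integral>z. (1/q) * (mollifier z * norm (f (x - d *\<^sub>R z)) powr q) + ((1 - 1/q) * ?a powr q) * mollifier z \<partial>lborel)"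
    proof (rule integral_mono)
      show "integrable lborel (\<lambda>z. ?a powr (q - 1) * (mollifier z * norm (f (x - d *\<^sub>R z))))" using i1 by auto
      show "integrable lborel (\<lambda>z. (1/q) * (mollifier z * norm (f (x - d *\<^sub>R z)) powr q) + ((1 - 1/q) * ?a powr q) * mollifier z)"
        using i2 mollifier_integrable by auto
      show "?a powr (q - 1) * (mollifier z * norm (f (x - d *\<^sub>R z))) \<le>
         (1/q) * (mollifier z * norm (f (x - d *\<^sub>R z)) powr q) + ((1 - 1/q) * ?a powr q) * mollifier z" for z
        using mult_left_mono[OF powr_tangent_le[OF q a norm_ge_zero[of "f (x - d *\<^sub>R z)"]] mollifier_nonneg[of z]]
        by (simp add: algebra_simps)
    qed
    also have "\<dots> = (1/q) * mollify d (\<lambda>x. norm (f x) powr q) x + (1 - 1/q) * ?a powr q"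
      unfolding mollify_def
      by (subst Bochner_Integration.integral_add)
        (use i2 in \<open>auto simp: mollifier_integrable integral_mollifier\<close>)
    finally have "(1/q) * ?a powr q \<le> (1/q) * mollify d (\<lambda>x. norm (f x) powr q) x" by (simp add: algebra_simps)
    then show ?thesis using q by (simp add: divide_le_cancel)
  qed
  moreover have "norm (mollify d f x) powr q \<le> ?a powr q"
    using le q by (intro powr_mono2) auto
  ultimately show ?thesis by linarith
qed

section \<open>Weak gradients of smooth maps\<close>

text \<open>Convergence in L1 gives almost everywhere convergence along suitable radii only. That is
  enough, since later arguments are free to choose their radii.\<close>

lemma mollify_AE_subseq:
  fixes f :: "real^'n::finite \<Rightarrow> 'b::{banach, second_countable_topology}"
  assumes f: "integrable lborel f"
  obtains d where "\<And>k. d k > 0" "d \<longlonglongrightarrow> 0" "AE x in lborel. (\<lambda>k. mollify (d k) f x) \<longlonglongrightarrow> f x"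
proof -
  have [measurable]: "f \<in> borel_measurable borel" using f by auto
  have "\<exists>d. 0 < d \<and> d < inverse (Suc k) \<and> (\<integral>\<^sup>+x. norm (mollify d f x - f x) \<partial>lborel) \<le> ennreal (inverse (Suc k))" for k
  proof -
    obtain d0 where d0: "d0 > 0" "\<And>d. 0 < d \<Longrightarrow> d < d0 \<Longrightarrow> (\<integral>\<^sup>+x. norm (mollify d f x - f x) \<partial>lborel) \<le> ennreal (inverse (Suc k))"
      using mollify_L1_converges[OF f, of "inverse (real (Suc k))"] by auto
    define d where "d = min d0 (inverse (Suc k)) / 2"
    have "0 < d" "d < d0" "d < inverse (Suc k)" using d0(1) by (auto simp: d_def min_def)
    then show ?thesis using d0(2) by blast
  qed
  then have "\<exists>d. \<forall>k. 0 < d k \<and> d k < inverse (Suc k) \<and>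
      (\<integral>\<^sup>+x. norm (mollify (d k) f x - f x) \<partial>lborel) \<le> ennreal (inverse (Suc k))"
    by (intro choice allI)
  then obtain d where d: "\<And>k. 0 < d k" "\<And>k. d k < inverse (Suc k)"
    "\<And>k. (\<integral>\<^sup>+x. norm (mollify (d k) f x - f x) \<partial>lborel) \<le> ennreal (inverse (Suc k))" by blast
  have [measurable]: "mollify d f \<in> borel_measurable borel" for d by (rule mollify_borel) measurable
  have int: "integrable lborel (\<lambda>x. mollify (d k) f x - f x)" for k
    unfolding integrable_iff_bounded using d(3)[of k] by (auto simp: ennreal_less_top intro: le_less_trans)
  have "(\<lambda>k. \<integral>x. norm (mollify (d k) f x - f x) \<partial>lborel) \<longlonglongrightarrow> 0"
  proof (rule tendsto_sandwich[of "\<lambda>_. 0" _ _ "\<lambda>k. inverse (real (Suc k))"])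
    have "(\<integral>x. norm (mollify (d k) f x - f x) \<partial>lborel) \<le> inverse (Suc k)" for k
      using d(3)[of k] nn_integral_eq_integral[OF integrable_norm[OF int[of k]]] by (simp add: ennreal_le_iff)
    then show "\<forall>\<^sub>F k in sequentially. (\<integral>x. norm (mollify (d k) f x - f x) \<partial>lborel) \<le> inverse (Suc k)" by simp
  qed (auto intro: LIMSEQ_inverse_real_of_nat simp del: of_nat_Suc)
  from tendsto_L1_AE_subseq[OF int this] obtain r :: "nat \<Rightarrow> nat" where r: "strict_mono r"
    "AE x in lborel. (\<lambda>n. mollify (d (r n)) f x - f x) \<longlonglongrightarrow> 0" by blast
  have "d \<longlonglongrightarrow> 0"
    by (rule tendsto_sandwich[of "\<lambda>_. 0" _ _ "\<lambda>k. inverse (real (Suc k))"])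
      (auto intro!: LIMSEQ_inverse_real_of_nat always_eventually less_imp_le[OF d(1)] less_imp_le[OF d(2)] simp del: of_nat_Suc)
  show ?thesis
  proof (rule that[of "d \<circ> r"])
    show "(d \<circ> r) \<longlonglongrightarrow> 0" using \<open>d \<longlonglongrightarrow> 0\<close> r(1) by (rule LIMSEQ_subseq_LIMSEQ)
    show "AE x in lborel. (\<lambda>k. mollify ((d \<circ> r) k) f x) \<longlonglongrightarrow> f x"
      using r(2) by eventually_elim (simp add: LIM_zero_iff)
  qed (use d in auto)
qed

text \<open>At an interior point of \<open>V\<close> the mollification with small radius is the
  integral of \<open>f\<close> against a test function of \<open>V\<close>, hence 0; at almost every
  point it converges to \<open>f x\<close> along a sequence of radii.\<close>

lemma fundamental_lemma:
  fixes f :: "real^'n::finite \<Rightarrow> real"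
  assumes f: "integrable lborel f"
    and 0: "\<And>\<phi>. \<phi> \<in> test_functions V \<Longrightarrow> (\<integral>x. f x * \<phi> x \<partial>lborel) = 0"
  shows "AE x in lborel. x \<in> interior V \<longrightarrow> f x = 0"
proof -
  obtain d where d: "\<And>k. d k > 0" "d \<longlonglongrightarrow> 0" and ae: "AE x in lborel. (\<lambda>k. mollify (d k) f x) \<longlonglongrightarrow> f x"
    using mollify_AE_subseq[OF f] by blast
  have z: "mollify r f x = 0" if "r > 0" "cball x r \<subseteq> V" for r x
  proof -
    have "mollify r f x = (\<integral>y. f y * ((1 / r ^ CARD('n)) * mollifier ((1/r) *\<^sub>R (x - y))) \<partial>lborel)"
      using mollify_eq_convolution[of f r x] f that by (simp add: convolution_def mult.commute)
    also have "\<dots> = 0" by (rule 0[OF scaled_mollifier_test_function[OF that]])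
    finally show ?thesis .
  qed
  show ?thesis using ae
  proof eventually_elim
    fix x assume l: "(\<lambda>k. mollify (d k) f x) \<longlonglongrightarrow> f x"
    show "x \<in> interior V \<longrightarrow> f x = 0"
    proof
      assume "x \<in> interior V"
      then obtain e where e: "e > 0" "cball x e \<subseteq> V" by (auto simp: mem_interior_cball)
      have "\<forall>\<^sub>F k in sequentially. d k < e" using d(2) e(1) by (rule order_tendstoD)
      then have "\<forall>\<^sub>F k in sequentially. mollify (d k) f x = 0"
        by eventually_elim (rule z, use d e in \<open>auto simp: subset_iff\<close>)
      then have "(\<lambda>k. mollify (d k) f x) \<longlonglongrightarrow> 0" by (rule tendsto_eventually)
      with l show "f x = 0" by (rule LIMSEQ_unique)
    qed
  qed
qed

section \<open>Inner parallel sets, Borel representatives and uniqueness of weak gradients\<close>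

definition core :: "'a::metric_space set \<Rightarrow> real \<Rightarrow> 'a set" where
  "core U d = {x. ball x d \<subseteq> U}"

lemma core_subset:
  assumes "d > 0" shows "core U d \<subseteq> U"
proof
  fix x assume "x \<in> core U d"
  then have "ball x d \<subseteq> U" by (simp add: core_def)
  with centre_in_ball[of x d] assms show "x \<in> U" by blast
qed

lemma closed_core: "closed (core U d)"
proof -
  \<comment> \<open>A point fails to lie in the core exactly when it is closer than \<open>d\<close>
    to the complement, so the core is closed whatever \<open>U\<close> is. For bounded
    \<open>U\<close> the cores are therefore compact, and they exhaust \<open>U\<close> when
    \<open>U\<close> is open.\<close>
  have "- core U d = (\<Union>y\<in>-U. ball y d)" by (auto simp: core_def dist_commute)
  then show ?thesis unfolding closed_def by (metis open_UN open_ball)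
qed

lemma core_antimono: "d \<le> d' \<Longrightarrow> core U d' \<subseteq> core U d"
  by (auto simp: core_def)

lemma compact_core: "bounded (U::'a::heine_borel set) \<Longrightarrow> d > 0 \<Longrightarrow> compact (core U d)"
  by (meson bounded_subset closed_core compact_eq_bounded_closed core_subset)

lemma cball_subset_core: "x \<in> core U (d + e) \<Longrightarrow> cball x d \<subseteq> core U e"
proof (clarsimp simp: core_def)
  fix y z assume *: "ball x (d + e) \<subseteq> U" "dist x y \<le> d" "dist y z < e"
  then have "dist x z < d + e" using dist_triangle[of x z y] by linarith
  with * show "z \<in> U" by auto
qed

lemma core_subset_interior:
  assumes "d > 0" shows "core U (2 * d) \<subseteq> interior (core U d)"
proof
  fix x assume "x \<in> core U (2 * d)"
  then have "cball x d \<subseteq> core U d" unfolding mult_2 by (rule cball_subset_core)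
  with assms show "x \<in> interior (core U d)" unfolding mem_interior_cball by blast
qed

lemma open_in_core:
  assumes "open U" "x \<in> U"
  obtains n where "x \<in> core U (2 * inverse (real (Suc n)))"
proof -
  obtain e where e: "e > 0" "ball x e \<subseteq> U" using assms openE by blast
  obtain n where "inverse (real (Suc n)) < e / 2" using reals_Archimedean[of "e/2"] e by auto
  then have "x \<in> core U (2 * inverse (real (Suc n)))" using e by (auto simp: core_def)
  then show ?thesis by (rule that)
qed

text \<open>The definitions use the completed measure, whereas Fubini's theorem and affine
  substitutions are applied to Borel functions on \<open>lborel\<close>. Coordinates are replaced
  one at a time, and the finitely many exceptional null sets are united.\<close>

lemma borel_representative:
  fixes f :: "'a::euclidean_space \<Rightarrow> 'b::euclidean_space"
  assumes "integrable lebesgue f"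
  obtains g where "integrable lborel g" "AE x in lborel. g x = f x"
proof -
  have "\<exists>g. g \<in> borel_measurable lborel \<and> (AE x in lborel. f x \<bullet> b = g x)" for b
    using completion_ex_borel_measurable_real[of "\<lambda>x. f x \<bullet> b" lborel] assms by auto
  then obtain h where h: "\<And>b. h b \<in> borel_measurable lborel" "\<And>b. AE x in lborel. f x \<bullet> b = h b x" by metis
  define g where "g x = (\<Sum>b\<in>Basis. h b x *\<^sub>R b)" for x
  have gm: "g \<in> borel_measurable lborel" unfolding g_def[abs_def] using h(1) by measurable
  have "AE x in lborel. \<forall>b\<in>Basis. f x \<bullet> b = h b x"
    using h(2) by (intro AE_finite_allI) auto
  then have eq: "AE x in lborel. g x = f x"
  proof eventually_elim
    fix x assume "\<forall>b\<in>Basis. f x \<bullet> b = h b x"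
    then have "g x = (\<Sum>b\<in>Basis. (f x \<bullet> b) *\<^sub>R b)" unfolding g_def by (intro sum.cong) auto
    then show "g x = f x" by (simp only: euclidean_representation)
  qed
  have "integrable lebesgue g"
  proof (subst integrable_cong_AE)
    show "AE x in lebesgue. g x = f x" using eq by (rule AE_completion)
    show "g \<in> borel_measurable lebesgue" using gm by (rule measurable_completion)
  qed (use assms in auto)
  then have "integrable lborel g" using integrable_completion[OF gm] by simp
  with eq that show ?thesis by blast
qed

lemma locally_integrable_representative:
  assumes "locally_integrable U f" "compact K" "K \<subseteq> U"
  obtains g where "integrable lborel g" "AE x in lborel. g x = indicator K x *\<^sub>R f x"
proof -
  have "integrable lebesgue (\<lambda>x. indicator K x *\<^sub>R f x)"
    using assms unfolding locally_integrable_def set_integrable_def by blast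
  then obtain g where "integrable lborel g" "AE x in lborel. g x = indicat_real K x *\<^sub>R f x"
    by (rule borel_representative)
  then show ?thesis by (rule that)
qed

text \<open>Bridge between \<open>lebesgue_on U\<close>, where weak gradients are defined, and
  \<open>lborel\<close>: since \<phi> vanishes off \<open>K\<close>, both integrals see
  \<open>f\<close> on \<open>K\<close> only, and there \<open>g\<close> agrees with it almost
  everywhere.\<close>

lemma integral_representative:
  fixes f g \<phi> :: "real^'n::finite \<Rightarrow> real"
  assumes g: "g \<in> borel_measurable borel" and ae: "AE x in lborel. g x = indicator K x * f x"
    and \<phi>: "\<phi> \<in> borel_measurable borel" and 0: "\<And>x. x \<notin> K \<Longrightarrow> \<phi> x = 0"
    and KU: "K \<subseteq> U" "U \<in> sets lebesgue"
  shows "(\<integral>x. f x * \<phi> x \<partial>lebesgue_on U) = (\<integral>x. g x * \<phi> x \<partial>lborel)"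
proof -
  have "(\<integral>x. f x * \<phi> x \<partial>lebesgue_on U) = (\<integral>x. indicator U x *\<^sub>R (f x * \<phi> x) \<partial>lebesgue)"
    using KU by (intro integral_restrict_space) auto
  also have "\<dots> = (\<integral>x. g x * \<phi> x \<partial>lebesgue)"
  proof -
    have m: "(\<lambda>x. g x * \<phi> x) \<in> borel_measurable lebesgue"
      by (rule measurable_completion) (use g \<phi> in simp)
    have eq: "AE x in lebesgue. g x * \<phi> x = indicator U x *\<^sub>R (f x * \<phi> x)"
      using AE_completion[OF ae] by eventually_elim (use 0 KU(1) in \<open>auto simp: indicator_def split: if_splits\<close>)
    from m eq have m': "(\<lambda>x. indicator U x *\<^sub>R (f x * \<phi> x)) \<in> borel_measurable lebesgue"
      by (rule borel_measurable_AE)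
    show ?thesis by (rule integral_cong_AE[OF m m' eq, symmetric])
  qed
  also have "\<dots> = (\<integral>x. g x * \<phi> x \<partial>lborel)"
    by (rule integral_completion) (use g \<phi> in simp)
  finally show ?thesis .
qed

lemma test_functions_mono: "\<phi> \<in> test_functions U \<Longrightarrow> U \<subseteq> V \<Longrightarrow> \<phi> \<in> test_functions V"
  by (auto simp: test_functions_def)

lemma test_function_outside:
  assumes "\<phi> \<in> test_functions U" "x \<notin> U"
  shows "\<phi> x = 0" "partial_deriv j \<phi> x = 0"
proof -
  have "\<phi> x = 0 \<and> partial_deriv j \<phi> x = 0"
    by (rule test_function_support[OF assms(1)]) (use assms(2) in blast)
  then show "\<phi> x = 0" "partial_deriv j \<phi> x = 0" by auto
qed

text \<open>Weak gradients are integrable on compact subsets only, so the comparison runs on cores.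
  On the core of width d the difference of Borel representatives is orthogonal to all test functions
  and vanishes almost everywhere in the interior, which contains the core of width 2 d. With d =
  1/(n + 1) these sets exhaust \<open>U\<close>.\<close>

lemma open_bounded_AE_unique_weak_gradient:
  fixes u :: "real^'n::finite \<Rightarrow> real^'m::finite"
  assumes U: "open U" "bounded U" and G: "has_weak_gradient U u G" and H: "has_weak_gradient U u H"
  shows "AE x in lborel. x \<in> U \<longrightarrow> G x = H x"
proof -
  have "AE x in lborel. x \<in> core U (2 * inverse (real (Suc n))) \<longrightarrow> G x = H x" for n
  proof -
    define d where "d = inverse (real (Suc n))"
    have d: "d > 0" by (simp add: d_def)
    let ?K = "core U d"
    have K: "compact ?K" "?K \<subseteq> U" using compact_core[OF U(2) d] core_subset[OF d] by auto
    have lG: "locally_integrable U G" and lH: "locally_integrable U H"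
      using G H unfolding has_weak_gradient_def by blast+
    obtain g where g: "integrable lborel g" "AE x in lborel. g x = indicator ?K x *\<^sub>R G x"
      by (rule locally_integrable_representative[OF lG K])
    obtain h where h: "integrable lborel h" "AE x in lborel. h x = indicator ?K x *\<^sub>R H x"
      by (rule locally_integrable_representative[OF lH K])
    have "AE x in lborel. x \<in> interior ?K \<longrightarrow> g x $ i $ j - h x $ i $ j = 0" for i j
    proof (rule fundamental_lemma)
      have ig: "integrable lborel (\<lambda>x. g x $ i $ j)" and ih: "integrable lborel (\<lambda>x. h x $ i $ j)"
        by (rule integrable_vec_nth[OF integrable_vec_nth[OF g(1)]] integrable_vec_nth[OF integrable_vec_nth[OF h(1)]])+
      show "integrable lborel (\<lambda>x. g x $ i $ j - h x $ i $ j)"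
        by (rule Bochner_Integration.integrable_diff[OF ig ih])
      fix \<phi> assume \<phi>: "\<phi> \<in> test_functions ?K"
      have \<phi>U: "\<phi> \<in> test_functions U" by (rule test_functions_mono[OF \<phi> K(2)])
      obtain B where B: "\<And>x. \<bar>\<phi> x\<bar> \<le> B" using test_function_bounded[OF \<phi>] by blast
      have \<phi>m[measurable]: "\<phi> \<in> borel_measurable borel" using \<phi> by measurable
      have Ul: "U \<in> sets lebesgue" using borel_open[OF U(1)] by simp
      have gm: "(\<lambda>x. g x $ i $ j) \<in> borel_measurable borel" and hm: "(\<lambda>x. h x $ i $ j) \<in> borel_measurable borel"
        using borel_measurable_integrable[OF ig] borel_measurable_integrable[OF ih] unfolding measurable_lborel2 by blast+
      have gA: "AE x in lborel. g x $ i $ j = indicator ?K x * G x $ i $ j" using g(2) by eventually_elim simp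
      have hA: "AE x in lborel. h x $ i $ j = indicator ?K x * H x $ i $ j" using h(2) by eventually_elim simp
      note \<phi>0 = test_function_outside(1)[OF \<phi>]
      have "(\<integral>x. g x $ i $ j * \<phi> x \<partial>lborel) = (\<integral>x. G x $ i $ j * \<phi> x \<partial>lebesgue_on U)"
        by (rule integral_representative[symmetric, OF gm gA \<phi>m \<phi>0 K(2) Ul])
      also have "\<dots> = (\<integral>x. H x $ i $ j * \<phi> x \<partial>lebesgue_on U)"
      proof -
        have "(\<integral>x. u x $ i * partial_deriv j \<phi> x \<partial>lebesgue_on U) = - (\<integral>x. G x $ i $ j * \<phi> x \<partial>lebesgue_on U)"
          using G \<phi>U unfolding has_weak_gradient_def by blast
        moreover have "(\<integral>x. u x $ i * partial_deriv j \<phi> x \<partial>lebesgue_on U) = - (\<integral>x. H x $ i $ j * \<phi> x \<partial>lebesgue_on U)"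
          using H \<phi>U unfolding has_weak_gradient_def by blast
        ultimately show ?thesis by linarith
      qed
      also have "\<dots> = (\<integral>x. h x $ i $ j * \<phi> x \<partial>lborel)"
        by (rule integral_representative[OF hm hA \<phi>m \<phi>0 K(2) Ul])
      finally have eq: "(\<integral>x. g x $ i $ j * \<phi> x \<partial>lborel) = (\<integral>x. h x $ i $ j * \<phi> x \<partial>lborel)" .
      have "integrable lborel (\<lambda>x. g x $ i $ j * \<phi> x)" "integrable lborel (\<lambda>x. h x $ i $ j * \<phi> x)"
        using integrable_bounded_mult[OF ig _ B] integrable_bounded_mult[OF ih _ B] \<phi>m
        by (simp_all add: mult.commute)
      from Bochner_Integration.integral_diff[OF this] eq
      show "(\<integral>x. (g x $ i $ j - h x $ i $ j) * \<phi> x \<partial>lborel) = 0"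
        unfolding left_diff_distrib by linarith
    qed
    then have "AE x in lborel. \<forall>i j. x \<in> interior ?K \<longrightarrow> g x $ i $ j - h x $ i $ j = 0"
      unfolding AE_all_countable by blast
    with g(2) h(2) have "AE x in lborel. x \<in> core U (2 * d) \<longrightarrow> G x = H x"
    proof eventually_elim
      fix x assume *: "g x = indicator ?K x *\<^sub>R G x" "h x = indicator ?K x *\<^sub>R H x"
        "\<forall>i j. x \<in> interior ?K \<longrightarrow> g x $ i $ j - h x $ i $ j = 0"
      show "x \<in> core U (2 * d) \<longrightarrow> G x = H x"
      proof
        assume "x \<in> core U (2 * d)"
        then have "x \<in> interior ?K" using core_subset_interior[OF d] by blast
        moreover from this have "x \<in> ?K" using interior_subset by blast
        ultimately have "g x = G x" "h x = H x" "\<And>i j. g x $ i $ j = h x $ i $ j"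
          using * by simp_all
        then show "G x = H x" unfolding vec_eq_iff by metis
      qed
    qed
    then show ?thesis by (simp add: d_def)
  qed
  then have "AE x in lborel. \<forall>n. x \<in> core U (2 * inverse (real (Suc n))) \<longrightarrow> G x = H x"
    unfolding AE_all_countable by blast
  then show ?thesis
  proof eventually_elim
    fix x assume *: "\<forall>n. x \<in> core U (2 * inverse (real (Suc n))) \<longrightarrow> G x = H x"
    show "x \<in> U \<longrightarrow> G x = H x"
    proof
      assume "x \<in> U"
      then obtain n where "x \<in> core U (2 * inverse (real (Suc n)))" by (rule open_in_core[OF U(1)])
      with * show "G x = H x" by blast
    qed
  qed
qed

section \<open>Classical gradients and quasiconvexity on test functions\<close>

definition gradient :: "(real^'n::finite \<Rightarrow> real^'m::finite) \<Rightarrow> real^'n \<Rightarrow> real^'n^'m" where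
  "gradient u x = (\<chi> i j. partial_deriv j (\<lambda>y. u y $ i) x)"

definition smooth_map :: "(real^'n::finite \<Rightarrow> real^'m::finite) \<Rightarrow> bool" where
  "smooth_map u \<longleftrightarrow> (\<forall>i. smooth (\<lambda>x. u x $ i))"

lemma continuous_on_componentwise_vec:
  fixes f :: "'a::topological_space \<Rightarrow> 'b::topological_space^'m::finite"
  assumes "\<And>i. continuous_on S (\<lambda>x. f x $ i)" shows "continuous_on S f"
  using continuous_on_vec_lambda[of S "\<lambda>i x. f x $ i"] assms by simp

lemma smooth_map_continuous: "smooth_map u \<Longrightarrow> continuous_on S u"
  by (rule continuous_on_componentwise_vec) (simp add: smooth_map_def smooth_continuous)

lemma gradient_continuous: "smooth_map u \<Longrightarrow> continuous_on S (gradient u)"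
  by (intro continuous_on_componentwise_vec)
    (simp add: smooth_map_def gradient_def smooth_continuous smooth_partial_deriv)

lemma smooth_map_borel: "smooth_map u \<Longrightarrow> u \<in> borel_measurable borel"
  using smooth_map_continuous borel_measurable_continuous_onI by blast

lemma gradient_borel: "smooth_map u \<Longrightarrow> gradient u \<in> borel_measurable borel"
  using gradient_continuous borel_measurable_continuous_onI by blast

lemma continuous_locally_integrable:
  fixes f :: "real^'n::finite \<Rightarrow> 'b::euclidean_space"
  assumes "continuous_on UNIV f" shows "locally_integrable U f"
  unfolding locally_integrable_def set_integrable_def
proof safe
  fix K :: "(real^'n) set" assume K: "compact K"
  have "integrable lborel (\<lambda>x. indicator K x *\<^sub>R f x)"
    by (rule borel_integrable_compact[OF K]) (rule continuous_on_subset[OF assms subset_UNIV])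
  then show "integrable lebesgue (\<lambda>x. indicat_real K x *\<^sub>R f x)"
    by (subst integrable_completion) auto
qed

lemma integral_lebesgue_on_eq:
  fixes f :: "'a::euclidean_space \<Rightarrow> real"
  assumes f: "f \<in> borel_measurable borel" "\<And>x. x \<notin> U \<Longrightarrow> f x = 0" and U: "U \<in> sets lebesgue"
  shows "(\<integral>x. f x \<partial>lebesgue_on U) = (\<integral>x. f x \<partial>lborel)"
proof -
  have "(\<integral>x. f x \<partial>lebesgue_on U) = (\<integral>x. indicator U x *\<^sub>R f x \<partial>lebesgue)"
    using U by (intro integral_restrict_space) auto
  also have "(\<lambda>x. indicator U x *\<^sub>R f x) = f" using f(2) by (auto simp: fun_eq_iff indicator_def)
  also have "(\<integral>x. f x \<partial>lebesgue) = (\<integral>x. f x \<partial>lborel)"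
    by (rule integral_completion) (use f in simp)
  finally show ?thesis .
qed

lemma smooth_has_weak_gradient:
  assumes u: "smooth_map u" and U: "U \<in> sets lebesgue"
  shows "has_weak_gradient U u (gradient u)"
  unfolding has_weak_gradient_def
proof (intro conjI ballI allI)
  show "locally_integrable U u" "locally_integrable U (gradient u)"
    using u by (auto intro: continuous_locally_integrable smooth_map_continuous gradient_continuous)
  fix \<phi> i j assume \<phi>: "\<phi> \<in> test_functions U"
  have ui: "smooth (\<lambda>x. u x $ i)" using u by (simp add: smooth_map_def)
  have [measurable]: "(\<lambda>x. u x $ i) \<in> borel_measurable borel" "\<phi> \<in> borel_measurable borel"
    "partial_deriv j \<phi> \<in> borel_measurable borel" "partial_deriv j (\<lambda>x. u x $ i) \<in> borel_measurable borel"
    using ui test_function_smooth[OF \<phi>] by (auto intro!: smooth_borel smooth_partial_deriv)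
  have "(\<integral>x. u x $ i * partial_deriv j \<phi> x \<partial>lebesgue_on U) = (\<integral>x. u x $ i * partial_deriv j \<phi> x \<partial>lborel)"
    by (rule integral_lebesgue_on_eq[OF _ _ U]) (auto simp: test_function_outside[OF \<phi>])
  also have "\<dots> = - (\<integral>x. partial_deriv j (\<lambda>x. u x $ i) x * \<phi> x \<partial>lborel)"
    by (rule integral_by_parts_smooth[OF \<phi> ui])
  also have "(\<integral>x. partial_deriv j (\<lambda>x. u x $ i) x * \<phi> x \<partial>lborel) = (\<integral>x. partial_deriv j (\<lambda>x. u x $ i) x * \<phi> x \<partial>lebesgue_on U)"
    by (rule integral_lebesgue_on_eq[OF _ _ U, symmetric]) (auto simp: test_function_outside[OF \<phi>])
  finally show "(\<integral>x. u x $ i * partial_deriv j \<phi> x \<partial>lebesgue_on U) = - (\<integral>x. gradient u x $ i $ j * \<phi> x \<partial>lebesgue_on U)"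
    by (simp add: gradient_def)
qed

text \<open>The classical gradient shows that the choice in \<open>weak_gradient\<close> is made
  from a nonempty set; the chosen representative then agrees with it almost everywhere by
  uniqueness, and no more can be expected of a choice.\<close>

lemma weak_gradient_smooth:
  assumes "smooth_map u" "open U" "bounded U"
  shows "AE x in lborel. x \<in> U \<longrightarrow> weak_gradient U u x = gradient u x"
proof -
  have "has_weak_gradient U u (gradient u)" using assms by (intro smooth_has_weak_gradient) auto
  then have "has_weak_gradient U u (weak_gradient U u)" unfolding weak_gradient_def by (rule someI[of "has_weak_gradient U u"])
  then show ?thesis
    using assms smooth_has_weak_gradient[of u U] by (intro open_bounded_AE_unique_weak_gradient[of U u]) auto
qed

lemma AE_lebesgue_on:
  assumes "AE x in lborel. x \<in> U \<longrightarrow> P x" "U \<in> sets lebesgue"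
  shows "AE x in lebesgue_on U. P x"
  using AE_completion[OF assms(1)] assms(2) by (subst AE_restrict_space_iff) auto

lemma bounded_support_Lp_space:
  fixes f :: "real^'n::finite \<Rightarrow> 'b::euclidean_space"
  assumes f: "continuous_on UNIV f" and B: "\<And>x. norm (f x) \<le> B" and U: "open U" "bounded U" and q: "q > 0"
  shows "f \<in> Lp_space U q"
proof -
  have fb: "f \<in> borel_measurable borel" using f by (rule borel_measurable_continuous_onI)
  then have m: "f \<in> borel_measurable (lebesgue_on U)"
    by (intro measurable_restrict_space1 measurable_completion) simp
  interpret finite_measure "lebesgue_on U"
    by (rule finite_measure_lebesgue_on) (use U in \<open>auto intro: lmeasurable_open\<close>)
  have "integrable (lebesgue_on U) (\<lambda>x. norm (f x) powr q)"
  proof (rule integrable_const_bound[of _ "B powr q"])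
    show "AE x in lebesgue_on U. norm (norm (f x) powr q) \<le> B powr q"
      using B q by (intro AE_I2) (auto intro: powr_mono2)
    show "(\<lambda>x. norm (f x) powr q) \<in> borel_measurable (lebesgue_on U)" using m by measurable
  qed
  with m show ?thesis by (simp add: Lp_space_def)
qed

lemma norm_vec_le_sum:
  fixes x :: "'b::real_normed_vector^'m::finite"
  shows "norm x \<le> (\<Sum>i\<in>UNIV. norm (x $ i))"
  unfolding norm_vec_def by (rule L2_set_le_sum) simp

lemma vec_bounded_componentwise:
  fixes f :: "'a \<Rightarrow> 'b::real_normed_vector^'m::finite"
  assumes "\<And>i. \<exists>B. \<forall>x. norm (f x $ i) \<le> B" shows "\<exists>B. \<forall>x. norm (f x) \<le> B"
proof -
  obtain B where B: "\<And>i x. norm (f x $ i) \<le> B i" using assms by metis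
  have "norm (f x) \<le> (\<Sum>i\<in>UNIV. B i)" for x
    by (rule order_trans[OF norm_vec_le_sum sum_mono[OF B]])
  then show ?thesis by blast
qed

lemma vector_test_function_smooth_map: "v \<in> vector_test_functions U \<Longrightarrow> smooth_map v"
  unfolding vector_test_functions_def smooth_map_def using test_function_smooth by blast

text \<open>The constant sequence \<open>v\<close> approximates \<open>v\<close>. What needs proof
  is that the distance evaluates to 0: \<open>sobolev_norm\<close> contains a chosen weak gradient
  of the zero map, which is known to vanish only almost everywhere.\<close>

lemma vector_test_function_sobolev0:
  fixes v :: "real^'n::finite \<Rightarrow> real^'m::finite"
  assumes v: "v \<in> vector_test_functions U" and U: "open U" "bounded U" and q: "q > 0"
  shows "v \<in> sobolev0 U q"
proof -
  have sm: "smooth_map v" by (rule vector_test_function_smooth_map[OF v])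
  have t: "(\<lambda>x. v x $ i) \<in> test_functions U" for i using v by (simp add: vector_test_functions_def)
  have "\<exists>B. \<forall>x. norm (v x $ i) \<le> B" for i
    using test_function_bounded[OF t[of i]] unfolding real_norm_def by blast
  from vec_bounded_componentwise[OF this] obtain B where "\<And>x. norm (v x) \<le> B" by blast
  then have v1: "v \<in> Lp_space U q"
    using U q by (intro bounded_support_Lp_space smooth_map_continuous[OF sm])
  have "\<exists>B. \<forall>x. norm (gradient v x $ i $ j) \<le> B" for i j
    using test_function_bounded[OF test_function_partial_deriv[OF t[of i], of j]]
    unfolding real_norm_def gradient_def vec_lambda_beta by blast
  then have "\<exists>B. \<forall>x. norm (gradient v x $ i) \<le> B" for i by (rule vec_bounded_componentwise)
  from vec_bounded_componentwise[OF this] obtain B where "\<And>x. norm (gradient v x) \<le> B" by blast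
  then have v2: "gradient v \<in> Lp_space U q"
    using U q by (intro bounded_support_Lp_space gradient_continuous[OF sm])
  have "has_weak_gradient U v (gradient v)"
    by (rule smooth_has_weak_gradient[OF sm]) (use U in auto)
  with v1 v2 have s: "v \<in> sobolev U q" unfolding sobolev_def by blast
  have "smooth_map (\<lambda>x::real^'n. 0::real^'m)" by (simp add: smooth_map_def smooth_const)
  from weak_gradient_smooth[OF this U]
  have "AE x in lborel. x \<in> U \<longrightarrow> weak_gradient U (\<lambda>x. 0::real^'m) x = 0"
    by eventually_elim
      (simp add: gradient_def vec_eq_iff partial_deriv_has_derivative[OF has_derivative_const])
  then have "AE x in lebesgue_on U. weak_gradient U (\<lambda>x. 0::real^'m) x = 0"
    by (rule AE_lebesgue_on) (use U in auto)
  then have "AE x in lebesgue_on U. norm (weak_gradient U (\<lambda>x. 0::real^'m) x) powr q = 0"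
    by eventually_elim simp
  then have "(\<integral>x. norm (weak_gradient U (\<lambda>x. 0::real^'m) x) powr q \<partial>lebesgue_on U) = 0"
    by (rule integral_eq_zero_AE)
  then have "sobolev_norm U q (\<lambda>x. v x - v x) = 0" by (simp add: sobolev_norm_def)
  then have "(\<lambda>k::nat. sobolev_norm U q (\<lambda>x. v x - v x)) \<longlonglongrightarrow> 0" by simp
  with s v show ?thesis unfolding sobolev0_def by (intro CollectI conjI exI[of _ "\<lambda>k::nat. v"]) auto
qed

lemma gradient_affine_add:
  assumes "smooth_map v"
  shows "smooth_map (\<lambda>y. \<xi> *v y + v y)" "gradient (\<lambda>y. \<xi> *v y + v y) x = \<xi> + gradient v x"
proof -
  have c: "(\<lambda>y. (\<xi> *v y + v y) $ i) = (\<lambda>y. (\<Sum>j\<in>UNIV. \<xi> $ i $ j * y $ j) + v y $ i)" for i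
    by (simp add: matrix_vector_mult_def)
  show "smooth_map (\<lambda>y. \<xi> *v y + v y)"
    unfolding smooth_map_def c
    using assms by (auto intro!: smooth_add smooth_sum smooth_mult smooth_const smooth_vec_nth simp: smooth_map_def)
  have "partial_deriv j (\<lambda>y. (\<xi> *v y + v y) $ i) x = \<xi> $ i $ j + partial_deriv j (\<lambda>y. v y $ i) x" for i j
  proof -
    have "((\<lambda>y. (\<xi> *v y + v y) $ i) has_derivative
        (\<lambda>h. (\<Sum>j\<in>UNIV. \<xi> $ i $ j * h $ j) + (\<Sum>j\<in>UNIV. partial_deriv j (\<lambda>y. v y $ i) x * h $ j))) (at x)"
      unfolding c
    proof (rule has_derivative_add)
      show "((\<lambda>y. \<Sum>j\<in>UNIV. \<xi> $ i $ j * y $ j) has_derivative (\<lambda>h. \<Sum>j\<in>UNIV. \<xi> $ i $ j * h $ j)) (at x)"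
        by (intro has_derivative_sum has_derivative_mult_right has_derivative_vec_nth)
      show "((\<lambda>y. v y $ i) has_derivative (\<lambda>h. \<Sum>j\<in>UNIV. partial_deriv j (\<lambda>y. v y $ i) x * h $ j)) (at x)"
        using assms by (intro smooth_has_derivative) (simp add: smooth_map_def)
    qed
    from partial_deriv_has_derivative[OF this, of j] show ?thesis
      by (simp add: axis_def if_distrib cong: if_cong)
  qed
  then show "gradient (\<lambda>y. \<xi> *v y + v y) x = \<xi> + gradient v x"
    by (simp add: gradient_def vec_eq_iff)
qed

lemma open_unit_cube: "open (unit_cube :: (real^'n::finite) set)" and bounded_unit_cube: "bounded (unit_cube :: (real^'n::finite) set)"
  by (auto simp: unit_cube_def bounded_box)

lemma nn_integral_lebesgue_on_eq:
  fixes f :: "'a::euclidean_space \<Rightarrow> ennreal"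
  assumes g: "g \<in> borel_measurable borel" and ae: "AE x in lborel. x \<in> U \<longrightarrow> f x = g x" and U: "U \<in> sets borel"
  shows "(\<integral>\<^sup>+x. f x \<partial>lebesgue_on U) = (\<integral>\<^sup>+x\<in>U. g x \<partial>lborel)"
proof -
  have "(\<integral>\<^sup>+x. f x \<partial>lebesgue_on U) = (\<integral>\<^sup>+x. f x * indicator U x \<partial>lebesgue)"
    using U by (intro nn_integral_restrict_space) auto
  also have "\<dots> = (\<integral>\<^sup>+x. g x * indicator U x \<partial>lebesgue)"
  proof (rule nn_integral_cong_AE)
    show "AE x in lebesgue. f x * indicator U x = g x * indicator U x"
      using AE_completion[OF ae] by eventually_elim (auto simp: indicator_def)
  qed
  also have "\<dots> = (\<integral>\<^sup>+x. g x * indicator U x \<partial>lborel)"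
    by (rule nn_integral_completion)
  finally show ?thesis .
qed

text \<open>This is the only access to quasiconvexity: all later arguments use it for test
  functions, with classical gradients and a Borel integral in place of
  \<open>energy\<close>.\<close>

lemma quasiconvex_test_functions:
  fixes L :: "real^'n::finite^'m::finite \<Rightarrow> real"
  assumes L: "W1_quasiconvex q L" "continuous_on UNIV L" and q: "q > 0" and v: "v \<in> vector_test_functions unit_cube"
  shows "ennreal (L \<xi>) \<le> (\<integral>\<^sup>+x\<in>unit_cube. ennreal (L (\<xi> + gradient v x)) \<partial>lborel)"
proof -
  have sm: "smooth_map v" by (rule vector_test_function_smooth_map[OF v])
  have Lb: "L \<in> borel_measurable borel" using L(2) by (rule borel_measurable_continuous_onI)
  have "ennreal (L \<xi>) \<le> energy unit_cube L (\<lambda>y. \<xi> *v y + v y)"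
    using L(1) vector_test_function_sobolev0[OF v open_unit_cube bounded_unit_cube q]
    unfolding W1_quasiconvex_def by blast
  also have "\<dots> = (\<integral>\<^sup>+x\<in>unit_cube. ennreal (L (\<xi> + gradient v x)) \<partial>lborel)"
    unfolding energy_def
  proof (rule nn_integral_lebesgue_on_eq)
    show "AE x in lborel. x \<in> unit_cube \<longrightarrow>
        ennreal (L (weak_gradient unit_cube (\<lambda>y. \<xi> *v y + v y) x)) = ennreal (L (\<xi> + gradient v x))"
      using weak_gradient_smooth[OF gradient_affine_add(1)[OF sm, of \<xi>] open_unit_cube bounded_unit_cube]
      by eventually_elim (simp add: gradient_affine_add(2)[OF sm])
    show "(\<lambda>x. ennreal (L (\<xi> + gradient v x))) \<in> borel_measurable borel"
      using gradient_borel[OF sm] Lb by measurable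
  qed (rule borel_open[OF open_unit_cube])
  finally show ?thesis .
qed

section \<open>Poincare inequality and strong convergence on the unit cube\<close>

lemma smooth_map_has_derivative:
  fixes f :: "real^'a::finite \<Rightarrow> real^'b::finite"
  assumes "smooth_map f"
  shows "(f has_derivative (\<lambda>h. gradient f x *v h)) (at x)"
proof -
  have "(f has_derivative (\<lambda>h. \<chi> i. \<Sum>j\<in>UNIV. partial_deriv j (\<lambda>y. f y $ i) x * h $ j)) (at x)"
  proof (rule has_derivative_componentwise_within[THEN iffD2], rule ballI)
    fix b :: "real^'b" assume "b \<in> Basis"
    then obtain i where b: "b = axis i 1" unfolding Basis_vec_def by auto
    have "((\<lambda>y. f y $ i) has_derivative (\<lambda>h. \<Sum>j\<in>UNIV. partial_deriv j (\<lambda>y. f y $ i) x * h $ j)) (at x)"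
      using assms unfolding smooth_map_def by (intro smooth_has_derivative) blast
    then show "((\<lambda>y. f y \<bullet> b) has_derivative
        (\<lambda>h. (\<chi> i. \<Sum>j\<in>UNIV. partial_deriv j (\<lambda>y. f y $ i) x * h $ j) \<bullet> b)) (at x)"
      by (simp add: b inner_axis)
  qed
  moreover have "(\<lambda>h. \<chi> i. \<Sum>j\<in>UNIV. partial_deriv j (\<lambda>y. f y $ i) x * h $ j) = (\<lambda>h. gradient f x *v h)"
    by (simp add: gradient_def matrix_vector_mult_def fun_eq_iff)
  ultimately show ?thesis by simp
qed

lemma norm_matrix_vector_mult_le:
  fixes A :: "real^'n::finite^'m::finite"
  shows "norm (A *v x) \<le> norm A * norm x"
proof -
  have "norm (A *v x) = L2_set (\<lambda>i. \<bar>A $ i \<bullet> x\<bar>) UNIV"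
    unfolding norm_vec_def by (simp add: matrix_mult_dot)
  also have "\<dots> \<le> L2_set (\<lambda>i. norm (A $ i) * norm x) UNIV"
    by (intro L2_set_mono Cauchy_Schwarz_ineq2) simp
  also have "\<dots> = norm A * norm x"
    by (simp add: norm_vec_def L2_set_left_distrib)
  finally show ?thesis .
qed

text \<open>Fundamental theorem of calculus along the segment. The bound is a nonnegative integral,
  so that it can be integrated once more and reordered without integrability conditions.\<close>

lemma norm_diff_le_nn_integral_gradient:
  fixes f :: "real^'n::finite \<Rightarrow> real^'m::finite"
  assumes f: "smooth_map f"
  shows "ennreal (norm (f (x + w) - f x)) \<le>
    (\<integral>\<^sup>+t\<in>{0..1}. ennreal (norm w * norm (gradient f (x + t *\<^sub>R w))) \<partial>lborel)"
proof -
  let ?g = "\<lambda>t. norm w * norm (gradient f (x + t *\<^sub>R w))"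
  have gc: "continuous_on UNIV (\<lambda>t. gradient f (x + t *\<^sub>R w))"
    by (rule continuous_on_compose2[OF gradient_continuous[OF f, of UNIV]]) (auto intro!: continuous_intros)
  then have "continuous_on UNIV ?g" by (intro continuous_intros)
  then have gi: "?g integrable_on {0..1}"
    using integrable_continuous_interval continuous_on_subset[OF _ subset_UNIV] by metis
  have "((\<lambda>t. gradient f (x + t *\<^sub>R w) *v w) has_integral (f (x + 1 *\<^sub>R w) - f (x + 0 *\<^sub>R w))) {0..1}"
  proof (rule fundamental_theorem_of_calculus)
    fix t :: real
    have "((\<lambda>t. x + t *\<^sub>R w) has_derivative (\<lambda>s. s *\<^sub>R w)) (at t within {0..1})"
      by (auto intro!: derivative_eq_intros)
    from has_derivative_compose[OF this smooth_map_has_derivative[OF f]]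
    show "((\<lambda>t. f (x + t *\<^sub>R w)) has_vector_derivative gradient f (x + t *\<^sub>R w) *v w) (at t within {0..1})"
      unfolding has_vector_derivative_def by (simp add: matrix_vector_mult_scaleR)
  qed simp
  then have hi: "((\<lambda>t. gradient f (x + t *\<^sub>R w) *v w) has_integral (f (x + w) - f x)) {0..1}" by simp
  have "norm (integral {0..1} (\<lambda>t. gradient f (x + t *\<^sub>R w) *v w)) \<le> integral {0..1} ?g"
  proof (rule integral_norm_bound_integral[OF has_integral_integrable[OF hi] gi])
    show "norm (gradient f (x + t *\<^sub>R w) *v w) \<le> norm w * norm (gradient f (x + t *\<^sub>R w))" for t
      using norm_matrix_vector_mult_le[of "gradient f (x + t *\<^sub>R w)" w] by (simp only: mult.commute)
  qed
  then have "ennreal (norm (f (x + w) - f x)) \<le> ennreal (integral {0..1} ?g)"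
    using hi by (simp add: integral_unique ennreal_leI)
  also have "\<dots> = (\<integral>\<^sup>+t\<in>{0..1}. ennreal (?g t) \<partial>lborel)"
    by (rule nn_integral_has_integral_lebesgue'[symmetric, OF _ integrable_integral[OF gi]]) simp
  finally show ?thesis .
qed

lemma unit_cube_iff: "x \<in> unit_cube \<longleftrightarrow> (\<forall>i. - 1/2 < x $ i \<and> x $ i < 1/2)"
  by (auto simp: unit_cube_def mem_box_cart)

lemma convex_unit_cube: "convex (unit_cube :: (real^'n::finite) set)"
  by (simp add: unit_cube_def convex_box)

lemma unit_cube_borel[measurable]: "(unit_cube :: (real^'n::finite) set) \<in> sets borel"
  by (simp add: open_unit_cube)

lemma emeasure_unit_cube: "emeasure lborel (unit_cube :: (real^'n::finite) set) = 1"
proof -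
  have "measure lborel (unit_cube :: (real^'n) set) = 1"
    unfolding unit_cube_def measure_lborel_box_eq
    by (auto simp: Basis_vec_def inner_axis intro!: prod.neutral)
  then show ?thesis
    using emeasure_bounded_finite[OF bounded_unit_cube[where 'n='n]]
    by (simp add: emeasure_eq_ennreal_measure)
qed

lemma norm_diff_unit_cube:
  assumes "x \<in> unit_cube" "y \<in> (unit_cube :: (real^'n::finite) set)"
  shows "norm (y - x) \<le> real CARD('n)"
proof -
  have "norm (y - x) \<le> (\<Sum>i\<in>UNIV. \<bar>(y - x) $ i\<bar>)" by (rule norm_le_l1_cart)
  also have "\<dots> \<le> (\<Sum>i\<in>(UNIV::'n set). 1)"
  proof (rule sum_mono)
    fix i
    have "-1/2 < x $ i" "x $ i < 1/2" "-1/2 < y $ i" "y $ i < 1/2"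
      using assms unfolding unit_cube_iff by auto
    then show "\<bar>(y - x) $ i\<bar> \<le> 1" by simp
  qed
  finally show ?thesis by simp
qed

lemma unit_cube_contract:
  assumes "x \<in> unit_cube" "y \<in> (unit_cube :: (real^'n::finite) set)" "0 \<le> s" "s \<le> 1"
  shows "x + s *\<^sub>R (y - x) \<in> unit_cube"
  using convexD[OF convex_unit_cube assms(1,2), of "1 - s" s] assms(3,4) by (simp add: algebra_simps)

text \<open>For fixed \<open>y\<close> the map x -> s y + (1 - s) x sends the cube into itself by
  convexity and multiplies volumes by (1 - s)^N, which is at least 2^(-N) for s \<le> 1/2; hence the
  factor 2^N. The integrals are exchanged so that \<open>y\<close> is the one held fixed.\<close>

lemma nn_integral_unit_cube_contract:
  fixes g :: "real^'n::finite \<Rightarrow> ennreal"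
  assumes [measurable]: "g \<in> borel_measurable borel" and s: "0 \<le> s" "s \<le> 1/2"
  shows "(\<integral>\<^sup>+x\<in>unit_cube. (\<integral>\<^sup>+y\<in>unit_cube. g (x + s *\<^sub>R (y - x)) \<partial>lborel) \<partial>lborel)
    \<le> ennreal (2 ^ CARD('n)) * (\<integral>\<^sup>+x\<in>unit_cube. g x \<partial>lborel)"
proof -
  let ?Y = "unit_cube :: (real^'n) set"
  have "(\<integral>\<^sup>+x\<in>?Y. (\<integral>\<^sup>+y\<in>?Y. g (x + s *\<^sub>R (y - x)) \<partial>lborel) \<partial>lborel)
      = (\<integral>\<^sup>+x. \<integral>\<^sup>+y. g (x + s *\<^sub>R (y - x)) * indicator ?Y y * indicator ?Y x \<partial>lborel \<partial>lborel)"
    by (intro nn_integral_cong nn_integral_multc[symmetric]) measurable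
  also have "\<dots> = (\<integral>\<^sup>+y. \<integral>\<^sup>+x. g (x + s *\<^sub>R (y - x)) * indicator ?Y y * indicator ?Y x \<partial>lborel \<partial>lborel)"
    by (rule lborel_pair.Fubini') measurable
  also have "\<dots> \<le> (\<integral>\<^sup>+y. ennreal (2 ^ CARD('n)) * (\<integral>\<^sup>+x\<in>?Y. g x \<partial>lborel) * indicator ?Y y \<partial>lborel)"
  proof (rule nn_integral_mono)
    fix y :: "real^'n"
    show "(\<integral>\<^sup>+x. g (x + s *\<^sub>R (y - x)) * indicator ?Y y * indicator ?Y x \<partial>lborel)
        \<le> ennreal (2 ^ CARD('n)) * (\<integral>\<^sup>+x\<in>?Y. g x \<partial>lborel) * indicator ?Y y"
    proof (cases "y \<in> ?Y")
      case True
      let ?c = "1 - s"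
      have "(\<integral>\<^sup>+x. g (x + s *\<^sub>R (y - x)) * indicator ?Y y * indicator ?Y x \<partial>lborel)
          \<le> (\<integral>\<^sup>+x. g (s *\<^sub>R y + ?c *\<^sub>R x) * indicator ?Y (s *\<^sub>R y + ?c *\<^sub>R x) \<partial>lborel)"
      proof (rule nn_integral_mono)
        fix x :: "real^'n"
        have eq: "x + s *\<^sub>R (y - x) = s *\<^sub>R y + ?c *\<^sub>R x" by (simp add: algebra_simps)
        have "x \<in> ?Y \<Longrightarrow> s *\<^sub>R y + ?c *\<^sub>R x \<in> ?Y"
          using unit_cube_contract[OF _ True, of x s] s eq by simp
        then show "g (x + s *\<^sub>R (y - x)) * indicator ?Y y * indicator ?Y x
            \<le> g (s *\<^sub>R y + ?c *\<^sub>R x) * indicator ?Y (s *\<^sub>R y + ?c *\<^sub>R x)"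
          unfolding eq by (auto simp: indicator_def)
      qed
      also have "\<dots> \<le> ennreal (2 ^ CARD('n)) * (ennreal (\<bar>?c\<bar> ^ CARD('n)) * \<dots>)"
      proof -
        have "1 \<le> (2 * ?c) ^ CARD('n)" using s by (intro one_le_power) simp
        then have "1 \<le> ennreal (2 ^ CARD('n)) * ennreal (\<bar>?c\<bar> ^ CARD('n))"
          using s by (subst ennreal_mult[symmetric]) (simp_all add: power_mult_distrib[symmetric])
        from mult_right_mono[OF this, of "\<integral>\<^sup>+x. g (s *\<^sub>R y + ?c *\<^sub>R x) * indicator ?Y (s *\<^sub>R y + ?c *\<^sub>R x) \<partial>lborel"]
        show ?thesis by (simp add: mult.assoc)
      qed
      also have "ennreal (\<bar>?c\<bar> ^ CARD('n)) * (\<integral>\<^sup>+x. g (s *\<^sub>R y + ?c *\<^sub>R x) * indicator ?Y (s *\<^sub>R y + ?c *\<^sub>R x) \<partial>lborel)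
          = (\<integral>\<^sup>+x\<in>?Y. g x \<partial>lborel)"
        using nn_integral_lborel_affine[of "\<lambda>x. g x * indicator ?Y x" ?c "s *\<^sub>R y"] s by simp
      finally show ?thesis using True by simp
    qed simp
  qed
  also have "\<dots> = ennreal (2 ^ CARD('n)) * (\<integral>\<^sup>+x\<in>?Y. g x \<partial>lborel)"
    by (subst nn_integral_cmult) (auto simp: emeasure_unit_cube)
  finally show ?thesis .
qed

text \<open>The increment is an integral of the gradient over a segment of length at most s N, since
  two points of the cube are at most N apart in the sum norm. The point at parameter t of that
  segment is a contraction with ratio t s, still at most 1/2, so each t costs the factor 2^N of
  \<open>nn_integral_unit_cube_contract\<close>.\<close>

lemma nn_integral_difference_le_gradient:
  fixes f :: "real^'n::finite \<Rightarrow> real^'m::finite"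
  assumes f: "smooth_map f" and s: "0 \<le> s" "s \<le> 1/2"
  shows "(\<integral>\<^sup>+x\<in>unit_cube. (\<integral>\<^sup>+y\<in>unit_cube. norm (f (x + s *\<^sub>R (y - x)) - f x) \<partial>lborel) \<partial>lborel)
    \<le> ennreal (s * (real CARD('n) * 2 ^ CARD('n))) * (\<integral>\<^sup>+x\<in>unit_cube. norm (gradient f x) \<partial>lborel)"
proof -
  let ?Y = "unit_cube :: (real^'n) set" and ?N = "real CARD('n)"
  have fm[measurable]: "f \<in> borel_measurable borel" by (rule smooth_map_borel[OF f])
  have gm[measurable]: "gradient f \<in> borel_measurable borel" by (rule gradient_borel[OF f])
  let ?h = "\<lambda>t x y. ennreal (s * ?N) * ennreal (norm (gradient f (x + (t * s) *\<^sub>R (y - x))))"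
  let ?I = "indicator {0..1} :: real \<Rightarrow> ennreal"
  have pt: "ennreal (norm (f (x + s *\<^sub>R (y - x)) - f x)) \<le> (\<integral>\<^sup>+t\<in>{0..1}. ?h t x y \<partial>lborel)"
    if "x \<in> ?Y" "y \<in> ?Y" for x y
  proof -
    have "ennreal (norm (f (x + s *\<^sub>R (y - x)) - f x)) \<le>
        (\<integral>\<^sup>+t\<in>{0..1}. ennreal (norm (s *\<^sub>R (y - x)) * norm (gradient f (x + t *\<^sub>R s *\<^sub>R (y - x)))) \<partial>lborel)"
      by (rule norm_diff_le_nn_integral_gradient[OF f])
    also have "\<dots> \<le> (\<integral>\<^sup>+t\<in>{0..1}. ?h t x y \<partial>lborel)"
    proof (intro nn_integral_mono mult_right_mono)
      fix t
      have "norm (s *\<^sub>R (y - x)) \<le> s * ?N"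
        using norm_diff_unit_cube[OF that] s by (auto intro: mult_left_mono)
      then show "ennreal (norm (s *\<^sub>R (y - x)) * norm (gradient f (x + t *\<^sub>R s *\<^sub>R (y - x)))) \<le> ?h t x y"
        using s by (subst ennreal_mult[symmetric]) (auto intro!: ennreal_leI mult_right_mono simp del: norm_scaleR)
    qed simp
    finally show ?thesis .
  qed
  have "(\<integral>\<^sup>+x\<in>?Y. (\<integral>\<^sup>+y\<in>?Y. norm (f (x + s *\<^sub>R (y - x)) - f x) \<partial>lborel) \<partial>lborel)
      \<le> (\<integral>\<^sup>+x. (\<integral>\<^sup>+y. (\<integral>\<^sup>+t. ?h t x y * ?I t * indicator ?Y y * indicator ?Y x \<partial>lborel) \<partial>lborel) \<partial>lborel)"
  proof -
    have "(\<integral>\<^sup>+y\<in>?Y. norm (f (x + s *\<^sub>R (y - x)) - f x) \<partial>lborel) * indicator ?Y x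
        \<le> (\<integral>\<^sup>+y. (\<integral>\<^sup>+t. ?h t x y * ?I t * indicator ?Y y * indicator ?Y x \<partial>lborel) \<partial>lborel)" for x
    proof -
      have "(\<integral>\<^sup>+y\<in>?Y. norm (f (x + s *\<^sub>R (y - x)) - f x) \<partial>lborel) * indicator ?Y x
          = (\<integral>\<^sup>+y. ennreal (norm (f (x + s *\<^sub>R (y - x)) - f x)) * indicator ?Y y * indicator ?Y x \<partial>lborel)"
        by (rule nn_integral_multc[symmetric]) measurable
      also have "\<dots> \<le> (\<integral>\<^sup>+y. (\<integral>\<^sup>+t. ?h t x y * ?I t * indicator ?Y y * indicator ?Y x \<partial>lborel) \<partial>lborel)"
      proof (rule nn_integral_mono)
        fix y
        show "ennreal (norm (f (x + s *\<^sub>R (y - x)) - f x)) * indicator ?Y y * indicator ?Y x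
          \<le> (\<integral>\<^sup>+t. ?h t x y * ?I t * indicator ?Y y * indicator ?Y x \<partial>lborel)"
          using pt[of x y] by (cases "x \<in> ?Y"; cases "y \<in> ?Y") auto
      qed
      finally show ?thesis .
    qed
    then show ?thesis by (intro nn_integral_mono)
  qed
  also have "\<dots> = (\<integral>\<^sup>+x. (\<integral>\<^sup>+t. (\<integral>\<^sup>+y. ?h t x y * ?I t * indicator ?Y y * indicator ?Y x \<partial>lborel) \<partial>lborel) \<partial>lborel)"
    by (intro nn_integral_cong lborel_pair.Fubini') measurable
  also have "\<dots> = (\<integral>\<^sup>+t. (\<integral>\<^sup>+x. (\<integral>\<^sup>+y. ?h t x y * ?I t * indicator ?Y y * indicator ?Y x \<partial>lborel) \<partial>lborel) \<partial>lborel)"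
    by (rule lborel_pair.Fubini') measurable
  also have "\<dots> \<le> (\<integral>\<^sup>+t. ennreal (s * ?N) * (ennreal (2 ^ CARD('n)) * (\<integral>\<^sup>+x\<in>?Y. norm (gradient f x) \<partial>lborel)) * ?I t \<partial>lborel)"
  proof (rule nn_integral_mono)
    fix t :: real
    show "(\<integral>\<^sup>+x. (\<integral>\<^sup>+y. ?h t x y * ?I t * indicator ?Y y * indicator ?Y x \<partial>lborel) \<partial>lborel)
      \<le> ennreal (s * ?N) * (ennreal (2 ^ CARD('n)) * (\<integral>\<^sup>+x\<in>?Y. norm (gradient f x) \<partial>lborel)) * ?I t"
    proof (cases "t \<in> {0..1}")
      case True
      have ts: "0 \<le> t * s" "t * s \<le> 1/2" using True s mult_mono[of t 1 s "1/2"] by auto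
      have "(\<integral>\<^sup>+x. (\<integral>\<^sup>+y. ?h t x y * ?I t * indicator ?Y y * indicator ?Y x \<partial>lborel) \<partial>lborel)
          = (\<integral>\<^sup>+x. (\<integral>\<^sup>+y. ennreal (s * ?N) * (ennreal (norm (gradient f (x + (t * s) *\<^sub>R (y - x)))) * indicator ?Y y * indicator ?Y x) \<partial>lborel) \<partial>lborel)"
        using True by (simp add: mult.assoc)
      also have "\<dots> = (\<integral>\<^sup>+x. ennreal (s * ?N) * (\<integral>\<^sup>+y. (ennreal (norm (gradient f (x + (t * s) *\<^sub>R (y - x)))) * indicator ?Y y * indicator ?Y x) \<partial>lborel) \<partial>lborel)"
        by (intro nn_integral_cong nn_integral_cmult) measurable
      also have "\<dots> = (\<integral>\<^sup>+x. ennreal (s * ?N) * ((\<integral>\<^sup>+y\<in>?Y. ennreal (norm (gradient f (x + (t * s) *\<^sub>R (y - x)))) \<partial>lborel) * indicator ?Y x) \<partial>lborel)"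
        by (intro nn_integral_cong arg_cong2[where f="(*)"] refl nn_integral_multc) measurable
      also have "\<dots> = ennreal (s * ?N) * (\<integral>\<^sup>+x\<in>?Y. (\<integral>\<^sup>+y\<in>?Y. ennreal (norm (gradient f (x + (t * s) *\<^sub>R (y - x)))) \<partial>lborel) \<partial>lborel)"
        by (rule nn_integral_cmult) measurable
      also have "\<dots> \<le> ennreal (s * ?N) * (ennreal (2 ^ CARD('n)) * (\<integral>\<^sup>+x\<in>?Y. norm (gradient f x) \<partial>lborel))"
        by (intro mult_left_mono nn_integral_unit_cube_contract[OF _ ts]) auto
      finally show ?thesis using True by simp
    qed simp
  qed
  also have "\<dots> = ennreal (s * ?N) * (ennreal (2 ^ CARD('n)) * (\<integral>\<^sup>+x\<in>?Y. norm (gradient f x) \<partial>lborel))"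
    by (subst nn_integral_cmult) auto
  also have "\<dots> = ennreal (s * (?N * 2 ^ CARD('n))) * (\<integral>\<^sup>+x\<in>?Y. norm (gradient f x) \<partial>lborel)"
    using s by (simp only: ennreal_mult mult.assoc mult_nonneg_nonneg of_nat_0_le_iff zero_le_power zero_le_numeral)
  finally show ?thesis .
qed

lemma norm_integral_le_nn_integral:
  fixes g :: "'a \<Rightarrow> 'b::{banach, second_countable_topology}"
  shows "ennreal (norm (\<integral>x. g x \<partial>M)) \<le> (\<integral>\<^sup>+x. norm (g x) \<partial>M)"
  by (cases "integrable M g") (simp_all add: integral_norm_bound_ennreal not_integrable_integral_eq)

lemma norm_integral_unit_cube_le:
  fixes g :: "real^'n::finite \<Rightarrow> 'b::{banach, second_countable_topology}"
  shows "ennreal (norm (\<integral>x. indicator unit_cube x *\<^sub>R g x \<partial>lborel)) \<le> (\<integral>\<^sup>+x\<in>unit_cube. norm (g x) \<partial>lborel)"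
proof -
  have "(\<integral>\<^sup>+x. norm (indicat_real unit_cube x *\<^sub>R g x) \<partial>lborel) = (\<integral>\<^sup>+x\<in>unit_cube. norm (g x) \<partial>lborel)"
    by (intro nn_integral_cong) (auto simp: indicator_def)
  then show ?thesis using norm_integral_le_nn_integral[of lborel "\<lambda>x. indicat_real unit_cube x *\<^sub>R g x"] by simp
qed

lemma norm_diff_mean_unit_cube_le:
  fixes g :: "real^'n::finite \<Rightarrow> 'b::{banach, second_countable_topology}"
  assumes g: "integrable lborel (\<lambda>x. indicator unit_cube x *\<^sub>R g x)"
  shows "ennreal (norm (c - (\<integral>x. indicator unit_cube x *\<^sub>R g x \<partial>lborel)))
    \<le> (\<integral>\<^sup>+x\<in>unit_cube. norm (g x - c) \<partial>lborel)"
proof -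
  have e: "emeasure lborel (unit_cube :: (real^'n) set) < \<infinity>" by (simp add: emeasure_unit_cube)
  have m: "measure lborel (unit_cube :: (real^'n) set) = 1" by (simp add: measure_def emeasure_unit_cube)
  have i: "integrable lborel (\<lambda>x::real^'n. indicator unit_cube x *\<^sub>R c)"
    using e by (intro integrable_scaleR_left integrable_real_indicator) auto
  have "(\<integral>x. indicator unit_cube x *\<^sub>R c \<partial>(lborel :: (real^'n) measure)) = c"
    using e m by (subst integral_scaleR_left) auto
  then have "c - (\<integral>x. indicator unit_cube x *\<^sub>R g x \<partial>lborel) = - (\<integral>x. indicator unit_cube x *\<^sub>R (g x - c) \<partial>lborel)"
    unfolding scaleR_diff_right using Bochner_Integration.integral_diff[OF g i] by simp
  then show ?thesis using norm_integral_unit_cube_le[of "\<lambda>x. g x - c"] by simp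
qed

lemma nn_integral_unit_cube_swap:
  fixes F :: "real^'n::finite \<Rightarrow> real^'n \<Rightarrow> ennreal"
  assumes [measurable]: "case_prod F \<in> borel_measurable (borel \<Otimes>\<^sub>M borel)"
  shows "(\<integral>\<^sup>+x\<in>unit_cube. (\<integral>\<^sup>+y\<in>unit_cube. F x y \<partial>lborel) \<partial>lborel)
    = (\<integral>\<^sup>+y\<in>unit_cube. (\<integral>\<^sup>+x\<in>unit_cube. F x y \<partial>lborel) \<partial>lborel)"
proof -
  let ?Y = "unit_cube :: (real^'n) set"
  have "(\<integral>\<^sup>+x\<in>?Y. (\<integral>\<^sup>+y\<in>?Y. F x y \<partial>lborel) \<partial>lborel)
      = (\<integral>\<^sup>+x. (\<integral>\<^sup>+y. F x y * indicator ?Y y * indicator ?Y x \<partial>lborel) \<partial>lborel)"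
    by (intro nn_integral_cong nn_integral_multc[symmetric]) measurable
  also have "\<dots> = (\<integral>\<^sup>+y. (\<integral>\<^sup>+x. F x y * indicator ?Y y * indicator ?Y x \<partial>lborel) \<partial>lborel)"
    by (rule lborel_pair.Fubini') measurable
  also have "\<dots> = (\<integral>\<^sup>+y. (\<integral>\<^sup>+x. F x y * indicator ?Y x * indicator ?Y y \<partial>lborel) \<partial>lborel)"
    by (simp only: mult_ac)
  also have "\<dots> = (\<integral>\<^sup>+y\<in>?Y. (\<integral>\<^sup>+x\<in>?Y. F x y \<partial>lborel) \<partial>lborel)"
    by (intro nn_integral_cong nn_integral_multc) measurable
  finally show ?thesis .
qed

lemma nn_integral_unit_cube_const: "(\<integral>\<^sup>+x\<in>(unit_cube :: (real^'n::finite) set). c \<partial>lborel) = c"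
  by (subst nn_integral_cmult) (auto simp: emeasure_unit_cube)

lemma nn_integral_unit_cube_add:
  fixes f g :: "real^'n::finite \<Rightarrow> ennreal"
  assumes [measurable]: "f \<in> borel_measurable borel" "g \<in> borel_measurable borel"
  shows "(\<integral>\<^sup>+x\<in>unit_cube. f x + g x \<partial>lborel) = (\<integral>\<^sup>+x\<in>unit_cube. f x \<partial>lborel) + (\<integral>\<^sup>+x\<in>unit_cube. g x \<partial>lborel)"
  unfolding distrib_right by (rule nn_integral_add) measurable

lemma nn_integral_unit_cube_mono:
  "(\<And>x. x \<in> unit_cube \<Longrightarrow> f x \<le> g x) \<Longrightarrow> (\<integral>\<^sup>+x\<in>unit_cube. f x \<partial>lborel) \<le> (\<integral>\<^sup>+x\<in>unit_cube. g x \<partial>lborel)"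
  by (intro nn_integral_mono) (auto simp: indicator_def)

text \<open>\<open>f x\<close> and \<open>f y\<close> are compared through the value at their
  midpoint, because the contraction estimate allows ratios up to 1/2 and the midpoint has ratio 1/2
  seen from either end. The two halves are equal by symmetry.\<close>

lemma poincare_unit_cube_smooth:
  fixes f :: "real^'n::finite \<Rightarrow> real^'m::finite"
  assumes f: "smooth_map f"
  shows "(\<integral>\<^sup>+x\<in>unit_cube. (\<integral>\<^sup>+y\<in>unit_cube. norm (f y - f x) \<partial>lborel) \<partial>lborel)
    \<le> ennreal (real CARD('n) * 2 ^ CARD('n)) * (\<integral>\<^sup>+x\<in>unit_cube. norm (gradient f x) \<partial>lborel)"
proof -
  let ?Y = "unit_cube :: (real^'n) set" and ?D = "\<integral>\<^sup>+x\<in>unit_cube. norm (gradient f x) \<partial>lborel"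
  let ?K = "real CARD('n) * 2 ^ CARD('n)"
  have fm[measurable]: "f \<in> borel_measurable borel" by (rule smooth_map_borel[OF f])
  let ?A = "\<lambda>x y. ennreal (norm (f (x + (1/2) *\<^sub>R (y - x)) - f x))"
  have A: "(\<integral>\<^sup>+x\<in>?Y. (\<integral>\<^sup>+y\<in>?Y. ?A x y \<partial>lborel) \<partial>lborel) \<le> ennreal (?K / 2) * ?D"
    using nn_integral_difference_le_gradient[OF f, of "1/2"] by simp
  have tri: "ennreal (norm (f y - f x)) \<le> ?A x y + ?A y x" for x y
  proof -
    have "y + (1/2) *\<^sub>R (x - y) = x + (1/2) *\<^sub>R (y - x)"
      using scaleR_half_double[of x] scaleR_half_double[of y] by (simp add: algebra_simps scaleR_left_distrib[symmetric] flip: scaleR_add_left)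
    then have "norm (f y - f x) \<le> norm (f (x + (1/2) *\<^sub>R (y - x)) - f x) + norm (f (y + (1/2) *\<^sub>R (x - y)) - f y)"
      using norm_triangle_ineq4[of "f (x + (1/2) *\<^sub>R (y - x)) - f x" "f (x + (1/2) *\<^sub>R (y - x)) - f y"] by simp
    then show ?thesis by (simp add: ennreal_leI flip: ennreal_plus)
  qed
  have "(\<integral>\<^sup>+x\<in>?Y. (\<integral>\<^sup>+y\<in>?Y. norm (f y - f x) \<partial>lborel) \<partial>lborel)
    \<le> (\<integral>\<^sup>+x\<in>?Y. (\<integral>\<^sup>+y\<in>?Y. ?A x y + ?A y x \<partial>lborel) \<partial>lborel)"
    by (intro nn_integral_unit_cube_mono tri)
  also have "\<dots> = (\<integral>\<^sup>+x\<in>?Y. (\<integral>\<^sup>+y\<in>?Y. ?A x y \<partial>lborel) + (\<integral>\<^sup>+y\<in>?Y. ?A y x \<partial>lborel) \<partial>lborel)"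
  proof -
    have "(\<integral>\<^sup>+y\<in>?Y. ?A x y + ?A y x \<partial>lborel) = (\<integral>\<^sup>+y\<in>?Y. ?A x y \<partial>lborel) + (\<integral>\<^sup>+y\<in>?Y. ?A y x \<partial>lborel)" for x
      by (rule nn_integral_unit_cube_add) measurable
    then show ?thesis by (simp only:)
  qed
  also have "\<dots> = (\<integral>\<^sup>+x\<in>?Y. (\<integral>\<^sup>+y\<in>?Y. ?A x y \<partial>lborel) \<partial>lborel) + (\<integral>\<^sup>+x\<in>?Y. (\<integral>\<^sup>+y\<in>?Y. ?A y x \<partial>lborel) \<partial>lborel)"
    by (rule nn_integral_unit_cube_add) measurable
  also have "(\<integral>\<^sup>+x\<in>?Y. (\<integral>\<^sup>+y\<in>?Y. ?A y x \<partial>lborel) \<partial>lborel) = (\<integral>\<^sup>+x\<in>?Y. (\<integral>\<^sup>+y\<in>?Y. ?A x y \<partial>lborel) \<partial>lborel)"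
    by (rule nn_integral_unit_cube_swap) measurable
  also have "(\<integral>\<^sup>+x\<in>?Y. (\<integral>\<^sup>+y\<in>?Y. ?A x y \<partial>lborel) \<partial>lborel) + (\<integral>\<^sup>+x\<in>?Y. (\<integral>\<^sup>+y\<in>?Y. ?A x y \<partial>lborel) \<partial>lborel)
     \<le> ennreal (?K / 2) * ?D + ennreal (?K / 2) * ?D" by (intro add_mono A)
  also have "\<dots> = ennreal ?K * ?D"
    by (subst distrib_right[symmetric], subst ennreal_plus[symmetric]) auto
  finally show ?thesis .
qed

text \<open>Limit of the smooth case. \<open>W\<close> is known only as the L1 limit of the
  gradients, which is the form in which the gradient of a Sobolev limit is available after
  mollification.\<close>

lemma poincare_unit_cube:
  fixes w :: "real^'n::finite \<Rightarrow> real^'m::finite" and W :: "real^'n \<Rightarrow> real^'n^'m"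
  assumes w[measurable]: "w \<in> borel_measurable borel" and W[measurable]: "W \<in> borel_measurable borel"
    and f: "\<And>k::nat. smooth_map (f k)"
    and fw: "(\<lambda>k. \<integral>\<^sup>+x\<in>unit_cube. norm (f k x - w x) \<partial>lborel) \<longlonglongrightarrow> 0"
    and gW: "(\<lambda>k. \<integral>\<^sup>+x\<in>unit_cube. norm (gradient (f k) x - W x) \<partial>lborel) \<longlonglongrightarrow> 0"
  shows "(\<integral>\<^sup>+x\<in>unit_cube. (\<integral>\<^sup>+y\<in>unit_cube. norm (w y - w x) \<partial>lborel) \<partial>lborel)
    \<le> ennreal (real CARD('n) * 2 ^ CARD('n)) * (\<integral>\<^sup>+x\<in>unit_cube. norm (W x) \<partial>lborel)"
proof -
  let ?Y = "unit_cube :: (real^'n) set"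
  let ?K = "ennreal (real CARD('n) * 2 ^ CARD('n))"
  have fm[measurable]: "f k \<in> borel_measurable borel" and gm[measurable]: "gradient (f k) \<in> borel_measurable borel" for k
    using f smooth_map_borel gradient_borel by blast+
  let ?e = "\<lambda>k. \<integral>\<^sup>+x\<in>?Y. norm (f k x - w x) \<partial>lborel"
  let ?e' = "\<lambda>k. \<integral>\<^sup>+x\<in>?Y. norm (gradient (f k) x - W x) \<partial>lborel"
  let ?D = "\<integral>\<^sup>+x\<in>?Y. norm (W x) \<partial>lborel"
  have le: "(\<integral>\<^sup>+x\<in>?Y. (\<integral>\<^sup>+y\<in>?Y. norm (w y - w x) \<partial>lborel) \<partial>lborel) \<le> ?e k + ?K * (?e' k + ?D) + ?e k" for k
  proof -
    have tri: "ennreal (norm (w y - w x)) \<le> ennreal (norm (f k y - w y)) + ennreal (norm (f k y - f k x)) + ennreal (norm (f k x - w x))" for x y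
    proof -
      have "norm (w y - w x) \<le> norm (f k y - w y) + norm (f k y - f k x) + norm (f k x - w x)"
        using norm_triangle_ineq[of "w y - f k y" "f k y - f k x"] norm_triangle_ineq[of "w y - f k x" "f k x - w x"]
        by (simp add: norm_minus_commute)
      then show ?thesis by (simp add: ennreal_leI flip: ennreal_plus)
    qed
    have "(\<integral>\<^sup>+x\<in>?Y. (\<integral>\<^sup>+y\<in>?Y. norm (w y - w x) \<partial>lborel) \<partial>lborel)
      \<le> (\<integral>\<^sup>+x\<in>?Y. (\<integral>\<^sup>+y\<in>?Y. ennreal (norm (f k y - w y)) + ennreal (norm (f k y - f k x)) + ennreal (norm (f k x - w x)) \<partial>lborel) \<partial>lborel)"
      by (intro nn_integral_unit_cube_mono tri)
    also have "\<dots> = (\<integral>\<^sup>+x\<in>?Y. ?e k + (\<integral>\<^sup>+y\<in>?Y. norm (f k y - f k x) \<partial>lborel) + ennreal (norm (f k x - w x)) \<partial>lborel)"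
    proof -
      have "(\<integral>\<^sup>+y\<in>?Y. ennreal (norm (f k y - w y)) + ennreal (norm (f k y - f k x)) + ennreal (norm (f k x - w x)) \<partial>lborel)
          = ?e k + (\<integral>\<^sup>+y\<in>?Y. norm (f k y - f k x) \<partial>lborel) + ennreal (norm (f k x - w x))" for x
        by (simp add: nn_integral_unit_cube_add nn_integral_unit_cube_const)
      then show ?thesis by simp
    qed
    also have "\<dots> = ?e k + (\<integral>\<^sup>+x\<in>?Y. (\<integral>\<^sup>+y\<in>?Y. norm (f k y - f k x) \<partial>lborel) \<partial>lborel) + ?e k"
      by (simp add: nn_integral_unit_cube_add nn_integral_unit_cube_const)
    also have "\<dots> \<le> ?e k + ?K * (\<integral>\<^sup>+x\<in>?Y. norm (gradient (f k) x) \<partial>lborel) + ?e k"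
      by (intro add_mono order_refl poincare_unit_cube_smooth f)
    also have "(\<integral>\<^sup>+x\<in>?Y. norm (gradient (f k) x) \<partial>lborel) \<le> (\<integral>\<^sup>+x\<in>?Y. ennreal (norm (gradient (f k) x - W x)) + ennreal (norm (W x)) \<partial>lborel)"
    proof (rule nn_integral_unit_cube_mono)
      fix x
      show "ennreal (norm (gradient (f k) x)) \<le> ennreal (norm (gradient (f k) x - W x)) + ennreal (norm (W x))"
        using norm_triangle_ineq[of "gradient (f k) x - W x" "W x"] by (simp add: ennreal_leI flip: ennreal_plus)
    qed
    also have "\<dots> = ?e' k + ?D" by (rule nn_integral_unit_cube_add) measurable
    finally show ?thesis by (simp add: add_mono mult_left_mono)
  qed
  have "(\<lambda>k. ?e k + ?K * (?e' k + ?D) + ?e k) \<longlonglongrightarrow> 0 + ?K * (0 + ?D) + 0"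
    by (intro tendsto_add fw gW tendsto_const ennreal_tendsto_cmult) auto
  from LIMSEQ_le_const[OF this] le show ?thesis by auto
qed


section \<open>Compactness in L1 through contracted means\<close>

lemma smooth_map_diff: "smooth_map f \<Longrightarrow> smooth_map g \<Longrightarrow> smooth_map (\<lambda>x. f x - g x)"
  by (simp add: smooth_map_def smooth_diff)

lemma gradient_diff:
  assumes "smooth_map f" "smooth_map g"
  shows "gradient (\<lambda>x. f x - g x) x = gradient f x - gradient g x"
proof -
  have "partial_deriv j (\<lambda>y. (f y - g y) $ i) x = partial_deriv j (\<lambda>y. f y $ i) x - partial_deriv j (\<lambda>y. g y $ i) x" for i j
  proof -
    have "((\<lambda>y. f y $ i) has_derivative frechet_derivative (\<lambda>y. f y $ i) (at x)) (at x)"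
      "((\<lambda>y. g y $ i) has_derivative frechet_derivative (\<lambda>y. g y $ i) (at x)) (at x)"
      using assms smooth_differentiable unfolding smooth_map_def frechet_derivative_works[symmetric] by blast+
    from has_derivative_diff[OF this] have "((\<lambda>y. (f y - g y) $ i) has_derivative
       (\<lambda>h. frechet_derivative (\<lambda>y. f y $ i) (at x) h - frechet_derivative (\<lambda>y. g y $ i) (at x) h)) (at x)"
      by simp
    from partial_deriv_has_derivative[OF this] show ?thesis by (simp only: partial_deriv_def)
  qed
  then show ?thesis by (simp add: gradient_def vec_eq_iff)
qed

lemma continuous_integrable_unit_cube:
  fixes g :: "real^'n::finite \<Rightarrow> 'b::euclidean_space"
  assumes "continuous_on UNIV g"
  shows "integrable lborel (\<lambda>x. indicator unit_cube x *\<^sub>R g x)"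
proof -
  let ?Y = "unit_cube :: (real^'n) set"
  have "compact (closure ?Y)" using bounded_unit_cube by (simp add: compact_closure)
  then have "integrable lborel (\<lambda>x. indicator (closure ?Y) x *\<^sub>R g x)"
    by (rule borel_integrable_compact) (rule continuous_on_subset[OF assms subset_UNIV])
  then have "integrable lborel (\<lambda>x. indicator ?Y x *\<^sub>R (indicator (closure ?Y) x *\<^sub>R g x))"
    by (rule integrable_mult_indicator[rotated]) simp
  moreover have "(\<lambda>x. indicator ?Y x *\<^sub>R (indicator (closure ?Y) x *\<^sub>R g x)) = (\<lambda>x. indicator ?Y x *\<^sub>R g x)"
    using closure_subset[of ?Y] by (auto simp: fun_eq_iff indicator_def)
  ultimately show ?thesis by simp
qed

text \<open>Averaging over the cube contracted towards \<open>x\<close>, instead of a cube centred at \<open>x\<close>, stays inside the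
  unit cube, so no boundary layer has to be controlled.\<close>

definition contracted_mean :: "real \<Rightarrow> (real^'n::finite \<Rightarrow> 'b::{banach, second_countable_topology}) \<Rightarrow> real^'n \<Rightarrow> 'b" where
  "contracted_mean s g x = (\<integral>y. indicator unit_cube y *\<^sub>R g (x + s *\<^sub>R (y - x)) \<partial>lborel)"

text \<open>The density of the contracted mean in the variable z = x + s (y - x). For x in the cube
  it is bounded and supported in the cube, hence an admissible weight for the weak convergence that
  is assumed.\<close>

definition contracted_kernel :: "real \<Rightarrow> real^'n::finite \<Rightarrow> real^'n \<Rightarrow> real" where
  "contracted_kernel s x z = (1 / s ^ CARD('n)) * indicator unit_cube (x + (1/s) *\<^sub>R (z - x))"

lemma contracted_mean_eq:
  fixes g :: "real^'n::finite \<Rightarrow> 'b::{banach, second_countable_topology}"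
  assumes [measurable]: "g \<in> borel_measurable borel" and s: "s > 0"
  shows "contracted_mean s g x = (\<integral>z. contracted_kernel s x z *\<^sub>R g z \<partial>lborel)"
proof -
  have e: "(x - s *\<^sub>R x) + s *\<^sub>R y = x + s *\<^sub>R (y - x)" for y by (simp add: algebra_simps)
  have "(\<integral>z. contracted_kernel s x z *\<^sub>R g z \<partial>lborel)
      = (\<bar>s\<bar> ^ DIM(real^'n)) *\<^sub>R (\<integral>y. contracted_kernel s x ((x - s *\<^sub>R x) + s *\<^sub>R y) *\<^sub>R g ((x - s *\<^sub>R x) + s *\<^sub>R y) \<partial>lborel)"
    using s unfolding contracted_kernel_def by (intro integral_lborel_affine) auto
  also have "\<dots> = (\<bar>s\<bar> ^ DIM(real^'n)) *\<^sub>R (\<integral>y. (1 / s ^ CARD('n)) *\<^sub>R (indicator unit_cube y *\<^sub>R g (x + s *\<^sub>R (y - x))) \<partial>lborel)"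
    unfolding e contracted_kernel_def using s by simp
  also have "\<dots> = contracted_mean s g x"
    using s unfolding contracted_mean_def by (subst integral_scaleR_right) auto
  finally show ?thesis by simp
qed

lemma contracted_kernel_props:
  fixes x :: "real^'n::finite"
  assumes s: "0 < s" "s \<le> 1/2" and x: "x \<in> unit_cube"
  shows "contracted_kernel s x \<in> borel_measurable borel" "\<bar>contracted_kernel s x z\<bar> \<le> 1 / s ^ CARD('n)"
    "z \<notin> unit_cube \<Longrightarrow> contracted_kernel s x z = 0"
proof -
  show "contracted_kernel s x \<in> borel_measurable borel"
    unfolding contracted_kernel_def[abs_def] by measurable
  show "\<bar>contracted_kernel s x z\<bar> \<le> 1 / s ^ CARD('n)"
    using s by (auto simp: contracted_kernel_def indicator_def)
  assume z: "z \<notin> unit_cube"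
  have "x + s *\<^sub>R ((x + (1/s) *\<^sub>R (z - x)) - x) = z" using s by simp
  with z x s unit_cube_contract[OF x, of "x + (1/s) *\<^sub>R (z - x)" s]
  have "x + (1/s) *\<^sub>R (z - x) \<notin> unit_cube" by auto
  then show "contracted_kernel s x z = 0" by (simp add: contracted_kernel_def)
qed

lemma contracted_mean_borel:
  fixes g :: "real^'n::finite \<Rightarrow> 'b::{banach, second_countable_topology}"
  assumes [measurable]: "g \<in> borel_measurable borel"
  shows "contracted_mean s g \<in> borel_measurable borel"
  unfolding contracted_mean_def[abs_def] by measurable

lemma integrable_kernel_mult:
  fixes g :: "real^'n::finite \<Rightarrow> 'b::{banach, second_countable_topology}"
  assumes "integrable lborel (\<lambda>x. indicator unit_cube x *\<^sub>R g x)"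
    and "\<psi> \<in> borel_measurable borel" "\<And>z. \<bar>\<psi> z\<bar> \<le> B" "\<And>z. z \<notin> unit_cube \<Longrightarrow> \<psi> z = 0"
  shows "integrable lborel (\<lambda>z. \<psi> z *\<^sub>R g z)"
proof -
  have "integrable lborel (\<lambda>z. \<psi> z *\<^sub>R (indicator unit_cube z *\<^sub>R g z))"
    by (rule integrable_bounded_mult[OF assms(1) _ assms(3)]) (use assms(2) in simp)
  moreover have "(\<lambda>z. \<psi> z *\<^sub>R (indicator unit_cube z *\<^sub>R g z)) = (\<lambda>z. \<psi> z *\<^sub>R g z)"
    using assms(4) by (auto simp: fun_eq_iff indicator_def)
  ultimately show ?thesis by simp
qed

lemma contracted_mean_L1_le:
  fixes g :: "real^'n::finite \<Rightarrow> 'b::{banach, second_countable_topology}"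
  assumes [measurable]: "g \<in> borel_measurable borel" and s: "0 < s" "s \<le> 1/2"
  shows "(\<integral>\<^sup>+x\<in>unit_cube. norm (contracted_mean s g x) \<partial>lborel) \<le> ennreal (2 ^ CARD('n)) * (\<integral>\<^sup>+x\<in>unit_cube. norm (g x) \<partial>lborel)"
proof -
  have "(\<integral>\<^sup>+x\<in>unit_cube. norm (contracted_mean s g x) \<partial>lborel)
      \<le> (\<integral>\<^sup>+x\<in>unit_cube. (\<integral>\<^sup>+y\<in>unit_cube. norm (g (x + s *\<^sub>R (y - x))) \<partial>lborel) \<partial>lborel)"
    unfolding contracted_mean_def by (intro nn_integral_unit_cube_mono norm_integral_unit_cube_le)
  also have "\<dots> \<le> ennreal (2 ^ CARD('n)) * (\<integral>\<^sup>+x\<in>unit_cube. norm (g x) \<partial>lborel)"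
    by (rule nn_integral_unit_cube_contract) (use s in auto)
  finally show ?thesis .
qed

text \<open>Only increments of length of order s are averaged, so a gradient bound in L1 makes the
  error linear in s, uniformly over a sequence with bounded gradients.\<close>

lemma contracted_mean_error_le:
  fixes h :: "real^'n::finite \<Rightarrow> real^'m::finite"
  assumes h: "smooth_map h" and s: "0 < s" "s \<le> 1/2"
  shows "(\<integral>\<^sup>+x\<in>unit_cube. norm (h x - contracted_mean s h x) \<partial>lborel)
    \<le> ennreal (s * (real CARD('n) * 2 ^ CARD('n))) * (\<integral>\<^sup>+x\<in>unit_cube. norm (gradient h x) \<partial>lborel)"
proof -
  have "(\<integral>\<^sup>+x\<in>unit_cube. norm (h x - contracted_mean s h x) \<partial>lborel)
      \<le> (\<integral>\<^sup>+x\<in>unit_cube. (\<integral>\<^sup>+y\<in>unit_cube. norm (h (x + s *\<^sub>R (y - x)) - h x) \<partial>lborel) \<partial>lborel)"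
  proof (rule nn_integral_unit_cube_mono)
    fix x :: "real^'n"
    have "continuous_on UNIV (\<lambda>y. h (x + s *\<^sub>R (y - x)))"
      by (rule continuous_on_compose2[OF smooth_map_continuous[OF h, of UNIV]]) (auto intro!: continuous_intros)
    then show "ennreal (norm (h x - contracted_mean s h x)) \<le> (\<integral>\<^sup>+y\<in>unit_cube. norm (h (x + s *\<^sub>R (y - x)) - h x) \<partial>lborel)"
      unfolding contracted_mean_def by (intro norm_diff_mean_unit_cube_le continuous_integrable_unit_cube)
  qed
  also have "\<dots> \<le> ennreal (s * (real CARD('n) * 2 ^ CARD('n))) * (\<integral>\<^sup>+x\<in>unit_cube. norm (gradient h x) \<partial>lborel)"
    by (rule nn_integral_difference_le_gradient[OF h]) (use s in auto)
  finally show ?thesis .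
qed

lemma nn_integral_unit_cube_triangle:
  fixes f g :: "real^'n::finite \<Rightarrow> 'b::{second_countable_topology, real_normed_vector}"
  assumes [measurable]: "f \<in> borel_measurable borel" "g \<in> borel_measurable borel"
  shows "(\<integral>\<^sup>+x\<in>unit_cube. norm (f x + g x) \<partial>lborel) \<le> (\<integral>\<^sup>+x\<in>unit_cube. norm (f x) \<partial>lborel) + (\<integral>\<^sup>+x\<in>unit_cube. norm (g x) \<partial>lborel)"
proof -
  have "(\<integral>\<^sup>+x\<in>unit_cube. norm (f x + g x) \<partial>lborel) \<le> (\<integral>\<^sup>+x\<in>unit_cube. ennreal (norm (f x)) + ennreal (norm (g x)) \<partial>lborel)"
    by (intro nn_integral_unit_cube_mono) (simp add: ennreal_leI norm_triangle_ineq flip: ennreal_plus)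
  also have "\<dots> = (\<integral>\<^sup>+x\<in>unit_cube. norm (f x) \<partial>lborel) + (\<integral>\<^sup>+x\<in>unit_cube. norm (g x) \<partial>lborel)"
    by (rule nn_integral_unit_cube_add) measurable
  finally show ?thesis .
qed

text \<open>At fixed \<open>s\<close> the kernel is a weight to which \<open>weak\<close> applies,
  so the means converge at every point of the cube. Dominated convergence needs a constant bound,
  and that is the supremum of the kernel times an L1 bound for \<open>h k\<close>.\<close>

lemma contracted_means_converge:
  fixes h :: "nat \<Rightarrow> real^'n::finite \<Rightarrow> real^'m::finite"
  assumes h: "\<And>k. smooth_map (h k)" and M: "\<And>k. (\<integral>\<^sup>+x\<in>unit_cube. norm (gradient (h k) x) \<partial>lborel) \<le> ennreal M"
    and z[measurable]: "z \<in> borel_measurable borel" and s: "0 < s" "s \<le> 1/2"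
    and weak: "\<And>\<psi> B. \<psi> \<in> borel_measurable borel \<Longrightarrow> (\<And>x. \<bar>\<psi> x\<bar> \<le> B) \<Longrightarrow> (\<And>x. x \<notin> unit_cube \<Longrightarrow> \<psi> x = 0)
      \<Longrightarrow> (\<lambda>k. \<integral>x. \<psi> x *\<^sub>R h k x \<partial>lborel) \<longlonglongrightarrow> (\<integral>x. \<psi> x *\<^sub>R z x \<partial>lborel)"
  shows "(\<lambda>k. \<integral>\<^sup>+x\<in>unit_cube. norm (contracted_mean s (h k) x - contracted_mean s z x) \<partial>lborel) \<longlonglongrightarrow> 0"
proof -
  let ?Y = "unit_cube :: (real^'n) set" and ?K = "real CARD('n) * 2 ^ CARD('n)"
  have hm[measurable]: "h k \<in> borel_measurable borel" for k by (rule smooth_map_borel[OF h])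
  have [measurable]: "contracted_mean s (h k) \<in> borel_measurable borel" "contracted_mean s z \<in> borel_measurable borel" for k
    by (rule contracted_mean_borel, measurable)+
  have hi: "integrable lborel (\<lambda>x. indicator ?Y x *\<^sub>R h k x)" for k
    by (rule continuous_integrable_unit_cube[OF smooth_map_continuous[OF h]])
  define a where "a k = (\<integral>x. indicator ?Y x *\<^sub>R h k x \<partial>lborel)" for k
  have "a \<longlonglongrightarrow> (\<integral>x. indicator ?Y x *\<^sub>R z x \<partial>lborel)"
    unfolding a_def by (rule weak[where B=1]) (auto simp: indicator_def)
  then have "Bseq a" using convergent_def convergent_imp_Bseq by blast
  then obtain A where A: "0 < A" "\<And>k. norm (a k) \<le> A" using BseqE by blast
  \<comment> \<open>Poincare's inequality controls the distance to the mean value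
    \<open>a k\<close>, and the mean values are bounded because \<open>weak\<close> with the
    indicator as weight makes them converge.\<close>
  have hb: "(\<integral>\<^sup>+x\<in>?Y. norm (h k x) \<partial>lborel) \<le> ennreal ?K * ennreal M + ennreal A" for k
  proof -
    have "(\<integral>\<^sup>+x\<in>?Y. norm ((h k x - a k) + a k) \<partial>lborel)
       \<le> (\<integral>\<^sup>+x\<in>?Y. norm (h k x - a k) \<partial>lborel) + (\<integral>\<^sup>+x\<in>?Y. norm (a k) \<partial>lborel)"
      by (rule nn_integral_unit_cube_triangle) measurable
    also have "(\<integral>\<^sup>+x\<in>?Y. norm (a k) \<partial>lborel) \<le> ennreal A"
      using A(2)[of k] by (simp add: nn_integral_unit_cube_const ennreal_leI)
    also have "(\<integral>\<^sup>+x\<in>?Y. norm (h k x - a k) \<partial>lborel) \<le> (\<integral>\<^sup>+x\<in>?Y. (\<integral>\<^sup>+y\<in>?Y. norm (h k y - h k x) \<partial>lborel) \<partial>lborel)"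
      unfolding a_def by (intro nn_integral_unit_cube_mono norm_diff_mean_unit_cube_le hi)
    also have "\<dots> \<le> ennreal ?K * (\<integral>\<^sup>+x\<in>?Y. norm (gradient (h k) x) \<partial>lborel)"
      by (rule poincare_unit_cube_smooth[OF h])
    also have "\<dots> \<le> ennreal ?K * ennreal M" by (rule mult_left_mono[OF M]) simp
    finally show ?thesis by (simp add: add_mono)
  qed
  \<comment> \<open>Kernel bound times L1 bound. \<open>M\<close> is not assumed nonnegative and
    \<open>ennreal\<close> sends negative numbers to 0, hence \<open>max M 0\<close>.\<close>
  define C where "C = (1 / s ^ CARD('n)) * (?K * max M 0 + A)"
  have kb: "norm (contracted_mean s (h k) x) \<le> C" if x: "x \<in> ?Y" for k x
  proof -
    note kp = contracted_kernel_props[OF s x]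
    have "ennreal (norm (contracted_mean s (h k) x)) \<le> (\<integral>\<^sup>+z. norm (contracted_kernel s x z *\<^sub>R h k z) \<partial>lborel)"
      unfolding contracted_mean_eq[OF hm s(1)] by (rule norm_integral_le_nn_integral)
    also have "\<dots> \<le> (\<integral>\<^sup>+z. ennreal (1 / s ^ CARD('n)) * (ennreal (norm (h k z)) * indicator ?Y z) \<partial>lborel)"
    proof (rule nn_integral_mono)
      fix y
      show "ennreal (norm (contracted_kernel s x y *\<^sub>R h k y)) \<le> ennreal (1 / s ^ CARD('n)) * (ennreal (norm (h k y)) * indicator ?Y y)"
      proof (cases "y \<in> ?Y")
        case True
        have "norm (contracted_kernel s x y *\<^sub>R h k y) \<le> (1 / s ^ CARD('n)) * norm (h k y)"
          unfolding norm_scaleR by (rule mult_right_mono[OF kp(2)]) simp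
        then have "ennreal (norm (contracted_kernel s x y *\<^sub>R h k y)) \<le> ennreal ((1 / s ^ CARD('n)) * norm (h k y))"
          by (rule ennreal_leI)
        also have "\<dots> = ennreal (1 / s ^ CARD('n)) * ennreal (norm (h k y))"
          using s by (intro ennreal_mult) auto
        finally show ?thesis using True by simp
      qed (simp add: kp(3))
    qed
    also have "\<dots> = ennreal (1 / s ^ CARD('n)) * (\<integral>\<^sup>+z\<in>?Y. norm (h k z) \<partial>lborel)"
      by (rule nn_integral_cmult) measurable
    also have "\<dots> \<le> ennreal (1 / s ^ CARD('n)) * (ennreal ?K * ennreal M + ennreal A)"
      by (rule mult_left_mono[OF hb]) simp
    also have "\<dots> \<le> ennreal (1 / s ^ CARD('n)) * (ennreal ?K * ennreal (max M 0) + ennreal A)"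
      by (intro mult_left_mono add_mono) (auto intro: ennreal_leI)
    also have "\<dots> = ennreal C"
    proof -
      have "ennreal (?K * max M 0 + A) = ennreal (?K * max M 0) + ennreal A" using A by (intro ennreal_plus) auto
      moreover have "ennreal (?K * max M 0) = ennreal ?K * ennreal (max M 0)" by (intro ennreal_mult) auto
      moreover have "ennreal C = ennreal (1 / s ^ CARD('n)) * ennreal (?K * max M 0 + A)"
        unfolding C_def using s A by (intro ennreal_mult) auto
      ultimately show ?thesis by (simp only:)
    qed
    finally show ?thesis
      using s A by (subst (asm) ennreal_le_iff) (auto simp: C_def intro!: mult_nonneg_nonneg add_nonneg_nonneg divide_nonneg_nonneg)
  qed
  have "(\<lambda>k. \<integral>\<^sup>+x. norm (indicat_real ?Y x *\<^sub>R contracted_mean s z x - indicat_real ?Y x *\<^sub>R contracted_mean s (h k) x) \<partial>lborel) \<longlonglongrightarrow> 0"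
  proof (rule nn_integral_dominated_convergence_norm[where w="\<lambda>x. C * indicator ?Y x"])
    show "AE x in lborel. norm (indicat_real ?Y x *\<^sub>R contracted_mean s (h k) x) \<le> C * indicat_real ?Y x" for k
      using kb by (intro AE_I2) (auto simp: indicator_def)
    show "(\<integral>\<^sup>+x. ennreal (C * indicat_real ?Y x) \<partial>lborel) < \<infinity>"
    proof -
      have "0 \<le> C" unfolding C_def using s A by (intro mult_nonneg_nonneg add_nonneg_nonneg divide_nonneg_nonneg) auto
      then have "(\<integral>\<^sup>+x. ennreal (C * indicat_real ?Y x) \<partial>lborel) = (\<integral>\<^sup>+x\<in>?Y. ennreal C \<partial>lborel)"
        by (intro nn_integral_cong) (auto simp: indicator_def)
      then show ?thesis by (simp add: nn_integral_unit_cube_const)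
    qed
    show "AE x in lborel. (\<lambda>k. indicat_real ?Y x *\<^sub>R contracted_mean s (h k) x) \<longlonglongrightarrow> indicat_real ?Y x *\<^sub>R contracted_mean s z x"
    proof (rule AE_I2)
      fix x :: "real^'n"
      show "(\<lambda>k. indicat_real ?Y x *\<^sub>R contracted_mean s (h k) x) \<longlonglongrightarrow> indicat_real ?Y x *\<^sub>R contracted_mean s z x"
      proof (cases "x \<in> ?Y")
        case True
        note kp = contracted_kernel_props[OF s True]
        show ?thesis
          unfolding contracted_mean_eq[OF hm s(1)] contracted_mean_eq[OF z s(1)]
          by (intro tendsto_scaleR tendsto_const weak[OF kp])
      qed simp
    qed
  qed measurable
  moreover have "(\<integral>\<^sup>+x. norm (indicat_real ?Y x *\<^sub>R contracted_mean s z x - indicat_real ?Y x *\<^sub>R contracted_mean s (h k) x) \<partial>lborel)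
     = (\<integral>\<^sup>+x\<in>?Y. norm (contracted_mean s (h k) x - contracted_mean s z x) \<partial>lborel)" for k
    by (intro nn_integral_cong) (auto simp: indicator_def norm_minus_commute)
  ultimately show ?thesis by simp
qed


text \<open>For small \<open>s\<close> a smooth map is close to its contracted mean, and at fixed
  \<open>s\<close> the means converge. The limit \<open>w\<close> has no classical gradient, so a
  smooth \<open>v j\<close> near it is subtracted throughout: \<open>f k - v j\<close> still has
  gradients bounded by 2 M, while \<open>w - v j\<close> is small in L1 and so is its contracted
  mean.\<close>

lemma strong_convergence_unit_cube:
  fixes f :: "nat \<Rightarrow> real^'n::finite \<Rightarrow> real^'m::finite"
  assumes f: "\<And>k. smooth_map (f k)" and fM: "\<And>k. (\<integral>\<^sup>+x\<in>unit_cube. norm (gradient (f k) x) \<partial>lborel) \<le> ennreal M"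
    and w[measurable]: "w \<in> borel_measurable borel" and wi: "integrable lborel (\<lambda>x. indicator unit_cube x *\<^sub>R w x)"
    and v: "\<And>j. smooth_map (v j)" and vM: "\<And>j. (\<integral>\<^sup>+x\<in>unit_cube. norm (gradient (v j) x) \<partial>lborel) \<le> ennreal M"
    and vw: "(\<lambda>j::nat. \<integral>\<^sup>+x\<in>unit_cube. norm (v j x - w x) \<partial>lborel) \<longlonglongrightarrow> 0" and M: "0 \<le> M"
    and weak: "\<And>\<psi> B. \<psi> \<in> borel_measurable borel \<Longrightarrow> (\<And>x. \<bar>\<psi> x\<bar> \<le> B) \<Longrightarrow> (\<And>x. x \<notin> unit_cube \<Longrightarrow> \<psi> x = 0)
      \<Longrightarrow> (\<lambda>k. \<integral>x. \<psi> x *\<^sub>R f k x \<partial>lborel) \<longlonglongrightarrow> (\<integral>x. \<psi> x *\<^sub>R w x \<partial>lborel)"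
    and e: "(e::real) > 0"
  shows "\<forall>\<^sub>F k in sequentially. (\<integral>\<^sup>+x\<in>unit_cube. norm (f k x - w x) \<partial>lborel) \<le> ennreal e"
proof -
  let ?Y = "unit_cube :: (real^'n) set" and ?K = "real CARD('n) * 2 ^ CARD('n)"
  \<comment> \<open>Makes the error of the contracted mean at most e/4, with 2 M as gradient bound;
    the added 1 keeps the denominator positive for M = 0.\<close>
  define s where "s = min (1/2) (e / (4 * (?K * (2 * M) + 1)))"
  have K0: "0 \<le> ?K * (2 * M)" using M by auto
  have s: "0 < s" "s \<le> 1/2" "s * (?K * (2 * M)) \<le> e / 4"
  proof -
    have "0 < ?K * (2 * M) + 1" by (rule add_nonneg_pos[OF K0]) simp
    then have "0 < e / (4 * (?K * (2 * M) + 1))" using e by (intro divide_pos_pos mult_pos_pos) auto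
    then show "0 < s" unfolding s_def by (subst min_less_iff_conj) simp
    show "s \<le> 1/2" unfolding s_def by (rule min.cobounded1)
    have "s * (?K * (2 * M)) \<le> e / (4 * (?K * (2 * M) + 1)) * (?K * (2 * M) + 1)"
      using K0 e by (intro mult_mono) (auto simp: s_def)
    also have "\<dots> = e / 4" using K0 by (simp add: field_simps)
    finally show "s * (?K * (2 * M)) \<le> e / 4" .
  qed
  \<comment> \<open>Splits e/4 between \<open>v j - w\<close> itself and the contracted mean of
    \<open>z\<close>, which costs 2^N times as much.\<close>
  define e2 where "e2 = e / (4 * (2 ^ CARD('n) + 1))"
  have p: "0 < (2 ^ CARD('n) + 1 :: real)" by (simp add: add_pos_pos)
  have "2 ^ CARD('n) * e2 + e2 = (2 ^ CARD('n) + 1) * e2" by (simp only: distrib_right mult_1_left)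
  also have "\<dots> = e / 4" unfolding e2_def using p
    by (metis nonzero_mult_divide_mult_cancel_left mult.commute less_irrefl times_divide_eq_right)
  finally have e2: "e2 > 0" "2 ^ CARD('n) * e2 + e2 = e / 4" using e p by (auto simp: e2_def)
  have "\<forall>\<^sub>F j in sequentially. (\<integral>\<^sup>+x\<in>?Y. norm (v j x - w x) \<partial>lborel) < ennreal e2"
    using order_tendstoD(2)[OF vw] e2 by simp
  from eventually_happens'[OF _ this] obtain j where j: "(\<integral>\<^sup>+x\<in>?Y. norm (v j x - w x) \<partial>lborel) < ennreal e2" by auto
  define h where "h k x = f k x - v j x" for k x
  define z where "z x = w x - v j x" for x
  have [measurable]: "f k \<in> borel_measurable borel" "v j \<in> borel_measurable borel" for k
    using smooth_map_borel f v by blast+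
  have zm[measurable]: "z \<in> borel_measurable borel" unfolding z_def[abs_def] by measurable
  have h: "smooth_map (h k)" for k unfolding h_def by (rule smooth_map_diff[OF f v])
  have hm[measurable]: "h k \<in> borel_measurable borel" for k by (rule smooth_map_borel[OF h])
  have gm[measurable]: "gradient (f k) \<in> borel_measurable borel" "gradient (v j) \<in> borel_measurable borel" for k
    using gradient_borel f v by blast+
  have hM: "(\<integral>\<^sup>+x\<in>?Y. norm (gradient (h k) x) \<partial>lborel) \<le> ennreal (2 * M)" for k
  proof -
    have "gradient (h k) x = gradient (f k) x + - gradient (v j) x" for x
      unfolding h_def using gradient_diff[OF f v, of k j x] by simp
    then have "(\<integral>\<^sup>+x\<in>?Y. norm (gradient (h k) x) \<partial>lborel) \<le> (\<integral>\<^sup>+x\<in>?Y. norm (gradient (f k) x) \<partial>lborel) + (\<integral>\<^sup>+x\<in>?Y. norm (- gradient (v j) x) \<partial>lborel)"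
      by (simp only:) (rule nn_integral_unit_cube_triangle, measurable)
    also have "\<dots> \<le> ennreal M + ennreal M" unfolding norm_minus_cancel by (intro add_mono fM vM)
    also have "\<dots> = ennreal (2 * M)" using M by (simp flip: ennreal_plus)
    finally show ?thesis .
  qed
  have fi: "integrable lborel (\<lambda>x. indicator ?Y x *\<^sub>R f k x)" for k
    by (rule continuous_integrable_unit_cube[OF smooth_map_continuous[OF f]])
  have vi: "integrable lborel (\<lambda>x. indicator ?Y x *\<^sub>R v j x)"
    by (rule continuous_integrable_unit_cube[OF smooth_map_continuous[OF v]])
  have "(\<lambda>k. \<integral>\<^sup>+x\<in>?Y. norm (contracted_mean s (h k) x - contracted_mean s z x) \<partial>lborel) \<longlonglongrightarrow> 0"
  proof (rule contracted_means_converge[OF h hM zm s(1,2)])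
    fix \<psi> :: "real^'n \<Rightarrow> real" and B
    assume \<psi>: "\<psi> \<in> borel_measurable borel" "\<And>x. \<bar>\<psi> x\<bar> \<le> B" "\<And>x. x \<notin> ?Y \<Longrightarrow> \<psi> x = 0"
    note i = integrable_kernel_mult[OF fi \<psi>] integrable_kernel_mult[OF vi \<psi>] integrable_kernel_mult[OF wi \<psi>]
    have "(\<lambda>k. (\<integral>x. \<psi> x *\<^sub>R f k x \<partial>lborel) - (\<integral>x. \<psi> x *\<^sub>R v j x \<partial>lborel))
      \<longlonglongrightarrow> (\<integral>x. \<psi> x *\<^sub>R w x \<partial>lborel) - (\<integral>x. \<psi> x *\<^sub>R v j x \<partial>lborel)"
      by (intro tendsto_diff tendsto_const weak[OF \<psi>])
    moreover have "(\<integral>x. \<psi> x *\<^sub>R h k x \<partial>lborel) = (\<integral>x. \<psi> x *\<^sub>R f k x \<partial>lborel) - (\<integral>x. \<psi> x *\<^sub>R v j x \<partial>lborel)" for k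
      unfolding h_def scaleR_diff_right by (rule Bochner_Integration.integral_diff[OF i(1,2)])
    moreover have "(\<integral>x. \<psi> x *\<^sub>R z x \<partial>lborel) = (\<integral>x. \<psi> x *\<^sub>R w x \<partial>lborel) - (\<integral>x. \<psi> x *\<^sub>R v j x \<partial>lborel)"
      unfolding z_def scaleR_diff_right by (rule Bochner_Integration.integral_diff[OF i(3,2)])
    ultimately show "(\<lambda>k. \<integral>x. \<psi> x *\<^sub>R h k x \<partial>lborel) \<longlonglongrightarrow> (\<integral>x. \<psi> x *\<^sub>R z x \<partial>lborel)"
      by simp
  qed
  then have "\<forall>\<^sub>F k in sequentially. (\<integral>\<^sup>+x\<in>?Y. norm (contracted_mean s (h k) x - contracted_mean s z x) \<partial>lborel) < ennreal (e/4)"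
    using e by (intro order_tendstoD(2)) auto
  then show ?thesis
  proof eventually_elim
    fix k assume k: "(\<integral>\<^sup>+x\<in>?Y. norm (contracted_mean s (h k) x - contracted_mean s z x) \<partial>lborel) < ennreal (e/4)"
    have cm[measurable]: "contracted_mean s (h k) \<in> borel_measurable borel" "contracted_mean s z \<in> borel_measurable borel"
      by (rule contracted_mean_borel, measurable)+
    have "f k x - w x = (h k x - contracted_mean s (h k) x) + ((contracted_mean s (h k) x - contracted_mean s z x)
        + (contracted_mean s z x + (v j x - w x)))" for x
      by (simp add: h_def)
    then have "(\<integral>\<^sup>+x\<in>?Y. norm (f k x - w x) \<partial>lborel) \<le> (\<integral>\<^sup>+x\<in>?Y. norm (h k x - contracted_mean s (h k) x) \<partial>lborel)
      + (\<integral>\<^sup>+x\<in>?Y. norm ((contracted_mean s (h k) x - contracted_mean s z x) + (contracted_mean s z x + (v j x - w x))) \<partial>lborel)"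
      by (simp only:) (rule nn_integral_unit_cube_triangle, measurable)
    also have "(\<integral>\<^sup>+x\<in>?Y. norm ((contracted_mean s (h k) x - contracted_mean s z x) + (contracted_mean s z x + (v j x - w x))) \<partial>lborel)
      \<le> (\<integral>\<^sup>+x\<in>?Y. norm (contracted_mean s (h k) x - contracted_mean s z x) \<partial>lborel) + (\<integral>\<^sup>+x\<in>?Y. norm (contracted_mean s z x + (v j x - w x)) \<partial>lborel)"
      by (rule nn_integral_unit_cube_triangle) measurable
    also have "(\<integral>\<^sup>+x\<in>?Y. norm (contracted_mean s z x + (v j x - w x)) \<partial>lborel) \<le>
       (\<integral>\<^sup>+x\<in>?Y. norm (contracted_mean s z x) \<partial>lborel) + (\<integral>\<^sup>+x\<in>?Y. norm (v j x - w x) \<partial>lborel)"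
      by (rule nn_integral_unit_cube_triangle) measurable
    also have "(\<integral>\<^sup>+x\<in>?Y. norm (contracted_mean s z x) \<partial>lborel) \<le> ennreal (2 ^ CARD('n) * e2)"
    proof -
      have "(\<integral>\<^sup>+x\<in>?Y. norm (contracted_mean s z x) \<partial>lborel) \<le> ennreal (2 ^ CARD('n)) * (\<integral>\<^sup>+x\<in>?Y. norm (z x) \<partial>lborel)"
        by (rule contracted_mean_L1_le[OF zm s(1,2)])
      also have "(\<integral>\<^sup>+x\<in>?Y. norm (z x) \<partial>lborel) \<le> ennreal e2"
        using j by (simp add: z_def norm_minus_commute less_imp_le)
      finally show ?thesis using e2 by (simp add: ennreal_mult mult_left_mono)
    qed
    also have "(\<integral>\<^sup>+x\<in>?Y. norm (v j x - w x) \<partial>lborel) \<le> ennreal e2" using j by (rule less_imp_le)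
    also have "(\<integral>\<^sup>+x\<in>?Y. norm (contracted_mean s (h k) x - contracted_mean s z x) \<partial>lborel) \<le> ennreal (e/4)"
      using k by (rule less_imp_le)
    also have "(\<integral>\<^sup>+x\<in>?Y. norm (h k x - contracted_mean s (h k) x) \<partial>lborel) \<le> ennreal (e/4)"
    proof -
      have "(\<integral>\<^sup>+x\<in>?Y. norm (h k x - contracted_mean s (h k) x) \<partial>lborel) \<le> ennreal (s * ?K) * (\<integral>\<^sup>+x\<in>?Y. norm (gradient (h k) x) \<partial>lborel)"
        by (rule contracted_mean_error_le[OF h s(1,2)])
      also have "\<dots> \<le> ennreal (s * ?K) * ennreal (2 * M)" by (rule mult_left_mono[OF hM]) simp
      also have "\<dots> = ennreal (s * (?K * (2 * M)))" using s M by (subst ennreal_mult[symmetric]) (auto simp: mult.assoc)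
      also have "\<dots> \<le> ennreal (e/4)" by (rule ennreal_leI[OF s(3)])
      finally show ?thesis .
    qed
    finally have "(\<integral>\<^sup>+x\<in>?Y. norm (f k x - w x) \<partial>lborel) \<le> ennreal (e/4) + (ennreal (e/4) + (ennreal (2 ^ CARD('n) * e2) + ennreal e2))"
      by (simp add: add_mono)
    also have "\<dots> = ennreal (e/4 + (e/4 + (2 ^ CARD('n) * e2 + e2)))"
      using less_imp_le[OF e] less_imp_le[OF e2(1)]
      by (simp only: ennreal_plus divide_nonneg_nonneg add_nonneg_nonneg mult_nonneg_nonneg zero_le_numeral zero_le_power)
    also have "\<dots> \<le> ennreal e" unfolding e2(2) using e by (intro ennreal_leI) simp
    finally show "(\<integral>\<^sup>+x\<in>?Y. norm (f k x - w x) \<partial>lborel) \<le> ennreal e" .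
  qed
qed

section \<open>Truncation\<close>

lemma powr_add_le:
  fixes a b q :: real
  assumes "0 \<le> a" "0 \<le> b" "0 < q"
  shows "(a + b) powr q \<le> 2 powr q * (a powr q + b powr q)"
proof -
  have "(a + b) powr q \<le> (2 * max a b) powr q" using assms by (intro powr_mono2) auto
  also have "\<dots> = 2 powr q * max a b powr q" using assms by (simp add: powr_mult)
  also have "max a b powr q \<le> a powr q + b powr q" by (auto simp: max_def)
  finally show ?thesis by (simp add: mult_left_mono)
qed

lemma partial_deriv_extremum:
  fixes f :: "real^'n::finite \<Rightarrow> real"
  assumes f: "smooth f" and e: "(\<forall>y. f y \<le> f x) \<or> (\<forall>y. f x \<le> f y)"
  shows "partial_deriv j f x = 0"
proof -
  have "(f has_derivative frechet_derivative f (at x)) (at x)"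
    using smooth_differentiable[OF f] by (simp add: frechet_derivative_works)
  then have "frechet_derivative f (at x) = (\<lambda>v. 0)"
    by (rule differential_zero_maxmin[OF UNIV_I open_UNIV]) (use e in auto)
  then show ?thesis by (simp add: partial_deriv_def)
qed

text \<open>Truncating the values as well as the support makes closeness in \<open>L\<^sup>1\<close> sufficient in
  \<open>quasiconvex_near_affine\<close>: \<open>z\<close> need not be small in \<open>L\<^sup>q\<close>.\<close>

definition truncation :: "(real^'n::finite \<Rightarrow> real) \<Rightarrow> real \<Rightarrow> (real^'n \<Rightarrow> real^'m::finite) \<Rightarrow> real^'n \<Rightarrow> real^'m" where
  "truncation \<phi> s z y = (\<phi> y * cutoff 1 4 ((z y \<bullet> z y) / s\<^sup>2)) *\<^sub>R z y"

lemma smooth_truncation_cutoff: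
  assumes "smooth_map z"
  shows "smooth (\<lambda>y. cutoff 1 4 ((z y \<bullet> z y) / s\<^sup>2))"
proof -
  have "smooth (\<lambda>y. z y \<bullet> z y)" unfolding inner_vec_def inner_real_def
    using assms by (intro smooth_sum smooth_mult) (auto simp: smooth_map_def)
  then show ?thesis
    unfolding divide_inverse by (intro smooth_cutoff smooth_mult smooth_const)
qed

lemma smooth_truncation_factor:
  assumes "smooth_map z" "smooth \<phi>"
  shows "smooth (\<lambda>y. \<phi> y * cutoff 1 4 ((z y \<bullet> z y) / s\<^sup>2))"
  by (rule smooth_mult[OF assms(2) smooth_truncation_cutoff[OF assms(1)]])

lemma truncation_test_function:
  assumes "smooth_map z" "\<phi> \<in> test_functions U"
  shows "truncation \<phi> s z \<in> vector_test_functions U"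
  unfolding vector_test_functions_def
proof safe
  fix i
  have "smooth (\<lambda>y. cutoff 1 4 ((z y \<bullet> z y) / s\<^sup>2) * z y $ i)"
    using assms(1) by (intro smooth_mult smooth_truncation_cutoff) (simp_all add: smooth_map_def)
  from test_function_mult_smooth[OF assms(2) this]
  show "(\<lambda>x. truncation \<phi> s z x $ i) \<in> test_functions U"
    by (simp add: truncation_def mult_ac)
qed

lemma gradient_truncation:
  assumes z: "smooth_map z" and \<phi>: "smooth \<phi>"
  shows "gradient (truncation \<phi> s z) y $ i $ j =
    (\<phi> y * cutoff 1 4 ((z y \<bullet> z y) / s\<^sup>2)) * gradient z y $ i $ j
     + partial_deriv j (\<lambda>y. \<phi> y * cutoff 1 4 ((z y \<bullet> z y) / s\<^sup>2)) y * z y $ i"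
proof -
  have "partial_deriv j (\<lambda>y. (\<phi> y * cutoff 1 4 ((z y \<bullet> z y) / s\<^sup>2)) * z y $ i) y =
    (\<phi> y * cutoff 1 4 ((z y \<bullet> z y) / s\<^sup>2)) * partial_deriv j (\<lambda>y. z y $ i) y
     + partial_deriv j (\<lambda>y. \<phi> y * cutoff 1 4 ((z y \<bullet> z y) / s\<^sup>2)) y * z y $ i"
    using smooth_truncation_factor[OF z \<phi>] z
    by (intro partial_deriv_mult smooth_differentiable) (auto simp: smooth_map_def)
  then show ?thesis by (simp add: gradient_def truncation_def)
qed

text \<open>The factor takes values in [0,1], so 0 and 1 are extremal values, at which its own
  derivatives vanish. Its value at the single point y decides, with no neighbourhood involved; this
  also settles the edges of the plateaus.\<close>

lemma gradient_truncation_eq: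
  assumes z: "smooth_map z" and \<phi>: "smooth \<phi>" "\<And>y. 0 \<le> \<phi> y" "\<And>y. \<phi> y \<le> 1"
  shows "\<phi> y * cutoff 1 4 ((z y \<bullet> z y) / s\<^sup>2) = 0 \<Longrightarrow> gradient (truncation \<phi> s z) y = 0"
    and "\<phi> y * cutoff 1 4 ((z y \<bullet> z y) / s\<^sup>2) = 1 \<Longrightarrow> gradient (truncation \<phi> s z) y = gradient z y"
proof -
  let ?w = "\<lambda>y. \<phi> y * cutoff 1 4 ((z y \<bullet> z y) / s\<^sup>2)"
  have w: "0 \<le> ?w y" "?w y \<le> 1" for y
    using \<phi> cutoff_nonneg cutoff_le_1 by (auto intro!: mult_nonneg_nonneg mult_le_one)
  have pd: "partial_deriv j ?w y = 0" if "?w y = 0 \<or> ?w y = 1" for j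
    using w that by (intro partial_deriv_extremum smooth_truncation_factor z \<phi>(1)) metis
  show "?w y = 0 \<Longrightarrow> gradient (truncation \<phi> s z) y = 0"
    using pd by (simp add: vec_eq_iff gradient_truncation[OF z \<phi>(1)])
  show "?w y = 1 \<Longrightarrow> gradient (truncation \<phi> s z) y = gradient z y"
    using pd by (simp add: vec_eq_iff gradient_truncation[OF z \<phi>(1)])
qed

lemma component_le_norm_matrix: "\<bar>(A::real^'n::finite^'m::finite) $ i $ j\<bar> \<le> norm A"
  using component_le_norm_cart[of "A $ i" j] Finite_Cartesian_Product.norm_nth_le[of A i] by linarith

lemma norm_matrix_le:
  fixes A :: "real^'n::finite^'m::finite"
  assumes "\<And>i j. \<bar>A $ i $ j\<bar> \<le> B"
  shows "norm A \<le> real CARD('m) * (real CARD('n) * B)"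
proof -
  have "norm A \<le> (\<Sum>i\<in>UNIV. norm (A $ i))" by (rule norm_vec_le_sum)
  also have "\<dots> \<le> (\<Sum>i\<in>(UNIV::'m set). real CARD('n) * B)"
  proof (rule sum_mono)
    fix i
    have "norm (A $ i) \<le> (\<Sum>j\<in>UNIV. \<bar>A $ i $ j\<bar>)" by (rule norm_le_l1_cart)
    also have "\<dots> \<le> (\<Sum>j\<in>(UNIV::'n set). B)" by (rule sum_mono[OF assms])
    finally show "norm (A $ i) \<le> real CARD('n) * B" by simp
  qed
  finally show ?thesis by simp
qed

text \<open>Differentiating the value cutoff yields a term of size |d| 2 |z| |grad z| / s^2 times
  |z|. Where d is nonzero, |z|^2 < 4 s^2, so \<open>s\<close> cancels and 8 H |grad z| remains,
  apart from the factor \<open>CARD('m)\<close> from summing components. Differentiating the support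
  cutoff costs \<open>D\<close> times |z|, still multiplied by the value cutoff.\<close>

lemma norm_gradient_truncation_le:
  fixes z :: "real^'n::finite \<Rightarrow> real^'m::finite" and H D s :: real
  assumes H: "\<And>t. (cutoff 1 4 has_real_derivative d t) (at t)" "\<And>t. \<bar>d t\<bar> \<le> H" "\<And>t. t \<le> 1 \<or> 4 \<le> t \<Longrightarrow> d t = 0"
    and z: "smooth_map z" and \<phi>: "smooth \<phi>" "\<And>y. 0 \<le> \<phi> y" "\<And>y. \<phi> y \<le> 1" "\<And>j. \<bar>partial_deriv j \<phi> y\<bar> \<le> D"
    and s: "0 < s"
  shows "norm (gradient (truncation \<phi> s z) y) \<le>
    (CARD('m) * CARD('n) * D) * (cutoff 1 4 ((z y \<bullet> z y) / s\<^sup>2) * norm (z y))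
    + (CARD('m) * CARD('n) * (8 * H * CARD('m) + 1)) * norm (gradient z y)"
proof -
  let ?\<chi> = "\<lambda>y. cutoff 1 4 ((z y \<bullet> z y) / s\<^sup>2)"
  let ?g = "norm (gradient z y)"
  have H0: "0 \<le> H" using H(2)[of 0] by linarith
  have D0: "0 \<le> D" using \<phi>(4)[of undefined] by linarith
  have zi: "smooth (\<lambda>y. z y $ i)" for i using z by (simp add: smooth_map_def)
  have zz: "smooth (\<lambda>y. (z y \<bullet> z y) / s\<^sup>2)" unfolding inner_vec_def inner_real_def divide_inverse
    using zi by (intro smooth_sum smooth_mult smooth_const) auto
  have pz: "partial_deriv j (\<lambda>y. (z y \<bullet> z y) / s\<^sup>2) y = 2 * (\<Sum>i\<in>UNIV. z y $ i * gradient z y $ i $ j) / s\<^sup>2" for j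
  proof -
    have d: "((\<lambda>y. z y $ i) has_derivative frechet_derivative (\<lambda>y. z y $ i) (at y)) (at y)" for i
      using smooth_differentiable[OF zi] by (simp add: frechet_derivative_works)
    have "((\<lambda>y. (\<Sum>i\<in>UNIV. z y $ i * z y $ i) / s\<^sup>2) has_derivative
      (\<lambda>h. (\<Sum>i\<in>UNIV. z y $ i * frechet_derivative (\<lambda>y. z y $ i) (at y) h + frechet_derivative (\<lambda>y. z y $ i) (at y) h * z y $ i) / s\<^sup>2)) (at y)"
      unfolding divide_inverse
      by (rule has_derivative_mult_left[OF has_derivative_sum[OF has_derivative_mult[OF d d]]])
    from partial_deriv_has_derivative[OF this, of j] show ?thesis
      by (simp add: inner_vec_def gradient_def partial_deriv_def sum.distrib sum_distrib_left mult.commute)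
  qed
  have p\<chi>: "partial_deriv j ?\<chi> y = d ((z y \<bullet> z y) / s\<^sup>2) * (2 * (\<Sum>i\<in>UNIV. z y $ i * gradient z y $ i $ j) / s\<^sup>2)" for j
    unfolding pz[symmetric] by (rule partial_deriv_compose[OF smooth_differentiable[OF zz] H(1)])
  have b\<chi>: "\<bar>partial_deriv j ?\<chi> y\<bar> * norm (z y) \<le> 8 * H * CARD('m) * ?g" for j
  proof (cases "(z y \<bullet> z y) / s\<^sup>2 < 4")
    case False
    then have "d ((z y \<bullet> z y) / s\<^sup>2) = 0" by (intro H(3)) auto
    then show ?thesis unfolding p\<chi> using H0 by simp
  next
    case True
    have "\<bar>\<Sum>i\<in>UNIV. z y $ i * gradient z y $ i $ j\<bar> \<le> (\<Sum>i\<in>(UNIV::'m set). norm (z y) * ?g)"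
      by (rule order_trans[OF sum_abs sum_mono])
        (auto simp: abs_mult intro!: mult_mono component_le_norm_cart component_le_norm_matrix)
    then have S: "\<bar>\<Sum>i\<in>UNIV. z y $ i * gradient z y $ i $ j\<bar> \<le> CARD('m) * (norm (z y) * ?g)" by simp
    have "\<bar>partial_deriv j ?\<chi> y\<bar> * norm (z y) = \<bar>d ((z y \<bullet> z y) / s\<^sup>2)\<bar> * (2 * \<bar>\<Sum>i\<in>UNIV. z y $ i * gradient z y $ i $ j\<bar> / s\<^sup>2) * norm (z y)"
      unfolding p\<chi> by (simp add: abs_mult)
    also have "\<dots> \<le> H * (2 * (CARD('m) * (norm (z y) * ?g)) / s\<^sup>2) * norm (z y)"
      using S H0 s by (intro mult_right_mono mult_mono H(2) divide_right_mono) auto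
    also have "\<dots> = (2 * H * CARD('m) * ?g) * ((z y \<bullet> z y) / s\<^sup>2)"
      by (simp add: dot_square_norm power2_eq_square)
    also have "\<dots> \<le> (2 * H * CARD('m) * ?g) * 4"
      using True H0 by (intro mult_left_mono) auto
    finally show ?thesis by simp
  qed
  have comp: "\<bar>gradient (truncation \<phi> s z) y $ i $ j\<bar> \<le> D * (?\<chi> y * norm (z y)) + (8 * H * CARD('m) + 1) * ?g" for i j
  proof -
    have pw: "partial_deriv j (\<lambda>y. \<phi> y * ?\<chi> y) y = \<phi> y * partial_deriv j ?\<chi> y + partial_deriv j \<phi> y * ?\<chi> y"
      by (intro partial_deriv_mult smooth_differentiable \<phi>(1) smooth_truncation_cutoff[OF z])
    have "\<bar>gradient (truncation \<phi> s z) y $ i $ j\<bar> \<le> \<bar>(\<phi> y * ?\<chi> y) * gradient z y $ i $ j\<bar> + \<bar>partial_deriv j (\<lambda>y. \<phi> y * ?\<chi> y) y * z y $ i\<bar>"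
      unfolding gradient_truncation[OF z \<phi>(1)] by (rule abs_triangle_ineq)
    also have "\<bar>(\<phi> y * ?\<chi> y) * gradient z y $ i $ j\<bar> \<le> 1 * ?g"
      unfolding abs_mult[of "\<phi> y * ?\<chi> y"] using \<phi> cutoff_nonneg[of 1 4] cutoff_le_1[of 1 4]
      by (intro mult_mono component_le_norm_matrix) (auto simp: abs_mult intro!: mult_le_one)
    also have "\<bar>partial_deriv j (\<lambda>y. \<phi> y * ?\<chi> y) y * z y $ i\<bar> \<le> (\<bar>partial_deriv j ?\<chi> y\<bar> + D * ?\<chi> y) * norm (z y)"
      unfolding abs_mult[of "partial_deriv j (\<lambda>y. \<phi> y * ?\<chi> y) y"]
    proof (intro mult_mono component_le_norm_cart)
      have "\<bar>\<phi> y * partial_deriv j ?\<chi> y\<bar> \<le> 1 * \<bar>partial_deriv j ?\<chi> y\<bar>"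
        unfolding abs_mult using \<phi> by (intro mult_right_mono) auto
      moreover have "\<bar>partial_deriv j \<phi> y * ?\<chi> y\<bar> \<le> D * ?\<chi> y"
        unfolding abs_mult abs_of_nonneg[OF cutoff_nonneg] by (intro mult_right_mono \<phi>(4) cutoff_nonneg)
      ultimately show "\<bar>partial_deriv j (\<lambda>y. \<phi> y * ?\<chi> y) y\<bar> \<le> \<bar>partial_deriv j ?\<chi> y\<bar> + D * ?\<chi> y"
        unfolding pw by linarith
    qed (use D0 cutoff_nonneg in auto)
    also have "\<dots> = \<bar>partial_deriv j ?\<chi> y\<bar> * norm (z y) + D * (?\<chi> y * norm (z y))"
      by (simp add: algebra_simps)
    also have "\<dots> \<le> 8 * H * CARD('m) * ?g + D * (?\<chi> y * norm (z y))" using b\<chi> by simp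
    finally show ?thesis by (simp add: algebra_simps)
  qed
  from norm_matrix_le[OF comp] show ?thesis by (simp add: algebra_simps)
qed

text \<open>The order of the quantifiers is the point. \<open>K\<close> multiplies the energy and
  does not depend on the layer, so the number of layers can be fixed in terms of \<open>K\<close>
  before the layers are built. The steepness \<open>D\<close> enters only through \<open>K2\<close>,
  which multiplies |z| and is compensated by the smallness of z in L1.\<close>

lemma truncation_growth:
  fixes L :: "real^'n::finite^'m::finite \<Rightarrow> real"
  assumes C: "0 \<le> C" "\<And>\<zeta>. L \<zeta> \<le> C * (1 + norm \<zeta> powr q)" and q: "1 < q"
  obtains K where "0 \<le> K"
    "\<And>D. \<exists>K2\<ge>0. \<forall>(z :: real^'n \<Rightarrow> real^'m) \<phi> s y. smooth_map z \<longrightarrow> smooth \<phi> \<longrightarrow> (\<forall>y. 0 \<le> \<phi> y \<and> \<phi> y \<le> 1)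
      \<longrightarrow> (\<forall>j. \<bar>partial_deriv j \<phi> y\<bar> \<le> D) \<longrightarrow> 0 < s \<longrightarrow> s \<le> 1/2
      \<longrightarrow> L (\<xi> + gradient (truncation \<phi> s z) y) \<le> K * (1 + norm (\<xi> + gradient z y) powr q) + K2 * norm (z y)"
proof -
  obtain d H where H: "\<And>t. (cutoff 1 4 has_real_derivative d t) (at t)" "\<And>t. \<bar>d t\<bar> \<le> H"
    "\<And>t. t \<le> 1 \<or> 4 \<le> t \<Longrightarrow> d t = 0"
    using cutoff_has_derivative_bounded[of 1 4] by (metis one_less_numeral_iff semiring_norm(76))
  define E where "E = CARD('m) * CARD('n) * (8 * H * CARD('m) + 1)"
  define X where "X = norm \<xi> powr q"
  define K where "K = C * (1 + 2 powr q * (X + 2 powr q * (E powr q * (2 powr q * (1 + X)))))"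
  have H0: "0 \<le> H" using H(2)[of 0] by linarith
  then have E0: "0 \<le> E" by (simp add: E_def)
  have X0: "0 \<le> X" by (simp add: X_def)
  show ?thesis
  proof (rule that[of K])
    show "0 \<le> K" unfolding K_def using C(1) X0 by (intro mult_nonneg_nonneg add_nonneg_nonneg) auto
    fix D :: real
    define F where "F = CARD('m) * CARD('n) * D"
    define K2 where "K2 = C * (2 powr q * (2 powr q * (\<bar>F\<bar> powr q)))"
    have K20: "0 \<le> K2" unfolding K2_def using C(1) by (intro mult_nonneg_nonneg) auto
    show "\<exists>K2\<ge>0. \<forall>(z :: real^'n \<Rightarrow> real^'m) \<phi> s y. smooth_map z \<longrightarrow> smooth \<phi> \<longrightarrow> (\<forall>y. 0 \<le> \<phi> y \<and> \<phi> y \<le> 1)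
      \<longrightarrow> (\<forall>j. \<bar>partial_deriv j \<phi> y\<bar> \<le> D) \<longrightarrow> 0 < s \<longrightarrow> s \<le> 1/2
      \<longrightarrow> L (\<xi> + gradient (truncation \<phi> s z) y) \<le> K * (1 + norm (\<xi> + gradient z y) powr q) + K2 * norm (z y)"
    proof (intro exI[of _ K2] conjI K20 allI impI)
      fix z :: "real^'n \<Rightarrow> real^'m" and \<phi> :: "real^'n \<Rightarrow> real" and s :: real and y :: "real^'n"
      assume z: "smooth_map z" and \<phi>: "smooth \<phi>" "\<forall>y. 0 \<le> \<phi> y \<and> \<phi> y \<le> 1" "\<forall>j. \<bar>partial_deriv j \<phi> y\<bar> \<le> D"
        and s: "0 < s" "s \<le> 1/2"
      let ?\<chi> = "cutoff 1 4 ((z y \<bullet> z y) / s\<^sup>2)"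
      let ?g = "norm (gradient z y)" and ?P = "norm (\<xi> + gradient z y)" and ?t = "?\<chi> * norm (z y)"
      have D0: "0 \<le> D" using \<phi>(3)[rule_format, of undefined] by linarith
      then have F0: "0 \<le> F" by (simp add: F_def)
      have t0: "0 \<le> ?t" by (simp add: cutoff_nonneg)
      have tz: "?t \<le> norm (z y)" by (rule mult_left_le_one_le[OF norm_ge_zero cutoff_nonneg cutoff_le_1])
      \<comment> \<open>The value cutoff is nonzero only where |z| < 2 s \<le> 1. With q > 1 this
        gives \<open>?t powr q \<le> norm (z y)\<close>: the power q of the lower order term becomes
        linear in |z|.\<close>
      have t1: "?t \<le> 1"
      proof (cases "4 \<le> (z y \<bullet> z y) / s\<^sup>2")
        case True
        have "?\<chi> = 0" by (rule cutoff_eq_0[OF _ True]) simp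
        then show ?thesis by (simp only: mult_zero_left zero_le_one)
      next
        case False
        then have "(z y \<bullet> z y) / s\<^sup>2 < 4" by (simp only: not_le)
        then have "z y \<bullet> z y < 4 * s\<^sup>2" using s(1) by (simp only: pos_divide_less_eq zero_less_power)
        then have "(norm (z y))\<^sup>2 \<le> (2 * s)\<^sup>2"
          unfolding power2_norm_eq_inner power_mult_distrib by (simp only: power2_eq_square)
        then have "norm (z y) \<le> 2 * s" by (rule power2_le_imp_le) (use s(1) in simp)
        with tz s(2) show ?thesis by linarith
      qed
      have tq: "?t powr q \<le> norm (z y)"
      proof (cases "?t = 0")
        case False
        have "?t powr q \<le> ?t powr 1" using t0 t1 less_imp_le[OF q] by (intro powr_mono')
        also have "?t powr 1 = ?t" by (rule powr_one[OF t0])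
        finally show ?thesis using tz by (rule order_trans)
      next
        case True show ?thesis unfolding True by simp
      qed
      have v: "norm (gradient (truncation \<phi> s z) y) \<le> F * ?t + E * ?g"
        unfolding F_def E_def
        by (rule norm_gradient_truncation_le[OF H z \<phi>(1) _ _ _ s(1)]) (use \<phi>(2,3) in blast)+
      have g: "?g \<le> ?P + norm \<xi>"
        using norm_triangle_ineq4[of "\<xi> + gradient z y" \<xi>] by simp
      have gq: "?g powr q \<le> 2 powr q * (?P powr q + X)"
      proof -
        have "?g powr q \<le> (?P + norm \<xi>) powr q" using g q by (intro powr_mono2) auto
        also have "\<dots> \<le> 2 powr q * (?P powr q + norm \<xi> powr q)" using q by (intro powr_add_le) auto
        finally show ?thesis unfolding X_def .
      qed
      have nq: "norm (gradient (truncation \<phi> s z) y) powr q \<le> 2 powr q * (F powr q * ?t powr q + E powr q * ?g powr q)"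
      proof -
        have "norm (gradient (truncation \<phi> s z) y) powr q \<le> (F * ?t + E * ?g) powr q"
          using v q by (intro powr_mono2) auto
        also have "\<dots> \<le> 2 powr q * ((F * ?t) powr q + (E * ?g) powr q)"
          using F0 E0 t0 q by (intro powr_add_le) auto
        also have "\<dots> = 2 powr q * (F powr q * ?t powr q + E powr q * ?g powr q)"
          by (simp only: powr_mult)
        finally show ?thesis .
      qed
      have "norm (\<xi> + gradient (truncation \<phi> s z) y) powr q \<le> (norm \<xi> + norm (gradient (truncation \<phi> s z) y)) powr q"
        using q by (intro powr_mono2 norm_triangle_ineq) auto
      also have "\<dots> \<le> 2 powr q * (X + norm (gradient (truncation \<phi> s z) y) powr q)"
        unfolding X_def using q by (intro powr_add_le) auto
      also have "\<dots> \<le> 2 powr q * (X + 2 powr q * (F powr q * norm (z y) + E powr q * (2 powr q * (?P powr q + X))))"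
      proof -
        have "F powr q * ?t powr q \<le> F powr q * norm (z y)" by (rule mult_left_mono[OF tq]) simp
        moreover have "E powr q * ?g powr q \<le> E powr q * (2 powr q * (?P powr q + X))" by (rule mult_left_mono[OF gq]) simp
        ultimately have "2 powr q * (F powr q * ?t powr q + E powr q * ?g powr q)
            \<le> 2 powr q * (F powr q * norm (z y) + E powr q * (2 powr q * (?P powr q + X)))"
          by (intro mult_left_mono[OF add_mono]) auto
        from order_trans[OF nq this] show ?thesis by (intro mult_left_mono add_left_mono) auto
      qed
      finally have "C * (1 + norm (\<xi> + gradient (truncation \<phi> s z) y) powr q) \<le>
          C * (1 + 2 powr q * (X + 2 powr q * (F powr q * norm (z y) + E powr q * (2 powr q * (?P powr q + X)))))"
        using C(1) by (intro mult_left_mono) auto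
      also have "\<dots> = C * (1 + 2 powr q * (X + 2 powr q * (E powr q * (2 powr q * (?P powr q + X))))) + K2 * norm (z y)"
      proof -
        have alg: "c * (1 + a * (x + a * (f * n + e))) = c * (1 + a * (x + a * e)) + c * (a * (a * f)) * n"
          for c a x f n e :: real by (simp add: algebra_simps)
        show ?thesis unfolding K2_def abs_of_nonneg[OF F0] by (rule alg)
      qed
      also have "\<dots> \<le> K * (1 + ?P powr q) + K2 * norm (z y)"
      proof -
        \<comment> \<open>The difference of the two sides is a sum of products of nonnegative
          numbers; with p the q-th power of |\<xi> + grad z| this puts the whole dependence on z
          into the factor 1 + p.\<close>
        have alg: "c * (1 + a * (x + a * (e * (a * (p + x))))) \<le> c * (1 + a * (x + a * (e * (a * (1 + x))))) * (1 + p)"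
          if "0 \<le> c" "0 \<le> a" "0 \<le> x" "0 \<le> e" "0 \<le> p" for c a x e p :: real
        proof -
          have "0 \<le> c * (p + a * (x * p) + a * (a * (e * (a * (1 + x * p)))))"
            using that by (intro mult_nonneg_nonneg add_nonneg_nonneg) auto
          moreover have "c * (1 + a * (x + a * (e * (a * (1 + x))))) * (1 + p)
            = c * (1 + a * (x + a * (e * (a * (p + x))))) + c * (p + a * (x * p) + a * (a * (e * (a * (1 + x * p)))))"
            by (simp add: algebra_simps)
          ultimately show ?thesis by linarith
        qed
        show ?thesis unfolding K_def by (intro add_right_mono alg) (use C(1) X0 in auto)
      qed
      finally show "L (\<xi> + gradient (truncation \<phi> s z) y) \<le> K * (1 + ?P powr q) + K2 * norm (z y)"
        using C(2)[of "\<xi> + gradient (truncation \<phi> s z) y"] by linarith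
    qed
  qed
qed


section \<open>Layers near the boundary of the cube and the choice of a good one\<close>

definition box_cutoff :: "real \<Rightarrow> real \<Rightarrow> real^'n::finite \<Rightarrow> real" where
  "box_cutoff a b y = (\<Prod>j\<in>UNIV. cutoff a b ((y $ j)\<^sup>2))"

lemma smooth_box_cutoff: "smooth (box_cutoff a b :: real^'n::finite \<Rightarrow> real)"
  unfolding box_cutoff_def[abs_def]
  by (intro smooth_prod smooth_cutoff smooth_power2 smooth_vec_nth) simp

lemma box_cutoff_nonneg: "0 \<le> box_cutoff a b y"
  unfolding box_cutoff_def by (intro prod_nonneg) (simp add: cutoff_nonneg)

lemma box_cutoff_le_1: "box_cutoff a b y \<le> 1"
  unfolding box_cutoff_def by (intro prod_le_1) (simp add: cutoff_nonneg cutoff_le_1)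

lemma box_cutoff_eq_1: "(\<And>j. (y $ j)\<^sup>2 \<le> a) \<Longrightarrow> box_cutoff a b y = 1"
  unfolding box_cutoff_def by (intro prod.neutral) (simp add: cutoff_eq_1)

lemma box_cutoff_eq_0: "a < b \<Longrightarrow> b \<le> (y $ j)\<^sup>2 \<Longrightarrow> box_cutoff a b y = 0"
  unfolding box_cutoff_def by (rule prod_zero) (simp, use cutoff_eq_0 in blast)

text \<open>The thresholds refer to squared coordinates, which are smooth, unlike their absolute
  values. The cube consists of the points with all squares below 1/4, so b < 1/4 leaves the closed
  box of half side sqrt b, a compact subset of the cube, as support.\<close>

lemma box_cutoff_test_function:
  assumes "0 \<le> a" "a < b" "b < 1/4"
  shows "box_cutoff a b \<in> test_functions (unit_cube :: (real^'n::finite) set)"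
proof (rule test_functionI[OF smooth_box_cutoff, of "cbox (\<chi> i. - sqrt b) (\<chi> i. sqrt b)"])
  have "sqrt b < sqrt (1/4)" using assms by simp
  then have "sqrt b < 1/2" by (simp add: real_sqrt_divide)
  then have "- 1/2 < y $ i \<and> y $ i < 1/2" if "- sqrt b \<le> y $ i \<and> y $ i \<le> sqrt b" for y :: "real^'n" and i
    using that by linarith
  then show "cbox (\<chi> i. - sqrt b) (\<chi> i. sqrt b) \<subseteq> (unit_cube :: (real^'n) set)"
    unfolding subset_iff unit_cube_iff mem_box_cart vec_lambda_beta by blast
  fix x :: "real^'n" assume x: "x \<notin> cbox (\<chi> i. - sqrt b) (\<chi> i. sqrt b)"
  have "\<exists>j. sqrt b < \<bar>x $ j\<bar>"
  proof (rule ccontr)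
    assume "\<nexists>j. sqrt b < \<bar>x $ j\<bar>"
    then have "- sqrt b \<le> x $ j \<and> x $ j \<le> sqrt b" for j by (metis abs_le_iff linorder_not_less minus_le_iff)
    then have "x \<in> cbox (\<chi> i. - sqrt b) (\<chi> i. sqrt b)" unfolding mem_box_cart vec_lambda_beta by blast
    with x show False by blast
  qed
  then obtain j where "sqrt b < \<bar>x $ j\<bar>" by blast
  then have "(sqrt b)\<^sup>2 \<le> \<bar>x $ j\<bar>\<^sup>2" using assms by (intro power_mono) auto
  then have "b \<le> (x $ j)\<^sup>2" using assms by simp
  then show "box_cutoff a b x = 0" using assms(2) by (rule box_cutoff_eq_0[rotated])
qed simp

text \<open>The rims decrease to the empty set as the threshold increases to 1/4, since the largest
  squared coordinate of a point of the open cube is below 1/4 and is overtaken by some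
  \<open>t n\<close>.\<close>

lemma unit_cube_rim_small:
  assumes "(e::real) > 0"
  obtains t where "0 \<le> t" "t < 1/4" "emeasure lborel {y \<in> (unit_cube :: (real^'n::finite) set). \<exists>j. t < (y $ j)\<^sup>2} \<le> ennreal e"
proof -
  define t where "t n = 1/4 - inverse (real (Suc n)) / 4" for n
  define R where "R n = {y \<in> (unit_cube :: (real^'n) set). \<exists>j. t n < (y $ j)\<^sup>2}" for n
  have t: "0 \<le> t n" "t n < 1/4" for n by (auto simp: t_def field_simps)
  have tm: "t m \<le> t n" if "m \<le> n" for m n using that by (simp add: t_def field_simps)
  have Rm: "R n \<in> sets lborel" for n unfolding R_def by measurable
  have "(\<lambda>n. emeasure lborel (R n)) \<longlonglongrightarrow> emeasure lborel (\<Inter>n. R n)"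
  proof (rule Lim_emeasure_decseq)
    show "range R \<subseteq> sets lborel" using Rm by blast
    show "decseq R" unfolding decseq_def R_def using tm by (auto intro: le_less_trans)
    have "emeasure lborel (R n) \<le> emeasure lborel (unit_cube :: (real^'n) set)" for n
      by (rule emeasure_mono) (auto simp: R_def)
    then show "emeasure lborel (R n) \<noteq> \<infinity>" for n
      using emeasure_unit_cube[where 'n='n] by (metis ennreal_one_neq_top infinity_ennreal_def top.extremum_unique)
  qed
  moreover have "(\<Inter>n. R n) = {}"
  proof safe
    fix y assume "y \<in> (\<Inter>n. R n)"
    then have y: "y \<in> unit_cube" "\<And>n. \<exists>j. t n < (y $ j)\<^sup>2" by (auto simp: R_def)
    define m where "m = Max (range (\<lambda>j. (y $ j)\<^sup>2))"
    have "m \<in> range (\<lambda>j. (y $ j)\<^sup>2)" unfolding m_def by (rule Max_in) auto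
    then obtain j where j: "m = (y $ j)\<^sup>2" by blast
    have "- 1/2 < y $ j" "y $ j < 1/2" using y(1) unfolding unit_cube_iff by blast+
    then have "\<bar>y $ j\<bar> < 1/2" by linarith
    then have "\<bar>y $ j\<bar>\<^sup>2 < (1/2)\<^sup>2" by (intro power_strict_mono) auto
    then have m4: "m < 1/4" unfolding j power2_abs by (simp add: power2_eq_square)
    have "t n < m" for n
    proof -
      obtain i where "t n < (y $ i)\<^sup>2" using y(2) by blast
      also have "\<dots> \<le> m" unfolding m_def by (rule Max_ge) auto
      finally show ?thesis .
    qed
    moreover obtain n where "inverse (real (Suc n)) < 4 * (1/4 - m)"
      using reals_Archimedean[of "4 * (1/4 - m)"] m4 by auto
    then have "m < t n" by (simp add: t_def)
    ultimately show "y \<in> {}" using less_asym[of m "t n"] by blast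
  qed
  ultimately have "(\<lambda>n. emeasure lborel (R n)) \<longlonglongrightarrow> 0" by (simp only: emeasure_empty)
  then have "\<forall>\<^sub>F n in sequentially. emeasure lborel (R n) < ennreal e"
    using assms by (intro order_tendstoD(2)) auto
  from eventually_happens'[OF _ this] obtain n where "emeasure lborel (R n) < ennreal e" by auto
  with t that[of "t n"] show ?thesis unfolding R_def by (simp add: less_imp_le)
qed

lemma sum_indicator_le_1:
  assumes "\<And>i k. i < k \<Longrightarrow> y \<in> A i \<Longrightarrow> y \<notin> A k"
  shows "(\<Sum>i<J::nat. indicator (A i) y) \<le> (1::real)"
proof -
  have "(\<Sum>i<J. indicator (A i) y) = (\<Sum>i\<in>{i\<in>{..<J}. y \<in> A i}. 1::real)"
    by (simp add: indicator_def sum.If_cases Int_def conj_commute)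
  also have "\<dots> = real (card {i\<in>{..<J}. y \<in> A i})" by simp
  also have "card {i\<in>{..<J}. y \<in> A i} \<le> Suc 0"
  proof (subst card_le_Suc0_iff_eq)
    show "\<forall>i\<in>{i\<in>{..<J}. y \<in> A i}. \<forall>k\<in>{i\<in>{..<J}. y \<in> A i}. i = k"
      using assms by (metis (mono_tags, lifting) linorder_neqE_nat mem_Collect_eq)
  qed simp
  then have "real (card {i\<in>{..<J}. y \<in> A i}) \<le> 1" by simp
  finally show ?thesis .
qed

text \<open>Quasiconvexity is applied to the truncation of \<open>z\<close>. On the transition set
  \<open>T\<close> the growth bound is paid. Off \<open>T\<close> each of the two cutoff factors is
  exactly 0 or 1, so the truncation has either the gradient of \<open>z\<close> or gradient 0, the
  latter at cost L(\<xi>). That cost arises where |z| \<ge> 2 s, charged to the integral of |z|, or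
  close to the boundary of the cube, charged to the measure of the rim.\<close>

lemma quasiconvex_truncation_step:
  fixes L :: "real^'n::finite^'m::finite \<Rightarrow> real" and z :: "real^'n \<Rightarrow> real^'m"
  assumes L: "W1_quasiconvex q L" "continuous_on UNIV L" "\<And>\<zeta>. 0 \<le> L \<zeta>" and q: "1 < q"
    and z: "smooth_map z" and t: "0 \<le> t" "t \<le> a" "a < b" "b < 1/4" and s: "0 < s" "s \<le> 1/2" and K: "0 \<le> K" "0 \<le> K2"
    and growth: "\<And>y. L (\<xi> + gradient (truncation (box_cutoff a b) s z) y) \<le> K * (1 + norm (\<xi> + gradient z y) powr q) + K2 * norm (z y)"
  defines "T \<equiv> {y. s < norm (z y) \<and> norm (z y) < 2 * s} \<union> {y. (\<exists>j. a < (y $ j)\<^sup>2) \<and> (\<forall>j. (y $ j)\<^sup>2 < b)}"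
  shows "ennreal (L \<xi>) \<le> (\<integral>\<^sup>+y\<in>unit_cube. ennreal (L (\<xi> + gradient z y)) \<partial>lborel)
    + (\<integral>\<^sup>+y\<in>unit_cube. indicator T y * ennreal (K * (1 + norm (\<xi> + gradient z y) powr q)) \<partial>lborel)
    + ennreal (K2 + L \<xi> / s) * (\<integral>\<^sup>+y\<in>unit_cube. norm (z y) \<partial>lborel)
    + ennreal (L \<xi>) * emeasure lborel {y \<in> (unit_cube :: (real^'n) set). \<exists>j. t < (y $ j)\<^sup>2}"
proof -
  let ?Y = "unit_cube :: (real^'n) set"
  let ?v = "truncation (box_cutoff a b) s z"
  let ?R = "{y \<in> ?Y. \<exists>j. t < (y $ j)\<^sup>2}"
  let ?P = "\<lambda>y. K * (1 + norm (\<xi> + gradient z y) powr q)"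
  have [measurable]: "L \<in> borel_measurable borel" using L(2) by (rule borel_measurable_continuous_onI)
  have [measurable]: "z \<in> borel_measurable borel" by (rule smooth_map_borel[OF z])
  have [measurable]: "gradient z \<in> borel_measurable borel" by (rule gradient_borel[OF z])
  have Tm[measurable]: "T \<in> sets borel" unfolding T_def by measurable
  have Rm[measurable]: "?R \<in> sets borel" by measurable
  have pt: "L (\<xi> + gradient ?v y) \<le> L (\<xi> + gradient z y) + indicator T y * ?P y + (K2 + L \<xi> / s) * norm (z y) + L \<xi> * indicator ?R y"
    if y: "y \<in> ?Y" for y
  proof -
    have P0: "0 \<le> ?P y" using K by (intro mult_nonneg_nonneg add_nonneg_nonneg) auto
    have n1: "0 \<le> indicator T y * ?P y" using P0 by (simp add: indicator_def)
    have n2: "0 \<le> K2 * norm (z y)" "0 \<le> L \<xi> / s * norm (z y)" using K s L(3) by auto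
    have n3: "0 \<le> L \<xi> * indicator ?R y" using L(3) by simp
    have e: "(K2 + L \<xi> / s) * norm (z y) = K2 * norm (z y) + L \<xi> / s * norm (z y)" by (rule distrib_right)
    let ?w = "box_cutoff a b y * cutoff 1 4 ((z y \<bullet> z y) / s\<^sup>2)"
    note geq = gradient_truncation_eq[OF z smooth_box_cutoff box_cutoff_nonneg box_cutoff_le_1, of a b y s]
    have zero: "L (\<xi> + gradient ?v y) = L \<xi>" if "?w = 0" using geq(1)[OF that] by simp
    show ?thesis
    proof (cases "y \<in> T")
      case True
      then show ?thesis using growth[of y] L(3)[of "\<xi> + gradient z y"] n2 n3 e by simp
    next
      case False
      then have z': "norm (z y) \<le> s \<or> 2 * s \<le> norm (z y)" and b': "(\<forall>j. (y $ j)\<^sup>2 \<le> a) \<or> (\<exists>j. b \<le> (y $ j)\<^sup>2)"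
        unfolding T_def by (auto simp: not_less)
      consider (big) "2 * s \<le> norm (z y)" | (rim) j where "b \<le> (y $ j)\<^sup>2" | (mid) "norm (z y) \<le> s" "\<forall>j. (y $ j)\<^sup>2 \<le> a"
        using z' b' by blast
      then show ?thesis
      proof cases
        case big
        then have "(2 * s)\<^sup>2 \<le> (norm (z y))\<^sup>2" using s by (intro power_mono) auto
        then have "4 \<le> (z y \<bullet> z y) / s\<^sup>2"
          using s unfolding power2_norm_eq_inner by (simp add: le_divide_eq power_mult_distrib)
        then have "cutoff 1 4 ((z y \<bullet> z y) / s\<^sup>2) = 0" by (intro cutoff_eq_0) auto
        then have "L (\<xi> + gradient ?v y) = L \<xi>" by (intro zero) simp
        \<comment> \<open>Markov's inequality in pointwise form: from |z| \<ge> 2 s follows 1 \<le>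
          |z| / s.\<close>
        moreover have "L \<xi> * 1 \<le> L \<xi> * (norm (z y) / s)"
          using big s L(3) by (intro mult_left_mono) (auto simp: le_divide_eq)
        ultimately show ?thesis using n1 n2 n3 e L(3)[of "\<xi> + gradient z y"] by simp
      next
        case (rim j)
        then have "box_cutoff a b y = 0" using t by (intro box_cutoff_eq_0)
        then have "L (\<xi> + gradient ?v y) = L \<xi>" by (intro zero) simp
        moreover have "y \<in> ?R" using y rim t by (auto intro!: exI[of _ j])
        ultimately show ?thesis using n1 n2 e L(3)[of "\<xi> + gradient z y"] by simp
      next
        case mid
        then have "(norm (z y))\<^sup>2 \<le> s\<^sup>2" by (intro power_mono) auto
        then have "(z y \<bullet> z y) / s\<^sup>2 \<le> 1" using s unfolding power2_norm_eq_inner by (simp add: divide_le_eq)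
        then have "cutoff 1 4 ((z y \<bullet> z y) / s\<^sup>2) = 1" by (rule cutoff_eq_1)
        moreover have "box_cutoff a b y = 1" using mid by (intro box_cutoff_eq_1) auto
        ultimately have "gradient ?v y = gradient z y" by (intro geq(2)) simp
        then show ?thesis using n1 n2 n3 e by simp
      qed
    qed
  qed
  have "ennreal (L \<xi>) \<le> (\<integral>\<^sup>+y\<in>?Y. ennreal (L (\<xi> + gradient ?v y)) \<partial>lborel)"
    by (rule quasiconvex_test_functions[OF L(1,2)])
      (use q t in \<open>auto intro!: truncation_test_function[OF z] box_cutoff_test_function\<close>)
  also have "\<dots> \<le> (\<integral>\<^sup>+y\<in>?Y. ((ennreal (L (\<xi> + gradient z y)) + indicator T y * ennreal (?P y))
      + ennreal (K2 + L \<xi> / s) * ennreal (norm (z y))) + ennreal (L \<xi>) * indicator ?R y \<partial>lborel)"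
  proof (rule nn_integral_unit_cube_mono)
    fix y assume "y \<in> ?Y"
    have n: "0 \<le> K2 + L \<xi> / s" "0 \<le> ?P y" using K s L(3) by (auto intro!: add_nonneg_nonneg mult_nonneg_nonneg)
    from pt[OF \<open>y \<in> ?Y\<close>]
    have "ennreal (L (\<xi> + gradient ?v y)) \<le> ennreal (((L (\<xi> + gradient z y) + indicator T y * ?P y) + (K2 + L \<xi> / s) * norm (z y)) + L \<xi> * indicator ?R y)"
      by (rule ennreal_leI)
    also have "\<dots> = ((ennreal (L (\<xi> + gradient z y)) + ennreal (indicator T y * ?P y))
      + ennreal ((K2 + L \<xi> / s) * norm (z y))) + ennreal (L \<xi> * indicator ?R y)"
      using n L(3) by (simp add: ennreal_plus del: indicator_simps)
    also have "\<dots> = ((ennreal (L (\<xi> + gradient z y)) + indicator T y * ennreal (?P y))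
      + ennreal (K2 + L \<xi> / s) * ennreal (norm (z y))) + ennreal (L \<xi>) * indicator ?R y"
    proof -
      have "ennreal (indicator T y * ?P y) = indicator T y * ennreal (?P y)" by (simp add: indicator_def)
      moreover have "ennreal (L \<xi> * indicator ?R y) = ennreal (L \<xi>) * indicator ?R y"
        using ennreal_mult[OF L(3) indicator_pos_le, of \<xi> ?R y] by (simp only: ennreal_indicator)
      moreover have "ennreal ((K2 + L \<xi> / s) * norm (z y)) = ennreal (K2 + L \<xi> / s) * ennreal (norm (z y))"
        by (rule ennreal_mult[OF n(1) norm_ge_zero])
      ultimately show ?thesis by (simp only:)
    qed
    finally show "ennreal (L (\<xi> + gradient ?v y)) \<le> ((ennreal (L (\<xi> + gradient z y)) + indicator T y * ennreal (?P y))
      + ennreal (K2 + L \<xi> / s) * ennreal (norm (z y))) + ennreal (L \<xi>) * indicator ?R y" .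
  qed
  also have "\<dots> = (\<integral>\<^sup>+y\<in>?Y. (ennreal (L (\<xi> + gradient z y)) + indicator T y * ennreal (?P y))
      + ennreal (K2 + L \<xi> / s) * ennreal (norm (z y)) \<partial>lborel) + (\<integral>\<^sup>+y\<in>?Y. ennreal (L \<xi>) * indicator ?R y \<partial>lborel)"
    by (rule nn_integral_unit_cube_add) measurable
  also have "(\<integral>\<^sup>+y\<in>?Y. (ennreal (L (\<xi> + gradient z y)) + indicator T y * ennreal (?P y))
      + ennreal (K2 + L \<xi> / s) * ennreal (norm (z y)) \<partial>lborel)
     = (\<integral>\<^sup>+y\<in>?Y. ennreal (L (\<xi> + gradient z y)) + indicator T y * ennreal (?P y) \<partial>lborel)
       + (\<integral>\<^sup>+y\<in>?Y. ennreal (K2 + L \<xi> / s) * ennreal (norm (z y)) \<partial>lborel)"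
    by (rule nn_integral_unit_cube_add) measurable
  also have "(\<integral>\<^sup>+y\<in>?Y. ennreal (L (\<xi> + gradient z y)) + indicator T y * ennreal (?P y) \<partial>lborel)
     = (\<integral>\<^sup>+y\<in>?Y. ennreal (L (\<xi> + gradient z y)) \<partial>lborel) + (\<integral>\<^sup>+y\<in>?Y. indicator T y * ennreal (?P y) \<partial>lborel)"
    by (rule nn_integral_unit_cube_add) measurable
  also have "(\<integral>\<^sup>+y\<in>?Y. ennreal (K2 + L \<xi> / s) * ennreal (norm (z y)) \<partial>lborel) = ennreal (K2 + L \<xi> / s) * (\<integral>\<^sup>+y\<in>?Y. norm (z y) \<partial>lborel)"
    unfolding mult.assoc by (rule nn_integral_cmult) measurable
  also have "(\<integral>\<^sup>+y\<in>?Y. ennreal (L \<xi>) * indicator ?R y \<partial>lborel) = ennreal (L \<xi>) * emeasure lborel ?R"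
  proof -
    have "(\<integral>\<^sup>+y\<in>?Y. ennreal (L \<xi>) * indicator ?R y \<partial>lborel) = (\<integral>\<^sup>+y. ennreal (L \<xi>) * indicator ?R y \<partial>lborel)"
      by (intro nn_integral_cong) (auto simp: indicator_def)
    then show ?thesis by (simp add: nn_integral_cmult_indicator)
  qed
  finally show ?thesis .
qed

text \<open>The estimate of \<open>quasiconvex_truncation_step\<close> is summed over J pairs of a
  value band and a layer and divided by J. A point lies in at most two of the transition sets, so
  their total cost is at most 2 K (1 + L(\<xi>)/\<beta>), a number independent of z; \<tau> and
  \<delta> take care of the other two error terms.\<close>

lemma quasiconvex_near_affine:
  fixes L :: "real^'n::finite^'m::finite \<Rightarrow> real"
  assumes L: "W1_quasiconvex q L" "continuous_on UNIV L" "\<And>\<zeta>. 0 \<le> L \<zeta>" and q: "1 < q"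
    and C: "0 \<le> C" "\<And>\<zeta>. L \<zeta> \<le> C * (1 + norm \<zeta> powr q)"
    and \<beta>: "0 < \<beta>" "\<And>\<zeta>. \<beta> * norm \<zeta> powr q \<le> L \<zeta>" and \<epsilon>: "0 < \<epsilon>"
  obtains \<delta> where "0 < \<delta>" "\<And>z :: real^'n \<Rightarrow> real^'m. smooth_map z \<Longrightarrow> (\<integral>\<^sup>+y\<in>unit_cube. norm (z y) \<partial>lborel) \<le> ennreal \<delta>
    \<Longrightarrow> ennreal (L \<xi>) \<le> (\<integral>\<^sup>+y\<in>unit_cube. ennreal (L (\<xi> + gradient z y)) \<partial>lborel) + ennreal \<epsilon>"
proof -
  let ?Y = "unit_cube :: (real^'n) set"
  obtain K where K: "0 \<le> K"
    "\<And>D. \<exists>K2\<ge>0. \<forall>(z :: real^'n \<Rightarrow> real^'m) \<phi> s y. smooth_map z \<longrightarrow> smooth \<phi> \<longrightarrow> (\<forall>y. 0 \<le> \<phi> y \<and> \<phi> y \<le> 1)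
      \<longrightarrow> (\<forall>j. \<bar>partial_deriv j \<phi> y\<bar> \<le> D) \<longrightarrow> 0 < s \<longrightarrow> s \<le> 1/2
      \<longrightarrow> L (\<xi> + gradient (truncation \<phi> s z) y) \<le> K * (1 + norm (\<xi> + gradient z y) powr q) + K2 * norm (z y)"
    by (rule truncation_growth[OF C q, of \<xi>]) blast
  define M where "M = L \<xi>"
  have M0: "0 \<le> M" unfolding M_def by (rule L(3))
  \<comment> \<open>The transition cost divided by J has to be at most \<epsilon>/3. This is not
    circular, since \<open>K\<close> was obtained before any layer.\<close>
  obtain J :: nat where J: "2 * K * (1 + M / \<beta>) * 3 / \<epsilon> < real J" using reals_Archimedean2 by blast
  have KM: "0 \<le> 2 * K * (1 + M / \<beta>)" using K(1) M0 \<beta>(1) by (intro mult_nonneg_nonneg add_nonneg_nonneg) auto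
  then have "0 \<le> 2 * K * (1 + M / \<beta>) * 3 / \<epsilon>" using \<epsilon> by simp
  with J have J0: "0 < real J" by linarith
  have J1: "2 * K * (1 + M / \<beta>) \<le> real J * (\<epsilon> / 3)" using J \<epsilon> by (simp add: field_simps)
  \<comment> \<open>The rim costs M times its measure, which \<tau> limits to \<epsilon>/3.\<close>
  define \<tau> where "\<tau> = \<epsilon> / (3 * (M + 1))"
  have \<tau>: "0 < \<tau>" "M * \<tau> \<le> \<epsilon> / 3" using \<epsilon> M0 by (auto simp: \<tau>_def field_simps)
  obtain t where t: "0 \<le> t" "t < 1/4" "emeasure lborel {y \<in> ?Y. \<exists>j. t < (y $ j)\<^sup>2} \<le> ennreal \<tau>"
    using unit_cube_rim_small[OF \<tau>(1), where 'n='n] by blast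
  \<comment> \<open>Equidistant thresholds from \<open>t\<close> towards 1/4. The denominator J + 1
    keeps \<open>a J\<close> below 1/4, so even the outermost layer stays compactly inside the
    cube.\<close>
  define a where "a i = t + (1/4 - t) * (real i / (real J + 1))" for i :: nat
  have a_mono: "a i \<le> a k" if "i \<le> k" for i k
    using that t unfolding a_def by (intro add_left_mono mult_left_mono divide_right_mono) auto
  have a_Suc: "a i < a (Suc i)" for i
    using t unfolding a_def by (intro add_strict_left_mono mult_strict_left_mono divide_strict_right_mono) auto
  have a_t: "t \<le> a i" for i using t by (auto simp: a_def intro!: mult_nonneg_nonneg)
  have a_J: "a (Suc i) < 1/4" if "i < J" for i
  proof -
    have "real (Suc i) / (real J + 1) < 1" using that by (simp add: divide_less_eq)
    then have "(1/4 - t) * (real (Suc i) / (real J + 1)) < (1/4 - t) * 1" using t by (intro mult_strict_left_mono) auto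
    then show ?thesis unfolding a_def by (simp only: less_diff_eq mult_1_right add.commute)
  qed
  \<comment> \<open>With dyadic levels the value bands s < |z| < 2 s are disjoint, and starting at
    1/2 meets the condition on \<open>s\<close> in the growth estimate.\<close>
  define s where "s i = (1/2::real) ^ Suc i" for i :: nat
  have s: "0 < s i" "s i \<le> 1/2" for i
    using power_le_one[of "1/2::real" i] by (auto simp: s_def)
  have s_mono: "2 * s k \<le> s i" if "i < k" for i k
  proof -
    have "(1/2::real) ^ k \<le> (1/2) ^ Suc i" using that by (intro power_decreasing) auto
    then show ?thesis by (simp add: s_def)
  qed
  have "\<exists>K2\<ge>0. \<forall>(z :: real^'n \<Rightarrow> real^'m) y. smooth_map z \<longrightarrow>
      L (\<xi> + gradient (truncation (box_cutoff (a i) (a (Suc i))) (s i) z) y) \<le> K * (1 + norm (\<xi> + gradient z y) powr q) + K2 * norm (z y)"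
    if "i < J" for i
  proof -
    have "box_cutoff (a i) (a (Suc i)) \<in> test_functions ?Y"
      using a_Suc a_J[OF that] a_t[of i] t by (intro box_cutoff_test_function) auto
    \<comment> \<open>A Lipschitz bound of the box cutoff plays the role of \<open>D\<close>; it
      depends on the layer, and therefore so does \<open>K2 i\<close>.\<close>
    from test_function_lipschitz[OF this] obtain B where B: "\<And>x h. \<bar>\<Sum>j\<in>UNIV. partial_deriv j (box_cutoff (a i) (a (Suc i))) (x::real^'n) * h $ j\<bar> \<le> B * norm h"
      by metis
    have "\<bar>partial_deriv j (box_cutoff (a i) (a (Suc i))) (x::real^'n)\<bar> \<le> B" for j x
      using B[of x "axis j 1"] by (simp add: axis_def if_distrib norm_axis_1[unfolded axis_def] cong: if_cong)
    then show ?thesis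
      using K(2)[of B] smooth_box_cutoff box_cutoff_nonneg box_cutoff_le_1 s by metis
  qed
  then obtain K2 where K2: "\<And>i. i < J \<Longrightarrow> 0 \<le> K2 i"
    "\<And>i (z :: real^'n \<Rightarrow> real^'m) y. i < J \<Longrightarrow> smooth_map z \<Longrightarrow>
      L (\<xi> + gradient (truncation (box_cutoff (a i) (a (Suc i))) (s i) z) y) \<le> K * (1 + norm (\<xi> + gradient z y) powr q) + K2 i * norm (z y)"
    by metis
  \<comment> \<open>Collects the coefficients of the L1 norm of \<open>z\<close> from all J
    inequalities. The choice of \<delta> makes B \<delta> at most \<epsilon>/3 already without
    dividing by J.\<close>
  define B where "B = (\<Sum>i<J. K2 i + M / s i)"
  have Bi: "0 \<le> K2 i + M / s i" if "i < J" for i using K2(1)[OF that] M0 s[of i] by simp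
  have B0: "0 \<le> B" unfolding B_def using Bi by (intro sum_nonneg) auto
  define \<delta> where "\<delta> = \<epsilon> / (3 * (B + 1))"
  have \<delta>: "0 < \<delta>" using \<epsilon> B0 by (simp add: \<delta>_def)
  have B\<delta>: "B * \<delta> \<le> real J * (\<epsilon> / 3)"
  proof -
    have "B * \<delta> \<le> \<epsilon> / 3" using \<epsilon> B0 by (simp add: \<delta>_def field_simps)
    also have "\<dots> = 1 * (\<epsilon> / 3)" by simp
    also have "\<dots> \<le> real J * (\<epsilon> / 3)" using J0 \<epsilon> by (intro mult_right_mono) auto
    finally show ?thesis .
  qed
  show ?thesis
  proof (rule that[OF \<delta>])
    fix z :: "real^'n \<Rightarrow> real^'m"
    assume z: "smooth_map z" and z\<delta>: "(\<integral>\<^sup>+y\<in>?Y. norm (z y) \<partial>lborel) \<le> ennreal \<delta>"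
    define I where "I = (\<integral>\<^sup>+y\<in>?Y. ennreal (L (\<xi> + gradient z y)) \<partial>lborel)"
    have [measurable]: "L \<in> borel_measurable borel" using L(2) by (rule borel_measurable_continuous_onI)
    have [measurable]: "z \<in> borel_measurable borel" by (rule smooth_map_borel[OF z])
    have [measurable]: "gradient z \<in> borel_measurable borel" by (rule gradient_borel[OF z])
    show "ennreal (L \<xi>) \<le> I + ennreal \<epsilon>"
    proof (cases "I \<le> ennreal M")
      case False
      then have "ennreal (L \<xi>) \<le> I" unfolding M_def by simp
      then show ?thesis by (simp add: add_increasing2)
    next
      case True
      let ?P = "\<lambda>y. K * (1 + norm (\<xi> + gradient z y) powr q)"
      define T where "T i = {y. s i < norm (z y) \<and> norm (z y) < 2 * s i} \<union>
         {y. (\<exists>j. a i < (y $ j)\<^sup>2) \<and> (\<forall>j. (y $ j)\<^sup>2 < a (Suc i))}" for i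
      have Tm[measurable]: "T i \<in> sets borel" for i unfolding T_def by measurable
      have step: "ennreal M \<le> I + (\<integral>\<^sup>+y\<in>?Y. indicator (T i) y * ennreal (?P y) \<partial>lborel)
         + ennreal (K2 i + M / s i) * ennreal \<delta> + ennreal M * ennreal \<tau>" if "i < J" for i
      proof -
        have "ennreal M \<le> I + (\<integral>\<^sup>+y\<in>?Y. indicator (T i) y * ennreal (?P y) \<partial>lborel)
         + ennreal (K2 i + M / s i) * (\<integral>\<^sup>+y\<in>?Y. norm (z y) \<partial>lborel) + ennreal M * emeasure lborel {y \<in> ?Y. \<exists>j. t < (y $ j)\<^sup>2}"
          unfolding M_def I_def T_def
          by (rule quasiconvex_truncation_step[OF L q z t(1) a_t a_Suc a_J[OF that] s K(1) K2(1)[OF that] K2(2)[OF that z]])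
        also have "\<dots> \<le> I + (\<integral>\<^sup>+y\<in>?Y. indicator (T i) y * ennreal (?P y) \<partial>lborel)
         + ennreal (K2 i + M / s i) * ennreal \<delta> + ennreal M * ennreal \<tau>"
          by (intro add_mono mult_left_mono z\<delta> t(3) order_refl) auto
        finally show ?thesis .
      qed
      have Psum: "(\<Sum>i<J. \<integral>\<^sup>+y\<in>?Y. indicator (T i) y * ennreal (?P y) \<partial>lborel) \<le> ennreal (2 * K * (1 + M / \<beta>))"
      proof -
        \<comment> \<open>One for the value bands and one for the layers: each family consists of
          disjoint sets.\<close>
        have ind: "(\<Sum>i<J. indicator (T i) y) \<le> (2::real)" for y
        proof -
          let ?A = "\<lambda>i. {y. s i < norm (z y) \<and> norm (z y) < 2 * s i}"
          let ?B = "\<lambda>i. {y::real^'n. (\<exists>j. a i < (y $ j)\<^sup>2) \<and> (\<forall>j. (y $ j)\<^sup>2 < a (Suc i))}"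
          have "(\<Sum>i<J. indicator (T i) y) \<le> (\<Sum>i<J. indicator (?A i) y + indicator (?B i) y :: real)"
            by (intro sum_mono) (auto simp: T_def indicator_def)
          also have "\<dots> = (\<Sum>i<J. indicator (?A i) y) + (\<Sum>i<J. indicator (?B i) y)" by (rule sum.distrib)
          also have "(\<Sum>i<J. indicator (?A i) y) \<le> (1::real)"
          proof (rule sum_indicator_le_1)
            fix i k :: nat assume "i < k" "y \<in> ?A i"
            with s_mono[of i k] show "y \<notin> ?A k" by auto
          qed
          also have "(\<Sum>i<J. indicator (?B i) y) \<le> (1::real)"
          proof (rule sum_indicator_le_1)
            fix i k :: nat assume ik: "i < k" "y \<in> ?B i"
            with a_mono[of "Suc i" k] have "\<And>j. (y $ j)\<^sup>2 < a k" by (auto intro: less_le_trans)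
            then show "y \<notin> ?B k" by (auto dest: less_asym)
          qed
          finally show ?thesis by simp
        qed
        have P0: "0 \<le> ?P y" for y using K(1) by (intro mult_nonneg_nonneg add_nonneg_nonneg) auto
        have "(\<Sum>i<J. \<integral>\<^sup>+y\<in>?Y. indicator (T i) y * ennreal (?P y) \<partial>lborel) = (\<integral>\<^sup>+y. (\<Sum>i<J. indicator (T i) y * ennreal (?P y) * indicator ?Y y) \<partial>lborel)"
          by (rule nn_integral_sum[symmetric]) measurable
        also have "\<dots> \<le> (\<integral>\<^sup>+y\<in>?Y. ennreal (2 * K) + ennreal (2 * K / \<beta>) * ennreal (L (\<xi> + gradient z y)) \<partial>lborel)"
        proof (rule nn_integral_mono)
          fix y
          have "(\<Sum>i<J. indicator (T i) y * ennreal (?P y) * indicator ?Y y) = ennreal ((\<Sum>i<J. indicator (T i) y) * ?P y) * indicator ?Y y"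
          proof -
            have "(\<Sum>i<J. indicator (T i) y * ennreal (?P y)) = (\<Sum>i<J. ennreal (indicator (T i) y * ?P y))"
              by (intro sum.cong) (auto simp: indicator_def)
            also have "\<dots> = ennreal (\<Sum>i<J. indicator (T i) y * ?P y)" using P0 by (intro sum_ennreal) auto
            finally show ?thesis by (simp only: sum_distrib_right[symmetric])
          qed
          also have "\<dots> \<le> (ennreal (2 * K) + ennreal (2 * K / \<beta>) * ennreal (L (\<xi> + gradient z y))) * indicator ?Y y"
          proof (rule mult_right_mono)
            \<comment> \<open>Coercivity converts the transition cost back into energy, which in the
              present case is at most M.\<close>
            have "norm (\<xi> + gradient z y) powr q \<le> L (\<xi> + gradient z y) / \<beta>"
              using \<beta>(2)[of "\<xi> + gradient z y"] \<beta>(1) by (simp add: le_divide_eq mult.commute)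
            then have "?P y \<le> K * (1 + L (\<xi> + gradient z y) / \<beta>)" using K(1) by (intro mult_left_mono) auto
            then have "(\<Sum>i<J. indicator (T i) y) * ?P y \<le> 2 * (K * (1 + L (\<xi> + gradient z y) / \<beta>))"
              by (rule mult_mono[OF ind]) (simp, rule P0)
            also have "\<dots> = 2 * K + 2 * K / \<beta> * L (\<xi> + gradient z y)" by (simp add: algebra_simps)
            finally have "ennreal ((\<Sum>i<J. indicator (T i) y) * ?P y) \<le> ennreal (2 * K + 2 * K / \<beta> * L (\<xi> + gradient z y))"
              by (rule ennreal_leI)
            also have "\<dots> = ennreal (2 * K) + ennreal (2 * K / \<beta> * L (\<xi> + gradient z y))"
              using K(1) \<beta>(1) L(3) by (intro ennreal_plus mult_nonneg_nonneg divide_nonneg_nonneg) auto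
            also have "ennreal (2 * K / \<beta> * L (\<xi> + gradient z y)) = ennreal (2 * K / \<beta>) * ennreal (L (\<xi> + gradient z y))"
              using K(1) \<beta>(1) L(3) by (intro ennreal_mult divide_nonneg_nonneg) auto
            finally show "ennreal ((\<Sum>i<J. indicator (T i) y) * ?P y) \<le> ennreal (2 * K) + ennreal (2 * K / \<beta>) * ennreal (L (\<xi> + gradient z y))" .
          qed simp
          finally show "(\<Sum>i<J. indicator (T i) y * ennreal (?P y) * indicator ?Y y)
             \<le> (ennreal (2 * K) + ennreal (2 * K / \<beta>) * ennreal (L (\<xi> + gradient z y))) * indicator ?Y y" .
        qed
        also have "\<dots> = (\<integral>\<^sup>+y\<in>?Y. ennreal (2 * K) \<partial>lborel) + (\<integral>\<^sup>+y\<in>?Y. ennreal (2 * K / \<beta>) * ennreal (L (\<xi> + gradient z y)) \<partial>lborel)"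
          by (rule nn_integral_unit_cube_add) measurable
        also have "(\<integral>\<^sup>+y\<in>?Y. ennreal (2 * K) \<partial>lborel) = ennreal (2 * K)" by (rule nn_integral_unit_cube_const)
        also have "(\<integral>\<^sup>+y\<in>?Y. ennreal (2 * K / \<beta>) * ennreal (L (\<xi> + gradient z y)) \<partial>lborel) = ennreal (2 * K / \<beta>) * I"
          unfolding mult.assoc I_def by (rule nn_integral_cmult) measurable
        also have "\<dots> \<le> ennreal (2 * K / \<beta>) * ennreal M" by (rule mult_left_mono[OF True]) simp
        also have "\<dots> = ennreal (2 * K / \<beta> * M)" using K(1) \<beta>(1) M0 by (intro ennreal_mult[symmetric] divide_nonneg_nonneg) auto
        also have "ennreal (2 * K) + \<dots> = ennreal (2 * K + 2 * K / \<beta> * M)"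
          using K(1) \<beta>(1) M0 by (intro ennreal_plus[symmetric] mult_nonneg_nonneg divide_nonneg_nonneg) auto
        also have "2 * K + 2 * K / \<beta> * M = 2 * K * (1 + M / \<beta>)" by (simp add: algebra_simps)
        finally show ?thesis by (simp add: add_left_mono)
      qed
      \<comment> \<open>In this case the energy is finite, so the summed inequality can be moved to
        the reals and divided by J.\<close>
      obtain r where r: "0 \<le> r" "I = ennreal r" using True by (cases I) (auto simp: top_unique)
      have "(\<Sum>i<J. ennreal M) \<le> (\<Sum>i<J. I + (\<integral>\<^sup>+y\<in>?Y. indicator (T i) y * ennreal (?P y) \<partial>lborel)
         + ennreal (K2 i + M / s i) * ennreal \<delta> + ennreal M * ennreal \<tau>)"
        by (rule sum_mono) (simp add: step)
      also have "\<dots> = (\<Sum>i<J. I) + (\<Sum>i<J. \<integral>\<^sup>+y\<in>?Y. indicator (T i) y * ennreal (?P y) \<partial>lborel)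
         + (\<Sum>i<J. ennreal ((K2 i + M / s i) * \<delta>)) + (\<Sum>i<J. ennreal (M * \<tau>))"
      proof -
        have "ennreal (K2 i + M / s i) * ennreal \<delta> = ennreal ((K2 i + M / s i) * \<delta>)" if "i < J" for i
          using Bi[OF that] \<delta> by (intro ennreal_mult[symmetric]) auto
        moreover have "ennreal M * ennreal \<tau> = ennreal (M * \<tau>)" using M0 \<tau> by (intro ennreal_mult[symmetric]) auto
        ultimately show ?thesis by (simp add: sum.distrib)
      qed
      also have "(\<Sum>i<J. ennreal ((K2 i + M / s i) * \<delta>)) = ennreal (B * \<delta>)"
        unfolding B_def sum_distrib_right using Bi \<delta> by (intro sum_ennreal) (auto intro!: mult_nonneg_nonneg)
      also have "(\<Sum>i<J. I) = ennreal (real J * r)" unfolding r(2) using r(1) by (simp add: ennreal_of_nat_eq_real_of_nat ennreal_mult)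
      also have "(\<Sum>i<J. ennreal (M * \<tau>)) = ennreal (real J * (M * \<tau>))"
        using M0 \<tau> by (simp add: ennreal_of_nat_eq_real_of_nat ennreal_mult)
      also have "(\<Sum>i<J. ennreal M) = ennreal (real J * M)" using M0 by (simp add: ennreal_of_nat_eq_real_of_nat ennreal_mult)
      finally have "ennreal (real J * M) \<le> ennreal (real J * r) + ennreal (2 * K * (1 + M / \<beta>)) + ennreal (B * \<delta>) + ennreal (real J * (M * \<tau>))"
        by (rule order_trans) (intro add_mono Psum order_refl)
      also have "\<dots> = ennreal (real J * r + 2 * K * (1 + M / \<beta>) + B * \<delta> + real J * (M * \<tau>))"
        using r(1) KM B0 \<delta> M0 \<tau>(1) by (simp only: ennreal_plus add_nonneg_nonneg mult_nonneg_nonneg of_nat_0_le_iff less_imp_le)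
      finally have "real J * M \<le> real J * r + 2 * K * (1 + M / \<beta>) + B * \<delta> + real J * (M * \<tau>)"
        by (subst (asm) ennreal_le_iff) (use r(1) KM B0 \<delta> M0 \<tau>(1) in \<open>auto intro!: add_nonneg_nonneg mult_nonneg_nonneg\<close>)
      also have "\<dots> \<le> real J * r + real J * (\<epsilon> / 3) + real J * (\<epsilon> / 3) + real J * (\<epsilon> / 3)"
        by (intro add_mono J1 B\<delta> mult_left_mono[OF \<tau>(2)] order_refl) simp
      also have "\<dots> = real J * (r + \<epsilon>)" by (simp add: algebra_simps)
      finally have "M \<le> r + \<epsilon>" using J0 by (simp add: mult_le_cancel_left)
      then have "ennreal M \<le> ennreal (r + \<epsilon>)" by (rule ennreal_leI)
      also have "\<dots> = I + ennreal \<epsilon>" unfolding r(2) using r(1) \<epsilon> by (intro ennreal_plus) auto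
      finally show ?thesis unfolding M_def .
    qed
  qed
qed

section \<open>Blow-up\<close>

lemma smooth_map_rescale:
  fixes f :: "real^'n::finite \<Rightarrow> real^'m::finite"
  assumes f: "smooth_map f"
  shows "smooth_map (\<lambda>y. a *\<^sub>R (f (x + r *\<^sub>R y) - c))"
    and "gradient (\<lambda>y. a *\<^sub>R (f (x + r *\<^sub>R y) - c)) y = (a * r) *\<^sub>R gradient f (x + r *\<^sub>R y)"
proof -
  have fi: "smooth (\<lambda>y. f y $ i)" for i using f by (simp add: smooth_map_def)
  have fa: "smooth (\<lambda>y. f (x + r *\<^sub>R y) $ i)" for i by (rule smooth_affine[OF fi])
  then have fc: "smooth (\<lambda>y. f (x + r *\<^sub>R y) $ i + - c $ i)" for i by (intro smooth_add smooth_const)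
  show "smooth_map (\<lambda>y. a *\<^sub>R (f (x + r *\<^sub>R y) - c))"
    unfolding smooth_map_def using smooth_mult[OF smooth_const fc, of a] by simp
  have "partial_deriv j (\<lambda>y. a * (f (x + r *\<^sub>R y) $ i + - c $ i)) y = a * (r * partial_deriv j (\<lambda>y. f y $ i) (x + r *\<^sub>R y))" for i j
  proof -
    have "((\<lambda>y. f (x + r *\<^sub>R y) $ i) has_derivative frechet_derivative (\<lambda>y. f (x + r *\<^sub>R y) $ i) (at y)) (at y)"
      using smooth_differentiable[OF fa] by (simp add: frechet_derivative_works)
    from has_derivative_mult_right[OF has_derivative_add_const[OF this]]
    have "((\<lambda>y. a * (f (x + r *\<^sub>R y) $ i + - c $ i)) has_derivative
      (\<lambda>h. a * frechet_derivative (\<lambda>y. f (x + r *\<^sub>R y) $ i) (at y) h)) (at y)" .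
    from partial_deriv_has_derivative[OF this, of j]
    have "partial_deriv j (\<lambda>y. a * (f (x + r *\<^sub>R y) $ i + - c $ i)) y = a * partial_deriv j (\<lambda>y. f (x + r *\<^sub>R y) $ i) y"
      by (simp only: partial_deriv_def)
    also have "partial_deriv j (\<lambda>y. f (x + r *\<^sub>R y) $ i) y = r * partial_deriv j (\<lambda>y. f y $ i) (x + r *\<^sub>R y)"
      by (rule partial_deriv_affine[OF smooth_differentiable[OF fi]])
    finally show ?thesis .
  qed
  then show "gradient (\<lambda>y. a *\<^sub>R (f (x + r *\<^sub>R y) - c)) y = (a * r) *\<^sub>R gradient f (x + r *\<^sub>R y)"
    by (simp add: gradient_def vec_eq_iff mult.assoc)
qed

lemma smooth_map_rescale_1:
  fixes f :: "real^'n::finite \<Rightarrow> real^'m::finite"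
  assumes "smooth_map f"
  shows "smooth_map (\<lambda>y. f (x + r *\<^sub>R y))"
    and "gradient (\<lambda>y. f (x + r *\<^sub>R y)) y = r *\<^sub>R gradient f (x + r *\<^sub>R y)"
  using smooth_map_rescale[OF assms, of 1 x r 0] by simp_all

lemma nn_integral_unit_cube_rescale_le:
  fixes h :: "real^'n::finite \<Rightarrow> ennreal"
  assumes [measurable]: "h \<in> borel_measurable borel" "S \<in> sets borel" and r: "0 < r"
    and sub: "\<And>y. y \<in> unit_cube \<Longrightarrow> x + r *\<^sub>R y \<in> S"
  shows "(\<integral>\<^sup>+y\<in>unit_cube. h (x + r *\<^sub>R y) \<partial>lborel) \<le> ennreal (1 / r ^ CARD('n)) * (\<integral>\<^sup>+y\<in>S. h y \<partial>lborel)"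
proof -
  have "(\<integral>\<^sup>+y\<in>unit_cube. h (x + r *\<^sub>R y) \<partial>lborel) \<le> (\<integral>\<^sup>+y. h (x + r *\<^sub>R y) * indicator S (x + r *\<^sub>R y) \<partial>lborel)"
    using sub by (intro nn_integral_mono) (auto simp: indicator_def)
  also have "\<dots> = ennreal (1 / r ^ CARD('n)) * (ennreal (\<bar>r\<bar> ^ DIM(real^'n)) * \<dots>)"
    using r by (simp add: mult.assoc[symmetric] ennreal_mult[symmetric])
  also have "ennreal (\<bar>r\<bar> ^ DIM(real^'n)) * (\<integral>\<^sup>+y. h (x + r *\<^sub>R y) * indicator S (x + r *\<^sub>R y) \<partial>lborel) = (\<integral>\<^sup>+y\<in>S. h y \<partial>lborel)"
    using nn_integral_lborel_affine[of "\<lambda>y. h y * indicator S y" r x] r by simp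
  finally show ?thesis .
qed

lemma le_one_plus_powr:
  assumes "0 \<le> t" "1 < (q::real)" shows "t \<le> 1 + t powr q"
proof (cases "t \<le> 1")
  case False
  then have "t powr 1 \<le> t powr q" using assms by (intro powr_mono) auto
  then show ?thesis using False by simp
qed (use assms in \<open>simp add: add_increasing2\<close>)

text \<open>On the cube, f(x + r y) is compared with the affine map c + r \<xi> y, where
  \<open>c\<close> is the mean of U(x + r y) - r \<xi> y. Strong L1 convergence replaces
  \<open>f k\<close> by \<open>U\<close>, and Poincare's inequality bounds the rest through G(x + r
  y) - \<xi>. Dividing by r gives the map \<open>z\<close> handed to the quasiconvexity estimate.
  That \<open>G\<close> is the gradient of \<open>U\<close> enters only through the smooth maps
  \<open>v k\<close> converging to both.\<close>

lemma blow_up_lower_bound: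
  fixes L :: "real^'n::finite^'m::finite \<Rightarrow> real" and f v :: "nat \<Rightarrow> real^'n \<Rightarrow> real^'m" and U :: "real^'n \<Rightarrow> real^'m"
  assumes f: "\<And>k. smooth_map (f k)" and fM: "\<And>k. (\<integral>\<^sup>+y\<in>S. norm (gradient (f k) y) \<partial>lborel) \<le> ennreal M" and M: "0 \<le> M"
    and v: "\<And>k. smooth_map (v k)" and vM: "\<And>k. (\<integral>\<^sup>+y\<in>S. norm (gradient (v k) y) \<partial>lborel) \<le> ennreal M"
    and vU: "(\<lambda>k. \<integral>\<^sup>+y\<in>S. norm (v k y - U y) \<partial>lborel) \<longlonglongrightarrow> 0"
    and vG: "(\<lambda>k. \<integral>\<^sup>+y\<in>S. norm (gradient (v k) y - G y) \<partial>lborel) \<longlonglongrightarrow> 0"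
    and U: "integrable lborel U" and G[measurable]: "G \<in> borel_measurable borel" and S[measurable]: "S \<in> sets borel"
    and weak: "\<And>\<psi> B. \<psi> \<in> borel_measurable borel \<Longrightarrow> (\<And>x. \<bar>\<psi> x\<bar> \<le> B) \<Longrightarrow> (\<And>x. x \<notin> S \<Longrightarrow> \<psi> x = 0)
      \<Longrightarrow> (\<lambda>k. \<integral>x. \<psi> x *\<^sub>R f k x \<partial>lborel) \<longlonglongrightarrow> (\<integral>x. \<psi> x *\<^sub>R U x \<partial>lborel)"
    and r: "0 < r" and sub: "\<And>y. y \<in> unit_cube \<Longrightarrow> x + r *\<^sub>R y \<in> S"
    and \<delta>: "0 < \<delta>" "\<And>z :: real^'n \<Rightarrow> real^'m. smooth_map z \<Longrightarrow> (\<integral>\<^sup>+y\<in>unit_cube. norm (z y) \<partial>lborel) \<le> ennreal \<delta>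
      \<Longrightarrow> ennreal (L \<xi>) \<le> (\<integral>\<^sup>+y\<in>unit_cube. ennreal (L (\<xi> + gradient z y)) \<partial>lborel) + ennreal \<epsilon>"
    and \<Phi>: "ennreal (real CARD('n) * 2 ^ CARD('n)) * (\<integral>\<^sup>+y\<in>unit_cube. norm (G (x + r *\<^sub>R y) - \<xi>) \<partial>lborel) \<le> ennreal (\<delta> / 2)"
  shows "\<forall>\<^sub>F k in sequentially. ennreal (L \<xi>) \<le> (\<integral>\<^sup>+y\<in>unit_cube. ennreal (L (gradient (f k) (x + r *\<^sub>R y))) \<partial>lborel) + ennreal \<epsilon>"
proof -
  let ?Y = "unit_cube :: (real^'n) set" and ?R = "1 / r ^ CARD('n)"
  let ?K = "real CARD('n) * 2 ^ CARD('n)"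
  have R0: "0 \<le> ?R" using r by simp
  have Um[measurable]: "U \<in> borel_measurable borel" using U by auto
  have fm[measurable]: "f k \<in> borel_measurable borel" and vm[measurable]: "v k \<in> borel_measurable borel"
    and gfm[measurable]: "gradient (f k) \<in> borel_measurable borel" and gvm[measurable]: "gradient (v k) \<in> borel_measurable borel" for k
    using f v smooth_map_borel gradient_borel by blast+
  let ?f = "\<lambda>k y. f k (x + r *\<^sub>R y)" and ?w = "\<lambda>y. U (x + r *\<^sub>R y)" and ?v = "\<lambda>k y. v k (x + r *\<^sub>R y)"
  have wi: "integrable lborel (\<lambda>y. indicator ?Y y *\<^sub>R ?w y)"
    using r by (intro integrable_mult_indicator integrable_lborel_affine[OF U]) auto
  have scaled: "(\<lambda>k. \<integral>\<^sup>+y\<in>?Y. h k (x + r *\<^sub>R y) \<partial>lborel) \<longlonglongrightarrow> 0"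
    if h: "\<And>k::nat. h k \<in> borel_measurable borel" and l: "(\<lambda>k. \<integral>\<^sup>+y\<in>S. h k y \<partial>lborel) \<longlonglongrightarrow> 0" for h :: "nat \<Rightarrow> real^'n \<Rightarrow> ennreal"
  proof (rule tendsto_sandwich[of "\<lambda>_. 0"])
    have "(\<lambda>k. ennreal ?R * (\<integral>\<^sup>+y\<in>S. h k y \<partial>lborel)) \<longlonglongrightarrow> ennreal ?R * 0"
      by (intro ennreal_tendsto_cmult l) simp
    then show "(\<lambda>k. ennreal ?R * (\<integral>\<^sup>+y\<in>S. h k y \<partial>lborel)) \<longlonglongrightarrow> 0" by simp
    show "\<forall>\<^sub>F k in sequentially. (\<integral>\<^sup>+y\<in>?Y. h k (x + r *\<^sub>R y) \<partial>lborel) \<le> ennreal ?R * (\<integral>\<^sup>+y\<in>S. h k y \<partial>lborel)"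
      by (intro always_eventually allI nn_integral_unit_cube_rescale_le h S r sub)
  qed auto
  have vw: "(\<lambda>k. \<integral>\<^sup>+y\<in>?Y. norm (?v k y - ?w y) \<partial>lborel) \<longlonglongrightarrow> 0"
    by (rule scaled[OF _ vU]) measurable
  have gM: "(\<integral>\<^sup>+y\<in>?Y. norm (gradient (\<lambda>y. g (x + r *\<^sub>R y)) y) \<partial>lborel) \<le> ennreal (r * (?R * M))"
    if g: "smooth_map g" and gS: "(\<integral>\<^sup>+y\<in>S. norm (gradient g y) \<partial>lborel) \<le> ennreal M" for g :: "real^'n \<Rightarrow> real^'m"
  proof -
    have [measurable]: "gradient g \<in> borel_measurable borel" by (rule gradient_borel[OF g])
    have "(\<integral>\<^sup>+y\<in>?Y. norm (gradient (\<lambda>y. g (x + r *\<^sub>R y)) y) \<partial>lborel)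
      = (\<integral>\<^sup>+y. ennreal r * (ennreal (norm (gradient g (x + r *\<^sub>R y))) * indicator ?Y y) \<partial>lborel)"
      using r by (intro nn_integral_cong) (simp add: smooth_map_rescale_1(2)[OF g] ennreal_mult mult.assoc)
    also have "\<dots> = ennreal r * (\<integral>\<^sup>+y\<in>?Y. norm (gradient g (x + r *\<^sub>R y)) \<partial>lborel)"
      by (rule nn_integral_cmult) measurable
    also have "\<dots> \<le> ennreal r * (ennreal ?R * ennreal M)"
      by (intro mult_left_mono order_trans[OF nn_integral_unit_cube_rescale_le[OF _ S r sub] mult_left_mono[OF gS]]) (auto, measurable)
    also have "\<dots> = ennreal (r * (?R * M))"
      using r M R0 by (simp only: ennreal_mult mult_nonneg_nonneg less_imp_le)
    finally show ?thesis .
  qed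
  have M': "0 \<le> r * (?R * M)" using r M R0 by (intro mult_nonneg_nonneg) auto
  have weak': "(\<lambda>k. \<integral>y. \<psi> y *\<^sub>R ?f k y \<partial>lborel) \<longlonglongrightarrow> (\<integral>y. \<psi> y *\<^sub>R ?w y \<partial>lborel)"
    if \<psi>[measurable]: "\<psi> \<in> borel_measurable borel" and B: "\<And>y. \<bar>\<psi> y\<bar> \<le> B" and 0: "\<And>y. y \<notin> ?Y \<Longrightarrow> \<psi> y = 0" for \<psi> B
  proof -
    \<comment> \<open>Weights on the cube are transported to weights on \<open>S\<close>;
      \<open>sub\<close> ensures that the transported weight vanishes off \<open>S\<close>.\<close>
    let ?\<psi> = "\<lambda>z. \<psi> ((1/r) *\<^sub>R (z - x))"
    have eq: "(\<integral>y. \<psi> y *\<^sub>R g (x + r *\<^sub>R y) \<partial>lborel) = ?R *\<^sub>R (\<integral>z. ?\<psi> z *\<^sub>R g z \<partial>lborel)"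
      if [measurable]: "g \<in> borel_measurable borel" for g :: "real^'n \<Rightarrow> real^'m"
      using integral_lborel_affine[of "\<lambda>z. ?\<psi> z *\<^sub>R g z" r x] r by simp
    have "(\<lambda>k. ?R *\<^sub>R (\<integral>z. ?\<psi> z *\<^sub>R f k z \<partial>lborel)) \<longlonglongrightarrow> ?R *\<^sub>R (\<integral>z. ?\<psi> z *\<^sub>R U z \<partial>lborel)"
    proof (intro tendsto_scaleR tendsto_const weak[of ?\<psi> B] B)
      fix z assume "z \<notin> S"
      then have "(1/r) *\<^sub>R (z - x) \<notin> ?Y" using sub[of "(1/r) *\<^sub>R (z - x)"] r by auto
      then show "\<psi> ((1/r) *\<^sub>R (z - x)) = 0" by (rule 0)
    qed measurable
    then show ?thesis by (simp only: eq fm Um)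
  qed
  \<comment> \<open>Half of \<delta>, multiplied by r because \<open>z\<close> is a difference
    quotient with denominator r.\<close>
  have strong: "\<forall>\<^sub>F k in sequentially. (\<integral>\<^sup>+y\<in>?Y. norm (?f k y - ?w y) \<partial>lborel) \<le> ennreal (r * \<delta> / 2)"
    by (rule strong_convergence_unit_cube[OF smooth_map_rescale_1(1)[OF f] gM[OF f fM] _ wi smooth_map_rescale_1(1)[OF v] gM[OF v vM] vw M' weak'])
      (use r \<delta>(1) in \<open>measurable, auto\<close>)
  \<comment> \<open>With the linear part removed, the gradient becomes r (G(x + r y) - \<xi>), whose
    integral is small by \<Phi>; Poincare's inequality then applies around the mean
    \<open>c\<close>.\<close>
  define w1 where "w1 y = (- r *\<^sub>R \<xi>) *v y + ?w y" for y
  have aff: "continuous_on UNIV (\<lambda>y. (- r *\<^sub>R \<xi>) *v y)" by (intro matrix_vector_mult_linear_continuous_on)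
  then have affm[measurable]: "(\<lambda>y. (- r *\<^sub>R \<xi>) *v y) \<in> borel_measurable borel" by (rule borel_measurable_continuous_onI)
  have w1m[measurable]: "w1 \<in> borel_measurable borel" unfolding w1_def[abs_def] by measurable
  have w1i: "integrable lborel (\<lambda>y. indicator ?Y y *\<^sub>R w1 y)"
    unfolding w1_def scaleR_add_right by (intro Bochner_Integration.integrable_add wi continuous_integrable_unit_cube aff)
  define c where "c = (\<integral>y. indicator ?Y y *\<^sub>R w1 y \<partial>lborel)"
  have poin: "(\<integral>\<^sup>+y\<in>?Y. norm (w1 y - c) \<partial>lborel) \<le> ennreal (r * \<delta> / 2)"
  proof -
    let ?W = "\<lambda>y. r *\<^sub>R (G (x + r *\<^sub>R y) - \<xi>)"
    have "(\<integral>\<^sup>+y\<in>?Y. norm (w1 y - c) \<partial>lborel) \<le> (\<integral>\<^sup>+y\<in>?Y. (\<integral>\<^sup>+y'\<in>?Y. norm (w1 y' - w1 y) \<partial>lborel) \<partial>lborel)"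
      unfolding c_def by (intro nn_integral_unit_cube_mono norm_diff_mean_unit_cube_le w1i)
    also have "\<dots> \<le> ennreal ?K * (\<integral>\<^sup>+y\<in>?Y. norm (?W y) \<partial>lborel)"
    proof (rule poincare_unit_cube)
      show "smooth_map (\<lambda>y. (- r *\<^sub>R \<xi>) *v y + ?v k y)" for k
        by (rule gradient_affine_add(1)[OF smooth_map_rescale_1(1)[OF v]])
      show "(\<lambda>k. \<integral>\<^sup>+y\<in>?Y. norm ((- r *\<^sub>R \<xi>) *v y + ?v k y - w1 y) \<partial>lborel) \<longlonglongrightarrow> 0"
        using vw by (simp add: w1_def)
      have "(\<lambda>k. \<integral>\<^sup>+y\<in>?Y. norm (gradient (v k) (x + r *\<^sub>R y) - G (x + r *\<^sub>R y)) \<partial>lborel) \<longlonglongrightarrow> 0"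
        by (rule scaled[OF _ vG]) measurable
      from ennreal_tendsto_cmult[OF _ this, of "ennreal r"]
      have l: "(\<lambda>k. ennreal r * (\<integral>\<^sup>+y\<in>?Y. norm (gradient (v k) (x + r *\<^sub>R y) - G (x + r *\<^sub>R y)) \<partial>lborel)) \<longlonglongrightarrow> 0" by simp
      have "(\<integral>\<^sup>+y\<in>?Y. norm (gradient (\<lambda>y. (- r *\<^sub>R \<xi>) *v y + ?v k y) y - ?W y) \<partial>lborel)
        = ennreal r * (\<integral>\<^sup>+y\<in>?Y. norm (gradient (v k) (x + r *\<^sub>R y) - G (x + r *\<^sub>R y)) \<partial>lborel)" for k
      proof -
        have e: "gradient (\<lambda>y. (- r *\<^sub>R \<xi>) *v y + ?v k y) y - ?W y = r *\<^sub>R (gradient (v k) (x + r *\<^sub>R y) - G (x + r *\<^sub>R y))" for y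
          unfolding gradient_affine_add(2)[OF smooth_map_rescale_1(1)[OF v]] smooth_map_rescale_1(2)[OF v]
          by (simp add: scaleR_diff_right)
        have "(\<integral>\<^sup>+y\<in>?Y. norm (gradient (\<lambda>y. (- r *\<^sub>R \<xi>) *v y + ?v k y) y - ?W y) \<partial>lborel)
          = (\<integral>\<^sup>+y. ennreal r * (ennreal (norm (gradient (v k) (x + r *\<^sub>R y) - G (x + r *\<^sub>R y))) * indicator ?Y y) \<partial>lborel)"
          unfolding e using r by (intro nn_integral_cong) (simp add: ennreal_mult mult.assoc)
        also have "\<dots> = ennreal r * (\<integral>\<^sup>+y\<in>?Y. norm (gradient (v k) (x + r *\<^sub>R y) - G (x + r *\<^sub>R y)) \<partial>lborel)"
          by (rule nn_integral_cmult) measurable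
        finally show ?thesis .
      qed
      with l show "(\<lambda>k. \<integral>\<^sup>+y\<in>?Y. norm (gradient (\<lambda>y. (- r *\<^sub>R \<xi>) *v y + ?v k y) y - ?W y) \<partial>lborel) \<longlonglongrightarrow> 0"
        by (simp only:)
    qed measurable
    also have "(\<integral>\<^sup>+y\<in>?Y. norm (?W y) \<partial>lborel) = (\<integral>\<^sup>+y. ennreal r * (ennreal (norm (G (x + r *\<^sub>R y) - \<xi>)) * indicator ?Y y) \<partial>lborel)"
      using r by (intro nn_integral_cong) (simp add: ennreal_mult mult.assoc)
    also have "\<dots> = ennreal r * (\<integral>\<^sup>+y\<in>?Y. norm (G (x + r *\<^sub>R y) - \<xi>) \<partial>lborel)"
      by (rule nn_integral_cmult) measurable
    also have "ennreal ?K * \<dots> = ennreal r * (ennreal ?K * (\<integral>\<^sup>+y\<in>?Y. norm (G (x + r *\<^sub>R y) - \<xi>) \<partial>lborel))"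
      by (simp only: mult_ac)
    also have "\<dots> \<le> ennreal r * ennreal (\<delta> / 2)" by (rule mult_left_mono[OF \<Phi>]) simp
    also have "\<dots> = ennreal (r * \<delta> / 2)" using r \<delta>(1) by (simp flip: ennreal_mult)
    finally show ?thesis .
  qed
  from strong show ?thesis
  proof eventually_elim
    fix k assume k: "(\<integral>\<^sup>+y\<in>?Y. norm (?f k y - ?w y) \<partial>lborel) \<le> ennreal (r * \<delta> / 2)"
    let ?b = "\<lambda>y. (1/r) *\<^sub>R (f k (x + r *\<^sub>R y) - c)"
    \<comment> \<open>Normalised so that \<xi> + grad z(y) is exactly the gradient of
      \<open>f k\<close> at x + r y, and subtracting \<open>c\<close> removes the constant that L1
      closeness to a linear map would otherwise see.\<close>
    define z where "z y = (- \<xi>) *v y + ?b y" for y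
    note sb = smooth_map_rescale[OF f[of k], where a="1/r" and x=x and r=r and c=c]
    have z: "smooth_map z" unfolding z_def[abs_def] by (rule gradient_affine_add(1)[OF sb(1)])
    have gz: "\<xi> + gradient z y = gradient (f k) (x + r *\<^sub>R y)" for y
      unfolding z_def[abs_def] gradient_affine_add(2)[OF sb(1)] sb(2) using r by simp
    have "(\<integral>\<^sup>+y\<in>?Y. norm (z y) \<partial>lborel) = (\<integral>\<^sup>+y. ennreal (1/r) * (ennreal (norm ((?f k y - ?w y) + (w1 y - c))) * indicator ?Y y) \<partial>lborel)"
    proof (rule nn_integral_cong)
      fix y
      have "(?f k y - ?w y) + (w1 y - c) = r *\<^sub>R z y"
      proof -
        have "(- \<xi>) *v y = - (\<xi> *v y)" using scaleR_matrix_vector_assoc[of "-1" \<xi> y] by simp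
        moreover have "(- r *\<^sub>R \<xi>) *v y = - (r *\<^sub>R (\<xi> *v y))" using scaleR_matrix_vector_assoc[of "-r" \<xi> y] by simp
        ultimately show ?thesis unfolding z_def w1_def using r by (simp add: algebra_simps)
      qed
      then have "norm (z y) = (1/r) * norm ((?f k y - ?w y) + (w1 y - c))" using r by simp
      then have "ennreal (norm (z y)) = ennreal ((1/r) * norm ((?f k y - ?w y) + (w1 y - c)))" by (simp only:)
      also have "\<dots> = ennreal (1/r) * ennreal (norm ((?f k y - ?w y) + (w1 y - c)))"
        by (rule ennreal_mult) (use r in auto)
      finally show "ennreal (norm (z y)) * indicator ?Y y = ennreal (1/r) * (ennreal (norm ((?f k y - ?w y) + (w1 y - c))) * indicator ?Y y)"
        by (simp only: mult.assoc)
    qed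
    also have "\<dots> = ennreal (1/r) * (\<integral>\<^sup>+y\<in>?Y. norm ((?f k y - ?w y) + (w1 y - c)) \<partial>lborel)"
      by (rule nn_integral_cmult) measurable
    also have "\<dots> \<le> ennreal (1/r) * ((\<integral>\<^sup>+y\<in>?Y. norm (?f k y - ?w y) \<partial>lborel) + (\<integral>\<^sup>+y\<in>?Y. norm (w1 y - c) \<partial>lborel))"
      by (rule mult_left_mono[OF nn_integral_unit_cube_triangle]) measurable
    also have "\<dots> \<le> ennreal (1/r) * (ennreal (r * \<delta> / 2) + ennreal (r * \<delta> / 2))"
      by (intro mult_left_mono add_mono k poin) simp
    also have "\<dots> = ennreal (1/r) * ennreal (r * \<delta>)" using r \<delta>(1) by (simp add: mult.commute flip: ennreal_plus)
    also have "\<dots> = ennreal \<delta>" using r \<delta>(1) by (simp flip: ennreal_mult)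
    finally have "(\<integral>\<^sup>+y\<in>?Y. norm (z y) \<partial>lborel) \<le> ennreal \<delta>" .
    from \<delta>(2)[OF z this] show "ennreal (L \<xi>) \<le> (\<integral>\<^sup>+y\<in>?Y. ennreal (L (gradient (f k) (x + r *\<^sub>R y))) \<partial>lborel) + ennreal \<epsilon>"
      unfolding gz .
  qed
qed


text \<open>The functions x -> average of |G(x + r y) - G(x)| over the cube tend to 0 in L1 as r
  does, hence almost everywhere along a sequence of radii. A sequence of scales suffices for the
  blow-up, so translation continuity takes the place of Lebesgue's differentiation theorem.\<close>

lemma averages_converge_AE:
  fixes G :: "real^'n::finite \<Rightarrow> 'b::{banach, second_countable_topology}"
  assumes G: "integrable lborel G" and \<rho>: "0 < \<rho>"
  obtains r :: "nat \<Rightarrow> real" where "\<And>j. 0 < r j" "\<And>j. r j \<le> \<rho>"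
    "AE x in lborel. (\<lambda>j. \<integral>\<^sup>+y\<in>unit_cube. norm (G (x + r j *\<^sub>R y) - G x) \<partial>lborel) \<longlonglongrightarrow> 0"
proof -
  let ?Y = "unit_cube :: (real^'n) set"
  have Gm[measurable]: "G \<in> borel_measurable borel" using G by auto
  define \<Phi> where "\<Phi> r x = (\<integral>\<^sup>+y\<in>?Y. norm (G (x + r *\<^sub>R y) - G x) \<partial>lborel)" for r x
  have \<Phi>m[measurable]: "\<Phi> r \<in> borel_measurable borel" for r unfolding \<Phi>_def[abs_def] by measurable
  have "\<exists>r. 0 < r \<and> r \<le> \<rho> \<and> (\<integral>\<^sup>+x. \<Phi> r x \<partial>lborel) \<le> ennreal (inverse (real (Suc j)))" for j
  proof -
    have out: "indicat_real ?Y z = 0" if "norm z > real CARD('n)" for z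
    proof -
      have "(0::real^'n) \<in> ?Y" by (simp add: unit_cube_iff)
      from norm_diff_unit_cube[OF this, of z] that show ?thesis by (auto simp: indicator_def)
    qed
    have p: "inverse (real (Suc j)) > 0" by simp
    have im: "indicat_real ?Y \<in> borel_measurable borel" by measurable
    from L1_translation_average[OF G im out p]
    obtain d where d: "d > 0" "\<And>r. \<bar>r\<bar> < d \<Longrightarrow>
      (\<integral>\<^sup>+x. \<integral>\<^sup>+z. ennreal (indicat_real ?Y z) * ennreal (norm (G (x + r *\<^sub>R z) - G x)) \<partial>lborel \<partial>lborel)
      \<le> ennreal (inverse (real (Suc j))) * (\<integral>\<^sup>+z. indicat_real ?Y z \<partial>lborel)" by blast
    define r where "r = min \<rho> (d / 2)"
    have r: "0 < r" "r \<le> \<rho>" "\<bar>r\<bar> < d" using \<rho> d(1) by (auto simp: r_def min_def)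
    have "(\<integral>\<^sup>+z. indicat_real ?Y z \<partial>lborel) = 1" by (simp add: ennreal_indicator emeasure_unit_cube)
    moreover have "ennreal (indicat_real ?Y z) * ennreal (norm (G (x + r *\<^sub>R z) - G x)) = ennreal (norm (G (x + r *\<^sub>R z) - G x)) * indicator ?Y z" for x z
      by (simp only: ennreal_indicator mult.commute)
    ultimately have "(\<integral>\<^sup>+x. \<Phi> r x \<partial>lborel) \<le> ennreal (inverse (real (Suc j)))"
      using d(2)[OF r(3)] unfolding \<Phi>_def by (simp only: mult_1_right)
    with r show ?thesis by blast
  qed
  then have "\<exists>r. \<forall>j. 0 < r j \<and> r j \<le> \<rho> \<and> (\<integral>\<^sup>+x. \<Phi> (r j) x \<partial>lborel) \<le> ennreal (inverse (real (Suc j)))"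
    by (intro choice allI)
  then obtain r where r: "\<And>j. 0 < r j" "\<And>j. r j \<le> \<rho>" "\<And>j. (\<integral>\<^sup>+x. \<Phi> (r j) x \<partial>lborel) \<le> ennreal (inverse (real (Suc j)))" by blast
  \<comment> \<open>The passage from L1 to almost everywhere convergence is for real functions. Each
    \<open>\<Phi> (r j)\<close> has finite integral and is finite almost everywhere, so
    \<open>enn2real\<close> loses only a null set.\<close>
  let ?u = "\<lambda>j x. enn2real (\<Phi> (r j) x)"
  have ule: "(\<integral>\<^sup>+x. ennreal (norm (?u j x)) \<partial>lborel) \<le> ennreal (inverse (real (Suc j)))" for j
  proof -
    have "ennreal (norm (?u j x)) \<le> \<Phi> (r j) x" for x
      by (cases "\<Phi> (r j) x") auto
    then have "(\<integral>\<^sup>+x. ennreal (norm (?u j x)) \<partial>lborel) \<le> (\<integral>\<^sup>+x. \<Phi> (r j) x \<partial>lborel)" by (intro nn_integral_mono)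
    with r(3)[of j] show ?thesis by (rule order_trans[rotated])
  qed
  have ui: "integrable lborel (?u j)" for j
    unfolding integrable_iff_bounded using le_less_trans[OF ule[of j] ennreal_less_top] by simp
  have "(\<lambda>j. \<integral>x. norm (?u j x) \<partial>lborel) \<longlonglongrightarrow> 0"
  proof (rule tendsto_sandwich[of "\<lambda>_. 0" _ _ "\<lambda>j. inverse (real (Suc j))"])
    have "(\<integral>x. norm (?u j x) \<partial>lborel) \<le> inverse (real (Suc j))" for j
      using ule[of j] unfolding nn_integral_eq_integral[OF integrable_norm[OF ui] AE_I2[OF norm_ge_zero]]
      by (simp add: ennreal_le_iff)
    then show "\<forall>\<^sub>F j in sequentially. (\<integral>x. norm (?u j x) \<partial>lborel) \<le> inverse (real (Suc j))" by simp
  qed (auto intro: LIMSEQ_inverse_real_of_nat simp del: of_nat_Suc)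
  from tendsto_L1_AE_subseq[OF ui this] obtain \<sigma> :: "nat \<Rightarrow> nat" where
    \<sigma>: "AE x in lborel. (\<lambda>j. ?u (\<sigma> j) x) \<longlonglongrightarrow> 0" by blast
  have "AE x in lborel. \<Phi> (r j) x \<noteq> \<infinity>" for j
    by (rule nn_integral_PInf_AE) (use le_less_trans[OF r(3)[of j] ennreal_less_top] in auto)
  then have "AE x in lborel. \<forall>j. \<Phi> (r j) x \<noteq> \<infinity>" unfolding AE_all_countable by blast
  with \<sigma> have "AE x in lborel. (\<lambda>j. \<Phi> (r (\<sigma> j)) x) \<longlonglongrightarrow> 0"
  proof eventually_elim
    fix x assume l: "(\<lambda>j. ?u (\<sigma> j) x) \<longlonglongrightarrow> 0" and fin: "\<forall>j. \<Phi> (r j) x \<noteq> \<infinity>"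
    have "\<Phi> (r (\<sigma> j)) x = ennreal (?u (\<sigma> j) x)" for j
      using fin by (simp add: ennreal_enn2real_if)
    with tendsto_ennrealI[OF l] show "(\<lambda>j. \<Phi> (r (\<sigma> j)) x) \<longlonglongrightarrow> 0" by simp
  qed
  then show ?thesis using r by (intro that[of "\<lambda>j. r (\<sigma> j)"]) (auto simp: \<Phi>_def)
qed

text \<open>After exchanging the integrals each \<open>y\<close> contributes at most the integral of
  \<open>h\<close> over the translate of \<open>S'\<close> by r y, which lies in \<open>S\<close>,
  and the cube has measure 1. Averaging thus never increases the energy, whatever the scale.\<close>

lemma nn_integral_averages_le:
  fixes h :: "real^'n::finite \<Rightarrow> ennreal"
  assumes [measurable]: "h \<in> borel_measurable borel" "S \<in> sets borel" "S' \<in> sets borel"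
    and sub: "\<And>x y. x \<in> S' \<Longrightarrow> y \<in> unit_cube \<Longrightarrow> x + r *\<^sub>R y \<in> S"
  shows "(\<integral>\<^sup>+x\<in>S'. (\<integral>\<^sup>+y\<in>unit_cube. h (x + r *\<^sub>R y) \<partial>lborel) \<partial>lborel) \<le> (\<integral>\<^sup>+x\<in>S. h x \<partial>lborel)"
proof -
  let ?Y = "unit_cube :: (real^'n) set"
  have "(\<integral>\<^sup>+x\<in>S'. (\<integral>\<^sup>+y\<in>?Y. h (x + r *\<^sub>R y) \<partial>lborel) \<partial>lborel)
      = (\<integral>\<^sup>+x. \<integral>\<^sup>+y. h (x + r *\<^sub>R y) * indicator ?Y y * indicator S' x \<partial>lborel \<partial>lborel)"
    by (intro nn_integral_cong nn_integral_multc[symmetric]) measurable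
  also have "\<dots> = (\<integral>\<^sup>+y. \<integral>\<^sup>+x. h (x + r *\<^sub>R y) * indicator ?Y y * indicator S' x \<partial>lborel \<partial>lborel)"
    by (rule lborel_pair.Fubini') measurable
  also have "\<dots> \<le> (\<integral>\<^sup>+y\<in>?Y. (\<integral>\<^sup>+x\<in>S. h x \<partial>lborel) \<partial>lborel)"
  proof (rule nn_integral_mono)
    fix y :: "real^'n"
    have "(\<integral>\<^sup>+x. h (x + r *\<^sub>R y) * indicator ?Y y * indicator S' x \<partial>lborel)
        \<le> (\<integral>\<^sup>+x. h (x + r *\<^sub>R y) * indicator S (x + r *\<^sub>R y) * indicator ?Y y \<partial>lborel)"
      using sub by (intro nn_integral_mono) (auto simp: indicator_def)
    also have "\<dots> = (\<integral>\<^sup>+x. h (x + r *\<^sub>R y) * indicator S (x + r *\<^sub>R y) \<partial>lborel) * indicator ?Y y"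
      by (rule nn_integral_multc) measurable
    also have "(\<integral>\<^sup>+x. h (x + r *\<^sub>R y) * indicator S (x + r *\<^sub>R y) \<partial>lborel) = (\<integral>\<^sup>+x\<in>S. h x \<partial>lborel)"
      by (rule nn_integral_lborel_translate) measurable
    finally show "(\<integral>\<^sup>+x. h (x + r *\<^sub>R y) * indicator ?Y y * indicator S' x \<partial>lborel) \<le> (\<integral>\<^sup>+x\<in>S. h x \<partial>lborel) * indicator ?Y y" .
  qed
  also have "\<dots> = (\<integral>\<^sup>+x\<in>S. h x \<partial>lborel)" by (rule nn_integral_unit_cube_const)
  finally show ?thesis .
qed

text \<open>For almost every x in \<open>S'\<close>, L(G(x)) is at most the lower limit over scales
  j of the lower limit over k of the averages \<open>F j k x\<close>, by the blow-up at x. Fatou's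
  lemma moves both lower limits out of the integral, and each integral of \<open>F j k\<close> over
  \<open>S'\<close> is at most the energy of \<open>f k\<close> on \<open>S\<close>. The slack 1/(k
  + 1) in \<open>fE\<close> is what mollification adds; it disappears in the limit.\<close>

lemma local_lower_semicontinuity:
  fixes L :: "real^'n::finite^'m::finite \<Rightarrow> real" and f v :: "nat \<Rightarrow> real^'n \<Rightarrow> real^'m" and U :: "real^'n \<Rightarrow> real^'m"
  assumes L: "W1_quasiconvex q L" "continuous_on UNIV L" "\<And>\<zeta>. 0 \<le> L \<zeta>" and q: "1 < q"
    and C: "0 \<le> C" "\<And>\<zeta>. L \<zeta> \<le> C * (1 + norm \<zeta> powr q)"
    and \<beta>: "0 < \<beta>" "\<And>\<zeta>. \<beta> * norm \<zeta> powr q \<le> L \<zeta>"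
    and f: "\<And>k. smooth_map (f k)" and c: "0 \<le> c"
    and fE: "\<And>k. (\<integral>\<^sup>+y\<in>S. ennreal (L (gradient (f k) y)) \<partial>lborel) \<le> ennreal (c + inverse (real (Suc k)))"
    and v: "\<And>k. smooth_map (v k)" and vM: "\<And>k. (\<integral>\<^sup>+y\<in>S. norm (gradient (v k) y) \<partial>lborel) \<le> ennreal M"
    and vU: "(\<lambda>k. \<integral>\<^sup>+y\<in>S. norm (v k y - U y) \<partial>lborel) \<longlonglongrightarrow> 0"
    and vG: "(\<lambda>k. \<integral>\<^sup>+y\<in>S. norm (gradient (v k) y - G y) \<partial>lborel) \<longlonglongrightarrow> 0"
    and U: "integrable lborel U" and G: "integrable lborel G"
    and S[measurable]: "S \<in> sets borel" and S': "S' \<in> sets borel" and Sfin: "emeasure lborel S < \<infinity>"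
    and d: "0 < d" "\<And>x. x \<in> S' \<Longrightarrow> cball x d \<subseteq> S"
    and weak: "\<And>\<psi> B. \<psi> \<in> borel_measurable borel \<Longrightarrow> (\<And>x. \<bar>\<psi> x\<bar> \<le> B) \<Longrightarrow> (\<And>x. x \<notin> S \<Longrightarrow> \<psi> x = 0)
      \<Longrightarrow> (\<lambda>k. \<integral>x. \<psi> x *\<^sub>R f k x \<partial>lborel) \<longlonglongrightarrow> (\<integral>x. \<psi> x *\<^sub>R U x \<partial>lborel)"
  shows "(\<integral>\<^sup>+x\<in>S'. ennreal (L (G x)) \<partial>lborel) \<le> ennreal c"
proof -
  note [measurable] = S'
  have Lm[measurable]: "L \<in> borel_measurable borel" using L(2) by (rule borel_measurable_continuous_onI)
  have Gm[measurable]: "G \<in> borel_measurable borel" using G by auto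
  have gfm[measurable]: "gradient (f k) \<in> borel_measurable borel" for k by (rule gradient_borel[OF f])
  obtain m where m: "0 \<le> m" "emeasure lborel S = ennreal m" using Sfin by (cases "emeasure lborel S") auto
  \<comment> \<open>By t \<le> 1 + t^q and coercivity the gradients of \<open>f k\<close> have L1
    norm at most m + (c + 1)/\<beta> on \<open>S\<close>, where c + 1 bounds c + 1/(k + 1). The
    maximum with |M| yields one nonnegative bound for both sequences.\<close>
  define M' where "M' = max (\<bar>M\<bar>) (m + (c + 1) / \<beta>)"
  have M': "0 \<le> M'" "M \<le> M'" "m + (c + 1) / \<beta> \<le> M'" unfolding M'_def by linarith+
  have fM: "(\<integral>\<^sup>+y\<in>S. norm (gradient (f k) y) \<partial>lborel) \<le> ennreal M'" for k
  proof -
    have "(\<integral>\<^sup>+y\<in>S. norm (gradient (f k) y) \<partial>lborel) \<le> (\<integral>\<^sup>+y. indicator S y + ennreal (1 / \<beta>) * (ennreal (L (gradient (f k) y)) * indicator S y) \<partial>lborel)"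
    proof (rule nn_integral_mono)
      fix y
      have "norm (gradient (f k) y) \<le> 1 + norm (gradient (f k) y) powr q" by (rule le_one_plus_powr[OF norm_ge_zero q])
      also have "norm (gradient (f k) y) powr q \<le> 1 / \<beta> * L (gradient (f k) y)"
        using \<beta>(2)[of "gradient (f k) y"] \<beta>(1) by (simp add: le_divide_eq mult.commute)
      finally have "ennreal (norm (gradient (f k) y)) \<le> ennreal (1 + 1 / \<beta> * L (gradient (f k) y))" by (simp add: ennreal_leI)
      also have "\<dots> = 1 + ennreal (1 / \<beta> * L (gradient (f k) y))"
        using \<beta>(1) L(3) by (subst ennreal_plus) (auto intro!: mult_nonneg_nonneg)
      also have "ennreal (1 / \<beta> * L (gradient (f k) y)) = ennreal (1 / \<beta>) * ennreal (L (gradient (f k) y))"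
        using \<beta>(1) L(3) by (intro ennreal_mult) auto
      finally show "ennreal (norm (gradient (f k) y)) * indicator S y \<le> indicator S y + ennreal (1 / \<beta>) * (ennreal (L (gradient (f k) y)) * indicator S y)"
        by (auto simp: indicator_def)
    qed
    also have "\<dots> = emeasure lborel S + ennreal (1 / \<beta>) * (\<integral>\<^sup>+y\<in>S. ennreal (L (gradient (f k) y)) \<partial>lborel)"
      by (subst nn_integral_add) (auto simp: nn_integral_cmult)
    also have "\<dots> \<le> ennreal m + ennreal (1 / \<beta>) * ennreal (c + 1)"
    proof (intro add_mono mult_left_mono order_trans[OF fE])
      show "ennreal (c + inverse (real (Suc k))) \<le> ennreal (c + 1)" by (intro ennreal_leI) (simp add: field_simps)
    qed (auto simp: m)
    also have "\<dots> = ennreal (m + (c + 1) / \<beta>)"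
      using m(1) c \<beta>(1) by (subst ennreal_mult[symmetric], simp, simp, subst ennreal_plus[symmetric]) auto
    also have "\<dots> \<le> ennreal M'" by (rule ennreal_leI[OF M'(3)])
    finally show ?thesis .
  qed
  have vM': "(\<integral>\<^sup>+y\<in>S. norm (gradient (v k) y) \<partial>lborel) \<le> ennreal M'" for k
    by (rule order_trans[OF vM ennreal_leI[OF M'(2)]])
  \<comment> \<open>Points of the unit cube have norm at most N, so radii up to d/N keep x + r y
    within distance d of x.\<close>
  have "0 < d / real CARD('n)" using d(1) by simp
  then obtain r :: "nat \<Rightarrow> real" where r: "\<And>j. 0 < r j" "\<And>j. r j \<le> d / real CARD('n)"
    and ae: "AE x in lborel. (\<lambda>j. \<integral>\<^sup>+y\<in>unit_cube. norm (G (x + r j *\<^sub>R y) - G x) \<partial>lborel) \<longlonglongrightarrow> 0"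
    by (rule averages_converge_AE[OF G]) blast
  have sub: "x + r j *\<^sub>R y \<in> S" if "x \<in> S'" "y \<in> unit_cube" for x y j
  proof -
    have "(0::real^'n) \<in> unit_cube" by (simp add: unit_cube_iff)
    from norm_diff_unit_cube[OF this that(2)] have "norm y \<le> real CARD('n)" by simp
    then have "r j * norm y \<le> d / real CARD('n) * real CARD('n)" using r d(1) by (intro mult_mono) (auto intro: less_imp_le)
    then have "norm (r j *\<^sub>R y) \<le> d" using r(1)[of j] by simp
    then have "x + r j *\<^sub>R y \<in> cball x d" by (simp add: dist_norm)
    with d(2)[OF that(1)] show ?thesis by blast
  qed
  define F where "F j k x = (\<integral>\<^sup>+y\<in>unit_cube. ennreal (L (gradient (f k) (x + r j *\<^sub>R y))) \<partial>lborel)" for j k x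
  have Fm[measurable]: "F j k \<in> borel_measurable borel" for j k unfolding F_def[abs_def] by measurable
  have low: "AE x in lborel. ennreal (L (G x)) * indicator S' x \<le> liminf (\<lambda>j. liminf (\<lambda>k. F j k x * indicator S' x))"
    using ae
  proof eventually_elim
    fix x assume l: "(\<lambda>j. \<integral>\<^sup>+y\<in>unit_cube. norm (G (x + r j *\<^sub>R y) - G x) \<partial>lborel) \<longlonglongrightarrow> 0"
    show "ennreal (L (G x)) * indicator S' x \<le> liminf (\<lambda>j. liminf (\<lambda>k. F j k x * indicator S' x))"
    proof (cases "x \<in> S'")
      case x: True
      have "ennreal (L (G x)) \<le> liminf (\<lambda>j. liminf (\<lambda>k. F j k x))"
      proof (rule ennreal_le_epsilon)
        fix \<epsilon> :: real assume \<epsilon>: "0 < \<epsilon>"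
        \<comment> \<open>Depends on \<open>G x\<close> and \<epsilon> but not on the scale, so it
          can be compared with the averages of |G(x + r y) - G(x)| for all large j.\<close>
        obtain \<delta> where \<delta>: "0 < \<delta>" "\<And>z :: real^'n \<Rightarrow> real^'m. smooth_map z \<Longrightarrow> (\<integral>\<^sup>+y\<in>unit_cube. norm (z y) \<partial>lborel) \<le> ennreal \<delta>
          \<Longrightarrow> ennreal (L (G x)) \<le> (\<integral>\<^sup>+y\<in>unit_cube. ennreal (L (G x + gradient z y)) \<partial>lborel) + ennreal \<epsilon>"
          by (rule quasiconvex_near_affine[OF L q C \<beta> \<epsilon>, of "G x"]) blast
        have "(\<lambda>j. ennreal (real CARD('n) * 2 ^ CARD('n)) * (\<integral>\<^sup>+y\<in>unit_cube. norm (G (x + r j *\<^sub>R y) - G x) \<partial>lborel)) \<longlonglongrightarrow> ennreal (real CARD('n) * 2 ^ CARD('n)) * 0"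
          by (intro ennreal_tendsto_cmult l) simp
        then have "\<forall>\<^sub>F j in sequentially. ennreal (real CARD('n) * 2 ^ CARD('n)) * (\<integral>\<^sup>+y\<in>unit_cube. norm (G (x + r j *\<^sub>R y) - G x) \<partial>lborel) < ennreal (\<delta> / 2)"
          using \<delta>(1) by (intro order_tendstoD(2)) auto
        then have "\<forall>\<^sub>F j in sequentially. ennreal (L (G x)) - ennreal \<epsilon> \<le> liminf (\<lambda>k. F j k x)"
        proof eventually_elim
          fix j assume j: "ennreal (real CARD('n) * 2 ^ CARD('n)) * (\<integral>\<^sup>+y\<in>unit_cube. norm (G (x + r j *\<^sub>R y) - G x) \<partial>lborel) < ennreal (\<delta> / 2)"
          have "\<forall>\<^sub>F k in sequentially. ennreal (L (G x)) \<le> (\<integral>\<^sup>+y\<in>unit_cube. ennreal (L (gradient (f k) (x + r j *\<^sub>R y))) \<partial>lborel) + ennreal \<epsilon>"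
            by (rule blow_up_lower_bound[OF f fM M'(1) v vM' vU vG U Gm S weak r(1) sub[OF x] \<delta> less_imp_le[OF j]])
          then have "\<forall>\<^sub>F k in sequentially. ennreal (L (G x)) - ennreal \<epsilon> \<le> F j k x"
            by eventually_elim (simp add: F_def ennreal_minus_le_iff add.commute)
          then show "ennreal (L (G x)) - ennreal \<epsilon> \<le> liminf (\<lambda>k. F j k x)" by (rule Liminf_bounded)
        qed
        then have "ennreal (L (G x)) - ennreal \<epsilon> \<le> liminf (\<lambda>j. liminf (\<lambda>k. F j k x))" by (rule Liminf_bounded)
        then show "ennreal (L (G x)) \<le> liminf (\<lambda>j. liminf (\<lambda>k. F j k x)) + ennreal \<epsilon>"
          by (simp add: ennreal_minus_le_iff add.commute)
      qed
      then show ?thesis using x by simp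
    qed simp
  qed
  have "(\<integral>\<^sup>+x\<in>S'. ennreal (L (G x)) \<partial>lborel) \<le> (\<integral>\<^sup>+x. liminf (\<lambda>j. liminf (\<lambda>k. F j k x * indicator S' x)) \<partial>lborel)"
    by (rule nn_integral_mono_AE[OF low])
  also have "\<dots> \<le> liminf (\<lambda>j. \<integral>\<^sup>+x. liminf (\<lambda>k. F j k x * indicator S' x) \<partial>lborel)"
    by (rule nn_integral_liminf) measurable
  also have "\<dots> \<le> ennreal c"
  proof -
    have "(\<integral>\<^sup>+x. liminf (\<lambda>k. F j k x * indicator S' x) \<partial>lborel) \<le> ennreal c" for j
    proof -
      have "(\<integral>\<^sup>+x. liminf (\<lambda>k. F j k x * indicator S' x) \<partial>lborel) \<le> liminf (\<lambda>k. \<integral>\<^sup>+x. F j k x * indicator S' x \<partial>lborel)"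
        by (rule nn_integral_liminf) measurable
      also have "\<dots> \<le> liminf (\<lambda>k. ennreal (c + inverse (real (Suc k))))"
      proof (rule Liminf_mono, rule always_eventually, rule allI)
        fix k
        have "(\<integral>\<^sup>+x. F j k x * indicator S' x \<partial>lborel) \<le> (\<integral>\<^sup>+y\<in>S. ennreal (L (gradient (f k) y)) \<partial>lborel)"
          unfolding F_def by (rule nn_integral_averages_le[OF _ S S' sub]) measurable
        then show "(\<integral>\<^sup>+x. F j k x * indicator S' x \<partial>lborel) \<le> ennreal (c + inverse (real (Suc k)))"
          by (rule order_trans[OF _ fE])
      qed
      also have "\<dots> = ennreal c"
      proof (rule lim_imp_Liminf)
        have "(\<lambda>k. c + inverse (real (Suc k))) \<longlonglongrightarrow> c + 0" by (intro tendsto_add tendsto_const LIMSEQ_inverse_real_of_nat)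
        then show "(\<lambda>k. ennreal (c + inverse (real (Suc k)))) \<longlonglongrightarrow> ennreal c" by (intro tendsto_ennrealI) simp
      qed simp
      finally show ?thesis .
    qed
    then have "liminf (\<lambda>j. \<integral>\<^sup>+x. liminf (\<lambda>k. F j k x * indicator S' x) \<partial>lborel) \<le> liminf (\<lambda>j::nat. ennreal c)"
      by (intro Liminf_mono always_eventually) blast
    then show ?thesis by (simp add: Liminf_const)
  qed
  finally show ?thesis .
qed

section \<open>Sobolev functions\<close>

text \<open>The upper limit controls the quotient outside a ball, and continuity bounds
  \<open>L\<close> on the ball.\<close>

lemma growth_bound:
  fixes L :: "'a::euclidean_space \<Rightarrow> real"
  assumes L: "continuous_on UNIV L" "\<And>\<zeta>. 0 \<le> L \<zeta>"
    and lim: "Limsup at_infinity (\<lambda>\<xi>. ereal (L \<xi> / norm \<xi> powr q)) < \<infinity>"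
  obtains C where "0 \<le> C" "\<And>\<zeta>. L \<zeta> \<le> C * (1 + norm \<zeta> powr q)"
proof -
  obtain c where c: "Limsup at_infinity (\<lambda>\<xi>. ereal (L \<xi> / norm \<xi> powr q)) < ereal c"
    using ereal_dense2[OF lim] by blast
  from Limsup_lessD[OF this] obtain b where b: "\<And>\<zeta>. b \<le> norm \<zeta> \<Longrightarrow> L \<zeta> / norm \<zeta> powr q < c"
    unfolding eventually_at_infinity by auto
  \<comment> \<open>A radius of at least 1 ensures |\<zeta>| > 0 outside the ball, so that the
    quotient can be cleared there.\<close>
  have "compact (L ` cball 0 (max b 1))"
    using continuous_on_subset[OF L(1) subset_UNIV] by (intro compact_continuous_image) auto
  from compact_imp_bounded[OF this] obtain B where B': "\<forall>y\<in>L ` cball 0 (max b 1). norm y \<le> B"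
    unfolding bounded_iff by blast
  have B: "\<bar>L \<zeta>\<bar> \<le> B" if "norm \<zeta> \<le> max b 1" for \<zeta>
    using B' that by (simp add: image_iff)
  define C where "C = max \<bar>c\<bar> \<bar>B\<bar>"
  have C: "0 \<le> C" "c \<le> C" "B \<le> C" unfolding C_def by linarith+
  show ?thesis
  proof (rule that[OF C(1)])
    fix \<zeta> :: 'a
    show "L \<zeta> \<le> C * (1 + norm \<zeta> powr q)"
    proof (cases "norm \<zeta> \<le> max b 1")
      case True
      have "L \<zeta> \<le> C * 1" using B[OF True] C(3) by linarith
      also have "\<dots> \<le> C * (1 + norm \<zeta> powr q)" using C(1) by (intro mult_left_mono) auto
      finally show ?thesis .
    next
      case False
      then have p: "0 < norm \<zeta> powr q" by auto
      have "L \<zeta> / norm \<zeta> powr q < c" using False by (intro b) linarith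
      then have "L \<zeta> < c * norm \<zeta> powr q" using p by (simp add: pos_divide_less_eq)
      also have "\<dots> \<le> C * norm \<zeta> powr q" using C(2) p by (intro mult_right_mono) auto
      also have "\<dots> \<le> C * (1 + norm \<zeta> powr q)" using C(1) by (intro mult_left_mono) auto
      finally show ?thesis by simp
    qed
  qed
qed

text \<open>Let g = |H|^q. Growth and Jensen's inequality bound L of the mollified map by C (1 +
  mollified g), so it exceeds its minimum with C (1 + g) by at most C |mollified g - g|. The minimum
  has the fixed integrable majorant C (1 + g) on \<open>S\<close> and converges along suitable
  radii; the excess tends to 0 in L1. One radius is then picked that also brings \<open>U\<close>
  close to its mollification.\<close>

lemma mollify_energy:
  fixes L :: "'b::euclidean_space \<Rightarrow> real" and H :: "real^'n::finite \<Rightarrow> 'b" and U :: "real^'n \<Rightarrow> 'c::euclidean_space"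
  assumes L: "continuous_on UNIV L" "\<And>\<zeta>. 0 \<le> L \<zeta>" and C: "0 \<le> C" "\<And>\<zeta>. L \<zeta> \<le> C * (1 + norm \<zeta> powr q)"
    and q: "1 < q" and H: "integrable lborel H" "integrable lborel (\<lambda>x. norm (H x) powr q)" and U: "integrable lborel U"
    and S[measurable]: "S \<in> sets borel" and Sfin: "emeasure lborel S < \<infinity>" and e: "(e::real) > 0" "0 < d"
  obtains \<delta> where "0 < \<delta>" "\<delta> < d" "(\<integral>\<^sup>+x. norm (mollify \<delta> U x - U x) \<partial>lborel) \<le> ennreal e"
    "(\<integral>\<^sup>+x\<in>S. ennreal (L (mollify \<delta> H x)) \<partial>lborel) \<le> (\<integral>\<^sup>+x\<in>S. ennreal (L (H x)) \<partial>lborel) + ennreal e"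
proof -
  define g where "g x = norm (H x) powr q" for x
  have gi: "integrable lborel g" using H(2) by (simp add: g_def[abs_def])
  have Hm[measurable]: "H \<in> borel_measurable borel" and gm[measurable]: "g \<in> borel_measurable borel"
    using H(1) gi by auto
  have Lm[measurable]: "L \<in> borel_measurable borel" using L(1) by (rule borel_measurable_continuous_onI)
  have mm[measurable]: "mollify \<delta> H \<in> borel_measurable borel" "mollify \<delta> g \<in> borel_measurable borel" for \<delta>
    by (rule mollify_borel, measurable)+
  have g0: "0 \<le> g x" for x by (simp add: g_def)
  have Cg: "0 \<le> C * (1 + g x)" for x using C(1) g0 by simp
  obtain \<delta> where \<delta>: "\<And>k. \<delta> k > 0" "\<delta> \<longlonglongrightarrow> 0" and ae: "AE x in lborel. (\<lambda>k. mollify (\<delta> k) H x) \<longlonglongrightarrow> H x"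
    using mollify_AE_subseq[OF H(1)] by blast
  \<comment> \<open>Multiplied by C this leaves at most e/2; the added 1 covers C = 0.\<close>
  have e': "0 < e / (2 * (C + 1))" using e C(1) by (intro divide_pos_pos) auto
  obtain d1 where d1: "d1 > 0" "\<And>s. 0 < s \<Longrightarrow> s < d1 \<Longrightarrow> (\<integral>\<^sup>+x. norm (mollify s g x - g x) \<partial>lborel) \<le> ennreal (e / (2 * (C + 1)))"
    using mollify_L1_converges[OF gi e'] by blast
  obtain d2 where d2: "d2 > 0" "\<And>s. 0 < s \<Longrightarrow> s < d2 \<Longrightarrow> (\<integral>\<^sup>+x. norm (mollify s U x - U x) \<partial>lborel) \<le> ennreal e"
    using mollify_L1_converges[OF U e(1)] by blast
  let ?F = "\<integral>\<^sup>+x\<in>S. ennreal (L (H x)) \<partial>lborel"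
  let ?u = "\<lambda>k x. ennreal (min (L (mollify (\<delta> k) H x)) (C * (1 + g x))) * indicator S x"
  have wfin: "(\<integral>\<^sup>+x. ennreal (C * (1 + g x)) * indicator S x \<partial>lborel) < \<infinity>"
  proof -
    have "(\<integral>\<^sup>+x. ennreal (C * (1 + g x)) * indicator S x \<partial>lborel) \<le> (\<integral>\<^sup>+x. ennreal C * indicator S x + ennreal C * ennreal (g x) \<partial>lborel)"
    proof (rule nn_integral_mono)
      fix x
      have "ennreal (C * (1 + g x)) = ennreal C + ennreal C * ennreal (g x)"
        using C(1) g0[of x] by (simp add: distrib_left ennreal_mult)
      then show "ennreal (C * (1 + g x)) * indicator S x \<le> ennreal C * indicator S x + ennreal C * ennreal (g x)"
        by (auto simp: indicator_def)
    qed
    also have "\<dots> = ennreal C * emeasure lborel S + ennreal C * (\<integral>\<^sup>+x. ennreal (g x) \<partial>lborel)"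
      by (subst nn_integral_add) (auto simp: nn_integral_cmult)
    also have "\<dots> < \<infinity>"
      using Sfin gi g0 by (auto simp: ennreal_mult_less_top integrable_iff_bounded)
    finally show ?thesis .
  qed
  have "(\<lambda>k. \<integral>\<^sup>+x. ?u k x \<partial>lborel) \<longlonglongrightarrow> ?F"
  proof (rule nn_integral_dominated_convergence[where w="\<lambda>x. ennreal (C * (1 + g x)) * indicator S x"])
    show "AE x in lborel. ?u k x \<le> ennreal (C * (1 + g x)) * indicator S x" for k
      by (intro AE_I2 mult_right_mono ennreal_leI) auto
    show "AE x in lborel. (\<lambda>k. ?u k x) \<longlonglongrightarrow> ennreal (L (H x)) * indicator S x"
      using ae
    proof eventually_elim
      fix x assume l: "(\<lambda>k. mollify (\<delta> k) H x) \<longlonglongrightarrow> H x"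
      have "isCont L (H x)" using L(1) by (simp add: continuous_on_eq_continuous_at)
      from isCont_tendsto_compose[OF this l]
      have "(\<lambda>k. min (L (mollify (\<delta> k) H x)) (C * (1 + g x))) \<longlonglongrightarrow> min (L (H x)) (C * (1 + g x))"
        by (intro tendsto_min tendsto_const)
      also have "min (L (H x)) (C * (1 + g x)) = L (H x)" using C(2)[of "H x"] by (simp add: g_def)
      finally show "(\<lambda>k. ?u k x) \<longlonglongrightarrow> ennreal (L (H x)) * indicator S x"
        by (cases "x \<in> S") (auto intro: tendsto_ennrealI)
    qed
  qed (use wfin in measurable)
  moreover have Ffin: "?F < \<infinity>"
  proof (rule le_less_trans[OF _ wfin], rule nn_integral_mono)
    show "ennreal (L (H x)) * indicator S x \<le> ennreal (C * (1 + g x)) * indicator S x" for x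
      using C(2)[of "H x"] by (intro mult_right_mono ennreal_leI) (auto simp: g_def)
  qed
  have "?F < ?F + ennreal (e/2)"
    using Ffin e(1) by (cases ?F) (auto simp: ennreal_less_iff simp flip: ennreal_plus)
  ultimately have "\<forall>\<^sub>F k in sequentially. (\<integral>\<^sup>+x. ?u k x \<partial>lborel) < ?F + ennreal (e/2)"
    by (intro order_tendstoD(2))
  moreover have "\<forall>\<^sub>F k in sequentially. \<delta> k < min d (min d1 d2)"
    using \<delta>(2) e(2) d1(1) d2(1) by (intro order_tendstoD(2)) auto
  ultimately have "\<forall>\<^sub>F k in sequentially. (\<integral>\<^sup>+x. ?u k x \<partial>lborel) < ?F + ennreal (e/2) \<and> \<delta> k < min d (min d1 d2)"
    by (rule eventually_conj)
  from eventually_happens'[OF _ this] obtain k where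
    k: "(\<integral>\<^sup>+x. ?u k x \<partial>lborel) < ?F + ennreal (e/2)" "\<delta> k < min d (min d1 d2)" by auto
  have "(\<integral>\<^sup>+x\<in>S. ennreal (L (mollify (\<delta> k) H x)) \<partial>lborel) \<le>
     (\<integral>\<^sup>+x. ?u k x + ennreal C * ennreal (norm (mollify (\<delta> k) g x - g x)) \<partial>lborel)"
  proof (rule nn_integral_mono)
    fix x
    have "L (mollify (\<delta> k) H x) \<le> C * (1 + norm (mollify (\<delta> k) H x) powr q)" by (rule C(2))
    also have "\<dots> \<le> C * (1 + mollify (\<delta> k) g x)"
      unfolding g_def[abs_def] using C(1) by (intro mult_left_mono add_left_mono mollify_jensen H q \<delta>(1))
    also have "\<dots> \<le> C * (1 + g x) + C * norm (mollify (\<delta> k) g x - g x)"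
      unfolding distrib_left[symmetric] using C(1) by (intro mult_left_mono) (auto simp: abs_if)
    finally have "L (mollify (\<delta> k) H x) \<le> min (L (mollify (\<delta> k) H x)) (C * (1 + g x)) + C * norm (mollify (\<delta> k) g x - g x)"
      using C(1) by (simp add: min_def)
    then have "ennreal (L (mollify (\<delta> k) H x)) \<le> ennreal (min (L (mollify (\<delta> k) H x)) (C * (1 + g x)) + C * norm (mollify (\<delta> k) g x - g x))"
      by (rule ennreal_leI)
    also have "\<dots> = ennreal (min (L (mollify (\<delta> k) H x)) (C * (1 + g x))) + ennreal C * ennreal (norm (mollify (\<delta> k) g x - g x))"
      using C(1) Cg[of x] L(2) by (subst ennreal_plus) (auto simp: ennreal_mult)
    finally show "ennreal (L (mollify (\<delta> k) H x)) * indicator S x \<le> ?u k x + ennreal C * ennreal (norm (mollify (\<delta> k) g x - g x))"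
      by (cases "x \<in> S") auto
  qed
  also have "\<dots> = (\<integral>\<^sup>+x. ?u k x \<partial>lborel) + ennreal C * (\<integral>\<^sup>+x. norm (mollify (\<delta> k) g x - g x) \<partial>lborel)"
    by (subst nn_integral_add) (auto simp: nn_integral_cmult)
  also have "\<dots> \<le> (?F + ennreal (e/2)) + ennreal C * ennreal (e / (2 * (C + 1)))"
    using k \<delta>(1)[of k] by (intro add_mono mult_left_mono d1(2)) auto
  also have "ennreal C * ennreal (e / (2 * (C + 1))) = ennreal (C * (e / (2 * (C + 1))))"
    using C(1) e' by (intro ennreal_mult[symmetric]) auto
  also have "\<dots> \<le> ennreal (e/2)"
    using C(1) e(1) by (intro ennreal_leI) (simp add: field_simps)
  finally have "(\<integral>\<^sup>+x\<in>S. ennreal (L (mollify (\<delta> k) H x)) \<partial>lborel) \<le> ?F + ennreal (e/2) + ennreal (e/2)"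
    by (simp add: add_left_mono)
  also have "\<dots> = ?F + ennreal e" using e(1) by (simp add: add.assoc flip: ennreal_plus)
  finally show ?thesis using k(2) \<delta>(1)[of k] by (intro that[of "\<delta> k"] d2(2)) auto
qed

lemma smooth_map_mollify:
  fixes U :: "real^'n::finite \<Rightarrow> real^'m::finite"
  assumes "integrable lborel U" "0 < d"
  shows "smooth_map (mollify d U)"
  unfolding smooth_map_def mollify_vec_nth[OF assms]
  using smooth_mollify[OF integrable_vec_nth[OF assms(1)] assms(2)] by blast

lemma gradient_mollify:
  fixes U :: "real^'n::finite \<Rightarrow> real^'m::finite" and H :: "real^'n \<Rightarrow> real^'n^'m"
  assumes U: "integrable lborel U" and H: "integrable lborel H" and d: "0 < d" "cball x d \<subseteq> V"
    and weak: "\<And>\<phi> i j. \<phi> \<in> test_functions V \<Longrightarrow>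
      (\<integral>y. U y $ i * partial_deriv j \<phi> y \<partial>lborel) = - (\<integral>y. H y $ i $ j * \<phi> y \<partial>lborel)"
  shows "gradient (mollify d U) x = mollify d H x"
proof -
  have "partial_deriv j (\<lambda>y. mollify d U y $ i) x = mollify d H x $ i $ j" for i j
  proof -
    have "(\<lambda>y. mollify d U y $ i) = mollify d (\<lambda>y. U y $ i)"
      using mollify_vec_nth[OF U d(1)] by blast
    then have "partial_deriv j (\<lambda>y. mollify d U y $ i) x = mollify d (\<lambda>y. H y $ i $ j) x"
      using partial_deriv_mollify[OF integrable_vec_nth[OF U] integrable_vec_nth[OF integrable_vec_nth[OF H]] d weak] by simp
    also have "\<dots> = mollify d H x $ i $ j"
      by (simp only: mollify_vec_nth[OF H d(1)] mollify_vec_nth[OF integrable_vec_nth[OF H] d(1)])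
    finally show ?thesis .
  qed
  then show ?thesis by (simp add: gradient_def vec_eq_iff)
qed

text \<open>Test functions of \<open>K\<close> and their derivatives vanish off \<open>K\<close>,
  where the representatives were cut to 0, so the weak identity on \<Omega> restricts to them. In
  use \<open>K\<close> is a compact core, on which integrability is known.\<close>

lemma representative_weak_gradient:
  fixes u :: "real^'n::finite \<Rightarrow> real^'m::finite"
  assumes w: "has_weak_gradient \<Omega> u W" and K: "K \<subseteq> \<Omega>" and \<Omega>: "open \<Omega>"
    and U: "integrable lborel U" "AE x in lborel. U x = indicator K x *\<^sub>R u x"
    and H: "integrable lborel H" "AE x in lborel. H x = indicator K x *\<^sub>R W x"
    and \<phi>: "\<phi> \<in> test_functions K"
  shows "(\<integral>y. U y $ i * partial_deriv j \<phi> y \<partial>lborel) = - (\<integral>y. H y $ i $ j * \<phi> y \<partial>lborel)"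
proof -
  have \<Omega>l: "\<Omega> \<in> sets lebesgue" using \<Omega> by simp
  have \<phi>m: "\<phi> \<in> borel_measurable borel" "partial_deriv j \<phi> \<in> borel_measurable borel"
    using smooth_borel[OF test_function_smooth[OF \<phi>]] smooth_borel[OF smooth_partial_deriv[OF test_function_smooth[OF \<phi>]]] by blast+
  have Ui: "(\<lambda>y. U y $ i) \<in> borel_measurable borel" and Hi: "(\<lambda>y. H y $ i $ j) \<in> borel_measurable borel"
    using borel_measurable_integrable[OF integrable_vec_nth[OF U(1)]]
      borel_measurable_integrable[OF integrable_vec_nth[OF integrable_vec_nth[OF H(1)]]] unfolding measurable_lborel2 by blast+
  have UA: "AE x in lborel. U x $ i = indicator K x * u x $ i" using U(2) by eventually_elim simp
  have HA: "AE x in lborel. H x $ i $ j = indicator K x * W x $ i $ j" using H(2) by eventually_elim simp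
  have "(\<integral>y. U y $ i * partial_deriv j \<phi> y \<partial>lborel) = (\<integral>y. u y $ i * partial_deriv j \<phi> y \<partial>lebesgue_on \<Omega>)"
    by (rule integral_representative[symmetric, OF Ui UA \<phi>m(2) test_function_outside(2)[OF \<phi>] K \<Omega>l])
  also have "\<dots> = - (\<integral>y. W y $ i $ j * \<phi> y \<partial>lebesgue_on \<Omega>)"
    using w test_functions_mono[OF \<phi> K] unfolding has_weak_gradient_def by blast
  also have "(\<integral>y. W y $ i $ j * \<phi> y \<partial>lebesgue_on \<Omega>) = (\<integral>y. H y $ i $ j * \<phi> y \<partial>lborel)"
    by (rule integral_representative[OF Hi HA \<phi>m(1) test_function_outside(1)[OF \<phi>] K \<Omega>l])
  finally show ?thesis .
qed

text \<open>The integrand formed with the chosen weak gradient inherits its measurability from the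
  Borel representative; the monotone limit over the cores relies on this.\<close>

lemma representative_energy:
  fixes L :: "'b::euclidean_space \<Rightarrow> real"
  assumes L: "continuous_on UNIV L" and H: "integrable lborel H" "AE x in lborel. H x = indicator K x *\<^sub>R W x"
    and B: "B \<in> sets borel" "B \<subseteq> K"
  shows "(\<integral>\<^sup>+x\<in>B. ennreal (L (H x)) \<partial>lborel) = (\<integral>\<^sup>+x. ennreal (L (W x)) * indicator B x \<partial>lebesgue)"
    and "(\<lambda>x. ennreal (L (W x)) * indicator B x) \<in> borel_measurable lebesgue"
proof -
  have [measurable]: "L \<in> borel_measurable borel" using L by (rule borel_measurable_continuous_onI)
  have [measurable]: "H \<in> borel_measurable borel" "B \<in> sets borel" using H B by auto
  have ae: "AE x in lebesgue. L (H x) * indicator B x = L (W x) * indicator B x"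
    using AE_completion[OF H(2)] by eventually_elim (use B(2) in \<open>auto simp: indicator_def split: if_splits\<close>)
  have "(\<integral>\<^sup>+x. ennreal (L (W x)) * indicator B x \<partial>lebesgue) = (\<integral>\<^sup>+x. ennreal (L (H x)) * indicator B x \<partial>lebesgue)"
  proof (rule nn_integral_cong_AE)
    show "AE x in lebesgue. ennreal (L (W x)) * indicator B x = ennreal (L (H x)) * indicator B x"
      using ae by eventually_elim (auto simp: indicator_def split: if_splits)
  qed
  also have "\<dots> = (\<integral>\<^sup>+x\<in>B. ennreal (L (H x)) \<partial>lborel)" by (rule nn_integral_completion)
  finally show "(\<integral>\<^sup>+x\<in>B. ennreal (L (H x)) \<partial>lborel) = (\<integral>\<^sup>+x. ennreal (L (W x)) * indicator B x \<partial>lebesgue)" by (rule sym)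
  have "(\<lambda>x. L (H x) * indicator B x) \<in> borel_measurable lebesgue"
    by (rule measurable_completion) measurable
  from borel_measurable_AE[OF this ae] have "(\<lambda>x. ennreal (L (W x) * indicator B x)) \<in> borel_measurable lebesgue"
    by measurable
  moreover have "(\<lambda>x. ennreal (L (W x) * indicator B x)) = (\<lambda>x. ennreal (L (W x)) * indicator B x)"
    by (auto simp: indicator_def fun_eq_iff)
  ultimately show "(\<lambda>x. ennreal (L (W x)) * indicator B x) \<in> borel_measurable lebesgue" by simp
qed

text \<open>Weak convergence is available only through abstract functionals; this provides the ones
  needed, integration of a coordinate against a bounded Borel weight. Boundedness amounts to the
  embedding of L^p into L^1 on a set of finite measure.\<close>

lemma weighted_mean_sobolev_dual:
  fixes \<psi> :: "real^'n::finite \<Rightarrow> real"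
  assumes \<Omega>: "bounded \<Omega>" "open \<Omega>" and p: "1 < p" and \<psi>: "\<psi> \<in> borel_measurable borel" "\<And>x. \<bar>\<psi> x\<bar> \<le> B"
  shows "(\<lambda>u :: real^'n \<Rightarrow> real^'m::finite. \<integral>x. u x $ i * \<psi> x \<partial>lebesgue_on \<Omega>) \<in> sobolev_dual \<Omega> p"
proof -
  let ?M = "lebesgue_on \<Omega>"
  interpret finite_measure ?M
    by (rule finite_measure_lebesgue_on) (use \<Omega> in \<open>auto intro: lmeasurable_open\<close>)
  have \<psi>m[measurable]: "\<psi> \<in> borel_measurable ?M"
    using \<psi>(1) by (intro measurable_restrict_space1 measurable_completion) simp
  have B0: "0 \<le> B" using \<psi>(2)[of 0] by linarith
  have um: "u \<in> borel_measurable ?M" and up: "integrable ?M (\<lambda>x. norm (u x) powr p)"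
    if "u \<in> sobolev \<Omega> p" for u :: "real^'n \<Rightarrow> real^'m"
    using that by (auto simp: sobolev_def Lp_space_def)
  have uim: "(\<lambda>x. u x $ i) \<in> borel_measurable ?M" if "u \<in> sobolev \<Omega> p" for u :: "real^'n \<Rightarrow> real^'m"
    using um[OF that] by (rule borel_measurable_continuous_on[rotated]) (intro continuous_intros)
  have un: "integrable ?M (\<lambda>x. norm (u x))" if u: "u \<in> sobolev \<Omega> p" for u :: "real^'n \<Rightarrow> real^'m"
  proof (rule Bochner_Integration.integrable_bound)
    show "integrable ?M (\<lambda>x. 1 + norm (u x) powr p)" using up[OF u] by auto
    show "(\<lambda>x. norm (u x)) \<in> borel_measurable ?M" using um[OF u] by measurable
    show "AE x in ?M. norm (norm (u x)) \<le> norm (1 + norm (u x) powr p)"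
    proof (rule AE_I2)
      fix x
      have "0 \<le> norm (u x) powr p" by simp
      with le_one_plus_powr[OF norm_ge_zero p, of "u x"] show "norm (norm (u x)) \<le> norm (1 + norm (u x) powr p)" by simp
    qed
  qed
  have ul: "integrable ?M (\<lambda>x. u x $ i * \<psi> x)" if u: "u \<in> sobolev \<Omega> p" for u :: "real^'n \<Rightarrow> real^'m"
  proof (rule Bochner_Integration.integrable_bound)
    show "integrable ?M (\<lambda>x. B * norm (u x))" using un[OF u] by auto
    show "(\<lambda>x. u x $ i * \<psi> x) \<in> borel_measurable ?M" using uim[OF u] by measurable
    show "AE x in ?M. norm (u x $ i * \<psi> x) \<le> norm (B * norm (u x))"
    proof (rule AE_I2)
      fix x
      have "\<bar>u x $ i\<bar> * \<bar>\<psi> x\<bar> \<le> norm (u x) * B" using \<psi>(2) by (intro mult_mono component_le_norm_cart) auto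
      then show "norm (u x $ i * \<psi> x) \<le> norm (B * norm (u x))" using B0 by (simp add: abs_mult mult.commute)
    qed
  qed
  define m where "m = measure ?M (space ?M)"
  have bound: "\<bar>\<integral>x. u x $ i * \<psi> x \<partial>?M\<bar> \<le> (B * (m + 1)) * sobolev_norm \<Omega> p u" if u: "u \<in> sobolev \<Omega> p" for u :: "real^'n \<Rightarrow> real^'m"
  proof -
    define A where "A = (\<integral>x. norm (u x) powr p \<partial>?M)"
    define a where "a = A powr (1 / p)"
    have A0: "0 \<le> A" unfolding A_def by (rule integral_nonneg_AE) simp
    have an: "a \<le> sobolev_norm \<Omega> p u"
    proof -
      have "0 \<le> (\<integral>x. norm (weak_gradient \<Omega> u x) powr p \<partial>?M)" by (rule integral_nonneg_AE) simp
      then show ?thesis unfolding a_def A_def[symmetric] sobolev_norm_def using A0 p by (intro powr_mono2) auto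
    qed
    have l1: "\<bar>\<integral>x. u x $ i * \<psi> x \<partial>?M\<bar> \<le> B * (\<integral>x. norm (u x) \<partial>?M)"
    proof -
      have "\<bar>\<integral>x. u x $ i * \<psi> x \<partial>?M\<bar> \<le> (\<integral>x. \<bar>u x $ i * \<psi> x\<bar> \<partial>?M)" by (rule integral_abs_bound)
      also have "\<dots> \<le> (\<integral>x. B * norm (u x) \<partial>?M)"
      proof (rule integral_mono)
        show "integrable ?M (\<lambda>x. \<bar>u x $ i * \<psi> x\<bar>)" using ul[OF u] by (rule integrable_abs)
        show "integrable ?M (\<lambda>x. B * norm (u x))" using un[OF u] by auto
        fix x
        have "\<bar>u x $ i\<bar> * \<bar>\<psi> x\<bar> \<le> norm (u x) * B" using \<psi>(2) by (intro mult_mono component_le_norm_cart) auto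
        then show "\<bar>u x $ i * \<psi> x\<bar> \<le> B * norm (u x)" by (simp add: abs_mult mult.commute)
      qed
      finally show ?thesis by simp
    qed
    \<comment> \<open>Apply t \<le> 1 + t^p to |u|/a, where a is the L^p norm of u, and integrate:
      the mean of (|u|/a)^p contributes 1 and the constant contributes the measure m. For a = 0 the
      function vanishes almost everywhere.\<close>
    have l2: "(\<integral>x. norm (u x) \<partial>?M) \<le> a * (m + 1)"
    proof (cases "A = 0")
      case True
      then have "AE x in ?M. norm (u x) powr p = 0"
        unfolding A_def by (subst (asm) integral_nonneg_eq_0_iff_AE[OF up[OF u]]) auto
      then have "AE x in ?M. norm (u x) = 0" by eventually_elim (simp add: powr_eq_0_iff)
      then have "(\<integral>x. norm (u x) \<partial>?M) = 0" by (rule integral_eq_zero_AE)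
      then show ?thesis by (simp add: a_def m_def)
    next
      case False
      then have A: "0 < A" using A0 by simp
      then have a: "0 < a" by (simp add: a_def)
      have ap: "a powr p = A" unfolding a_def using A p by (simp add: powr_powr)
      have "(\<integral>x. norm (u x) \<partial>?M) \<le> (\<integral>x. a * (1 + norm (u x) powr p / A) \<partial>?M)"
      proof (rule integral_mono[OF un[OF u]])
        show "integrable ?M (\<lambda>x. a * (1 + norm (u x) powr p / A))" using up[OF u] by auto
        fix x
        have "norm (u x) / a \<le> 1 + (norm (u x) / a) powr p" using a by (intro le_one_plus_powr p) auto
        also have "(norm (u x) / a) powr p = norm (u x) powr p / A" using a by (simp add: powr_divide ap)
        finally show "norm (u x) \<le> a * (1 + norm (u x) powr p / A)" using a by (simp add: pos_divide_le_eq mult.commute)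
      qed
      also have "\<dots> = a * (m + 1)"
        using up[OF u] A by (simp add: A_def[symmetric] m_def)
      finally show ?thesis .
    qed
    have "\<bar>\<integral>x. u x $ i * \<psi> x \<partial>?M\<bar> \<le> B * (a * (m + 1))" using order_trans[OF l1 mult_left_mono[OF l2 B0]] .
    also have "\<dots> = (B * (m + 1)) * a" by (simp only: mult_ac)
    also have "\<dots> \<le> (B * (m + 1)) * sobolev_norm \<Omega> p u" using an B0 by (intro mult_left_mono) (auto simp: m_def)
    finally show ?thesis .
  qed
  show ?thesis
    unfolding sobolev_dual_def
  proof (intro CollectI conjI ballI allI)
    fix u v :: "real^'n \<Rightarrow> real^'m" assume "u \<in> sobolev \<Omega> p" "v \<in> sobolev \<Omega> p"
    from Bochner_Integration.integral_add[OF ul[OF this(1)] ul[OF this(2)]]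
    show "(\<integral>x. (u x + v x) $ i * \<psi> x \<partial>?M) = (\<integral>x. u x $ i * \<psi> x \<partial>?M) + (\<integral>x. v x $ i * \<psi> x \<partial>?M)"
      by (simp add: distrib_right)
  next
    fix c and u :: "real^'n \<Rightarrow> real^'m" assume "u \<in> sobolev \<Omega> p"
    show "(\<integral>x. (c *\<^sub>R u x) $ i * \<psi> x \<partial>?M) = c * (\<integral>x. u x $ i * \<psi> x \<partial>?M)"
      by (simp add: mult.assoc)
  next
    show "\<exists>C. \<forall>u\<in>sobolev \<Omega> p. \<bar>\<integral>x. (u :: real^'n \<Rightarrow> real^'m) x $ i * \<psi> x \<partial>?M\<bar> \<le> C * sobolev_norm \<Omega> p u"
      using bound by blast
  qed
qed

text \<open>Coercivity turns finite energy on \<open>K\<close> into integrability of the q-th power;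
  off \<open>K\<close> the representative vanishes.\<close>

lemma gradient_integrable_powr:
  fixes L :: "'b::euclidean_space \<Rightarrow> real" and H :: "real^'n::finite \<Rightarrow> 'b"
  assumes L: "continuous_on UNIV L" "\<And>\<zeta>. 0 \<le> L \<zeta>" and \<beta>: "0 < \<beta>" "\<And>\<zeta>. \<beta> * norm \<zeta> powr q \<le> L \<zeta>"
    and H: "H \<in> borel_measurable borel" "AE x in lborel. x \<notin> K \<longrightarrow> H x = 0"
    and fin: "(\<integral>\<^sup>+x\<in>K. ennreal (L (H x)) \<partial>lborel) < \<infinity>" and K: "K \<in> sets borel"
  shows "integrable lborel (\<lambda>x. norm (H x) powr q)"
proof -
  note [measurable] = H(1) K
  have [measurable]: "L \<in> borel_measurable borel" using L(1) by (rule borel_measurable_continuous_onI)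
  have "(\<integral>\<^sup>+x. ennreal (norm (norm (H x) powr q)) \<partial>lborel) \<le> (\<integral>\<^sup>+x. ennreal (1/\<beta>) * (ennreal (L (H x)) * indicator K x) \<partial>lborel)"
  proof (rule nn_integral_mono_AE)
    show "AE x in lborel. ennreal (norm (norm (H x) powr q)) \<le> ennreal (1/\<beta>) * (ennreal (L (H x)) * indicator K x)"
      using H(2)
    proof eventually_elim
      fix x assume x: "x \<notin> K \<longrightarrow> H x = 0"
      show "ennreal (norm (norm (H x) powr q)) \<le> ennreal (1/\<beta>) * (ennreal (L (H x)) * indicator K x)"
      proof (cases "x \<in> K")
        case True
        have "norm (H x) powr q \<le> 1/\<beta> * L (H x)"
          using \<beta>(2)[of "H x"] \<beta>(1) by (simp add: le_divide_eq mult.commute)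
        then have "ennreal (norm (norm (H x) powr q)) \<le> ennreal (1/\<beta> * L (H x))" by (simp add: ennreal_leI)
        also have "\<dots> = ennreal (1/\<beta>) * ennreal (L (H x))" using \<beta>(1) L(2) by (intro ennreal_mult) auto
        finally show ?thesis using True by simp
      qed (use x in simp)
    qed
  qed
  also have "\<dots> = ennreal (1/\<beta>) * (\<integral>\<^sup>+x\<in>K. ennreal (L (H x)) \<partial>lborel)" by (rule nn_integral_cmult) measurable
  also have "\<dots> < \<infinity>" using fin by (simp add: ennreal_mult_less_top)
  finally show ?thesis unfolding integrable_iff_bounded by simp
qed

section \<open>From weakly convergent Sobolev functions to smooth maps\<close>

lemma mollify_both_L1:
  fixes U :: "real^'n::finite \<Rightarrow> 'b::{banach, second_countable_topology}" and G :: "real^'n \<Rightarrow> 'c::{banach, second_countable_topology}"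
  assumes U: "integrable lborel U" and G: "integrable lborel G" and e: "(e::real) > 0" "0 < d"
  shows "\<exists>s. 0 < s \<and> s < d \<and> (\<integral>\<^sup>+x. norm (mollify s U x - U x) \<partial>lborel) \<le> ennreal e \<and> (\<integral>\<^sup>+x. norm (mollify s G x - G x) \<partial>lborel) \<le> ennreal e"
proof -
  obtain d1 where d1: "d1 > 0" "\<And>s. 0 < s \<Longrightarrow> s < d1 \<Longrightarrow> (\<integral>\<^sup>+x. norm (mollify s U x - U x) \<partial>lborel) \<le> ennreal e"
    using mollify_L1_converges[OF U e(1)] by blast
  obtain d2 where d2: "d2 > 0" "\<And>s. 0 < s \<Longrightarrow> s < d2 \<Longrightarrow> (\<integral>\<^sup>+x. norm (mollify s G x - G x) \<partial>lborel) \<le> ennreal e"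
    using mollify_L1_converges[OF G e(1)] by blast
  define s where "s = min d (min d1 d2) / 2"
  have "0 < s" "s < d" "s < d1" "s < d2" using d1(1) d2(1) e(2) by (auto simp: s_def min_def)
  with d1(2) d2(2) show ?thesis by blast
qed

lemma weak_gradient_has_weak_gradient:
  assumes "u \<in> sobolev \<Omega> p" shows "has_weak_gradient \<Omega> u (weak_gradient \<Omega> u)"
proof -
  obtain G where "has_weak_gradient \<Omega> u G" using assms unfolding sobolev_def by blast
  then show ?thesis unfolding weak_gradient_def by (rule someI[of "has_weak_gradient \<Omega> u"])
qed

text \<open>Both the sequence and its limit are replaced by Borel representatives and mollified.
  Weak convergence survives in the form required: bounded weights give elements of
  \<open>sobolev_dual\<close>, and the mollification error tends to 0 in L1.\<close>

lemma energy_on_core_le: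
  fixes L :: "real^'n::finite^'m::finite \<Rightarrow> real" and us :: "nat \<Rightarrow> real^'n \<Rightarrow> real^'m"
  assumes \<Omega>: "bounded \<Omega>" "open \<Omega>" and p: "1 < p"
    and L: "W1_quasiconvex q L" "continuous_on UNIV L" "\<And>\<zeta>. 0 \<le> L \<zeta>" and q: "1 < q"
    and C: "0 \<le> C" "\<And>\<zeta>. L \<zeta> \<le> C * (1 + norm \<zeta> powr q)"
    and \<beta>: "0 < \<beta>" "\<And>\<zeta>. \<beta> * norm \<zeta> powr q \<le> L \<zeta>"
    and us: "\<And>k. us k \<in> sobolev \<Omega> p" and u: "u \<in> sobolev \<Omega> p"
    and conv: "\<And>l. l \<in> sobolev_dual \<Omega> p \<Longrightarrow> (\<lambda>k. l (us k)) \<longlonglongrightarrow> l u"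
    and c: "0 \<le> c" "\<And>k. energy \<Omega> L (us k) \<le> ennreal c" and d: "0 < d"
  shows "(\<integral>\<^sup>+x. ennreal (L (weak_gradient \<Omega> u x)) * indicator (core \<Omega> (3 * d)) x \<partial>lebesgue) \<le> ennreal c"
    and "(\<lambda>x. ennreal (L (weak_gradient \<Omega> u x)) * indicator (core \<Omega> (3 * d)) x) \<in> borel_measurable lebesgue"
proof -
  \<comment> \<open>Three nested cores leave room for two steps of length d: mollified gradients on
    \<open>S\<close> use the representatives on \<open>K\<close>, and the blow-up cubes around
    points of \<open>S'\<close> stay in \<open>S\<close>.\<close>
  define K where "K = core \<Omega> d"
  define S where "S = core \<Omega> (2 * d)"
  define S' where "S' = core \<Omega> (3 * d)"
  have K: "compact K" "K \<subseteq> \<Omega>" unfolding K_def using compact_core[OF \<Omega>(1) d] core_subset[OF d] by auto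
  have SK: "S \<subseteq> K" "S' \<subseteq> K" unfolding S_def S'_def K_def by (rule core_antimono, use d in simp)+
  have Sb[measurable]: "S \<in> sets borel" "S' \<in> sets borel" "K \<in> sets borel"
    unfolding S_def S'_def K_def by (intro borel_closed closed_core)+
  have ballK: "cball x d \<subseteq> K" if "x \<in> S" for x
    using that cball_subset_core[of x \<Omega> d d] unfolding S_def K_def by (simp only: mult_2)
  have ballS: "cball x d \<subseteq> S" if "x \<in> S'" for x
  proof -
    have "3 * d = d + 2 * d" by simp
    with that show ?thesis using cball_subset_core[of x \<Omega> d "2 * d"] unfolding S_def S'_def by (simp only:)
  qed
  have Sfin: "emeasure lborel S < \<infinity>"
    using K(1) SK(1) by (intro emeasure_bounded_finite) (meson bounded_subset compact_imp_bounded)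
  have wg: "has_weak_gradient \<Omega> (us k) (weak_gradient \<Omega> (us k))" for k
    by (rule weak_gradient_has_weak_gradient[OF us])
  have wu: "has_weak_gradient \<Omega> u (weak_gradient \<Omega> u)" by (rule weak_gradient_has_weak_gradient[OF u])
  have li: "locally_integrable \<Omega> w" "locally_integrable \<Omega> W" if "has_weak_gradient \<Omega> w W"
    for w :: "real^'n \<Rightarrow> real^'m" and W
    using that unfolding has_weak_gradient_def by blast+
  have rep: "\<exists>g. integrable lborel g \<and> (AE x in lborel. g x = indicator K x *\<^sub>R w x)"
    if "locally_integrable \<Omega> w" for w :: "real^'n \<Rightarrow> 'b::euclidean_space"
    by (rule locally_integrable_representative[OF that K]) blast
  obtain U where U: "integrable lborel U" "AE x in lborel. U x = indicator K x *\<^sub>R u x" using rep[OF li(1)[OF wu]] by blast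
  obtain G where G: "integrable lborel G" "AE x in lborel. G x = indicator K x *\<^sub>R weak_gradient \<Omega> u x" using rep[OF li(2)[OF wu]] by blast
  have "\<exists>Us. \<forall>k. integrable lborel (Us k) \<and> (AE x in lborel. Us k x = indicator K x *\<^sub>R us k x)"
    by (intro choice allI rep[OF li(1)[OF wg]])
  then obtain Us where Us: "\<And>k. integrable lborel (Us k)" "\<And>k. AE x in lborel. Us k x = indicator K x *\<^sub>R us k x" by blast
  have "\<exists>Hs. \<forall>k. integrable lborel (Hs k) \<and> (AE x in lborel. Hs k x = indicator K x *\<^sub>R weak_gradient \<Omega> (us k) x)"
    by (intro choice allI rep[OF li(2)[OF wg]])
  then obtain Hs where Hs: "\<And>k. integrable lborel (Hs k)" "\<And>k. AE x in lborel. Hs k x = indicator K x *\<^sub>R weak_gradient \<Omega> (us k) x" by blast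
  have Hsm: "Hs k \<in> borel_measurable borel" for k using borel_measurable_integrable[OF Hs(1)[of k]] by simp
  \<comment> \<open>Nonnegativity of the integrand lets the energy on \<Omega> bound the energy on
    every Borel subset of \<open>K\<close>.\<close>
  have EB: "(\<integral>\<^sup>+x\<in>B. ennreal (L (Hs k x)) \<partial>lborel) \<le> ennreal c" if B: "B \<in> sets borel" "B \<subseteq> K" for B k
  proof -
    have "(\<integral>\<^sup>+x\<in>B. ennreal (L (Hs k x)) \<partial>lborel) = (\<integral>\<^sup>+x. ennreal (L (weak_gradient \<Omega> (us k) x)) * indicator B x \<partial>lebesgue)"
      by (rule representative_energy(1)[OF L(2) Hs(1) Hs(2) B])
    also have "\<dots> \<le> (\<integral>\<^sup>+x. ennreal (L (weak_gradient \<Omega> (us k) x)) * indicator \<Omega> x \<partial>lebesgue)"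
      using B(2) K(2) by (intro nn_integral_mono) (auto simp: indicator_def)
    also have "\<dots> = energy \<Omega> L (us k)"
      unfolding energy_def using \<Omega>(2) by (intro nn_integral_restrict_space[symmetric]) auto
    finally show ?thesis using c(2)[of k] by (rule order_trans)
  qed
  have Hq: "integrable lborel (\<lambda>x. norm (Hs k x) powr q)" for k
  proof (rule gradient_integrable_powr[OF L(2,3) \<beta> Hsm])
    show "AE x in lborel. x \<notin> K \<longrightarrow> Hs k x = 0" using Hs(2)[of k] by eventually_elim simp
    show "(\<integral>\<^sup>+x\<in>K. ennreal (L (Hs k x)) \<partial>lborel) < \<infinity>"
      using le_less_trans[OF EB[OF Sb(3) order_refl] ennreal_less_top] by simp
  qed (rule Sb(3))
  \<comment> \<open>The radius is chosen for each k separately, so that L1 distance and energy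
    change by at most 1/(k + 1).\<close>
  have "\<exists>\<delta>. 0 < \<delta> \<and> \<delta> < d \<and> (\<integral>\<^sup>+x. norm (mollify \<delta> (Us k) x - Us k x) \<partial>lborel) \<le> ennreal (inverse (real (Suc k)))
      \<and> (\<integral>\<^sup>+x\<in>S. ennreal (L (mollify \<delta> (Hs k) x)) \<partial>lborel) \<le> (\<integral>\<^sup>+x\<in>S. ennreal (L (Hs k x)) \<partial>lborel) + ennreal (inverse (real (Suc k)))" for k
  proof -
    have "0 < inverse (real (Suc k))" by simp
    then show ?thesis
      by (rule mollify_energy[OF L(2,3) C q Hs(1)[of k] Hq[of k] Us(1)[of k] Sb(1) Sfin _ d]) blast
  qed
  then have "\<exists>\<delta>. \<forall>k. 0 < \<delta> k \<and> \<delta> k < d \<and> (\<integral>\<^sup>+x. norm (mollify (\<delta> k) (Us k) x - Us k x) \<partial>lborel) \<le> ennreal (inverse (real (Suc k)))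
      \<and> (\<integral>\<^sup>+x\<in>S. ennreal (L (mollify (\<delta> k) (Hs k) x)) \<partial>lborel) \<le> (\<integral>\<^sup>+x\<in>S. ennreal (L (Hs k x)) \<partial>lborel) + ennreal (inverse (real (Suc k)))"
    by (intro choice allI)
  then obtain \<delta> where \<delta>: "\<And>k. 0 < \<delta> k" "\<And>k. \<delta> k < d"
    "\<And>k. (\<integral>\<^sup>+x. norm (mollify (\<delta> k) (Us k) x - Us k x) \<partial>lborel) \<le> ennreal (inverse (real (Suc k)))"
    "\<And>k. (\<integral>\<^sup>+x\<in>S. ennreal (L (mollify (\<delta> k) (Hs k) x)) \<partial>lborel) \<le> (\<integral>\<^sup>+x\<in>S. ennreal (L (Hs k x)) \<partial>lborel) + ennreal (inverse (real (Suc k)))"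
    by blast
  have "\<exists>\<epsilon>. \<forall>k. 0 < \<epsilon> k \<and> \<epsilon> k < d \<and> (\<integral>\<^sup>+x. norm (mollify (\<epsilon> k) U x - U x) \<partial>lborel) \<le> ennreal (inverse (real (Suc k)))
      \<and> (\<integral>\<^sup>+x. norm (mollify (\<epsilon> k) G x - G x) \<partial>lborel) \<le> ennreal (inverse (real (Suc k)))"
    by (intro choice allI mollify_both_L1 U(1) G(1) d) simp
  then obtain \<epsilon> where \<epsilon>: "\<And>k. 0 < \<epsilon> k" "\<And>k. \<epsilon> k < d"
    "\<And>k. (\<integral>\<^sup>+x. norm (mollify (\<epsilon> k) U x - U x) \<partial>lborel) \<le> ennreal (inverse (real (Suc k)))"
    "\<And>k. (\<integral>\<^sup>+x. norm (mollify (\<epsilon> k) G x - G x) \<partial>lborel) \<le> ennreal (inverse (real (Suc k)))" by blast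
  define f where "f k = mollify (\<delta> k) (Us k)" for k
  define v where "v k = mollify (\<epsilon> k) U" for k
  have sub: "cball y s \<subseteq> K" if "y \<in> S" "s < d" for y s
    using ballK[OF that(1)] that(2) by (auto simp: subset_iff)
  have gf: "gradient (f k) y = mollify (\<delta> k) (Hs k) y" if "y \<in> S" for k y
    unfolding f_def
    by (rule gradient_mollify[OF Us(1) Hs(1) \<delta>(1) sub[OF that \<delta>(2)]])
      (rule representative_weak_gradient[OF wg K(2) \<Omega>(2) Us(1) Us(2) Hs(1) Hs(2)])
  have gv: "gradient (v k) y = mollify (\<epsilon> k) G y" if "y \<in> S" for k y
    unfolding v_def
    by (rule gradient_mollify[OF U(1) G(1) \<epsilon>(1) sub[OF that \<epsilon>(2)]])
      (rule representative_weak_gradient[OF wu K(2) \<Omega>(2) U G])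
  have inv0: "(\<lambda>k. ennreal (inverse (real (Suc k)))) \<longlonglongrightarrow> 0"
    using tendsto_ennrealI[OF LIMSEQ_inverse_real_of_nat] by simp
  have Gm[measurable]: "G \<in> borel_measurable borel" and Um[measurable]: "U \<in> borel_measurable borel"
    and Usm[measurable]: "Us k \<in> borel_measurable borel" for k
    using borel_measurable_integrable[OF G(1)] borel_measurable_integrable[OF U(1)] borel_measurable_integrable[OF Us(1)[of k]] by simp_all
  have mb[measurable]: "mollify s G \<in> borel_measurable borel" "mollify s U \<in> borel_measurable borel"
    "mollify s (Us k) \<in> borel_measurable borel" for s k
    by (rule mollify_borel, measurable)+
  obtain N where N: "(\<integral>\<^sup>+x. norm (G x) \<partial>lborel) = ennreal N" "0 \<le> N"
    using G(1) unfolding integrable_iff_bounded by (cases "\<integral>\<^sup>+x. norm (G x) \<partial>lborel") auto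
  have main: "(\<integral>\<^sup>+x\<in>S'. ennreal (L (G x)) \<partial>lborel) \<le> ennreal c"
  proof (rule local_lower_semicontinuity[OF L q C \<beta> _ c(1) _ _ _ _ _ U(1) G(1) Sb(1,2) Sfin d ballS])
    show "smooth_map (f k)" for k unfolding f_def by (rule smooth_map_mollify[OF Us(1) \<delta>(1)])
    show "smooth_map (v k)" for k unfolding v_def by (rule smooth_map_mollify[OF U(1) \<epsilon>(1)])
    show "(\<integral>\<^sup>+y\<in>S. ennreal (L (gradient (f k) y)) \<partial>lborel) \<le> ennreal (c + inverse (real (Suc k)))" for k
    proof -
      have "(\<integral>\<^sup>+y\<in>S. ennreal (L (gradient (f k) y)) \<partial>lborel) = (\<integral>\<^sup>+y\<in>S. ennreal (L (mollify (\<delta> k) (Hs k) y)) \<partial>lborel)"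
        by (intro nn_integral_cong) (auto simp: indicator_def gf)
      also have "\<dots> \<le> ennreal c + ennreal (inverse (real (Suc k)))"
        by (rule order_trans[OF \<delta>(4) add_right_mono[OF EB[OF Sb(1) SK(1)]]])
      also have "\<dots> = ennreal (c + inverse (real (Suc k)))" using c(1) by (intro ennreal_plus[symmetric]) auto
      finally show ?thesis .
    qed
    show "(\<integral>\<^sup>+y\<in>S. norm (gradient (v k) y) \<partial>lborel) \<le> ennreal (N + 1)" for k
    proof -
      have "(\<integral>\<^sup>+y\<in>S. norm (gradient (v k) y) \<partial>lborel) \<le> (\<integral>\<^sup>+y. ennreal (norm (mollify (\<epsilon> k) G y - G y)) + ennreal (norm (G y)) \<partial>lborel)"
      proof (rule nn_integral_mono)
        fix y
        have "norm (mollify (\<epsilon> k) G y) \<le> norm (mollify (\<epsilon> k) G y - G y) + norm (G y)"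
          using norm_triangle_ineq[of "mollify (\<epsilon> k) G y - G y" "G y"] by simp
        then have "ennreal (norm (mollify (\<epsilon> k) G y)) \<le> ennreal (norm (mollify (\<epsilon> k) G y - G y)) + ennreal (norm (G y))"
          by (simp add: ennreal_leI flip: ennreal_plus)
        then show "ennreal (norm (gradient (v k) y)) * indicator S y \<le> ennreal (norm (mollify (\<epsilon> k) G y - G y)) + ennreal (norm (G y))"
          by (cases "y \<in> S") (auto simp: gv)
      qed
      also have "\<dots> = (\<integral>\<^sup>+y. norm (mollify (\<epsilon> k) G y - G y) \<partial>lborel) + ennreal N"
        unfolding N(1)[symmetric] by (rule nn_integral_add) measurable
      also have "\<dots> \<le> ennreal 1 + ennreal N"
        by (intro add_mono order_trans[OF \<epsilon>(4)] ennreal_leI order_refl) (simp add: field_simps)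
      also have "\<dots> = ennreal (N + 1)" unfolding add.commute[of N] by (rule ennreal_plus[OF zero_le_one N(2), symmetric])
      finally show ?thesis .
    qed
    show "(\<lambda>k. \<integral>\<^sup>+y\<in>S. norm (v k y - U y) \<partial>lborel) \<longlonglongrightarrow> 0"
    proof (rule tendsto_sandwich[OF _ _ tendsto_const inv0])
      have "(\<integral>\<^sup>+y\<in>S. norm (v k y - U y) \<partial>lborel) \<le> ennreal (inverse (real (Suc k)))" for k
        unfolding v_def by (rule order_trans[OF nn_integral_mono \<epsilon>(3)]) (auto simp: indicator_def)
      then show "\<forall>\<^sub>F k in sequentially. (\<integral>\<^sup>+y\<in>S. norm (v k y - U y) \<partial>lborel) \<le> ennreal (inverse (real (Suc k)))"
        by (intro always_eventually allI)
    qed simp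
    show "(\<lambda>k. \<integral>\<^sup>+y\<in>S. norm (gradient (v k) y - G y) \<partial>lborel) \<longlonglongrightarrow> 0"
    proof (rule tendsto_sandwich[OF _ _ tendsto_const inv0])
      have "(\<integral>\<^sup>+y\<in>S. norm (gradient (v k) y - G y) \<partial>lborel) \<le> ennreal (inverse (real (Suc k)))" for k
        by (rule order_trans[OF nn_integral_mono \<epsilon>(4)[of k]]) (auto simp: indicator_def gv)
      then show "\<forall>\<^sub>F k in sequentially. (\<integral>\<^sup>+y\<in>S. norm (gradient (v k) y - G y) \<partial>lborel) \<le> ennreal (inverse (real (Suc k)))"
        by (intro always_eventually allI)
    qed simp
    fix \<psi> :: "real^'n \<Rightarrow> real" and B
    assume \<psi>: "\<psi> \<in> borel_measurable borel" "\<And>x. \<bar>\<psi> x\<bar> \<le> B" "\<And>x. x \<notin> S \<Longrightarrow> \<psi> x = 0"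
    have \<psi>l: "\<psi> \<in> borel_measurable lborel" using \<psi>(1) by simp
    have \<psi>K: "\<psi> x = 0" if "x \<notin> K" for x using that SK(1) \<psi>(3) by blast
    have iU: "integrable lborel (\<lambda>x. \<psi> x *\<^sub>R U x)" "integrable lborel (\<lambda>x. \<psi> x *\<^sub>R Us k x)" for k
      by (rule integrable_bounded_mult[OF U(1) \<psi>l \<psi>(2)], rule integrable_bounded_mult[OF Us(1) \<psi>l \<psi>(2)])
    have \<Omega>l: "\<Omega> \<in> sets lebesgue" using \<Omega>(2) by simp
    \<comment> \<open>Each coordinate of the vector integral is the value of a functional from
      \<open>weighted_mean_sobolev_dual\<close>; the weight vanishes off \<open>K\<close>, so the
      representative can be exchanged for the original map.\<close>
    have comp: "(\<integral>x. \<psi> x *\<^sub>R V x \<partial>lborel) $ i = (\<integral>x. w x $ i * \<psi> x \<partial>lebesgue_on \<Omega>)"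
      if V: "integrable lborel V" "AE x in lborel. V x = indicator K x *\<^sub>R w x" for V w :: "real^'n \<Rightarrow> real^'m" and i
    proof -
      have Vi: "(\<lambda>x. V x $ i) \<in> borel_measurable borel" using borel_measurable_integrable[OF integrable_vec_nth[OF V(1)]] by simp
      have VA: "AE x in lborel. V x $ i = indicator K x * w x $ i" using V(2) by eventually_elim simp
      have "(\<integral>x. \<psi> x *\<^sub>R V x \<partial>lborel) $ i = (\<integral>x. (\<psi> x *\<^sub>R V x) $ i \<partial>lborel)"
        by (rule integral_bounded_linear[OF bounded_linear_vec_nth integrable_bounded_mult[OF V(1) \<psi>l \<psi>(2)], symmetric])
      also have "\<dots> = (\<integral>x. V x $ i * \<psi> x \<partial>lborel)" by (simp add: mult.commute)
      also have "\<dots> = (\<integral>x. w x $ i * \<psi> x \<partial>lebesgue_on \<Omega>)"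
        by (rule integral_representative[symmetric, OF Vi VA \<psi>(1) \<psi>K K(2) \<Omega>l])
      finally show ?thesis .
    qed
    have l1: "(\<lambda>k. \<integral>x. \<psi> x *\<^sub>R Us k x \<partial>lborel) \<longlonglongrightarrow> (\<integral>x. \<psi> x *\<^sub>R U x \<partial>lborel)"
    proof (rule vec_tendstoI)
      fix i
      show "(\<lambda>k. (\<integral>x. \<psi> x *\<^sub>R Us k x \<partial>lborel) $ i) \<longlonglongrightarrow> (\<integral>x. \<psi> x *\<^sub>R U x \<partial>lborel) $ i"
        unfolding comp[OF Us(1) Us(2)] comp[OF U]
        by (rule conv[OF weighted_mean_sobolev_dual[OF \<Omega> p \<psi>(1,2)]])
    qed
    have id: "integrable lborel (\<lambda>x. f k x - Us k x)" for k
      unfolding integrable_iff_bounded f_def using le_less_trans[OF \<delta>(3)[of k] ennreal_less_top] by (simp add: Usm mb)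
    \<comment> \<open>The mollification error integrated against the weight is at most its bound
      times 1/(k + 1).\<close>
    have l2: "(\<lambda>k. \<integral>x. \<psi> x *\<^sub>R (f k x - Us k x) \<partial>lborel) \<longlonglongrightarrow> 0"
    proof (rule tendsto_norm_zero_cancel, rule tendsto_sandwich[of "\<lambda>_. 0" _ _ "\<lambda>k. \<bar>B\<bar> * inverse (real (Suc k))"])
      have "norm (\<integral>x. \<psi> x *\<^sub>R (f k x - Us k x) \<partial>lborel) \<le> \<bar>B\<bar> * inverse (real (Suc k))" for k
      proof -
        have "norm (\<integral>x. \<psi> x *\<^sub>R (f k x - Us k x) \<partial>lborel) \<le> (\<integral>x. \<bar>B\<bar> * norm (f k x - Us k x) \<partial>lborel)"
        proof (rule order_trans[OF integral_norm_bound integral_mono])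
          show "integrable lborel (\<lambda>x. norm (\<psi> x *\<^sub>R (f k x - Us k x)))"
            by (rule integrable_norm[OF integrable_bounded_mult[OF id \<psi>l \<psi>(2)]])
          show "integrable lborel (\<lambda>x. \<bar>B\<bar> * norm (f k x - Us k x))" using id by auto
          show "norm (\<psi> x *\<^sub>R (f k x - Us k x)) \<le> \<bar>B\<bar> * norm (f k x - Us k x)" for x
            unfolding norm_scaleR using order_trans[OF \<psi>(2)[of x] abs_ge_self] by (intro mult_right_mono) auto
        qed
        also have "\<dots> = \<bar>B\<bar> * (\<integral>x. norm (f k x - Us k x) \<partial>lborel)" by simp
        also have "(\<integral>x. norm (f k x - Us k x) \<partial>lborel) \<le> inverse (real (Suc k))"
          using \<delta>(3)[of k] unfolding f_def[symmetric] nn_integral_eq_integral[OF integrable_norm[OF id] AE_I2[OF norm_ge_zero]]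
          by (simp add: ennreal_le_iff)
        finally show ?thesis by (simp add: mult_left_mono)
      qed
      then show "\<forall>\<^sub>F k in sequentially. norm (\<integral>x. \<psi> x *\<^sub>R (f k x - Us k x) \<partial>lborel) \<le> \<bar>B\<bar> * inverse (real (Suc k))"
        by (intro always_eventually allI)
      show "(\<lambda>k. \<bar>B\<bar> * inverse (real (Suc k))) \<longlonglongrightarrow> 0"
        by (rule tendsto_mult_right_zero[OF LIMSEQ_inverse_real_of_nat])
    qed auto
    have "(\<integral>x. \<psi> x *\<^sub>R f k x \<partial>lborel) = (\<integral>x. \<psi> x *\<^sub>R Us k x \<partial>lborel) + (\<integral>x. \<psi> x *\<^sub>R (f k x - Us k x) \<partial>lborel)" for k
    proof -
      have "(\<integral>x. \<psi> x *\<^sub>R Us k x + \<psi> x *\<^sub>R (f k x - Us k x) \<partial>lborel) = (\<integral>x. \<psi> x *\<^sub>R Us k x \<partial>lborel) + (\<integral>x. \<psi> x *\<^sub>R (f k x - Us k x) \<partial>lborel)"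
        by (rule Bochner_Integration.integral_add[OF iU(2) integrable_bounded_mult[OF id \<psi>l \<psi>(2)]])
      then show ?thesis by (simp add: scaleR_add_right[symmetric])
    qed
    with tendsto_add[OF l1 l2] show "(\<lambda>k. \<integral>x. \<psi> x *\<^sub>R f k x \<partial>lborel) \<longlonglongrightarrow> (\<integral>x. \<psi> x *\<^sub>R U x \<partial>lborel)" by simp
  qed
  show "(\<integral>\<^sup>+x. ennreal (L (weak_gradient \<Omega> u x)) * indicator (core \<Omega> (3 * d)) x \<partial>lebesgue) \<le> ennreal c"
    using main unfolding representative_energy(1)[OF L(2) G Sb(2) SK(2)] unfolding S'_def .
  show "(\<lambda>x. ennreal (L (weak_gradient \<Omega> u x)) * indicator (core \<Omega> (3 * d)) x) \<in> borel_measurable lebesgue"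
    using representative_energy(2)[OF L(2) G Sb(2) SK(2)] unfolding S'_def .
qed

text \<open>The bound on a core does not depend on its width, so monotone convergence over the
  cores, which exhaust the open set \<Omega>, transfers it to \<Omega>.\<close>

lemma energy_le_bound:
  fixes L :: "real^'n::finite^'m::finite \<Rightarrow> real" and us :: "nat \<Rightarrow> real^'n \<Rightarrow> real^'m"
  assumes \<Omega>: "bounded \<Omega>" "open \<Omega>" and p: "1 < p"
    and L: "W1_quasiconvex q L" "continuous_on UNIV L" "\<And>\<zeta>. 0 \<le> L \<zeta>" and q: "1 < q"
    and C: "0 \<le> C" "\<And>\<zeta>. L \<zeta> \<le> C * (1 + norm \<zeta> powr q)"
    and \<beta>: "0 < \<beta>" "\<And>\<zeta>. \<beta> * norm \<zeta> powr q \<le> L \<zeta>"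
    and us: "\<And>k. us k \<in> sobolev \<Omega> p" and u: "u \<in> sobolev \<Omega> p"
    and conv: "\<And>l. l \<in> sobolev_dual \<Omega> p \<Longrightarrow> (\<lambda>k. l (us k)) \<longlonglongrightarrow> l u"
    and c: "0 \<le> c" "\<And>k. energy \<Omega> L (us k) \<le> ennreal c"
  shows "energy \<Omega> L u \<le> ennreal c"
proof -
  \<comment> \<open>Chosen so that 3 d(n) is the width 2/(n + 1) that occurs in
    \<open>open_in_core\<close>.\<close>
  define d where "d n = 2 * inverse (real (Suc n)) / 3" for n
  have d: "0 < d n" "3 * d n = 2 * inverse (real (Suc n))" for n by (auto simp: d_def)
  let ?W = "\<lambda>n x. ennreal (L (weak_gradient \<Omega> u x)) * indicator (core \<Omega> (3 * d n)) x"
  note le = energy_on_core_le[OF \<Omega> p L q C \<beta> us u conv c d(1)]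
  have dm: "d n \<le> d m" if "m \<le> n" for m n using that by (simp add: d_def field_simps)
  have "incseq ?W"
  proof (rule incseq_SucI, rule le_funI)
    fix n x
    have "core \<Omega> (3 * d n) \<subseteq> core \<Omega> (3 * d (Suc n))" using dm[of n "Suc n"] by (intro core_antimono) simp
    then show "?W n x \<le> ?W (Suc n) x" by (auto simp: indicator_def)
  qed
  have sup: "(SUP n. ?W n x) = ennreal (L (weak_gradient \<Omega> u x)) * indicator \<Omega> x" for x
  proof (cases "x \<in> \<Omega>")
    case True
    obtain n where n: "x \<in> core \<Omega> (2 * inverse (real (Suc n)))" using open_in_core[OF \<Omega>(2) True] by blast
    show ?thesis
    proof (rule antisym)
      show "(SUP n. ?W n x) \<le> ennreal (L (weak_gradient \<Omega> u x)) * indicator \<Omega> x"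
        using True by (intro SUP_least) (auto simp: indicator_def)
      show "ennreal (L (weak_gradient \<Omega> u x)) * indicator \<Omega> x \<le> (SUP n. ?W n x)"
        using n True by (intro SUP_upper2[of n]) (auto simp: d(2))
    qed
  next
    case False
    then have "x \<notin> core \<Omega> (3 * d n)" for n using core_subset[of "3 * d n" \<Omega>] d(1)[of n] by auto
    then show ?thesis using False by simp
  qed
  have "energy \<Omega> L u = (\<integral>\<^sup>+x. ennreal (L (weak_gradient \<Omega> u x)) * indicator \<Omega> x \<partial>lebesgue)"
    unfolding energy_def using \<Omega>(2) by (intro nn_integral_restrict_space) auto
  also have "\<dots> = (\<integral>\<^sup>+x. (SUP n. ?W n x) \<partial>lebesgue)" by (simp only: sup)
  also have "\<dots> = (SUP n. \<integral>\<^sup>+x. ?W n x \<partial>lebesgue)"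
    by (rule nn_integral_monotone_convergence_SUP[OF \<open>incseq ?W\<close> le(2)])
  also have "\<dots> \<le> ennreal c" by (intro SUP_least le(1))
  finally show ?thesis .
qed

lemma energy_seq_weakly_lsc:
  fixes L :: "real^'n::finite^'m::finite \<Rightarrow> real"
  assumes \<Omega>: "bounded \<Omega>" "open \<Omega>" and p: "1 < p"
    and L: "W1_quasiconvex q L" "continuous_on UNIV L" "\<And>\<zeta>. 0 \<le> L \<zeta>" and q: "1 < q"
    and C: "0 \<le> C" "\<And>\<zeta>. L \<zeta> \<le> C * (1 + norm \<zeta> powr q)"
    and \<beta>: "0 < \<beta>" "\<And>\<zeta>. \<beta> * norm \<zeta> powr q \<le> L \<zeta>"
  shows "seq_weakly_lsc \<Omega> p (energy \<Omega> L)"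
  unfolding seq_weakly_lsc_def
proof (intro allI impI)
  fix us :: "nat \<Rightarrow> real^'n \<Rightarrow> real^'m" and u
  assume "sobolev_weakly_converges \<Omega> p us u"
  then have us: "us k \<in> sobolev \<Omega> p" and u: "u \<in> sobolev \<Omega> p"
    and conv: "l \<in> sobolev_dual \<Omega> p \<Longrightarrow> (\<lambda>k. l (us k)) \<longlonglongrightarrow> l u" for k l
    unfolding sobolev_weakly_converges_def by blast+
  show "energy \<Omega> L u \<le> liminf (\<lambda>k. energy \<Omega> L (us k))"
  \<comment> \<open>The rule leaves the case of a finite lower limit, in which infinitely many
    energies lie below c + \<eta>.\<close>
  proof (rule ennreal_le_epsilon)
    fix \<eta> :: real
    assume fin: "liminf (\<lambda>k. energy \<Omega> L (us k)) < top" and \<eta>: "0 < \<eta>"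
    obtain c where c: "0 \<le> c" "liminf (\<lambda>k. energy \<Omega> L (us k)) = ennreal c"
      using fin by (cases "liminf (\<lambda>k. energy \<Omega> L (us k))") auto
    have "\<exists>k\<ge>n. energy \<Omega> L (us k) \<le> ennreal (c + \<eta>)" for n
    proof (rule ccontr)
      assume "\<not> (\<exists>k\<ge>n. energy \<Omega> L (us k) \<le> ennreal (c + \<eta>))"
      then have "\<forall>\<^sub>F k in sequentially. ennreal (c + \<eta>) \<le> energy \<Omega> L (us k)"
        unfolding eventually_sequentially by (metis linorder_le_cases)
      then have "ennreal (c + \<eta>) \<le> ennreal c" unfolding c(2)[symmetric] by (rule Liminf_bounded)
      then show False using c(1) \<eta> by (simp add: ennreal_le_iff)
    qed
    then have "\<exists>\<sigma>. \<forall>n. \<sigma> n \<ge> n \<and> energy \<Omega> L (us (\<sigma> n)) \<le> ennreal (c + \<eta>)" by (intro choice allI) blast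
    then obtain \<sigma> where \<sigma>: "\<And>n. \<sigma> n \<ge> n" "\<And>n. energy \<Omega> L (us (\<sigma> n)) \<le> ennreal (c + \<eta>)" by blast
    \<comment> \<open>\<sigma> need not be increasing; \<sigma>(n) \<ge> n is enough to carry the
      convergence of every functional over to the selected maps.\<close>
    have "filterlim \<sigma> sequentially sequentially"
      by (rule filterlim_at_top_mono[OF filterlim_ident always_eventually]) (use \<sigma>(1) in blast)
    then have conv': "(\<lambda>k. l (us (\<sigma> k))) \<longlonglongrightarrow> l u" if "l \<in> sobolev_dual \<Omega> p" for l
      using filterlim_compose[OF conv[OF that]] by blast
    have "0 \<le> c + \<eta>" using c(1) \<eta> by simp
    from energy_le_bound[OF \<Omega> p L q C \<beta> us u conv' this \<sigma>(2)] have "energy \<Omega> L u \<le> ennreal (c + \<eta>)" .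
    then show "energy \<Omega> L u \<le> liminf (\<lambda>k. energy \<Omega> L (us k)) + ennreal \<eta>"
      unfolding c(2) using c(1) \<eta> by simp
  qed
qed

theorem corollary1p5:
  fixes \<Omega> :: "(real^'n::finite) set"
    and L :: "real^'n^'m::finite \<Rightarrow> real"
    and p q :: real
  assumes "bounded \<Omega>" and "open \<Omega>" and "lipschitz_boundary \<Omega>"
    and "1 < p"
    and "continuous_on UNIV L" and "\<And>\<xi>. 0 \<le> L \<xi>"
    and "W1_quasiconvex q L"
    and "coercive q L"
    and "Limsup at_infinity (\<lambda>\<xi>. ereal (L \<xi> / norm \<xi> powr q)) < \<infinity>"
  shows "(p < real CARD('n) \<and> 1 < q \<and> q \<le> sobolev_exponent CARD('n) p
            \<longrightarrow> seq_weakly_lsc \<Omega> p (energy \<Omega> L)) \<and>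
         (real CARD('n) \<le> p \<and> 1 < q \<longrightarrow> seq_weakly_lsc \<Omega> p (energy \<Omega> L))"
proof -
  obtain C where C: "0 \<le> C" "\<And>\<zeta>. L \<zeta> \<le> C * (1 + norm \<zeta> powr q)"
    by (rule growth_bound[OF assms(5,6,9)]) blast
  obtain \<beta> where \<beta>: "0 < \<beta>" "\<And>\<zeta>. \<beta> * norm \<zeta> powr q \<le> L \<zeta>"
    using assms(8) unfolding coercive_def by blast
  have "seq_weakly_lsc \<Omega> p (energy \<Omega> L)" if "1 < q"
    by (rule energy_seq_weakly_lsc[OF assms(1,2,4,7,5,6) that C \<beta>])
  then show ?thesis by blast
qed

end
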